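(* Let $(K,v)$ be a valued field with henselization $(K^h,v^h)$ and let $g\in K[x]$ be monic irreducible. Let $$v\ \xrightarrow{\phi_0,\gamma_0}\ \mu_0\ \xrightarrow{\phi_1,\gamma_1}\ \cdots\ \longrightarrow\ \mu_{r-1}\ \xrightarrow{\phi_r,\gamma_r}\ \mu_r=\mu$$ be a Maclane–Vaquié chain of ordinary augmentations, with $\mu$ an inner node of $\mathcal T$, and let $\phi\in\mathrm{KP}(\mu)$ with $\deg(\phi_r)<\deg(\phi)$. Suppose that the type $(\mu,\phi)$ singles out an irreducible factor $G\in\mathrm{Irr}(K^h)$ of $g$. Let $\overline w_G$ be the valuation on $K[x]/(g)$ induced by $w_G$. Then its ramification index and residual degree over $v$ are $$e(\overline w_G/v)=e_0\cdots e_r,\qquad f(\overline w_G/v)=f_0\cdots f_r\,\deg\big(R_{\mu,\phi_r}(\phi)\big),$$ where $e_i,f_j$ are the numerical invariants of the chain.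
   Context: **Setting.** $(K,v)$ is a valued field, residue field $k$, $\Gamma=v(K^* )$, $\Gamma_{\mathbb Q}=\Gamma\otimes\mathbb Q$. Fix an algebraic closure $\overline K$ and an extension $\bar v$ of $v$ to $\overline K$; $(K^h,v^h)$ is the corresponding henselization. $\mathrm{Irr}(E)$ is the set of monic irreducible polynomials of $E[x]$. $\mathcal T$ is the set of valuations $\mu:K[x]\to\Gamma_{\mathbb Q}\cup\{\infty\}$ with $\mu|_K=v$ (nonzero support allowed), ordered pointwise; inner nodes are its non-maximal elements. For $F\in\mathrm{Irr}(K^h)$ with root $\theta$, $v_F(q)=\bar v(q(\theta))$ on $K^h[x]$ and $w_F=(v_F)|_{K[x]}$; if $F\mid g$ then $w_F$ has support $gK[x]$. $F\mapsto w_F$ is a bijection onto the elements of $\mathcal T$ with nonzero support. **Key polynomials.** $\mathcal G_\mu=\bigoplus_\alpha\{f:\mu(f)\ge\alpha\}/\{f:\mu(f)>\alpha\}$; $\mathrm{in}_\mu f$ is the class of $f$ in degree $\mu(f)$ (and $0$ if $\mu(f)=\infty$). $f\sim_\mu h$ means $\mathrm{in}_\mu f=\mathrm{in}_\mu h$; $h\mid_\mu f$ means $\mathrm{in}_\mu h\mid\mathrm{in}_\mu f$. $\mathrm{KP}(\mu)$ is the set of monic $\phi$ with $\mathrm{in}_\mu\phi$ a prime element and $\phi\nmid_\mu f$ for all nonzero $f$ with $\deg f<\deg\phi$; it is nonempty iff $\mu$ is an inner node. A type is a pair $(\mu,\phi)$ with $\mu$ an inner node and $\phi\in\mathrm{KP}(\mu)$.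 $[\phi]_\mu=\{\phi'\in\mathrm{KP}(\mu):\phi'\sim_\mu\phi\}$. For $\mu<\nu$, $\mathbf t(\mu,\nu)$ is the set of monic polynomials of minimal degree with $\mu(\phi)<\nu(\phi)$, which is a class $[\phi]_\mu$. $\deg(\mu)$ is the minimal degree of a key polynomial for $\mu$. **Chains.** $\mu_0=[v;\phi_0,\gamma_0]$ with $\phi_0=x-a$, $a\in K$, $\gamma_0\in\Gamma_{\mathbb Q}$, is $\sum a_n\phi_0^n\mapsto\min\{v(a_n)+n\gamma_0\}$ ($a_n\in K$). For $\phi\in\mathrm{KP}(\mu)$ and $\gamma>\mu(\phi)$, $\gamma\in\Gamma_{\mathbb Q}\cup\{\infty\}$, the ordinary augmentation $[\mu;\phi,\gamma]$ sends $\sum a_n\phi^n$ ($\deg a_n<\deg\phi$) to $\min\{\mu(a_n)+n\gamma\}$. The displayed chain is a Maclane–Vaquié chain of ordinary augmentations if $\mu_{n}=[\mu_{n-1};\phi_n,\gamma_n]$ with $\phi_n\in\mathrm{KP}(\mu_{n-1})$, $\gamma_n\in\Gamma_{\mathbb Q}$, and $\deg\mu_{n-1}<\deg\mu_n$, for $1\le n\le r$; then $\phi_n$ is a key polynomial of minimal degree for $\mu_n$. Let $\Gamma_{\mu_n}$ be the value group of $\mu_n$, $\Gamma_{\mu_{-1}}=\Gamma$; let $\kappa(\mu_n)$ be the relative algebraic closure of $k$ in the residue field of $\mu_n$ (viewed as valuation of $K(x)$), $\kappa(\mu_{-1})=k$; there are natural embeddings $\kappa(\mu_{n-1})\hookrightarrow\kappa(\mu_n)$.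 Set $e_n=(\Gamma_{\mu_n}:\Gamma_{\mu_{n-1}})$ and $f_n=[\kappa(\mu_n):\kappa(\mu_{n-1})]$, $0\le n\le r$. **Residual polynomial.** Let $\varphi$ be a key polynomial of minimal degree for an inner node $\mu$, $e$ the least positive integer with $e\mu(\varphi)$ in the group $\{\mu(a):a\neq0,\deg a<\deg\varphi\}$, and $u$ a fixed homogeneous unit of $\mathcal G_\mu$ of degree $e\mu(\varphi)$. For $h=\sum a_n\varphi^n\ne0$ ($\deg a_n<\deg\varphi$) let $S=\{n:\mu(a_n\varphi^n)=\mu(h)\}$, $\ell_0=\min S$, $\ell=\max S$; then $S\subset\{\ell_j=\ell_0+je:0\le j\le d\}$ with $\ell=\ell_0+de$, the elements $\mathrm{in}_\mu a_n$ are units, and $R_{\mu,\varphi}(h)=\sum_{j=0}^d\zeta_jy^j\in\kappa(\mu)[y]$, with $\zeta_j=(\mathrm{in}_\mu a_\ell)^{-1}u^{j-d}\,\mathrm{in}_\mu a_{\ell_j}$ if $\ell_j\in S$ and $\zeta_j=0$ otherwise ($\kappa(\mu)^*$ is the group of homogeneous units of degree $0$). Its degree does not depend on $u$. **Singling out.** $\mathcal F_{\mu,\phi}(g)=\{G\in\mathrm{Irr}(K^h):G\mid g,\ \mu<w_G,\ \mathbf t(\mu,w_G)=[\phi]_\mu\}$ (with multiplicities). $Q_{\mu,\phi}\in\mathrm{Irr}(K^h)$ is the unique irreducible factor of $\phi$ with $[\mu;\phi,\infty]=w_{Q_{\mu,\phi}}$. The type $(\mu,\phi)$ singles out $G$ if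 $\mathcal F_{\mu,\phi}(g)=\{G\}$ and $\deg G=\deg Q_{\mu,\phi}$. *)

theory Defs
  imports
    "HOL-Algebra.Algebraic_Closure_Type"
    "HOL-Algebra.Finite_Extensions"
    "HOL-Algebra.UnivPoly"
    "HOL-Algebra.QuotRing"
    "HOL-Computational_Algebra.Polynomial_Factorial"
begin

section \<open>Values\<close>

text \<open>
  The ordered group with one extra top element.  (The type \<open>extended\<close> of the library also has a
  bottom element, which is not a possible value.)
\<close>

datatype 'g vinf = Val 'g | Infty

instantiation vinf :: (linorder) linorder
begin

fun less_eq_vinf :: "'a vinf \<Rightarrow> 'a vinf \<Rightarrow> bool" where
  "less_eq_vinf x Infty \<longleftrightarrow> True"
| "less_eq_vinf Infty (Val y) \<longleftrightarrow> False"
| "less_eq_vinf (Val x) (Val y) \<longleftrightarrow> x \<le> y"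

definition less_vinf :: "'a vinf \<Rightarrow> 'a vinf \<Rightarrow> bool" where
  "less_vinf x y \<longleftrightarrow> x \<le> y \<and> \<not> y \<le> x"

instance
proof
  fix x y z :: "'a vinf"
  show "(x < y) = (x \<le> y \<and> \<not> y \<le> x)" by (simp add: less_vinf_def)
  show "x \<le> x" by (cases x) auto
  show "x \<le> y \<Longrightarrow> y \<le> z \<Longrightarrow> x \<le> z" by (cases x; cases y; cases z) auto
  show "x \<le> y \<Longrightarrow> y \<le> x \<Longrightarrow> x = y" by (cases x; cases y) auto
  show "x \<le> y \<or> y \<le> x" by (cases x; cases y) auto
qed

end

instantiation vinf :: (comm_monoid_add) comm_monoid_add
begin

definition zero_vinf :: "'a vinf" where "0 = Val 0"

fun plus_vinf :: "'a vinf \<Rightarrow> 'a vinf \<Rightarrow> 'a vinf" where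
  "Val x + Val y = Val (x + y)"
| "Infty + y = Infty"
| "x + Infty = Infty"

instance
proof
  fix x y z :: "'a vinf"
  show "x + y + z = x + (y + z)" by (cases x; cases y; cases z) (auto simp: add.assoc)
  show "x + y = y + x" by (cases x; cases y) (auto simp: add.commute)
  show "0 + x = x" by (cases x) (auto simp: zero_vinf_def)
qed

end

lemma Val_less_Infty [simp]: "Val x < Infty"
  by (simp add: less_vinf_def)

lemma Val_less_Val [simp]: "Val x < Val y \<longleftrightarrow> x < y"
  by (auto simp: less_vinf_def)

definition nmul :: "nat \<Rightarrow> 'm :: comm_monoid_add \<Rightarrow> 'm" where
  "nmul n x = (\<Sum>i<n. x)"

definition valuation :: "('r :: comm_ring_1 \<Rightarrow> 'g :: linordered_ab_group_add vinf) \<Rightarrow> bool" where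
  "valuation w \<longleftrightarrow> w 0 = Infty \<and> w 1 = 0 \<and> (\<forall>x y. w (x * y) = w x + w y) \<and>
     (\<forall>x y. min (w x) (w y) \<le> w (x + y))"

lemma valuation_field_eq_Infty_iff:
  fixes v :: "'a :: field \<Rightarrow> 'g :: linordered_ab_group_add vinf"
  assumes "valuation v"
  shows "v x = Infty \<longleftrightarrow> x = 0"
proof
  assume x: "v x = Infty"
  show "x = 0"
  proof (rule ccontr)
    assume "x \<noteq> 0"
    hence "v x + v (inverse x) = 0"
      using assms by (metis valuation_def right_inverse)
    with x show False by (simp add: zero_vinf_def)
  qed
qed (use assms in \<open>auto simp: valuation_def\<close>)

text \<open>
  \<open>'g\<close> is (a copy of) the ordered group obtained from its subgroup \<open>\<Gamma>\<close> by tensoring with the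
  rationals: it is divisible and torsion modulo \<open>\<Gamma>\<close>.  Being ordered, it is torsion-free.
\<close>

definition rational_hull :: "'g :: linordered_ab_group_add set \<Rightarrow> bool" where
  "rational_hull \<Gamma> \<longleftrightarrow>
     (\<forall>x. \<exists>n>0. nmul n x \<in> \<Gamma>) \<and> (\<forall>x::'g. \<forall>n>0. \<exists>y. nmul n y = x)"


section \<open>Valued fields: value groups, residue fields, ramification\<close>

text \<open>
  Fields are \<open>HOL-Algebra\<close> rings here, since the field \<open>K[x]/(g)\<close> is not a type.
\<close>

definition value_group :: "('r, 'm) ring_scheme \<Rightarrow> ('r \<Rightarrow> 'g vinf) \<Rightarrow> 'g set" where
  "value_group L w = {\<alpha>. \<exists>x\<in>carrier L. w x = Val \<alpha>}"

definition val_ring :: "('r, 'm) ring_scheme \<Rightarrow> ('r \<Rightarrow> 'g :: linordered_ab_group_add vinf) \<Rightarrow>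
    ('r, 'm) ring_scheme" where
  "val_ring L w = L\<lparr>carrier := {x \<in> carrier L. 0 \<le> w x}\<rparr>"

definition val_ideal :: "('r, 'm) ring_scheme \<Rightarrow> ('r \<Rightarrow> 'g :: linordered_ab_group_add vinf) \<Rightarrow>
    'r set" where
  "val_ideal L w = {x \<in> carrier L. 0 < w x}"

definition residue_field :: "('r, 'm) ring_scheme \<Rightarrow> ('r \<Rightarrow> 'g :: linordered_ab_group_add vinf) \<Rightarrow>
    'r set ring" where
  "residue_field L w = val_ring L w Quot val_ideal L w"

definition res_class :: "('r, 'm) ring_scheme \<Rightarrow> ('r \<Rightarrow> 'g :: linordered_ab_group_add vinf) \<Rightarrow>
    'r \<Rightarrow> 'r set" where
  "res_class L w x = val_ideal L w +>\<^bsub>val_ring L w\<^esub> x"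

text \<open>Index of a subgroup; it is \<open>0\<close> if the index is infinite.\<close>

definition grp_index :: "'g :: ab_group_add set \<Rightarrow> 'g set \<Rightarrow> nat" where
  "grp_index A B = card ((\<lambda>a. (+) a ` B) ` A)"

text \<open>
  In the next two definitions \<open>w\<close> is a valuation of the field \<open>L\<close> which restricts to the valuation
  \<open>v\<close> of \<open>K\<close> along the embedding \<open>\<iota>\<close> of \<open>K\<close> in \<open>L\<close>.
\<close>

definition ramification_index ::
  "('r, 'm) ring_scheme \<Rightarrow> ('r \<Rightarrow> 'g :: linordered_ab_group_add vinf) \<Rightarrow>
    ('s, 'n) ring_scheme \<Rightarrow> ('s \<Rightarrow> 'g vinf) \<Rightarrow> nat" where
  "ramification_index L w K v = grp_index (value_group L w) (value_group K v)"

definition residual_degree ::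
  "('r, 'm) ring_scheme \<Rightarrow> ('r \<Rightarrow> 'g :: linordered_ab_group_add vinf) \<Rightarrow>
    ('s, 'n) ring_scheme \<Rightarrow> ('s \<Rightarrow> 'g vinf) \<Rightarrow> ('s \<Rightarrow> 'r) \<Rightarrow> nat" where
  "residual_degree L w K v \<iota> =
     ring.dim (residue_field L w)
       {res_class L w (\<iota> a) | a. a \<in> carrier K \<and> 0 \<le> v a} (carrier (residue_field L w))"

abbreviation base_field :: "'a :: field ring" where
  "base_field \<equiv> ring_of_type_algebra"


section \<open>The tree of valuations on \<open>K[x]\<close>\<close>

definition val_tree :: "('a :: field \<Rightarrow> 'g :: linordered_ab_group_add vinf) \<Rightarrow>
    ('a poly \<Rightarrow> 'g vinf) set" where
  "val_tree v = {\<mu>. valuation \<mu> \<and> (\<forall>a. \<mu> [:a:] = v a)}"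

text \<open>The order on functions is the pointwise one.\<close>

definition inner_node :: "('a :: field \<Rightarrow> 'g :: linordered_ab_group_add vinf) \<Rightarrow>
    ('a poly \<Rightarrow> 'g vinf) \<Rightarrow> bool" where
  "inner_node v \<mu> \<longleftrightarrow> \<mu> \<in> val_tree v \<and> (\<exists>\<nu>\<in>val_tree v. \<mu> < \<nu>)"


section \<open>The graded algebra and key polynomials\<close>

context
  fixes \<mu> :: "'a :: field poly \<Rightarrow> 'g :: linordered_ab_group_add vinf"
begin

definition gr_filt :: "'g \<Rightarrow> 'a poly set" where
  "gr_filt \<alpha> = {f. Val \<alpha> \<le> \<mu> f}"

definition gr_plus :: "'g \<Rightarrow> 'a poly set" where
  "gr_plus \<alpha> = {f. Val \<alpha> < \<mu> f}"

definition gr_class :: "'g \<Rightarrow> 'a poly \<Rightarrow> 'a poly set" where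
  "gr_class \<alpha> f = (+) f ` gr_plus \<alpha>"

text \<open>
  An element of the direct sum is the family of its homogeneous components; the component of degree
  \<open>\<alpha>\<close> is a coset of \<open>gr_plus \<alpha>\<close> in \<open>gr_filt \<alpha>\<close>, and all but finitely many components are zero,
  that is, equal to \<open>gr_plus \<alpha>\<close>.  As for \<^const>\<open>rcoset_mult\<close>, the union in the product is over
  representatives and all its members coincide.
\<close>

definition gr_ring :: "('g \<Rightarrow> 'a poly set) ring" where
  "gr_ring = \<lparr>
     carrier = {z. (\<forall>\<alpha>. z \<alpha> \<in> gr_class \<alpha> ` gr_filt \<alpha>) \<and> finite {\<alpha>. z \<alpha> \<noteq> gr_plus \<alpha>}},
     monoid.mult = (\<lambda>z z' \<alpha>. \<Union>{gr_class \<alpha> (\<Sum>\<beta> | z \<beta> \<noteq> gr_plus \<beta>. s \<beta> * t (\<alpha> - \<beta>)) | s t.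
       (\<forall>\<beta>. s \<beta> \<in> z \<beta>) \<and> (\<forall>\<beta>. t \<beta> \<in> z' \<beta>)}),
     one = (\<lambda>\<alpha>. if \<alpha> = 0 then gr_class 0 1 else gr_plus \<alpha>),
     ring.zero = gr_plus,
     add = (\<lambda>z z' \<alpha>. {f + h | f h. f \<in> z \<alpha> \<and> h \<in> z' \<alpha>})\<rparr>"

definition gr_in :: "'a poly \<Rightarrow> 'g \<Rightarrow> 'a poly set" where
  "gr_in f = (\<lambda>\<alpha>. if \<mu> f = Val \<alpha> then gr_class \<alpha> f else gr_plus \<alpha>)"

definition mu_equiv :: "'a poly \<Rightarrow> 'a poly \<Rightarrow> bool" where
  "mu_equiv f h \<longleftrightarrow> gr_in f = gr_in h"

definition mu_divides :: "'a poly \<Rightarrow> 'a poly \<Rightarrow> bool" where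
  "mu_divides h f \<longleftrightarrow> gr_in h divides\<^bsub>gr_ring\<^esub> gr_in f"

definition KP :: "'a poly set" where
  "KP = {\<phi>. lead_coeff \<phi> = 1 \<and> ring_prime\<^bsub>gr_ring\<^esub> (gr_in \<phi>) \<and>
     (\<forall>f. f \<noteq> 0 \<and> degree f < degree \<phi> \<longrightarrow> \<not> mu_divides \<phi> f)}"

definition KP_class :: "'a poly \<Rightarrow> 'a poly set" where
  "KP_class \<phi> = {\<phi>' \<in> KP. mu_equiv \<phi>' \<phi>}"

definition KP_degree :: nat where
  "KP_degree = (LEAST d. \<exists>\<phi>\<in>KP. degree \<phi> = d)"

text \<open>The degree \<open>\<delta>\<close> may be \<^const>\<open>Infty\<close> only formally; no unit satisfies this then.\<close>

definition homogeneous_unit :: "'g vinf \<Rightarrow> ('g \<Rightarrow> 'a poly set) \<Rightarrow> bool" where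
  "homogeneous_unit \<delta> u \<longleftrightarrow> u \<in> Units gr_ring \<and> (\<forall>\<beta>. Val \<beta> \<noteq> \<delta> \<longrightarrow> u \<beta> = gr_plus \<beta>)"

definition tangent :: "('a poly \<Rightarrow> 'g vinf) \<Rightarrow> 'a poly set" where
  "tangent \<nu> = {\<phi>. lead_coeff \<phi> = 1 \<and> \<mu> \<phi> < \<nu> \<phi> \<and>
     (\<forall>\<psi>. lead_coeff \<psi> = 1 \<and> \<mu> \<psi> < \<nu> \<psi> \<longrightarrow> degree \<phi> \<le> degree \<psi>)}"

end


section \<open>Value group and \<open>\<kappa>(\<mu>)\<close>, for \<open>\<mu>\<close> of trivial support\<close>

definition frac_val :: "('a :: field poly \<Rightarrow> 'g :: linordered_ab_group_add vinf) \<Rightarrow>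
    'a poly fract \<Rightarrow> 'g vinf" where
  "frac_val \<mu> q = (THE c. \<exists>f h. h \<noteq> 0 \<and> q = Fract f h \<and> c + \<mu> h = \<mu> f)"

definition mu_value_group :: "('a :: field poly \<Rightarrow> 'g :: linordered_ab_group_add vinf) \<Rightarrow> 'g set" where
  "mu_value_group \<mu> = value_group (ring_of_type_algebra :: 'a poly fract ring) (frac_val \<mu>)"

definition mu_residue_field :: "('a :: field poly \<Rightarrow> 'g :: linordered_ab_group_add vinf) \<Rightarrow>
    'a poly fract set ring" where
  "mu_residue_field \<mu> = residue_field ring_of_type_algebra (frac_val \<mu>)"

definition mu_res_class :: "('a :: field poly \<Rightarrow> 'g :: linordered_ab_group_add vinf) \<Rightarrow>
    'a poly \<Rightarrow> 'a poly fract set" where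
  "mu_res_class \<mu> f = res_class ring_of_type_algebra (frac_val \<mu>) (to_fract f)"

text \<open>The image of \<open>k\<close> in the residue field of \<open>\<mu>\<close>.\<close>

definition base_residue_field :: "('a :: field poly \<Rightarrow> 'g :: linordered_ab_group_add vinf) \<Rightarrow>
    'a poly fract set set" where
  "base_residue_field \<mu> = {mu_res_class \<mu> [:a:] | a. 0 \<le> \<mu> [:a:]}"

definition kappa :: "('a :: field poly \<Rightarrow> 'g :: linordered_ab_group_add vinf) \<Rightarrow>
    'a poly fract set set" where
  "kappa \<mu> = {z \<in> carrier (mu_residue_field \<mu>).
     \<not> ring.transcendental (mu_residue_field \<mu>) (base_residue_field \<mu>) z}"

text \<open>
  For \<open>\<mu> \<le> \<nu>\<close>, the homomorphism from the graded algebra of \<open>\<mu>\<close> to that of \<open>\<nu>\<close> maps, in degree zero,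
  the class of a polynomial \<open>f\<close> with \<open>0 \<le> \<mu> f\<close> to the class of \<open>f\<close>; every element of \<open>\<kappa>(\<mu>)\<close> is the
  class of such an \<open>f\<close>.  This is the natural embedding of \<open>\<kappa>(\<mu>)\<close> in \<open>\<kappa>(\<nu>)\<close>, and the following is
  its image.
\<close>

definition kappa_image :: "('a :: field poly \<Rightarrow> 'g :: linordered_ab_group_add vinf) \<Rightarrow>
    ('a poly \<Rightarrow> 'g vinf) \<Rightarrow> 'a poly fract set set" where
  "kappa_image \<mu> \<nu> = {mu_res_class \<nu> f | f. 0 \<le> \<mu> f \<and> mu_res_class \<mu> f \<in> kappa \<mu>}"


section \<open>Augmentations and chains\<close>

text \<open>The coefficients of the expansion in powers of \<open>\<phi>\<close>, for \<open>\<phi>\<close> of positive degree.\<close>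

definition digit :: "'a :: field poly \<Rightarrow> 'a poly \<Rightarrow> nat \<Rightarrow> 'a poly" where
  "digit \<phi> f n = (f div \<phi> ^ n) mod \<phi>"

lemma degree_digit_less:
  assumes "degree \<phi> > 0"
  shows "degree (digit \<phi> f n) < degree \<phi>"
proof -
  have "\<phi> \<noteq> 0" using assms by auto
  thus ?thesis
    using assms degree_mod_less[of \<phi> "f div \<phi> ^ n"] by (auto simp: digit_def)
qed

lemma digit_expansion_aux:
  fixes \<phi> :: "'a :: field poly"
  shows "f = (\<Sum>n<m. digit \<phi> f n * \<phi> ^ n) + (f div \<phi> ^ m) * \<phi> ^ m"
proof (induction m)
  case (Suc m)
  have "f div \<phi> ^ m = (f div \<phi> ^ Suc m) * \<phi> + digit \<phi> f m"
    by (metis digit_def div_mult_mod_eq div_poly_eq_0_iff poly_div_mult_right power_Suc2)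
  hence "(f div \<phi> ^ m) * \<phi> ^ m = (f div \<phi> ^ Suc m) * \<phi> ^ Suc m + digit \<phi> f m * \<phi> ^ m"
    by (simp add: algebra_simps)
  with Suc show ?case by (simp add: algebra_simps)
qed simp

lemma digit_expansion:
  fixes \<phi> :: "'a :: field poly"
  assumes "degree \<phi> > 0"
  shows "f = (\<Sum>n\<le>degree f. digit \<phi> f n * \<phi> ^ n)"
proof -
  have "degree f < degree (\<phi> ^ Suc (degree f))"
  proof -
    have "\<phi> \<noteq> 0" using assms by auto
    moreover have "Suc (degree f) * 1 \<le> Suc (degree f) * degree \<phi>"
      using assms by (intro mult_le_mono2) auto
    ultimately show ?thesis by (simp add: degree_power_eq del: power_Suc)
  qed
  hence "f div \<phi> ^ Suc (degree f) = 0"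
    by (simp add: div_poly_less)
  thus ?thesis
    using digit_expansion_aux[of f \<phi> "Suc (degree f)"] by (simp add: lessThan_Suc_atMost)
qed

text \<open>The digits beyond \<open>degree f\<close> vanish and contribute the value \<^const>\<open>Infty\<close>.\<close>

definition augment :: "('a :: field poly \<Rightarrow> 'g :: linordered_ab_group_add vinf) \<Rightarrow> 'a poly \<Rightarrow>
    'g vinf \<Rightarrow> 'a poly \<Rightarrow> 'g vinf" where
  "augment \<mu> \<phi> \<gamma> f = (MIN n\<in>{..degree f}. \<mu> (digit \<phi> f n) + nmul n \<gamma>)"

text \<open>\<open>[v; x - a, \<gamma>]\<close>: the digits of the expansion in powers of \<open>x - a\<close> are constant polynomials.\<close>

definition depth_zero :: "('a :: field \<Rightarrow> 'g :: linordered_ab_group_add vinf) \<Rightarrow> 'a \<Rightarrow>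
    'g vinf \<Rightarrow> 'a poly \<Rightarrow> 'g vinf" where
  "depth_zero v a \<gamma> f =
     (MIN n\<in>{..degree f}. v (coeff (digit [:-a, 1:] f n) 0) + nmul n \<gamma>)"

definition ordinary_MLV_chain :: "('a :: field \<Rightarrow> 'g :: linordered_ab_group_add vinf) \<Rightarrow> nat \<Rightarrow>
    (nat \<Rightarrow> 'a poly) \<Rightarrow> (nat \<Rightarrow> 'g) \<Rightarrow> (nat \<Rightarrow> 'a poly \<Rightarrow> 'g vinf) \<Rightarrow> bool" where
  "ordinary_MLV_chain v r \<phi> \<gamma> \<mu> \<longleftrightarrow>
     (\<exists>a. \<phi> 0 = [:-a, 1:] \<and> \<mu> 0 = depth_zero v a (Val (\<gamma> 0))) \<and>
     (\<forall>n<r. \<phi> (Suc n) \<in> KP (\<mu> n) \<and> \<mu> n (\<phi> (Suc n)) < Val (\<gamma> (Suc n)) \<and>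
        \<mu> (Suc n) = augment (\<mu> n) (\<phi> (Suc n)) (Val (\<gamma> (Suc n))) \<and>
        KP_degree (\<mu> n) < KP_degree (\<mu> (Suc n)))"

fun chain_e :: "('a :: field \<Rightarrow> 'g :: linordered_ab_group_add vinf) \<Rightarrow>
    (nat \<Rightarrow> 'a poly \<Rightarrow> 'g vinf) \<Rightarrow> nat \<Rightarrow> nat" where
  "chain_e v \<mu> 0 = grp_index (mu_value_group (\<mu> 0)) (value_group base_field v)"
| "chain_e v \<mu> (Suc n) = grp_index (mu_value_group (\<mu> (Suc n))) (mu_value_group (\<mu> n))"

fun chain_f :: "(nat \<Rightarrow> 'a :: field poly \<Rightarrow> 'g :: linordered_ab_group_add vinf) \<Rightarrow> nat \<Rightarrow> nat" where
  "chain_f \<mu> 0 =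
     ring.dim (mu_residue_field (\<mu> 0)) (base_residue_field (\<mu> 0)) (kappa (\<mu> 0))"
| "chain_f \<mu> (Suc n) =
     ring.dim (mu_residue_field (\<mu> (Suc n))) (kappa_image (\<mu> n) (\<mu> (Suc n))) (kappa (\<mu> (Suc n)))"


section \<open>Residual polynomials\<close>

text \<open>
  The identification of the degree-zero homogeneous elements of the graded algebra with their images
  in the residue field of \<open>\<mu>\<close>; it identifies the homogeneous units of degree zero with the nonzero
  elements of \<open>\<kappa>(\<mu>)\<close>.
\<close>

definition gr_zero_to_res :: "('a :: field poly \<Rightarrow> 'g :: linordered_ab_group_add vinf) \<Rightarrow>
    ('g \<Rightarrow> 'a poly set) \<Rightarrow> 'a poly fract set" where
  "gr_zero_to_res \<mu> z = (THE c. \<exists>f\<in>z 0. c = mu_res_class \<mu> f)"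

definition rel_index :: "('a :: field poly \<Rightarrow> 'g :: linordered_ab_group_add vinf) \<Rightarrow> 'a poly \<Rightarrow>
    nat" where
  "rel_index \<mu> \<phi> =
     (LEAST e. e > 0 \<and> nmul e (\<mu> \<phi>) \<in> {\<mu> a | a. a \<noteq> 0 \<and> degree a < degree \<phi>})"

definition kappa_ring :: "('a :: field poly \<Rightarrow> 'g :: linordered_ab_group_add vinf) \<Rightarrow>
    'a poly fract set ring" where
  "kappa_ring \<mu> = (mu_residue_field \<mu>)\<lparr>carrier := kappa \<mu>\<rparr>"

text \<open>An element of \<open>UP (kappa_ring \<mu>)\<close>; \<open>u\<close> is a homogeneous unit of degree
  \<open>nmul (rel_index \<mu> \<phi>) (\<mu> \<phi>)\<close>.\<close>

definition residual_poly :: "('a :: field poly \<Rightarrow> 'g :: linordered_ab_group_add vinf) \<Rightarrow> 'a poly \<Rightarrow>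
    ('g \<Rightarrow> 'a poly set) \<Rightarrow> 'a poly \<Rightarrow> nat \<Rightarrow> 'a poly fract set" where
  "residual_poly \<mu> \<phi> u h =
     (let \<G> = gr_ring \<mu>;
          a = digit \<phi> h;
          e = rel_index \<mu> \<phi>;
          S = {n. \<mu> (a n * \<phi> ^ n) = \<mu> h};
          l0 = Min S;
          l = Max S;
          d = (l - l0) div e
      in (\<lambda>j. if j \<le> d \<and> l0 + j * e \<in> S
              then gr_zero_to_res \<mu>
                (inv\<^bsub>\<G>\<^esub> (gr_in \<mu> (a l)) \<otimes>\<^bsub>\<G>\<^esub> (inv\<^bsub>\<G>\<^esub> u [^]\<^bsub>\<G>\<^esub> (d - j)) \<otimes>\<^bsub>\<G>\<^esub> gr_in \<mu> (a (l0 + j * e)))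
              else \<zero>\<^bsub>kappa_ring \<mu>\<^esub>))"


section \<open>Henselization\<close>

definition extends_valuation :: "('a :: field alg_closure \<Rightarrow> 'g :: linordered_ab_group_add vinf) \<Rightarrow>
    ('a \<Rightarrow> 'g vinf) \<Rightarrow> bool" where
  "extends_valuation vb v \<longleftrightarrow> valuation vb \<and> (\<forall>a. vb (to_ac a) = v a)"

definition separable_over_base :: "'a :: field alg_closure \<Rightarrow> bool" where
  "separable_over_base x \<longleftrightarrow>
     (\<exists>p. irreducible p \<and> poly (map_poly to_ac p) x = 0 \<and> rsquarefree (map_poly to_ac p))"

text \<open>
  Restriction to the separable closure identifies the automorphism group of the algebraic closure
  over \<open>K\<close> with the absolute Galois group of \<open>K\<close>, and identifies the following group with the
  decomposition group.
\<close>

definition decomposition_group ::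
  "('a :: field alg_closure \<Rightarrow> 'g :: linordered_ab_group_add vinf) \<Rightarrow>
    ('a alg_closure \<Rightarrow> 'a alg_closure) set" where
  "decomposition_group vb = {\<sigma>. bij \<sigma> \<and> (\<forall>x y. \<sigma> (x + y) = \<sigma> x + \<sigma> y) \<and>
     (\<forall>x y. \<sigma> (x * y) = \<sigma> x * \<sigma> y) \<and> (\<forall>a. \<sigma> (to_ac a) = to_ac a) \<and> vb \<circ> \<sigma> = vb}"

text \<open>The field \<open>K\<^sup>h\<close>: the fixed field of the decomposition group in the separable closure.\<close>

definition henselization :: "('a :: field alg_closure \<Rightarrow> 'g :: linordered_ab_group_add vinf) \<Rightarrow>
    'a alg_closure set" where
  "henselization vb = {x. separable_over_base x \<and> (\<forall>\<sigma>\<in>decomposition_group vb. \<sigma> x = x)}"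


section \<open>Irreducible polynomials over the henselization\<close>

definition polys_over :: "'c :: field set \<Rightarrow> 'c poly set" where
  "polys_over E = {p. \<forall>i. coeff p i \<in> E}"

definition Irr_over :: "'c :: field set \<Rightarrow> 'c poly set" where
  "Irr_over E = {F \<in> polys_over E. lead_coeff F = 1 \<and> degree F > 0 \<and>
     (\<forall>A\<in>polys_over E. \<forall>B\<in>polys_over E. F = A * B \<longrightarrow> degree A = 0 \<or> degree B = 0)}"

definition irr_factors :: "'c :: field set \<Rightarrow> 'c poly \<Rightarrow> 'c poly multiset" where
  "irr_factors E f = (THE M. set_mset M \<subseteq> Irr_over E \<and> prod_mset M = f)"

text \<open>The value does not depend on the root if \<open>F\<close> is irreducible over the henselization.\<close>

definition w_of :: "('a :: field alg_closure \<Rightarrow> 'g :: linordered_ab_group_add vinf) \<Rightarrow>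
    'a alg_closure poly \<Rightarrow> 'a poly \<Rightarrow> 'g vinf" where
  "w_of vb F q = vb (poly (map_poly to_ac q) (SOME \<theta>. poly F \<theta> = 0))"


section \<open>Singling out\<close>

definition F_factors :: "('a :: field alg_closure \<Rightarrow> 'g :: linordered_ab_group_add vinf) \<Rightarrow>
    ('a poly \<Rightarrow> 'g vinf) \<Rightarrow> 'a poly \<Rightarrow> 'a poly \<Rightarrow> 'a alg_closure poly multiset" where
  "F_factors vb \<mu> \<phi> g =
     {#G \<in># irr_factors (henselization vb) (map_poly to_ac g).
        \<mu> < w_of vb G \<and> tangent \<mu> (w_of vb G) = KP_class \<mu> \<phi>#}"

definition Q_factor :: "('a :: field alg_closure \<Rightarrow> 'g :: linordered_ab_group_add vinf) \<Rightarrow>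
    ('a poly \<Rightarrow> 'g vinf) \<Rightarrow> 'a poly \<Rightarrow> 'a alg_closure poly" where
  "Q_factor vb \<mu> \<phi> =
     (THE Q. Q \<in># irr_factors (henselization vb) (map_poly to_ac \<phi>) \<and>
        augment \<mu> \<phi> Infty = w_of vb Q)"

definition singles_out :: "('a :: field alg_closure \<Rightarrow> 'g :: linordered_ab_group_add vinf) \<Rightarrow>
    ('a poly \<Rightarrow> 'g vinf) \<Rightarrow> 'a poly \<Rightarrow> 'a poly \<Rightarrow> 'a alg_closure poly \<Rightarrow> bool" where
  "singles_out vb \<mu> \<phi> g G \<longleftrightarrow>
     F_factors vb \<mu> \<phi> g = {#G#} \<and> degree G = degree (Q_factor vb \<mu> \<phi>)"


section \<open>The field \<open>K[x]/(g)\<close>\<close>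

definition poly_quot :: "'a :: field poly \<Rightarrow> 'a poly set ring" where
  "poly_quot g = ring_of_type_algebra Quot (PIdl\<^bsub>ring_of_type_algebra\<^esub> g)"

definition poly_quot_class :: "'a :: field poly \<Rightarrow> 'a poly \<Rightarrow> 'a poly set" where
  "poly_quot_class g f = (PIdl\<^bsub>ring_of_type_algebra\<^esub> g) +>\<^bsub>ring_of_type_algebra\<^esub> f"

text \<open>The valuation induced by a valuation \<open>w\<close> of \<open>K[x]\<close> with support \<open>gK[x]\<close>.\<close>

definition quot_val :: "('a :: field poly \<Rightarrow> 'g vinf) \<Rightarrow> 'a poly set \<Rightarrow> 'g vinf" where
  "quot_val w C = (THE c. \<exists>f\<in>C. c = w f)"

end

theory Submission
  imports Defs
begin

text \<open>
  Each valuation \<open>[\<mu>; \<phi>, \<gamma>]\<close> is governed by the valuation \<open>w = [\<mu>; \<phi>, \<infinity>]\<close> with support \<open>\<phi>\<close>.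
  The space of polynomials of degree less than \<open>deg \<phi>\<close> has a basis over \<open>K\<close>, consisting of one monic
  polynomial in each degree, which is orthogonal for \<open>w\<close>; it arises by multiplying the basis of the
  previous level with powers of the previous key polynomial. Counting its members by the cosets of
  their values gives \<open>deg \<phi> = E F\<close>, where \<open>E\<close> and \<open>F\<close> are the ramification index and the residual
  degree of \<open>w\<close> over \<open>v\<close>. Comparing these numbers at two consecutive levels gives
  \<open>E = e\<^sub>0 \<dots> e\<^sub>r\<close> and \<open>F = f\<^sub>0 \<dots> f\<^sub>r deg R(\<phi>)\<close>: the algebraic residues of \<open>[\<mu>; \<phi>, \<gamma>]\<close> are those
  of the polynomials of degree less than \<open>deg \<phi>\<close>, and the \<open>\<phi>\<^sub>r\<close>-expansion of a key polynomial of larger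
  degree has leading coefficient \<open>1\<close> and attains its value in degree zero as well.

  If \<open>(\<mu>, \<phi>)\<close> singles out \<open>G\<close>, then \<open>w\<^sub>G\<close> coincides with \<open>[\<mu>; \<phi>, \<infinity>]\<close> in degrees less than \<open>deg \<phi>\<close>, so
  that its ramification index and residual degree are at least \<open>E\<close> and \<open>F\<close>. Since the henselization is
  an immediate extension, a family of polynomials over \<open>K\<close> which is orthogonal for \<open>w\<^sub>G\<close> has at most
  \<open>deg G \<le> deg \<phi> = E F\<close> members, and they cannot be larger.
\<close>

text \<open>The counting argument needs a bound by \<open>degree G\<close>, but the family counted
  consists of polynomials over K, while \<open>G\<close> is irreducible over the henselization only.
  Immediateness bridges the two: the coefficients of a linear relation over the henselization are
  replaced by elements of K with the same leading part. Since the henselization is given as a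
  decomposition field, this must be derived from Galois theory: elements inducing the same valuation
  on K[x] are conjugate under the decomposition group, and this rests on separating finitely many
  valuations. Torsion of the values modulo \<Gamma> enters there, and again to make the values of
  polynomials a group. On the side of the chain, the obstacle is that \<kappa>(\<mu>) is defined by
  algebraicity inside the residue field of K(x). The function \<open>smax\<close>, the degree of an
  initial form in that of \<open>\<phi>\<close>, decides it: as it is additive, an algebraic nonzero
  residue of f/h forces equal \<open>smax\<close> of f and h, and the top digit can be
  cancelled.\<close>

instance vinf :: (linordered_ab_group_add) ordered_comm_monoid_add
proof
  fix a b c :: "'a vinf"
  show "a \<le> b \<Longrightarrow> c + a \<le> c + b"
    by (cases a; cases b; cases c) auto
qed

section \<open>Arithmetic of values and of their natural multiples\<close>

lemma Infty_plus [simp]: "x + Infty = (Infty :: 'a :: comm_monoid_add vinf)"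
  by (cases x) auto

lemma plus_eq_Infty_iff [simp]: "x + y = Infty \<longleftrightarrow> x = Infty \<or> y = (Infty :: 'a :: comm_monoid_add vinf)"
  by (cases x; cases y) auto

lemma Infty_le_iff [simp]: "Infty \<le> x \<longleftrightarrow> x = (Infty :: 'a :: linorder vinf)"
  by (cases x) auto

lemma not_Infty_less [simp]: "\<not> Infty < (x :: 'a :: linorder vinf)"
  by (simp add: not_less)

lemma less_Infty_iff [simp]: "x < Infty \<longleftrightarrow> x \<noteq> (Infty :: 'a :: linorder vinf)"
  by (cases x) auto

lemma Val_eq_0_iff [simp]: "Val x = 0 \<longleftrightarrow> x = 0"
  by (simp add: zero_vinf_def)

lemma Infty_neq_0 [simp]: "Infty \<noteq> 0" "0 \<noteq> Infty"
  by (simp_all add: zero_vinf_def)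

lemma Val_pos_iff [simp]: "0 < Val x \<longleftrightarrow> 0 < x" "Val x < 0 \<longleftrightarrow> x < 0"
  "0 \<le> Val x \<longleftrightarrow> 0 \<le> x" "Val x \<le> 0 \<longleftrightarrow> x \<le> 0"
  by (simp_all add: zero_vinf_def)

lemma Val_zero [simp]: "Val 0 = 0"
  by (simp add: zero_vinf_def)

lemma vinf_add_cancel [simp]:
  fixes a b c :: "'g :: linordered_ab_group_add vinf"
  assumes "a \<noteq> Infty"
  shows "a + b = a + c \<longleftrightarrow> b = c" "b + a = c + a \<longleftrightarrow> b = c"
    "a + b \<le> a + c \<longleftrightarrow> b \<le> c" "b + a \<le> c + a \<longleftrightarrow> b \<le> c"
    "a + b < a + c \<longleftrightarrow> b < c" "b + a < c + a \<longleftrightarrow> b < c"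
  using assms by (cases a; cases b; cases c; auto simp: less_vinf_def)+

lemma vinf_add_strict_mono:
  fixes a b c d :: "'g :: linordered_ab_group_add vinf"
  assumes "a < b" "c \<le> d" "c \<noteq> Infty"
  shows "a + c < b + d" "c + a < d + b"
  using assms by (cases a; cases b; cases c; cases d; auto intro: add_less_le_mono add_le_less_mono)+

lemma nmul_0 [simp]: "nmul 0 x = 0"
  by (simp add: nmul_def)

lemma nmul_Suc [simp]: "nmul (Suc n) x = x + nmul n x"
  by (simp add: nmul_def add.commute)

lemma nmul_add: "nmul (m + n) x = nmul m x + nmul n x"
  by (induction m) (simp_all add: ac_simps)

lemma nmul_mult: "nmul (m * n) x = nmul m (nmul n x)"
  by (induction m) (simp_all add: nmul_add)

lemma nmul_zero_right [simp]: "nmul n 0 = 0"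
  by (induction n) simp_all

lemma nmul_uminus: "nmul n (- x :: 'g :: ab_group_add) = - nmul n x"
  by (induction n) simp_all

lemma nmul_diff: "nmul n (x - y :: 'g :: ab_group_add) = nmul n x - nmul n y"
  by (induction n) simp_all

lemma nmul_Val [simp]: "nmul n (Val x) = Val (nmul n x)"
  by (induction n) simp_all

lemma nmul_Infty [simp]: "n > 0 \<Longrightarrow> nmul n Infty = (Infty :: 'g :: linordered_ab_group_add vinf)"
  by (cases n) simp_all

lemma nmul_eq_Infty_iff: "nmul n (x :: 'g :: linordered_ab_group_add vinf) = Infty \<longleftrightarrow> n > 0 \<and> x = Infty"
  by (cases x; cases "n > 0") auto

lemma nmul_pos: "0 < x \<Longrightarrow> n > 0 \<Longrightarrow> 0 < nmul n (x :: 'g :: linordered_ab_group_add)"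
proof (induction n)
  case (Suc n)
  thus ?case by (cases "n = 0") (auto intro: add_pos_pos)
qed simp

lemma nmul_sgn:
  fixes x :: "'g :: linordered_ab_group_add"
  assumes "n > 0"
  shows "0 < nmul n x \<longleftrightarrow> 0 < x" "nmul n x < 0 \<longleftrightarrow> x < 0" "nmul n x = 0 \<longleftrightarrow> x = 0"
proof -
  have 1: "x > 0 \<Longrightarrow> nmul n x > 0" for x :: 'g
    using nmul_pos assms by blast
  have 2: "x < 0 \<Longrightarrow> nmul n x < 0" for x :: 'g
    using 1[of "-x"] by (simp add: nmul_uminus)
  have "x < 0 \<or> x = 0 \<or> x > 0" by auto
  thus "0 < nmul n x \<longleftrightarrow> 0 < x" "nmul n x < 0 \<longleftrightarrow> x < 0" "nmul n x = 0 \<longleftrightarrow> x = 0"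
    using 1[of x] 2[of x] by auto
qed

lemma nmul_nat_inj:
  fixes x :: "'g :: linordered_ab_group_add"
  assumes "x \<noteq> 0" "nmul m x = nmul n x" shows "m = n"
proof (rule ccontr)
  assume ne: "m \<noteq> n"
  have *: False if "i < j" "nmul i x = nmul j x" for i j
  proof -
    have "nmul j x = nmul (j - i) x + nmul i x"
      using that(1) nmul_add[of "j - i" i x] by simp
    hence "nmul (j - i) x = 0" using that by simp
    thus False using nmul_sgn(3)[of "j - i" x] that assms by auto
  qed
  show False using *[of m n] *[of n m] ne assms(2) by (metis linorder_neqE_nat)
qed

section \<open>Valuations on a subring\<close>

text \<open>The explicit carrier allows for polynomials with coefficients in a subfield of the
  closure, which do not form a type. The support may be nonzero, as it is for evaluation at a
  root.\<close>

locale val_on =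
  fixes A :: "'r :: comm_ring_1 set" and u :: "'r \<Rightarrow> 'g :: linordered_ab_group_add vinf"
  assumes zero_in [simp, intro]: "0 \<in> A" and one_in [simp, intro]: "1 \<in> A"
    and add_in [simp, intro]: "x \<in> A \<Longrightarrow> y \<in> A \<Longrightarrow> x + y \<in> A"
    and mult_in [simp, intro]: "x \<in> A \<Longrightarrow> y \<in> A \<Longrightarrow> x * y \<in> A"
    and uminus_in [simp, intro]: "x \<in> A \<Longrightarrow> - x \<in> A"
    and zero [simp]: "u 0 = Infty" and one [simp]: "u 1 = 0"
    and mult: "x \<in> A \<Longrightarrow> y \<in> A \<Longrightarrow> u (x * y) = u x + u y"
    and add: "x \<in> A \<Longrightarrow> y \<in> A \<Longrightarrow> min (u x) (u y) \<le> u (x + y)"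
begin

lemma diff_in [simp, intro]: "x \<in> A \<Longrightarrow> y \<in> A \<Longrightarrow> x - y \<in> A"
  using add_in[of x "- y"] by simp

lemma sum_in [intro]: "(\<And>i. i \<in> I \<Longrightarrow> f i \<in> A) \<Longrightarrow> sum f I \<in> A"
  by (induction I rule: infinite_finite_induct) auto

lemma prod_in [intro]: "(\<And>i. i \<in> I \<Longrightarrow> f i \<in> A) \<Longrightarrow> prod f I \<in> A"
  by (induction I rule: infinite_finite_induct) auto

lemma power_in [simp, intro]: "x \<in> A \<Longrightarrow> x ^ n \<in> A"
  by (induction n) auto

lemma minus_one [simp]: "u (- 1) = 0"
proof -
  have "u (-1) + u (-1) = 0" using mult[of "-1" "-1"] by simp
  thus ?thesis
  proof (cases "u (-1)")
    case (Val a)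
    hence "a + a = 0" using \<open>u (-1) + u (-1) = 0\<close> by simp
    hence "a = 0" by (simp add: double_zero)
    thus ?thesis using Val by simp
  qed simp
qed

lemma uminus [simp]: "x \<in> A \<Longrightarrow> u (- x) = u x"
  using mult[of "- 1" x] by simp

lemma diff: "x \<in> A \<Longrightarrow> y \<in> A \<Longrightarrow> min (u x) (u y) \<le> u (x - y)"
  using add[of x "- y"] by simp

lemma add_eq: "x \<in> A \<Longrightarrow> y \<in> A \<Longrightarrow> u x < u y \<Longrightarrow> u (x + y) = u x"
proof -
  assume *: "x \<in> A" "y \<in> A" "u x < u y"
  have "u x \<le> u (x + y)" using add[of x y] * by simp
  moreover have "min (u (x + y)) (u y) \<le> u x" using diff[of "x + y" y] * by simp
  ultimately show ?thesis using * by (auto simp: min_def split: if_splits)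
qed

lemma add_eq': "x \<in> A \<Longrightarrow> y \<in> A \<Longrightarrow> u x < u y \<Longrightarrow> u (y + x) = u x"
  using add_eq by (simp add: add.commute)

lemma diff_eq: "x \<in> A \<Longrightarrow> y \<in> A \<Longrightarrow> u x < u y \<Longrightarrow> u (x - y) = u x"
  using add_eq[of x "- y"] by simp

lemma diff_eq': "x \<in> A \<Longrightarrow> y \<in> A \<Longrightarrow> u x < u y \<Longrightarrow> u (y - x) = u x"
  using add_eq'[of "- x" y] by simp

lemma eq_of_diff: "x \<in> A \<Longrightarrow> y \<in> A \<Longrightarrow> u x < u (x - y) \<Longrightarrow> u y = u x"
  using diff_eq[of x "x - y"] by simp

lemma add_ge: "x \<in> A \<Longrightarrow> y \<in> A \<Longrightarrow> c \<le> u x \<Longrightarrow> c \<le> u y \<Longrightarrow> c \<le> u (x + y)"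
  using add[of x y] by (auto simp: min_def split: if_splits)

lemma add_gt: "x \<in> A \<Longrightarrow> y \<in> A \<Longrightarrow> c < u x \<Longrightarrow> c < u y \<Longrightarrow> c < u (x + y)"
  using add[of x y] by (auto simp: min_def split: if_splits)

lemma diff_ge: "x \<in> A \<Longrightarrow> y \<in> A \<Longrightarrow> c \<le> u x \<Longrightarrow> c \<le> u y \<Longrightarrow> c \<le> u (x - y)"
  using add_ge[of x "- y"] by simp

lemma diff_gt: "x \<in> A \<Longrightarrow> y \<in> A \<Longrightarrow> c < u x \<Longrightarrow> c < u y \<Longrightarrow> c < u (x - y)"
  using add_gt[of x "- y"] by simp

lemma sum_ge: "(\<And>i. i \<in> I \<Longrightarrow> f i \<in> A) \<Longrightarrow> (\<And>i. i \<in> I \<Longrightarrow> c \<le> u (f i)) \<Longrightarrow> c \<le> u (sum f I)"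
  by (induction I rule: infinite_finite_induct) (auto intro!: add_ge)

lemma sum_gt: "c \<noteq> Infty \<Longrightarrow> (\<And>i. i \<in> I \<Longrightarrow> f i \<in> A) \<Longrightarrow> (\<And>i. i \<in> I \<Longrightarrow> c < u (f i)) \<Longrightarrow> c < u (sum f I)"
  by (induction I rule: infinite_finite_induct) (auto intro!: add_gt)

lemma sum_dominant:
  assumes "finite I" "k \<in> I" "\<And>i. i \<in> I \<Longrightarrow> f i \<in> A" "\<And>i. i \<in> I \<Longrightarrow> i \<noteq> k \<Longrightarrow> u (f k) < u (f i)"
  shows "u (sum f I) = u (f k)"
proof -
  have eq: "sum f I = f k + sum f (I - {k})"
    using assms by (simp add: sum.remove)
  \<comment> \<open>With a single summand the value may be \<open>Infty\<close>; otherwise the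
    strictly larger value of another summand makes it finite, as \<open>sum_gt\<close>
    requires.\<close>
  show ?thesis
  proof (cases "I - {k} = {}")
    case True
    thus ?thesis using eq by (metis add.right_neutral sum.empty)
  next
    case False
    then obtain i where "i \<in> I" "i \<noteq> k" by auto
    hence "u (f k) \<noteq> Infty" using assms(4)[of i] by auto
    hence "u (f k) < u (sum f (I - {k}))"
      using assms by (intro sum_gt) auto
    thus ?thesis unfolding eq using assms by (intro add_eq) auto
  qed
qed

lemma power: "x \<in> A \<Longrightarrow> u (x ^ n) = nmul n (u x)"
  by (induction n) (simp_all add: mult)

lemma prod: "(\<And>i. i \<in> I \<Longrightarrow> f i \<in> A) \<Longrightarrow> u (prod f I) = (\<Sum>i\<in>I. u (f i))"
  by (induction I rule: infinite_finite_induct) (auto simp: mult prod_in)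

end

lemma valuation_iff_val_on: "valuation w \<longleftrightarrow> val_on UNIV w"
  unfolding valuation_def val_on_def by auto

lemmas val_onD = valuation_iff_val_on[THEN iffD1]

lemmas val_zero = val_on.zero[OF val_onD]
  and val_one = val_on.one[OF val_onD]
  and val_mult = val_on.mult[OF val_onD, OF _ UNIV_I UNIV_I]
  and val_minus_one = val_on.minus_one[OF val_onD]
  and val_uminus = val_on.uminus[OF val_onD, OF _ UNIV_I]
  and val_diff_eq = val_on.diff_eq[OF val_onD, OF _ UNIV_I UNIV_I]
  and val_diff_eq' = val_on.diff_eq'[OF val_onD, OF _ UNIV_I UNIV_I]
  and val_eq_of_diff = val_on.eq_of_diff[OF val_onD, OF _ UNIV_I UNIV_I]
  and val_add_ge = val_on.add_ge[OF val_onD, OF _ UNIV_I UNIV_I]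
  and val_add_gt = val_on.add_gt[OF val_onD, OF _ UNIV_I UNIV_I]
  and val_diff_ge = val_on.diff_ge[OF val_onD, OF _ UNIV_I UNIV_I]
  and val_diff_gt = val_on.diff_gt[OF val_onD, OF _ UNIV_I UNIV_I]
  and val_sum_ge = val_on.sum_ge[OF val_onD, OF _ UNIV_I]
  and val_sum_gt = val_on.sum_gt[OF val_onD, OF _ _ UNIV_I]
  and val_sum_dominant = val_on.sum_dominant[OF val_onD, OF _ _ _ UNIV_I]
  and val_power = val_on.power[OF val_onD, OF _ UNIV_I]

section \<open>Separating finitely many valuations\<close>

text \<open>
  If \<open>x\<close> has value \<open>0\<close> at \<open>u\<^sub>0\<close> and negative value at \<open>u\<^sub>j\<close>, consider the sequence
  \<open>s\<^sub>n = 1 + x s\<^sub>0 \<dots> s\<^sub>n\<^sub>-\<^sub>1\<close>. A valuation which is nonnegative at \<open>x\<close> is positive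
  at no more than one of its members, since later members are congruent to \<open>1\<close>. Hence some \<open>s\<^sub>n\<close> has
  nonpositive value everywhere, and its inverse is the separating element.
\<close>

fun sylvester :: "'r :: comm_ring_1 \<Rightarrow> nat \<Rightarrow> 'r" and sylvester_prod :: "'r \<Rightarrow> nat \<Rightarrow> 'r" where
  "sylvester x n = 1 + x * sylvester_prod x n"
| "sylvester_prod x 0 = 1"
| "sylvester_prod x (Suc n) = sylvester_prod x n * sylvester x n"

declare sylvester.simps [simp del]

lemma sylvester_prod_eq: "sylvester_prod x n = (\<Prod>i<n. sylvester x i)"
  by (induction n) simp_all

lemma (in val_on) sylvester_in: "x \<in> A \<Longrightarrow> sylvester x n \<in> A \<and> sylvester_prod x n \<in> A"
  by (induction n) (auto simp: sylvester.simps)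

lemma (in val_on) sylvester_nonneg:
  assumes "x \<in> A" "0 \<le> u x" shows "0 \<le> u (sylvester x n) \<and> 0 \<le> u (sylvester_prod x n)"
proof (induction n)
  case 0
  show ?case using assms add_ge[of 1 x 0] by (simp add: sylvester.simps)
next
  case (Suc n)
  have "0 \<le> u (sylvester_prod x (Suc n))"
    using Suc sylvester_in[OF assms(1), of n] by (auto simp: mult intro: add_nonneg_nonneg)
  thus ?case
    using sylvester_in[OF assms(1), of "Suc n"] assms
    by (auto simp: sylvester.simps[of x "Suc n"] mult simp del: sylvester_prod.simps intro!: add_ge add_nonneg_nonneg)
qed

text \<open>The product of \<open>x\<close> with the earlier members has negative value and
  dominates the summand 1.\<close>

lemma (in val_on) sylvester_neg:
  assumes "x \<in> A" "u x < 0" shows "u (sylvester x n) < 0 \<and> u (sylvester_prod x n) \<le> 0"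
proof (induction n)
  case 0
  show ?case using assms add_eq[of x 1] by (simp add: sylvester.simps add.commute)
next
  case (Suc n)
  have 1: "u (sylvester_prod x (Suc n)) \<le> 0"
    using Suc sylvester_in[OF assms(1), of n] by (auto simp: mult intro: add_nonpos_nonpos)
  have "u x + u (sylvester_prod x (Suc n)) < 0 + 0"
    using assms 1 by (intro vinf_add_strict_mono) auto
  hence 2: "u (x * sylvester_prod x (Suc n)) < 0"
    using sylvester_in[OF assms(1), of "Suc n"] assms by (simp add: mult del: sylvester_prod.simps)
  hence "u (sylvester x (Suc n)) < 0"
    using add_eq[of "x * sylvester_prod x (Suc n)" 1] sylvester_in[OF assms(1), of "Suc n"] assms(1)
    by (simp add: sylvester.simps[of x "Suc n"] add.commute del: sylvester_prod.simps)
  thus ?case using 1 by blast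
qed

lemma (in val_on) sylvester_pos_unique:
  assumes "x \<in> A" "0 \<le> u x" "0 < u (sylvester x m)" "m < n"
  shows "u (sylvester x n) = 0"
proof -
  have in_A: "sylvester x i \<in> A" for i using sylvester_in[OF assms(1)] by blast
  have "sylvester_prod x n = sylvester x m * (\<Prod>i\<in>{..<n}-{m}. sylvester x i)"
    using assms(4) by (simp add: sylvester_prod_eq prod.remove)
  moreover have "u (\<Prod>i\<in>{..<n}-{m}. sylvester x i) \<ge> 0"
    using in_A sylvester_nonneg[OF assms(1,2)] by (subst prod) (auto intro!: sum_nonneg)
  ultimately have "u (sylvester_prod x n) > 0"
    using in_A assms(3) by (auto simp: mult prod_in intro!: add_pos_nonneg)
  hence "u (x * sylvester_prod x n) > 0"
    using assms sylvester_in[OF assms(1), of n] by (auto simp: mult intro!: add_nonneg_pos)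
  thus ?thesis
    using add_eq[of 1 "x * sylvester_prod x n"] assms sylvester_in[OF assms(1), of n]
    by (simp add: sylvester.simps)
qed

text \<open>The assumption \<open>inv\<close> expresses invertibility modulo the supports, with one
  inverse serving all of \<open>J\<close>. In the applications all supports are generated by the
  same irreducible polynomial, and Bezout's identity provides the inverse.\<close>

lemma separate_one:
  fixes u :: "'i \<Rightarrow> 'r :: comm_ring_1 \<Rightarrow> 'g :: linordered_ab_group_add vinf"
  assumes fin: "finite J" and val: "\<And>j. j \<in> J \<Longrightarrow> val_on A (u j)"
    and inv: "\<And>x j. x \<in> A \<Longrightarrow> j \<in> J \<Longrightarrow> u j x \<noteq> Infty \<Longrightarrow> \<exists>y\<in>A. \<forall>j\<in>J. u j x + u j y = 0"
    and x: "x \<in> A" "i \<in> J" "u i x = 0" "j \<in> J" "u j x < 0"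
  shows "\<exists>y\<in>A. u i y = 0 \<and> u j y > 0 \<and> (\<forall>k\<in>J. u k y \<ge> 0)"
proof -
  define bad where "bad k = {n. u k (sylvester x n) > 0}" for k
  have bad: "\<exists>m. bad k \<subseteq> {m}" if "k \<in> J" for k
  proof (cases "u k x \<ge> 0")
    case True
    have "m = n" if "m \<in> bad k" "n \<in> bad k" for m n
      using that val_on.sylvester_pos_unique[OF val[OF \<open>k \<in> J\<close>] x(1) True, of m n]
        val_on.sylvester_pos_unique[OF val[OF \<open>k \<in> J\<close>] x(1) True, of n m]
      by (cases m n rule: linorder_cases) (auto simp: bad_def)
    thus ?thesis by (cases "bad k = {}") blast+
  next
    case False
    hence "bad k = {}"
      using val_on.sylvester_neg[OF val[OF \<open>k \<in> J\<close>] x(1)] by (auto simp: bad_def not_le dest: less_asym)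
    thus ?thesis by auto
  qed
  have "finite (bad k)" if "k \<in> J" for k
    using bad[OF that] finite_subset by blast
  hence "finite (\<Union>k\<in>J. bad k)" using fin by blast
  then obtain n where n: "n \<notin> (\<Union>k\<in>J. bad k)"
    using infinite_UNIV_nat by (metis ex_new_if_finite)
  have le: "u k (sylvester x n) \<le> 0" if "k \<in> J" for k
    using n that by (auto simp: bad_def)
  have in_A: "sylvester x n \<in> A"
    using val_on.sylvester_in[OF val[OF x(2)] x(1)] by blast
  have s0: "u i (sylvester x n) = 0"
    using val_on.sylvester_nonneg[OF val[OF x(2)] x(1), of n] le[OF x(2)] x(3)
    by auto
  have sj: "u j (sylvester x n) < 0"
    using val_on.sylvester_neg[OF val[OF x(4)] x(1,5)] by blast
  obtain y where y: "y \<in> A" "\<And>k. k \<in> J \<Longrightarrow> u k (sylvester x n) + u k y = 0"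
    using inv[OF in_A x(2)] s0 by auto
  have *: "u k y \<ge> 0" if "k \<in> J" for k
    using y(2)[OF that] le[OF that] by (cases "u k (sylvester x n)"; cases "u k y") (auto simp: add_eq_0_iff)
  have "u i y = 0" using y(2)[OF x(2)] s0 by simp
  moreover have "u j y > 0"
    using y(2)[OF x(4)] sj by (cases "u j (sylvester x n)"; cases "u j y") (auto simp: add_eq_0_iff)
  ultimately show ?thesis using y(1) * by blast
qed

text \<open>If \<open>u i\<close> and \<open>u j\<close> differ at \<open>x\<close>, then a power of
  \<open>x\<close>, divided by a constant supplied by \<open>torsion\<close>, has value 0 at
  \<open>i\<close> and nonzero value at \<open>j\<close>; after inverting it if necessary,
  \<open>separate_one\<close> applies. The elements found for the various \<open>j\<close> are
  nonnegative everywhere, so their product serves all \<open>j\<close> at once.\<close>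

lemma separate_valuations:
  fixes u :: "'i \<Rightarrow> 'r :: comm_ring_1 \<Rightarrow> 'g :: linordered_ab_group_add vinf"
  assumes fin: "finite J" and i: "i \<in> J" and val: "\<And>j. j \<in> J \<Longrightarrow> val_on A (u j)"
    and inv: "\<And>x j. x \<in> A \<Longrightarrow> j \<in> J \<Longrightarrow> u j x \<noteq> Infty \<Longrightarrow> \<exists>y\<in>A. \<forall>j\<in>J. u j x + u j y = 0"
    and torsion: "\<And>a. \<exists>n>0. \<exists>e\<in>A. \<forall>j\<in>J. u j e = Val (nmul n a)"
    and ne: "\<And>j. j \<in> J \<Longrightarrow> j \<noteq> i \<Longrightarrow> \<exists>x\<in>A. u i x \<noteq> u j x"
  shows "\<exists>y\<in>A. u i y = 0 \<and> (\<forall>j\<in>J. j \<noteq> i \<longrightarrow> u j y > 0)"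
proof -
  have "\<exists>y\<in>A. u i y = 0 \<and> u j y > 0 \<and> (\<forall>k\<in>J. u k y \<ge> 0)" if j: "j \<in> J" "j \<noteq> i" for j
  proof -
    obtain x where x: "x \<in> A" "u i x \<noteq> u j x" using ne[OF j] by blast
    \<comment> \<open>Inverses are common to all members of \<open>J\<close>, so \<open>x\<close>
      lies in all of the supports or in none.\<close>
    have fin_iff: "u k x = Infty \<longleftrightarrow> u l x = Infty" if "k \<in> J" "l \<in> J" for k l
    proof -
      have "u l x \<noteq> Infty" if kl: "k \<in> J" "l \<in> J" "u k x \<noteq> Infty" for k l
      proof -
        obtain y where "u l x + u l y = 0" using inv[OF x(1) kl(1,3)] kl(2) by blast
        thus ?thesis by auto
      qed
      thus ?thesis using that by blast
    qed
    have nI: "u i x \<noteq> Infty" using x(2) fin_iff[OF i j(1)] by auto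
    then obtain a where a: "u i x = Val a" by (cases "u i x") auto
    obtain b where b: "u j x = Val b" using nI fin_iff[OF i j(1)] by (cases "u j x") auto
    obtain n e where n: "n > 0" "e \<in> A" "\<And>k. k \<in> J \<Longrightarrow> u k e = Val (nmul n a)"
      using torsion by blast
    obtain e' where e': "e' \<in> A" "\<And>k. k \<in> J \<Longrightarrow> u k e + u k e' = 0"
      using inv[OF n(2) i] n(3)[OF i] by auto
    have ve': "u k e' = Val (- nmul n a)" if "k \<in> J" for k
      using e'(2)[OF that] n(3)[OF that] by (cases "u k e'") (auto simp: add_eq_0_iff)
    define q where "q = x ^ n * e'"
    have q: "q \<in> A" unfolding q_def using x e' val_on.power_in[OF val[OF i]] val_on.mult_in[OF val[OF i]] by blast
    have pin: "x ^ n \<in> A" using x val_on.power_in[OF val[OF i]] by blast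
    have qi: "u i q = 0"
      using val_on.mult[OF val[OF i] pin e'(1)] val_on.power[OF val[OF i] x(1)] a ve'[OF i]
      by (simp add: q_def)
    have qj: "u j q = Val (nmul n (b - a))"
      using val_on.mult[OF val[OF j(1)] pin e'(1)] val_on.power[OF val[OF j(1)] x(1)] b ve'[OF j(1)]
      by (simp add: q_def nmul_diff)
    have "b - a \<noteq> 0" using x(2) a b by auto
    hence "nmul n (b - a) \<noteq> 0" using nmul_sgn(3)[OF n(1)] by blast
    then consider "u j q < 0" | "u j q > 0" using qj by (cases "nmul n (b - a) < 0") auto
    thus ?thesis
    proof cases
      case 1
      show ?thesis by (rule separate_one[OF fin val inv q i qi j(1) 1])
    next
      case 2
      obtain q' where q': "q' \<in> A" "\<And>k. k \<in> J \<Longrightarrow> u k q + u k q' = 0"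
        using inv[OF q i] qi by auto
      have "u i q' = 0" using q'(2)[OF i] qi by simp
      moreover have "u j q' < 0" using q'(2)[OF j(1)] 2
        by (cases "u j q"; cases "u j q'") (auto simp: add_eq_0_iff)
      ultimately show ?thesis by (intro separate_one[OF fin val inv q'(1) i _ j(1)])
    qed
  qed
  then obtain y where y: "\<And>j. j \<in> J \<Longrightarrow> j \<noteq> i \<Longrightarrow> y j \<in> A \<and> u i (y j) = 0 \<and> u j (y j) > 0 \<and> (\<forall>k\<in>J. u k (y j) \<ge> 0)"
    by metis
  define z where "z = (\<Prod>j\<in>J-{i}. y j)"
  have zA: "z \<in> A" unfolding z_def using y by (intro val_on.prod_in[OF val[OF i]]) auto
  have "u i z = 0"
    unfolding z_def using y by (subst val_on.prod[OF val[OF i]]) auto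
  moreover have "u j z > 0" if j: "j \<in> J" "j \<noteq> i" for j
  proof -
    have "u j z = (\<Sum>k\<in>J-{i}. u j (y k))"
      unfolding z_def using y by (subst val_on.prod[OF val[OF j(1)]]) auto
    also have "\<dots> = u j (y j) + (\<Sum>k\<in>J-{i}-{j}. u j (y k))"
      using j fin by (subst sum.remove[of _ j]) auto
    also have "\<dots> > 0"
      using y j by (intro add_pos_nonneg sum_nonneg) auto
    finally show ?thesis .
  qed
  ultimately show ?thesis using zA by blast
qed

section \<open>Polynomials over a subfield\<close>

definition subfld :: "'c :: field set \<Rightarrow> bool" where
  "subfld E \<longleftrightarrow> 0 \<in> E \<and> 1 \<in> E \<and> (\<forall>x\<in>E. \<forall>y\<in>E. x + y \<in> E \<and> x * y \<in> E) \<and>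
     (\<forall>x\<in>E. - x \<in> E \<and> inverse x \<in> E)"

lemma subfldD:
  assumes "subfld E"
  shows "0 \<in> E" "1 \<in> E" "x \<in> E \<Longrightarrow> y \<in> E \<Longrightarrow> x + y \<in> E" "x \<in> E \<Longrightarrow> y \<in> E \<Longrightarrow> x * y \<in> E"
    "x \<in> E \<Longrightarrow> - x \<in> E" "x \<in> E \<Longrightarrow> inverse x \<in> E" "x \<in> E \<Longrightarrow> y \<in> E \<Longrightarrow> x - y \<in> E"
    "x \<in> E \<Longrightarrow> y \<in> E \<Longrightarrow> x / y \<in> E"
  using assms unfolding subfld_def diff_conv_add_uminus[of x y] divide_inverse by blast+

lemma subfld_sum: "subfld E \<Longrightarrow> (\<And>i. i \<in> I \<Longrightarrow> f i \<in> E) \<Longrightarrow> sum f I \<in> E"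
  by (induction I rule: infinite_finite_induct) (auto simp: subfldD)

lemma subfld_power: "subfld E \<Longrightarrow> x \<in> E \<Longrightarrow> x ^ n \<in> E"
  by (induction n) (auto simp: subfldD)

lemma subfld_UNIV [simp]: "subfld UNIV"
  by (simp add: subfld_def)

lemma polys_over_UNIV [simp]: "polys_over UNIV = UNIV"
  by (simp add: polys_over_def)

lemma monic_dvd_antisym:
  fixes p q :: "'c :: field poly"
  assumes "p dvd q" "q dvd p" "lead_coeff p = 1" "lead_coeff q = 1"
  shows "p = q"
proof -
  obtain k where k: "q = p * k" using assms(1) by blast
  have nz: "p \<noteq> 0" "q \<noteq> 0" "k \<noteq> 0" using assms k by auto
  have "degree q \<le> degree p" using assms(2) nz dvd_imp_degree_le by blast
  hence "degree k = 0" using k nz by (simp add: degree_mult_eq)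
  then obtain c where c: "k = [:c:]" by (metis degree_eq_zeroE)
  have "lead_coeff q = lead_coeff p * c" unfolding k lead_coeff_mult by (simp add: c)
  hence "c = 1" using assms by simp
  thus ?thesis using k c by simp
qed

context
  fixes E :: "'c :: field set"
  assumes E: "subfld E"
begin

lemma polys_over_0 [simp]: "0 \<in> polys_over E"
  by (simp add: polys_over_def subfldD[OF E])

lemma polys_over_1 [simp]: "1 \<in> polys_over E"
  by (simp add: polys_over_def subfldD[OF E])

lemma polys_over_pCons: "pCons a p \<in> polys_over E \<longleftrightarrow> a \<in> E \<and> p \<in> polys_over E"
  by (auto simp: polys_over_def coeff_pCons split: nat.splits)

lemma polys_over_const: "a \<in> E \<Longrightarrow> [:a:] \<in> polys_over E"
  by (simp add: polys_over_pCons)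

lemma polys_over_X: "[:0, 1:] \<in> polys_over E"
  by (simp add: polys_over_pCons subfldD[OF E])

lemma polys_over_add: "p \<in> polys_over E \<Longrightarrow> q \<in> polys_over E \<Longrightarrow> p + q \<in> polys_over E"
  by (simp add: polys_over_def subfldD[OF E])

lemma polys_over_uminus: "p \<in> polys_over E \<Longrightarrow> - p \<in> polys_over E"
  by (simp add: polys_over_def subfldD[OF E])

lemma polys_over_diff: "p \<in> polys_over E \<Longrightarrow> q \<in> polys_over E \<Longrightarrow> p - q \<in> polys_over E"
  by (simp add: polys_over_def subfldD[OF E])

lemma polys_over_mult: "p \<in> polys_over E \<Longrightarrow> q \<in> polys_over E \<Longrightarrow> p * q \<in> polys_over E"
  by (auto simp: polys_over_def coeff_mult intro!: subfld_sum[OF E] subfldD(4)[OF E])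

lemma polys_over_smult: "a \<in> E \<Longrightarrow> p \<in> polys_over E \<Longrightarrow> smult a p \<in> polys_over E"
  by (simp add: polys_over_def subfldD[OF E])

lemma polys_over_power: "p \<in> polys_over E \<Longrightarrow> p ^ n \<in> polys_over E"
  by (induction n) (auto simp: polys_over_mult)

lemma polys_over_monom: "a \<in> E \<Longrightarrow> monom a n \<in> polys_over E"
  by (simp add: polys_over_def subfldD[OF E])

lemma polys_over_sum: "(\<And>i. i \<in> I \<Longrightarrow> f i \<in> polys_over E) \<Longrightarrow> sum f I \<in> polys_over E"
  by (induction I rule: infinite_finite_induct) (auto simp: polys_over_add)

lemma polys_over_pcompose: "p \<in> polys_over E \<Longrightarrow> q \<in> polys_over E \<Longrightarrow> pcompose p q \<in> polys_over E"
  by (induction p rule: pCons_induct)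
    (auto simp: pcompose_pCons polys_over_pCons intro!: polys_over_add polys_over_mult)

lemma poly_in: "p \<in> polys_over E \<Longrightarrow> x \<in> E \<Longrightarrow> poly p x \<in> E"
  by (induction p rule: pCons_induct) (auto simp: polys_over_pCons subfldD[OF E])

lemma polys_over_pderiv: "p \<in> polys_over E \<Longrightarrow> pderiv p \<in> polys_over E"
proof -
  assume p: "p \<in> polys_over E"
  have n: "of_nat n \<in> E" for n by (induction n) (auto simp: subfldD[OF E])
  show ?thesis unfolding polys_over_def mem_Collect_eq coeff_pderiv
    using p by (intro allI subfldD(4)[OF E] n) (auto simp: polys_over_def)
qed

text \<open>Long division uses only field operations on the coefficients. By uniqueness of division,
  \<open>div\<close> and \<open>mod\<close> of the ambient field then stay over
  \<open>E\<close>.\<close>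

lemma polys_over_division:
  assumes "p \<in> polys_over E" "d \<in> polys_over E" "d \<noteq> 0"
  shows "\<exists>q\<in>polys_over E. \<exists>r\<in>polys_over E. p = q * d + r \<and> (r = 0 \<or> degree r < degree d)"
  using assms(1)
proof (induction "degree p" arbitrary: p rule: less_induct)
  case less
  show ?case
  proof (cases "p = 0 \<or> degree p < degree d")
    case True
    thus ?thesis using less(2) by (intro bexI[of _ 0] bexI[of _ p]) auto
  next
    case False
    define t where "t = monom (lead_coeff p / lead_coeff d) (degree p - degree d)"
    have t: "t \<in> polys_over E"
      unfolding t_def using less(2) assms(2) by (intro polys_over_monom subfldD[OF E]) (auto simp: polys_over_def)
    have lc: "lead_coeff p / lead_coeff d \<noteq> 0" using False assms(3) by auto
    have dt: "degree (t * d) = degree p"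
      unfolding t_def using False assms(3) lc by (subst degree_mult_eq) (auto simp: degree_monom_eq)
    have ct: "coeff (t * d) (degree p) = lead_coeff p"
      using lead_coeff_mult[of t d] assms(3) lc unfolding dt by (simp add: t_def degree_monom_eq)
    have in_p: "p - t * d \<in> polys_over E"
      using less(2) t assms(2) by (intro polys_over_diff polys_over_mult)
    show ?thesis
    proof (cases "p - t * d = 0")
      case True
      thus ?thesis using t by (intro bexI[of _ t] bexI[of _ 0]) auto
    next
      case nz: False
      have "degree (p - t * d) < degree p"
      proof (rule ccontr)
        assume "\<not> ?thesis"
        moreover have "degree (p - t * d) \<le> degree p" using degree_diff_le_max[of p "t * d"] dt by simp
        ultimately have "degree (p - t * d) = degree p" by simp
        moreover have "coeff (p - t * d) (degree p) = 0" using ct by simp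
        ultimately show False using nz by (metis leading_coeff_0_iff)
      qed
      from less(1)[OF this in_p] obtain q r where qr: "q \<in> polys_over E" "r \<in> polys_over E"
        "p - t * d = q * d + r" "r = 0 \<or> degree r < degree d" by blast
      show ?thesis
        using qr t by (intro bexI[of _ "q + t"] bexI[of _ r] polys_over_add) (auto simp: algebra_simps)
    qed
  qed
qed

lemma polys_over_div_mod:
  assumes "p \<in> polys_over E" "d \<in> polys_over E"
  shows "p div d \<in> polys_over E" "p mod d \<in> polys_over E"
proof -
  have "p div d \<in> polys_over E \<and> p mod d \<in> polys_over E"
  proof (cases "d = 0")
    case False
    obtain q r where qr: "q \<in> polys_over E" "r \<in> polys_over E" "p = q * d + r" "r = 0 \<or> degree r < degree d"
      using polys_over_division[OF assms False] by blast
    have "r div d = 0" "r mod d = r" using qr(4) by (auto simp: div_poly_less mod_poly_less)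
    hence "p div d = q" "p mod d = r" using False qr(3) by (simp_all add: div_mult_self3)
    thus ?thesis using qr by simp
  qed (use assms in auto)
  thus "p div d \<in> polys_over E" "p mod d \<in> polys_over E" by auto
qed

lemma Irr_overD:
  assumes "F \<in> Irr_over E"
  shows "F \<in> polys_over E" "lead_coeff F = 1" "degree F > 0" "F \<noteq> 0"
  using assms unfolding Irr_over_def by auto

text \<open>An element of least degree in the ideal generated by \<open>p\<close> and
  \<open>q\<close> over \<open>E\<close> divides both of them, and irreducibility of
  \<open>p\<close> leaves only a constant.\<close>

lemma bezout_over:
  assumes p: "p \<in> Irr_over E" and q: "q \<in> polys_over E" and nd: "\<not> p dvd q"
  shows "\<exists>a\<in>polys_over E. \<exists>b\<in>polys_over E. a * p + b * q = 1"
proof -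
  note P = Irr_overD[OF p]
  define S where "S = {a * p + b * q | a b. a \<in> polys_over E \<and> b \<in> polys_over E}"
  have "p \<in> S" unfolding S_def using polys_over_0 polys_over_1
    by (metis (mono_tags, lifting) add.right_neutral mem_Collect_eq mult_1 mult_zero_left)
  hence "\<exists>d. d \<in> S \<and> d \<noteq> 0" using P by auto
  then obtain d where d: "d \<in> S" "d \<noteq> 0" "\<And>e. e \<in> S \<Longrightarrow> e \<noteq> 0 \<Longrightarrow> degree d \<le> degree e"
    using ex_has_least_nat[of "\<lambda>d. d \<in> S \<and> d \<noteq> 0" _ degree] by metis
  obtain a b where ab: "a \<in> polys_over E" "b \<in> polys_over E" "d = a * p + b * q"
    using d(1) by (auto simp: S_def)
  have dE: "d \<in> polys_over E" using ab P q by (auto intro!: polys_over_add polys_over_mult)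
  have dvd: "d dvd z" if z: "z \<in> S" for z
  proof (rule ccontr)
    assume "\<not> d dvd z"
    hence nz: "z mod d \<noteq> 0" by (simp add: dvd_eq_mod_eq_0)
    obtain a' b' where ab': "a' \<in> polys_over E" "b' \<in> polys_over E" "z = a' * p + b' * q"
      using z by (auto simp: S_def)
    have zE: "z \<in> polys_over E" using ab' P q by (auto intro!: polys_over_add polys_over_mult)
    have "z mod d = z - (z div d) * d" by (simp add: minus_div_mult_eq_mod)
    also have "\<dots> = (a' - (z div d) * a) * p + (b' - (z div d) * b) * q"
      unfolding ab(3) ab'(3) by (simp add: algebra_simps)
    finally have "z mod d \<in> S"
      unfolding S_def using ab ab' polys_over_div_mod[OF zE dE] by (auto intro!: polys_over_diff polys_over_mult)
    from d(3)[OF this nz] show False using degree_mod_less[OF d(2), of z] nz by auto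
  qed
  have dp: "d dvd p" using dvd \<open>p \<in> S\<close> by blast
  have "q \<in> S" unfolding S_def using polys_over_0 polys_over_1
    by (metis (mono_tags, lifting) add.left_neutral mem_Collect_eq mult_1 mult_zero_left)
  hence dq: "d dvd q" using dvd by blast
  have e: "p = d * (p div d)" using dp by simp
  have i: "p div d \<in> polys_over E" using polys_over_div_mod P dE by blast
  have "\<forall>A\<in>polys_over E. \<forall>B\<in>polys_over E. p = A * B \<longrightarrow> degree A = 0 \<or> degree B = 0"
    using p by (simp add: Irr_over_def)
  from this[THEN bspec, OF dE, THEN bspec, OF i] have "degree d = 0 \<or> degree (p div d) = 0"
    using e by simp
  hence d0: "degree d = 0"
  proof
    assume "degree (p div d) = 0"
    then obtain c where c: "p div d = [:c:]" by (metis degree_eq_zeroE)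
    hence "p = smult c d" using e by simp
    moreover have "c \<noteq> 0" using \<open>p = smult c d\<close> P(4) by auto
    ultimately have "p dvd q" using dq by (simp add: smult_dvd_iff)
    thus ?thesis using nd by simp
  qed simp
  then obtain c where c: "d = [:c:]" by (metis degree_eq_zeroE)
  have cE: "c \<in> E" using dE c by (simp add: polys_over_pCons)
  have "smult (inverse c) a * p + smult (inverse c) b * q = smult (inverse c) d"
    unfolding ab(3) by (simp add: smult_add_right)
  also have "\<dots> = 1" using c d(2) by (simp add: one_pCons)
  finally show ?thesis using ab cE subfldD(6)[OF E] polys_over_smult by blast
qed

definition is_minpoly :: "'c poly \<Rightarrow> 'c \<Rightarrow> bool" where
  "is_minpoly m x \<longleftrightarrow> m \<in> Irr_over E \<and> poly m x = 0"

lemma minpoly_dvd_iff: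
  assumes "is_minpoly m x" "q \<in> polys_over E"
  shows "poly q x = 0 \<longleftrightarrow> m dvd q"
proof
  assume "poly q x = 0"
  show "m dvd q"
  proof (rule ccontr)
    assume "\<not> m dvd q"
    then obtain a b where "a * m + b * q = 1"
      using bezout_over assms unfolding is_minpoly_def by blast
    hence "poly (a * m + b * q) x = 1" by simp
    thus False using assms(1) \<open>poly q x = 0\<close> by (simp add: is_minpoly_def)
  qed
next
  assume "m dvd q"
  thus "poly q x = 0" using assms(1) by (auto simp: is_minpoly_def)
qed

lemma ex_minpoly:
  assumes "q \<in> polys_over E" "q \<noteq> 0" "poly q x = 0"
  shows "\<exists>m. is_minpoly m x"
proof -
  define S where "S = {p \<in> polys_over E. p \<noteq> 0 \<and> poly p x = 0}"
  have "\<exists>p. p \<in> S" using assms by (auto simp: S_def)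
  then obtain d where d: "d \<in> S" "\<And>e. e \<in> S \<Longrightarrow> degree d \<le> degree e"
    using ex_has_least_nat[of "\<lambda>d. d \<in> S" _ degree] by metis
  define m where "m = smult (inverse (lead_coeff d)) d"
  have m: "m \<in> polys_over E" "m \<noteq> 0" "lead_coeff m = 1" "poly m x = 0" "degree m = degree d"
    using d(1) subfldD[OF E] by (auto simp: m_def S_def polys_over_def)
  have dm: "degree m > 0"
  proof (rule ccontr)
    assume "\<not> degree m > 0"
    then obtain c where "m = [:c:]" by (metis degree_eq_zeroE neq0_conv)
    thus False using m by simp
  qed
  have irr: "degree A = 0 \<or> degree B = 0" if AB: "A \<in> polys_over E" "B \<in> polys_over E" "m = A * B" for A B
  proof -
    have nz: "A \<noteq> 0" "B \<noteq> 0" using AB m(2) by auto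
    have "poly A x = 0 \<or> poly B x = 0" using AB m(4) by simp
    hence "A \<in> S \<or> B \<in> S" using AB nz by (auto simp: S_def)
    hence "degree m \<le> degree A \<or> degree m \<le> degree B" using d(2) m(5) by auto
    thus ?thesis using AB nz by (auto simp: degree_mult_eq)
  qed
  have "m \<in> Irr_over E" unfolding Irr_over_def
    by (intro CollectI conjI ballI impI m dm irr)
  thus ?thesis using m(4) unfolding is_minpoly_def by blast
qed

lemma minpoly_unique:
  assumes "is_minpoly m x" "is_minpoly n x" shows "m = n"
proof -
  have mn: "m \<in> Irr_over E" "poly m x = 0" "n \<in> Irr_over E" "poly n x = 0"
    using assms by (auto simp: is_minpoly_def)
  have "m dvd n" "n dvd m"
    using minpoly_dvd_iff[OF assms(1) Irr_overD(1)[OF mn(3)]] minpoly_dvd_iff[OF assms(2) Irr_overD(1)[OF mn(1)]] mn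
    by blast+
  moreover have "lead_coeff m = 1" "lead_coeff n = 1" using mn Irr_overD by blast+
  ultimately show ?thesis using monic_dvd_antisym by blast
qed

lemma ex_irr_factorization:
  assumes "f \<in> polys_over E" "lead_coeff f = 1"
  shows "\<exists>M. set_mset M \<subseteq> Irr_over E \<and> prod_mset M = f"
  using assms
proof (induction "degree f" arbitrary: f rule: less_induct)
  case less
  have "f \<noteq> 0" using less by auto
  show ?case
  proof (cases "degree f = 0")
    case True
    then obtain c where "f = [:c:]" by (metis degree_eq_zeroE)
    hence "f = 1" using less by (simp add: one_pCons)
    thus ?thesis by (intro exI[of _ "{#}"]) auto
  next
    case False
    show ?thesis
    proof (cases "f \<in> Irr_over E")
      case True
      thus ?thesis by (intro exI[of _ "{#f#}"]) auto
    next
      case nI: False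
      then obtain A B where AB: "A \<in> polys_over E" "B \<in> polys_over E" "f = A * B" "degree A > 0" "degree B > 0"
        using less False unfolding Irr_over_def by auto
      have nz: "A \<noteq> 0" "B \<noteq> 0" using AB \<open>f \<noteq> 0\<close> by auto
      have dg: "degree f = degree A + degree B" using AB nz by (simp add: degree_mult_eq)
      define a where "a = lead_coeff A"
      have a: "a \<noteq> 0" "a \<in> E" "lead_coeff B = inverse a"
        using AB nz less(3) lead_coeff_mult[of A B] by (auto simp: a_def polys_over_def inverse_unique)
      define A' where "A' = smult (inverse a) A"
      define B' where "B' = smult a B"
      have A': "A' \<in> polys_over E" "lead_coeff A' = 1" "degree A' < degree f"
        using AB a dg subfldD(6)[OF E] by (auto simp: A'_def a_def intro!: polys_over_smult)
      have B': "B' \<in> polys_over E" "lead_coeff B' = 1" "degree B' < degree f"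
        using AB a dg by (auto simp: B'_def intro!: polys_over_smult)
      obtain M N where "set_mset M \<subseteq> Irr_over E" "prod_mset M = A'" "set_mset N \<subseteq> Irr_over E" "prod_mset N = B'"
        using less(1)[OF A'(3,1,2)] less(1)[OF B'(3,1,2)] by blast
      moreover have "A' * B' = f" using AB a by (simp add: A'_def B'_def)
      ultimately show ?thesis by (intro exI[of _ "M + N"]) auto
    qed
  qed
qed

end

text \<open>A root of an irreducible factor identifies it: irreducible polynomials with a common
  root are both its minimal polynomial.\<close>

lemma irr_factorization_unique:
  fixes E :: "'c :: alg_closed_field set"
  assumes E: "subfld E" and "set_mset M \<subseteq> Irr_over E" "set_mset N \<subseteq> Irr_over E" "prod_mset M = prod_mset N"
  shows "M = N"
  using assms(2-)
proof (induction M arbitrary: N)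
  case empty
  show ?case
  proof (cases "N = {#}")
    case False
    then obtain F where F: "F \<in># N" by blast
    hence "F dvd 1" using empty by (metis dvd_prod_mset prod_mset_empty)
    hence "degree F = 0" using dvd_imp_degree_le[of F 1] by simp
    thus ?thesis using F empty Irr_overD(3)[OF E] by fastforce
  qed simp
next
  case (add F M)
  have F: "F \<in> Irr_over E" using add by auto
  obtain x where x: "poly F x = 0"
    using Irr_overD[OF E F] alg_closed_imp_poly_has_root[of F] by blast
  have "poly (prod_mset N) x = 0"
    using add(4) x by (metis mult_zero_left poly_mult prod_mset.add_mset)
  hence "\<exists>F'\<in>#N. poly F' x = 0"
    by (induction N) auto
  then obtain F' where F': "F' \<in># N" "poly F' x = 0" by blast
  have "F' = F"
    using minpoly_unique[OF E, of F' x F] F F' x add(3) unfolding is_minpoly_def[OF E] by blast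
  then obtain N' where N': "N = add_mset F N'" using F' by (metis multi_member_split)
  have "prod_mset M = prod_mset N'"
    using add(4) N' Irr_overD(4)[OF E F] by simp
  hence "M = N'" using add N' by auto
  thus ?case using N' by simp
qed

lemma irr_factors:
  fixes E :: "'c :: alg_closed_field set"
  assumes E: "subfld E" and "f \<in> polys_over E" "lead_coeff f = 1"
  shows "set_mset (irr_factors E f) \<subseteq> Irr_over E" "prod_mset (irr_factors E f) = f"
proof -
  have "\<exists>!M. set_mset M \<subseteq> Irr_over E \<and> prod_mset M = f"
    using ex_irr_factorization[OF assms] irr_factorization_unique[OF E] by metis
  from theI'[OF this] show "set_mset (irr_factors E f) \<subseteq> Irr_over E" "prod_mset (irr_factors E f) = f"
    unfolding irr_factors_def by auto
qed

section \<open>Homomorphisms of fields\<close>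

text \<open>Homomorphism laws are required on \<open>E\<close> only, since embeddings will be
  extended step by step from subfields of the closure.\<close>

locale fld_hom =
  fixes E :: "'b :: field set" and \<sigma> :: "'b \<Rightarrow> 'c :: field"
  assumes E: "subfld E" and hom_0 [simp]: "\<sigma> 0 = 0" and hom_1 [simp]: "\<sigma> 1 = 1"
    and hom_add: "x \<in> E \<Longrightarrow> y \<in> E \<Longrightarrow> \<sigma> (x + y) = \<sigma> x + \<sigma> y"
    and hom_mult: "x \<in> E \<Longrightarrow> y \<in> E \<Longrightarrow> \<sigma> (x * y) = \<sigma> x * \<sigma> y"
begin

abbreviation "mp \<equiv> map_poly \<sigma>"

lemma hom_uminus: "x \<in> E \<Longrightarrow> \<sigma> (- x) = - \<sigma> x"
  using hom_add[of x "-x"] subfldD(5)[OF E, of x] by (simp add: eq_neg_iff_add_eq_0 add.commute)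

lemma hom_eq_0_iff: "x \<in> E \<Longrightarrow> \<sigma> x = 0 \<longleftrightarrow> x = 0"
  using hom_mult[of x "inverse x"] subfldD(6)[OF E, of x] by (cases "x = 0") auto

lemma hom_diff: "x \<in> E \<Longrightarrow> y \<in> E \<Longrightarrow> \<sigma> (x - y) = \<sigma> x - \<sigma> y"
  using hom_add[of x "- y"] hom_uminus[of y] subfldD(5)[OF E, of y] by simp

lemma hom_inj: "x \<in> E \<Longrightarrow> y \<in> E \<Longrightarrow> \<sigma> x = \<sigma> y \<longleftrightarrow> x = y"
  using hom_eq_0_iff[OF subfldD(7)[OF E], of x y] hom_diff[of x y] by (metis right_minus_eq)

lemma hom_sum: "(\<And>i. i \<in> I \<Longrightarrow> f i \<in> E) \<Longrightarrow> \<sigma> (sum f I) = (\<Sum>i\<in>I. \<sigma> (f i))"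
  by (induction I rule: infinite_finite_induct) (auto simp: hom_add subfld_sum[OF E])

lemma coeff_mp [simp]: "coeff (mp p) n = \<sigma> (coeff p n)"
  by (simp add: coeff_map_poly)

lemma mp_0 [simp]: "mp 0 = 0" and mp_1 [simp]: "mp 1 = 1"
  by (simp_all add: map_poly_def one_pCons)

lemma mp_pCons [simp]: "mp (pCons a p) = pCons (\<sigma> a) (mp p)"
  by (rule poly_eqI) (simp add: coeff_pCons split: nat.splits)

lemma mp_add: "p \<in> polys_over E \<Longrightarrow> q \<in> polys_over E \<Longrightarrow> mp (p + q) = mp p + mp q"
  by (rule poly_eqI) (simp add: polys_over_def hom_add)

lemma mp_uminus: "p \<in> polys_over E \<Longrightarrow> mp (- p) = - mp p"
  by (rule poly_eqI) (simp add: polys_over_def hom_uminus)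

lemma mp_diff: "p \<in> polys_over E \<Longrightarrow> q \<in> polys_over E \<Longrightarrow> mp (p - q) = mp p - mp q"
  using mp_add[of p "- q"] mp_uminus[of q] polys_over_uminus[OF E, of q] by simp

lemma mp_mult: "p \<in> polys_over E \<Longrightarrow> q \<in> polys_over E \<Longrightarrow> mp (p * q) = mp p * mp q"
  by (rule poly_eqI) (auto simp: polys_over_def coeff_mult hom_sum hom_mult subfldD[OF E])

lemma mp_sum: "(\<And>i. i \<in> I \<Longrightarrow> f i \<in> polys_over E) \<Longrightarrow> mp (sum f I) = (\<Sum>i\<in>I. mp (f i))"
  by (induction I rule: infinite_finite_induct) (auto simp: mp_add polys_over_sum[OF E])

lemma mp_pcompose: "p \<in> polys_over E \<Longrightarrow> q \<in> polys_over E \<Longrightarrow> mp (pcompose p q) = pcompose (mp p) (mp q)"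
  by (induction p rule: pCons_induct)
    (auto simp: pcompose_pCons polys_over_pCons[OF E] mp_add mp_mult polys_over_mult[OF E] polys_over_pcompose[OF E]
      polys_over_0[OF E])

lemma mp_eq_0_iff: "p \<in> polys_over E \<Longrightarrow> mp p = 0 \<longleftrightarrow> p = 0"
  by (auto simp: poly_eq_iff polys_over_def hom_eq_0_iff)

lemma degree_mp: "p \<in> polys_over E \<Longrightarrow> degree (mp p) = degree p"
proof (cases "p = 0")
  case False
  assume p: "p \<in> polys_over E"
  have "degree (mp p) \<le> degree p" by (rule degree_le) (simp add: coeff_eq_0)
  moreover have "coeff (mp p) (degree p) \<noteq> 0"
    using p False by (simp add: polys_over_def hom_eq_0_iff)
  ultimately show ?thesis by (meson antisym le_degree)
qed simp

lemma poly_mp: "p \<in> polys_over E \<Longrightarrow> x \<in> E \<Longrightarrow> poly (mp p) (\<sigma> x) = \<sigma> (poly p x)"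
  by (induction p rule: pCons_induct)
    (auto simp: polys_over_pCons[OF E] hom_add hom_mult subfldD[OF E] poly_in[OF E])

lemma mp_pderiv: "p \<in> polys_over E \<Longrightarrow> mp (pderiv p) = pderiv (mp p)"
proof (rule poly_eqI)
  fix n assume p: "p \<in> polys_over E"
  have 1: "of_nat n \<in> E \<and> \<sigma> (of_nat n) = of_nat n" for n
    by (induction n) (auto simp: subfldD[OF E] hom_add)
  have "of_nat (Suc n) \<in> E" "\<sigma> (of_nat (Suc n)) = of_nat (Suc n)" using 1[of "Suc n"] by blast+
  thus "coeff (mp (pderiv p)) n = coeff (pderiv (mp p)) n"
    using p by (simp add: coeff_pderiv polys_over_def hom_mult del: of_nat_Suc)
qed

lemma image_subfld: "subfld (\<sigma> ` E)"
proof -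
  have "inverse (\<sigma> x) = \<sigma> (inverse x)" if "x \<in> E" for x
    using hom_mult[of x "inverse x"] subfldD(6)[OF E that] that
    by (cases "x = 0") (auto intro: inverse_unique)
  moreover have "0 \<in> \<sigma> ` E" "1 \<in> \<sigma> ` E" using subfldD(1,2)[OF E] by (metis hom_0 hom_1 imageI)+
  ultimately show ?thesis
    unfolding subfld_def using subfldD[OF E] by (auto simp flip: hom_add hom_mult hom_uminus)
qed

text \<open>Polynomials agreeing at \<open>x\<close> differ by a multiple of \<open>m\<close>, whose
  image vanishes at \<open>y\<close>; hence sending \<open>x\<close> to \<open>y\<close> is well
  defined.\<close>

lemma extend_hom:
  assumes m: "is_minpoly E m x" and y: "poly (mp m) y = 0"
  obtains E' \<sigma>' where "fld_hom E' \<sigma>'" "E' = (\<lambda>q. poly q x) ` polys_over E"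
    "\<And>q. q \<in> polys_over E \<Longrightarrow> \<sigma>' (poly q x) = poly (mp q) y"
proof -
  have mE: "m \<in> polys_over E" "m \<in> Irr_over E" "poly m x = 0" using m Irr_overD[OF E] by (auto simp: is_minpoly_def[OF E])
  define E' where "E' = (\<lambda>q. poly q x) ` polys_over E"
  define \<sigma>' where "\<sigma>' z = poly (mp (SOME q. q \<in> polys_over E \<and> poly q x = z)) y" for z
  have wd: "poly (mp q) y = poly (mp r) y" if "q \<in> polys_over E" "r \<in> polys_over E" "poly q x = poly r x" for q r
  proof -
    have d: "q - r \<in> polys_over E" using that polys_over_diff[OF E] by blast
    have "m dvd q - r" using minpoly_dvd_iff[OF E m d] that by simp
    hence "q - r = m * ((q - r) div m)" by simp
    hence "mp (q - r) = mp m * mp ((q - r) div m)"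
      using mp_mult polys_over_div_mod[OF E d mE(1)] mE(1) by metis
    hence "poly (mp (q - r)) y = 0" using y by simp
    thus ?thesis using that by (simp add: mp_diff)
  qed
  have s: "\<sigma>' (poly q x) = poly (mp q) y" if "q \<in> polys_over E" for q
  proof -
    have "\<exists>r. r \<in> polys_over E \<and> poly r x = poly q x" using that by blast
    from someI_ex[OF this] show ?thesis unfolding \<sigma>'_def using wd that by blast
  qed
  have "subfld E'"
  proof -
    have "inverse (poly q x) \<in> E'" if q: "q \<in> polys_over E" for q
    proof (cases "m dvd q")
      case True
      hence "poly q x = 0" using mE by auto
      thus ?thesis unfolding E'_def using polys_over_0[OF E] by (metis image_eqI inverse_zero poly_0)
    next
      case False
      obtain a b where "a \<in> polys_over E" "b \<in> polys_over E" "a * m + b * q = 1"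
        using bezout_over[OF E mE(2) q False] by blast
      hence "poly b x * poly q x = 1" using mE(3)
        by (metis add_0 mult_zero_right poly_1 poly_add poly_mult)
      hence "inverse (poly q x) = poly b x" by (metis inverse_unique mult.commute)
      thus ?thesis using \<open>b \<in> polys_over E\<close> by (auto simp: E'_def)
    qed
    moreover have "0 \<in> E'" "1 \<in> E'" unfolding E'_def
      by (metis image_eqI poly_0 polys_over_0[OF E], metis image_eqI poly_1 polys_over_1[OF E])
    moreover have "poly q x + poly r x \<in> E'" "poly q x * poly r x \<in> E'" "- poly q x \<in> E'"
      if "q \<in> polys_over E" "r \<in> polys_over E" for q r
      unfolding E'_def using that polys_over_add[OF E] polys_over_mult[OF E] polys_over_uminus[OF E]
      by (metis image_eqI poly_add, metis image_eqI poly_mult, metis image_eqI poly_minus)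
    ultimately show ?thesis unfolding subfld_def by (auto simp: E'_def)
  qed
  moreover have "\<sigma>' 0 = 0" "\<sigma>' 1 = 1" using s[of 0] s[of 1] polys_over_0[OF E] polys_over_1[OF E] by auto
  moreover have "\<sigma>' (poly q x + poly r x) = \<sigma>' (poly q x) + \<sigma>' (poly r x)"
      "\<sigma>' (poly q x * poly r x) = \<sigma>' (poly q x) * \<sigma>' (poly r x)"
    if "q \<in> polys_over E" "r \<in> polys_over E" for q r
    using s[of "q + r"] s[of "q * r"] s[of q] s[of r] that polys_over_add[OF E] polys_over_mult[OF E]
    by (auto simp: mp_add mp_mult)
  ultimately have "fld_hom E' \<sigma>'" by unfold_locales (auto simp: E'_def)
  thus ?thesis using that E'_def s by blast
qed

end

text \<open>
  A root \<open>\<eta>\<close> of the conjugate of the minimal polynomial of \<open>q(\<theta>)\<close> determines an embedding of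
  \<open>E(q(\<theta>))\<close>, and its extension to \<open>E(\<theta>)\<close> sends \<open>\<theta>\<close> to the required root.
\<close>

lemma (in fld_hom) conjugate_of_value:
  fixes q :: "'b poly"
  assumes ac: "\<And>p :: 'c poly. degree p > 0 \<Longrightarrow> \<exists>z. poly p z = 0"
    and m: "is_minpoly E m x" and q: "q \<in> polys_over E"
    and n: "is_minpoly E n (poly q x)" and eta: "poly (mp n) \<eta> = 0"
  shows "\<exists>y. poly (mp m) y = 0 \<and> poly (mp q) y = \<eta>"
proof -
  obtain F \<tau> where F: "fld_hom F \<tau>" "F = (\<lambda>r. poly r (poly q x)) ` polys_over E"
    "\<And>r. r \<in> polys_over E \<Longrightarrow> \<tau> (poly r (poly q x)) = poly (mp r) \<eta>"
    using extend_hom[OF n eta] by metis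
  interpret F: fld_hom F \<tau> by fact
  have EF: "e \<in> F \<and> \<tau> e = \<sigma> e" if "e \<in> E" for e
    using F(2,3) polys_over_const[OF E that] by (metis (no_types, lifting) image_eqI mp_0 mp_pCons poly_const_conv)
  have mF: "r \<in> polys_over F" "F.mp r = mp r" if "r \<in> polys_over E" for r
    using that EF by (auto simp: polys_over_def intro!: poly_eqI)
  have "\<tau> (poly q x) = \<eta>"
    using F(3)[OF polys_over_X[OF E]] by simp
  have qF: "poly q x \<in> F"
    using F(2) polys_over_X[OF E] by (metis (no_types, lifting) image_eqI mult.right_neutral poly_0 poly_pCons add_0 mult_zero_right add.right_neutral)
  have mE: "m \<in> polys_over E" "m \<noteq> 0" "poly m x = 0" using m Irr_overD[OF E] by (auto simp: is_minpoly_def[OF E])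
  obtain m' where m': "is_minpoly F m' x" using ex_minpoly[OF F.E mF(1)[OF mE(1)] mE(2,3)] by blast
  have m'F: "m' \<in> polys_over F" "degree m' > 0" using m' Irr_overD[OF F.E] by (auto simp: is_minpoly_def[OF F.E])
  have "degree (F.mp m') > 0" using F.degree_mp m'F by simp
  then obtain y where y: "poly (F.mp m') y = 0" using ac by blast
  obtain G \<rho> where G: "fld_hom G \<rho>" "G = (\<lambda>r. poly r x) ` polys_over F"
    "\<And>r. r \<in> polys_over F \<Longrightarrow> \<rho> (poly r x) = poly (F.mp r) y"
    using F.extend_hom[OF m' y] by metis
  have "poly (mp m) y = 0"
    using G(3)[OF mF(1)[OF mE(1)]] mF(2)[OF mE(1)] mE(3) fld_hom.hom_0[OF G(1)] by simp
  moreover have "\<rho> (poly q x) = poly (mp q) y" using G(3)[OF mF(1)[OF q]] mF(2)[OF q] by simp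
  \<comment> \<open>As an element of \<open>F\<close>, \<open>poly q x\<close> is the value of a
    constant polynomial, on which \<open>\<rho>\<close> acts as \<open>\<tau>\<close>.\<close>
  moreover have "\<rho> (poly q x) = \<eta>"
    using G(3)[OF polys_over_const[OF F.E qF]] \<open>\<tau> (poly q x) = \<eta>\<close> by simp
  ultimately show ?thesis by auto
qed

section \<open>Conjugation of extensions of a valuation\<close>

interpretation to_ac: fld_hom UNIV "to_ac :: 'a :: field \<Rightarrow> 'a alg_closure"
  by unfold_locales auto

abbreviation ac_poly :: "'a :: field poly \<Rightarrow> 'a alg_closure poly" where
  "ac_poly \<equiv> map_poly to_ac"

lemma subfld_range_to_ac: "subfld (range to_ac)"
  using to_ac.image_subfld by simp

lemma ac_poly_in: "range to_ac \<subseteq> E \<Longrightarrow> ac_poly q \<in> polys_over E"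
  by (auto simp: polys_over_def)

lemma polys_over_range_to_ac: "p \<in> polys_over (range to_ac) \<longleftrightarrow> (\<exists>q. p = ac_poly q)"
proof
  assume p: "p \<in> polys_over (range to_ac)"
  have "p = ac_poly (map_poly of_ac p)"
    using p by (intro poly_eqI) (auto simp: coeff_map_poly polys_over_def to_ac_of_ac)
  thus "\<exists>q. p = ac_poly q" by blast
qed (auto simp: ac_poly_in)

lemma ex_minpoly_alg_closure:
  fixes x :: "'a :: field alg_closure"
  assumes E: "subfld E" "range to_ac \<subseteq> E"
  shows "\<exists>m. is_minpoly E m x"
proof -
  obtain p where p: "p \<noteq> 0" "poly (ac_poly p) x = 0" using alg_closure_algebraic by blast
  thus ?thesis using ex_minpoly[OF E(1) ac_poly_in[OF E(2)], of p x] to_ac.mp_eq_0_iff[of p] by auto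
qed

text \<open>\<open>extend_hom\<close>, applied to the identity of K, is used only for its
  information that K[x] is a field.\<close>

lemma inverse_alg_closure_poly:
  fixes x :: "'a :: field alg_closure"
  shows "\<exists>q. inverse x = poly (ac_poly q) x"
proof -
  interpret id: fld_hom "range to_ac" id by unfold_locales (auto simp: subfld_range_to_ac)
  obtain m where m: "is_minpoly (range to_ac) m x" using ex_minpoly_alg_closure[OF subfld_range_to_ac] by blast
  have "id.mp m = m" by (rule poly_eqI) (simp add: coeff_map_poly)
  hence r: "poly (id.mp m) x = 0" using m by (simp add: is_minpoly_def[OF subfld_range_to_ac])
  obtain E' and \<sigma> :: "'a alg_closure \<Rightarrow> 'a alg_closure" where E': "fld_hom E' \<sigma>" "E' = (\<lambda>q. poly q x) ` polys_over (range to_ac)"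
    by (rule id.extend_hom[OF m r]) blast
  have "poly [:0, 1:] x \<in> E'" unfolding E'(2) by (rule imageI[OF polys_over_X[OF subfld_range_to_ac]])
  hence "x \<in> E'" by simp
  hence "inverse x \<in> E'" using subfldD(6)[OF fld_hom.E[OF E'(1)]] by blast
  then obtain p where p: "p \<in> polys_over (range to_ac)" "inverse x = poly p x" using E'(2) by blast
  then obtain q where "p = ac_poly q" using polys_over_range_to_ac[of p] by blast
  thus ?thesis using p(2) by blast
qed

text \<open>Up to sign, the nonleading coefficients are elementary symmetric functions of positive
  degree in the roots. The induction over the linear factors also carries that all coefficients are
  nonnegative.\<close>

lemma coeff_pos_of_roots_pos:
  fixes w :: "'c :: alg_closed_field \<Rightarrow> 'g :: linordered_ab_group_add vinf"
  assumes w: "valuation w" and q: "lead_coeff q = 1" "\<And>x. poly q x = 0 \<Longrightarrow> 0 < w x"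
  shows "i < degree q \<Longrightarrow> 0 < w (coeff q i)"
proof -
  have *: "(\<forall>i. 0 \<le> w (coeff (\<Prod>x\<in>#A. [:-x, 1:]) i)) \<and> degree (\<Prod>x\<in>#A. [:-x, 1:]) = size A \<and>
     (\<forall>i<size A. 0 < w (coeff (\<Prod>x\<in>#A. [:-x, 1:]) i))" if "\<And>x. x \<in># A \<Longrightarrow> 0 < w x" for A
    using that
  proof (induction A)
    case empty
    show ?case by (auto simp: coeff_1 val_one[OF w] val_zero[OF w])
  next
    case (add x A)
    define r where "r = (\<Prod>x\<in>#A. [:-x, 1:])"
    have IH: "0 \<le> w (coeff r i)" "degree r = size A" "i < size A \<Longrightarrow> 0 < w (coeff r i)" for i
      using add unfolding r_def by auto
    have "r \<noteq> 0" unfolding r_def by auto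
    have cf: "coeff ([:-x, 1:] * r) i = (if i = 0 then 0 else coeff r (i - 1)) - x * coeff r i" for i
      by (cases i) auto
    have x: "0 < w x" using add by auto
    have xr: "0 < w (x * coeff r i)" for i
      using x IH(1)[of i] by (auto simp: val_mult[OF w] intro: add_pos_nonneg)
    have "0 \<le> w (coeff ([:-x, 1:] * r) i)" for i
      unfolding cf using IH(1) xr by (intro val_diff_ge[OF w]) (auto simp: val_zero[OF w] less_imp_le)
    moreover have "0 < w (coeff ([:-x, 1:] * r) i)" if "i < Suc (size A)" for i
      unfolding cf using IH(3)[of "i - 1"] xr that by (intro val_diff_gt[OF w]) (auto simp: val_zero[OF w])
    moreover have "degree ([:-x, 1:] * r) = Suc (size A)"
      using \<open>r \<noteq> 0\<close> IH(2) by (subst degree_mult_eq) auto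
    ultimately show ?case by (simp add: r_def)
  qed
  have "q \<noteq> 0" using q(1) by auto
  then obtain A where A: "size A = degree q" "q = (\<Prod>x\<in>#A. [:-x, 1:])"
    using alg_closed_imp_factorization[of q] q(1) by auto
  have "poly (\<Prod>x\<in>#B. [:-x, 1:]) x = 0" if "x \<in># B" for x and B :: "'c multiset"
    using that by (induction B) auto
  hence "poly q x = 0" if "x \<in># A" for x using that A(2) by metis
  hence "0 < w x" if "x \<in># A" for x using q(2) that by blast
  from *[OF this] have "\<forall>i<size A. 0 < w (coeff q i)" using A(2) by metis
  thus "i < degree q \<Longrightarrow> 0 < w (coeff q i)" using A(1) by simp
qed

locale valued_closure =
  fixes v :: "'a :: field \<Rightarrow> 'g :: linordered_ab_group_add vinf" and vb :: "'a alg_closure \<Rightarrow> 'g vinf"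
  assumes v: "valuation v" and hull: "rational_hull (value_group base_field v)"
    and ext: "extends_valuation vb v"
begin

lemma vb: "valuation vb" and vb_to_ac [simp]: "vb (to_ac a) = v a"
  using ext by (auto simp: extends_valuation_def)

lemma v_eq_Infty: "v x = Infty \<longleftrightarrow> x = 0" and vb_eq_Infty: "vb y = Infty \<longleftrightarrow> y = 0"
  using valuation_field_eq_Infty_iff v vb by blast+

lemma torsion: "\<exists>n>0. \<exists>e. v e = Val (nmul n a)"
  using hull unfolding rational_hull_def value_group_def by blast

text \<open>Let \<open>\<theta>\<^sub>1, \<dots>\<close> be the roots of the conjugate of \<open>p\<close>. If \<open>u\<^sub>0\<close> were none of the
  corresponding valuations, some \<open>y\<close> would have value \<open>0\<close> at \<open>u\<^sub>0\<close> and positive value at all the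
  others; then the nonleading coefficients of its minimal polynomial have positive value, which is
  absurd at \<open>u\<^sub>0\<close>.\<close>

lemma conjugate_valuation:
  fixes E :: "'a alg_closure set" and \<sigma> :: "'a alg_closure \<Rightarrow> 'a alg_closure"
  assumes hom: "fld_hom E \<sigma>" and KE: "range to_ac \<subseteq> E" "\<And>a. \<sigma> (to_ac a) = to_ac a"
    and p: "p \<in> Irr_over E" and u0: "val_on (polys_over E) u0"
    and supp: "\<And>P. P \<in> polys_over E \<Longrightarrow> u0 P = Infty \<longleftrightarrow> p dvd P"
    and const: "\<And>e. e \<in> E \<Longrightarrow> u0 [:e:] = vb (\<sigma> e)"
  shows "\<exists>\<theta>. poly (map_poly \<sigma> p) \<theta> = 0 \<and> (\<forall>P\<in>polys_over E. u0 P = vb (poly (map_poly \<sigma> P) \<theta>))"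
proof (rule ccontr)
  assume contra: "\<not> ?thesis"
  interpret fld_hom E \<sigma> by fact
  interpret u0: val_on "polys_over E" u0 by fact
  note pE = Irr_overD[OF E p]
  \<comment> \<open>\<open>None\<close> stands for \<open>u0\<close> and \<open>Some z\<close> for
    evaluation at the root \<open>z\<close>. On polynomials over \<open>E\<close> all of them have
    the multiples of \<open>p\<close> as support.\<close>
  define J where "J = insert None (Some ` {z. poly (mp p) z = 0})"
  define u where "u j P = (case j of None \<Rightarrow> u0 P | Some z \<Rightarrow> vb (poly (mp P) z))" for j P
  have uN: "u None = u0" and uS: "u (Some z) P = vb (poly (mp P) z)" for z P
    by (auto simp: u_def)
  have "mp p \<noteq> 0" using mp_eq_0_iff pE by auto
  hence fin: "finite J" unfolding J_def using poly_roots_finite by auto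
  have val: "val_on (polys_over E) (u j)" for j
  proof (cases j)
    case (Some z)
    show ?thesis unfolding Some
      using u0.add_in u0.mult_in u0.uminus_in
      by unfold_locales (auto simp: uS mp_add mp_mult val_zero[OF vb] val_one[OF vb] val_mult[OF vb] intro: val_add_ge[OF vb])
  qed (simp add: uN u0)
  have inv: "\<exists>y\<in>polys_over E. \<forall>j\<in>J. u j x + u j y = 0" if x: "x \<in> polys_over E" "j \<in> J" "u j x \<noteq> Infty" for x j
  proof -
    have "\<not> p dvd x"
    proof
      assume d: "p dvd x"
      have "u j x = Infty"
      proof (cases j)
        case None
        thus ?thesis using supp[OF x(1)] d by (simp add: uN)
      next
        case (Some z)
        have "x = p * (x div p)" using d by simp
        hence "mp x = mp p * mp (x div p)" using mp_mult[OF pE(1) polys_over_div_mod(1)[OF E x(1) pE(1)]] by simp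
        thus ?thesis using x(2) Some by (auto simp: uS J_def val_zero[OF vb])
      qed
      thus False using x by simp
    qed
    from bezout_over[OF E p x(1) this] obtain a b where
      ab: "a \<in> polys_over E" "b \<in> polys_over E" "a * p + b * x = 1" by blast
    have "u k x + u k b = 0" if k: "k \<in> J" for k
    proof (cases k)
      case None
      have "a * p \<in> polys_over E" using ab pE by blast
      hence "u0 (a * p) = Infty" using supp by simp
      hence "u0 (1 - a * p) = 0" using u0.diff_eq[of 1 "a * p"] \<open>a * p \<in> polys_over E\<close> by simp
      moreover have "1 - a * p = x * b" using ab(3) by (simp add: algebra_simps)
      ultimately show ?thesis using None u0.mult[OF x(1) ab(2)] by (simp add: uN)
    next
      case (Some z)
      have "mp a * mp p + mp b * mp x = mp (a * p + b * x)"
        using ab(1,2) x(1) pE(1) by (simp add: mp_add mp_mult)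
      hence "mp a * mp p + mp b * mp x = 1" using ab(3) by simp
      hence "poly (mp a * mp p + mp b * mp x) z = 1" by simp
      hence "poly (mp x) z * poly (mp b) z = 1" using k Some by (auto simp: J_def mult.commute)
      thus ?thesis unfolding Some uS using val_mult[OF vb] val_one[OF vb] by metis
    qed
    thus ?thesis using ab by blast
  qed
  have tor: "\<exists>n>0. \<exists>e\<in>polys_over E. \<forall>j\<in>J. u j e = Val (nmul n a)" for a
  proof -
    obtain n e where n: "n > 0" "v e = Val (nmul n a)" using torsion by blast
    have eE: "to_ac e \<in> E" using KE by blast
    have "u j [:to_ac e:] = Val (nmul n a)" for j
      using n(2) const[OF eE] KE(2) by (cases j) (auto simp: uN uS)
    thus ?thesis using n(1) polys_over_const[OF E eE] by blast
  qed
  have ne: "\<exists>x\<in>polys_over E. u None x \<noteq> u j x" if "j \<in> J" "j \<noteq> None" for j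
    using contra that unfolding J_def uN by (auto simp: uS)
  have NJ: "None \<in> J" by (simp add: J_def)
  have "\<exists>y\<in>polys_over E. u None y = 0 \<and> (\<forall>j\<in>J. j \<noteq> None \<longrightarrow> u j y > 0)"
    by (rule separate_valuations[OF fin NJ val]) (fact inv tor ne)+
  then obtain y where y: "y \<in> polys_over E" "u0 y = 0" "\<And>z. poly (mp p) z = 0 \<Longrightarrow> 0 < vb (poly (mp y) z)"
    by (auto simp: J_def uN uS)
  obtain \<theta> where \<theta>: "poly p \<theta> = 0" using alg_closed_imp_poly_has_root[OF pE(3)] by blast
  have mth: "is_minpoly E p \<theta>" using \<theta> p by (simp add: is_minpoly_def[OF E])
  obtain n where n: "is_minpoly E n (poly y \<theta>)" using ex_minpoly_alg_closure[OF E KE(1)] by blast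
  have nI: "n \<in> Irr_over E" "poly n (poly y \<theta>) = 0" using n by (auto simp: is_minpoly_def[OF E])
  note nE = Irr_overD[OF E nI(1)]
  \<comment> \<open>Every root of the conjugate of \<open>n\<close> is the value of the conjugate of
    \<open>y\<close> at a root of the conjugate of \<open>p\<close>.\<close>
  have "0 < vb \<eta>" if "poly (mp n) \<eta> = 0" for \<eta>
    using conjugate_of_value[OF alg_closed_imp_poly_has_root mth y(1) n that] y(3) by blast
  moreover have "lead_coeff (mp n) = 1" using nE by (simp add: degree_mp)
  ultimately have cpos: "0 < vb (coeff (mp n) i)" if "i < degree n" for i
    using coeff_pos_of_roots_pos[OF vb, of "mp n" i] that by (simp add: degree_mp nE)
  have cE: "coeff n i \<in> E" for i using nE(1) by (auto simp: polys_over_def)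
  have "poly (pcompose n y) \<theta> = 0" using nI(2) by (simp add: poly_pcompose)
  hence "p dvd pcompose n y"
    using minpoly_dvd_iff[OF E mth polys_over_pcompose[OF E nE(1) y(1)]] by blast
  hence inf: "u0 (pcompose n y) = Infty"
    using supp polys_over_pcompose[OF E nE(1) y(1)] by blast
  \<comment> \<open>The polynomial \<open>pcompose n y\<close> is a multiple of \<open>p\<close>, so
    \<open>u0\<close> is infinite there; but its leading term has value 0 and every other term has
    positive value.\<close>
  define t where "t i = [:coeff n i:] * y ^ i" for i
  have "pcompose n y = (\<Sum>i\<le>degree n. t i)"
    by (simp add: pcompose_altdef poly_altdef t_def coeff_map_poly degree_map_poly)
  moreover have tE: "t i \<in> polys_over E" for i
    unfolding t_def using cE y(1) by (intro u0.mult_in u0.power_in polys_over_const[OF E])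
  have ut: "u0 (t i) = vb (coeff (mp n) i)" for i
    unfolding t_def using cE y polys_over_const[OF E]
    by (subst u0.mult) (auto simp: u0.power const)
  have "u0 (\<Sum>i\<le>degree n. t i) = u0 (t (degree n))"
    using nE(2) by (intro u0.sum_dominant) (auto simp: tE ut val_one[OF vb] cpos[simplified])
  also have "\<dots> = 0" using nE(2) by (simp add: ut val_one[OF vb])
  ultimately show False using inf by simp
qed

section \<open>Extension of embeddings that preserve the valuation\<close>

text \<open>The graph of a K-embedding of a subfield of the closure that preserves
  \<open>vb\<close>. For relations the union of a chain is immediate. Single-valuedness follows
  since equal values keep nonzero elements nonzero, and closure under inverses since inverses are
  polynomial expressions over K.\<close>

definition vcorr :: "('a alg_closure \<times> 'a alg_closure) set \<Rightarrow> bool" where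
  "vcorr R \<longleftrightarrow> (\<forall>a. (to_ac a, to_ac a) \<in> R) \<and>
     (\<forall>x y x' y'. (x, y) \<in> R \<longrightarrow> (x', y') \<in> R \<longrightarrow> (x + x', y + y') \<in> R \<and> (x * x', y * y') \<in> R) \<and>
     (\<forall>x y. (x, y) \<in> R \<longrightarrow> vb x = vb y)"

lemma vcorrD:
  assumes "vcorr R"
  shows "(to_ac a, to_ac a) \<in> R" "(x, y) \<in> R \<Longrightarrow> (x', y') \<in> R \<Longrightarrow> (x + x', y + y') \<in> R"
    "(x, y) \<in> R \<Longrightarrow> (x', y') \<in> R \<Longrightarrow> (x * x', y * y') \<in> R" "(x, y) \<in> R \<Longrightarrow> vb x = vb y"
  using assms unfolding vcorr_def by blast+

lemma vcorr_uminus: "vcorr R \<Longrightarrow> (x, y) \<in> R \<Longrightarrow> (- x, - y) \<in> R"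
  using vcorrD(3)[of R "to_ac (-1)" "to_ac (-1)" x y] vcorrD(1)[of R "-1"] by simp

lemma vcorr_functional: "vcorr R \<Longrightarrow> (x, y) \<in> R \<Longrightarrow> (x, y') \<in> R \<Longrightarrow> y = y'"
  using vcorrD(2)[of R x y "-x" "-y'"] vcorr_uminus[of R x y'] vcorrD(4)[of R 0 "y - y'"]
  by (simp add: val_zero[OF vb] vb_eq_Infty eq_commute[of Infty])

lemma vcorr_poly: "vcorr R \<Longrightarrow> (x, y) \<in> R \<Longrightarrow> (poly (ac_poly q) x, poly (ac_poly q) y) \<in> R"
  by (induction q rule: pCons_induct) (use vcorrD(1)[of R 0] in \<open>auto intro!: vcorrD\<close>)

lemma vcorr_inverse:
  assumes R: "vcorr R" "(x, y) \<in> R" shows "(inverse x, inverse y) \<in> R"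
proof (cases "x = 0")
  case True
  have "y = 0" using vcorr_functional[OF R(1), of x y 0] R True vcorrD(1)[OF R(1), of 0] by simp
  thus ?thesis using True R by simp
next
  case False
  obtain q where q: "inverse x = poly (ac_poly q) x" using inverse_alg_closure_poly by blast
  have 1: "(inverse x, poly (ac_poly q) y) \<in> R" using vcorr_poly[OF R, of q] q by simp
  hence "(x * inverse x, y * poly (ac_poly q) y) \<in> R" using vcorrD(3)[OF R(1) R(2)] by blast
  hence "y * poly (ac_poly q) y = 1"
    using vcorr_functional[OF R(1), of 1 _ 1] vcorrD(1)[OF R(1), of 1] False by simp
  thus ?thesis using 1 inverse_unique by metis
qed

lemma vcorr_hom:
  assumes R: "vcorr R"
  obtains \<sigma> where "fld_hom (Domain R) \<sigma>" "\<And>x y. (x, y) \<in> R \<longleftrightarrow> x \<in> Domain R \<and> y = \<sigma> x"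
    "range to_ac \<subseteq> Domain R" "\<And>a. \<sigma> (to_ac a) = to_ac a"
proof -
  define \<sigma> where "\<sigma> x = (SOME y. (x, y) \<in> R)" for x
  have s: "(x, \<sigma> x) \<in> R" if "x \<in> Domain R" for x
    using that someI_ex[of "\<lambda>y. (x, y) \<in> R"] by (auto simp: \<sigma>_def)
  have iff: "(x, y) \<in> R \<longleftrightarrow> x \<in> Domain R \<and> y = \<sigma> x" for x y
    using s vcorr_functional[OF R] by blast
  have K: "range to_ac \<subseteq> Domain R" using vcorrD(1)[OF R] by blast
  have K': "\<sigma> (to_ac a) = to_ac a" for a using vcorrD(1)[OF R, of a] iff[of "to_ac a" "to_ac a"] by metis
  have "subfld (Domain R)"
    unfolding subfld_def
  proof (intro conjI ballI)
    show "0 \<in> Domain R" "1 \<in> Domain R" using vcorrD(1)[OF R, of 0] vcorrD(1)[OF R, of 1] by auto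
    fix x y assume "x \<in> Domain R" "y \<in> Domain R"
    hence xy: "(x, \<sigma> x) \<in> R" "(y, \<sigma> y) \<in> R" using s by auto
    show "x + y \<in> Domain R" "x * y \<in> Domain R" "- x \<in> Domain R" "inverse x \<in> Domain R"
      using vcorrD(2,3)[OF R xy] vcorr_uminus[OF R xy(1)] vcorr_inverse[OF R xy(1)] by (simp_all add: DomainI)
  qed
  moreover have "\<sigma> (x + y) = \<sigma> x + \<sigma> y" "\<sigma> (x * y) = \<sigma> x * \<sigma> y" if "x \<in> Domain R" "y \<in> Domain R" for x y
    using vcorrD(2,3)[OF R s[OF that(1)] s[OF that(2)]] iff[of "x + y"] iff[of "x * y"] by metis+
  moreover have "\<sigma> 0 = 0" "\<sigma> 1 = 1" using K'[of 0] K'[of 1] by simp_all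
  ultimately have "fld_hom (Domain R) \<sigma>" by unfold_locales auto
  thus ?thesis using that[OF _ iff K K'] by blast
qed

text \<open>\<open>conjugate_valuation\<close> realises the valuation of the extension by
  \<open>\<theta>\<close> at a root of the conjugate minimal polynomial, and sending
  \<open>\<theta>\<close> to that root preserves \<open>vb\<close>.\<close>

lemma vcorr_extend:
  assumes R: "vcorr R"
  shows "\<exists>R'. vcorr R' \<and> R \<subseteq> R' \<and> \<theta> \<in> Domain R'"
proof -
  obtain \<sigma> where hom: "fld_hom (Domain R) \<sigma>" and iff: "\<And>x y. (x, y) \<in> R \<longleftrightarrow> x \<in> Domain R \<and> y = \<sigma> x"
    and K: "range to_ac \<subseteq> Domain R" "\<And>a. \<sigma> (to_ac a) = to_ac a"
    by (rule vcorr_hom[OF R]) (rule that)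
  interpret fld_hom "Domain R" \<sigma> by fact
  obtain p where p: "is_minpoly (Domain R) p \<theta>" using ex_minpoly_alg_closure[OF E K(1)] by blast
  hence pI: "p \<in> Irr_over (Domain R)" by (simp add: is_minpoly_def[OF E])
  have "val_on (polys_over (Domain R)) (\<lambda>P. vb (poly P \<theta>))"
    by unfold_locales (auto simp: polys_over_0[OF E] polys_over_1[OF E] polys_over_add[OF E] polys_over_mult[OF E]
        polys_over_uminus[OF E] val_zero[OF vb] val_one[OF vb] val_mult[OF vb] intro: val_add_ge[OF vb])
  moreover have "vb (poly P \<theta>) = Infty \<longleftrightarrow> p dvd P" if "P \<in> polys_over (Domain R)" for P
    using minpoly_dvd_iff[OF E p that] by (simp add: vb_eq_Infty)
  moreover have "vb (poly [:e:] \<theta>) = vb (\<sigma> e)" if "e \<in> Domain R" for e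
    using vcorrD(4)[OF R, of e "\<sigma> e"] iff[of e "\<sigma> e"] that by simp
  ultimately have "\<exists>\<theta>'. poly (mp p) \<theta>' = 0 \<and> (\<forall>P\<in>polys_over (Domain R). vb (poly P \<theta>) = vb (poly (mp P) \<theta>'))"
    by (rule conjugate_valuation[OF hom K pI])
  then obtain \<theta>' where
    \<theta>': "\<And>P. P \<in> polys_over (Domain R) \<Longrightarrow> vb (poly P \<theta>) = vb (poly (mp P) \<theta>')" by blast
  define R' where "R' = {(poly P \<theta>, poly (mp P) \<theta>') | P. P \<in> polys_over (Domain R)}"
  have cst: "(x, y) \<in> R'" if "(x, y) \<in> R" for x y
    unfolding R'_def using that iff[of x y] polys_over_const[OF E, of x] by (auto intro!: exI[of _ "[:x:]"])
  have "vcorr R'"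
    unfolding vcorr_def
  proof (intro conjI allI impI)
    show "(to_ac a, to_ac a) \<in> R'" for a using cst vcorrD(1)[OF R] by blast
    fix x y assume "(x, y) \<in> R'"
    then obtain P where P: "P \<in> polys_over (Domain R)" "x = poly P \<theta>" "y = poly (mp P) \<theta>'" by (auto simp: R'_def)
    show "vb x = vb y" using P \<theta>' by simp
    fix x' y' assume "(x', y') \<in> R'"
    then obtain Q where Q: "Q \<in> polys_over (Domain R)" "x' = poly Q \<theta>" "y' = poly (mp Q) \<theta>'" by (auto simp: R'_def)
    show "(x + x', y + y') \<in> R'" unfolding R'_def mem_Collect_eq
      using P Q by (intro exI[of _ "P + Q"]) (simp add: mp_add polys_over_add[OF E])
    show "(x * x', y * y') \<in> R'" unfolding R'_def mem_Collect_eq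
      using P Q by (intro exI[of _ "P * Q"]) (simp add: mp_mult polys_over_mult[OF E])
  qed
  moreover have "\<theta> \<in> Domain R'"
    unfolding R'_def using polys_over_X[OF E] by (auto intro!: DomainI exI[of _ "[:0, 1:]"])
  moreover have "R \<subseteq> R'" using cst by auto
  ultimately show ?thesis by blast
qed

text \<open>By assumption, sending \<open>\<theta>\<close> to \<open>\<theta>'\<close> preserves
  \<open>vb\<close> on K(\<open>\<theta>\<close>). Zorn's lemma gives a maximal extension, which
  \<open>vcorr_extend\<close> shows to be defined everywhere.\<close>

theorem conjugate_elements:
  assumes eq: "\<And>q. vb (poly (ac_poly q) \<theta>) = vb (poly (ac_poly q) \<theta>')"
  shows "\<exists>\<sigma>\<in>decomposition_group vb. \<sigma> \<theta> = \<theta>'"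
proof -
  define R0 where "R0 = {(poly (ac_poly q) \<theta>, poly (ac_poly q) \<theta>') | q. True}"
  have R0: "vcorr R0" unfolding vcorr_def
  proof (intro conjI allI impI)
    show "(to_ac a, to_ac a) \<in> R0" for a unfolding R0_def by (auto intro!: exI[of _ "[:a:]"])
    fix x y assume "(x, y) \<in> R0"
    then obtain P where P: "x = poly (ac_poly P) \<theta>" "y = poly (ac_poly P) \<theta>'" by (auto simp: R0_def)
    show "vb x = vb y" using P eq by simp
    fix x' y' assume "(x', y') \<in> R0"
    then obtain Q where Q: "x' = poly (ac_poly Q) \<theta>" "y' = poly (ac_poly Q) \<theta>'" by (auto simp: R0_def)
    show "(x + x', y + y') \<in> R0" unfolding R0_def mem_Collect_eq
      using P Q by (intro exI[of _ "P + Q"]) (simp add: to_ac.mp_add)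
    show "(x * x', y * y') \<in> R0" unfolding R0_def mem_Collect_eq
      using P Q by (intro exI[of _ "P * Q"]) (simp add: to_ac.mp_mult)
  qed
  define \<A> where "\<A> = {R. vcorr R \<and> R0 \<subseteq> R}"
  have "\<exists>M\<in>\<A>. \<forall>S\<in>\<A>. M \<subseteq> S \<longrightarrow> S = M"
  proof (rule subset_Zorn_nonempty)
    show "\<A> \<noteq> {}" using R0 by (auto simp: \<A>_def)
    fix \<C> assume C: "\<C> \<noteq> {}" "subset.chain \<A> \<C>"
    have el: "vcorr R" "R0 \<subseteq> R" if "R \<in> \<C>" for R
      using C(2) that unfolding subset_chain_def \<A>_def by auto
    have cmp: "R \<subseteq> S \<or> S \<subseteq> R" if "R \<in> \<C>" "S \<in> \<C>" for R S
      using C(2) that unfolding subset_chain_def by blast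
    have "vcorr (\<Union>\<C>)" unfolding vcorr_def
    proof (intro conjI allI impI)
      show "(to_ac a, to_ac a) \<in> \<Union>\<C>" for a using C(1) el vcorrD(1) by blast
      fix x y assume "(x, y) \<in> \<Union>\<C>"
      then obtain R where R: "R \<in> \<C>" "(x, y) \<in> R" by blast
      show "vb x = vb y" using R el vcorrD(4) by blast
      fix x' y' assume "(x', y') \<in> \<Union>\<C>"
      then obtain S where S: "S \<in> \<C>" "(x', y') \<in> S" by blast
      obtain T where T: "T \<in> \<C>" "(x, y) \<in> T" "(x', y') \<in> T" using cmp[OF R(1) S(1)] R S by blast
      show "(x + x', y + y') \<in> \<Union>\<C>" using vcorrD(2)[OF el(1)[OF T(1)] T(2,3)] T(1) by blast
      show "(x * x', y * y') \<in> \<Union>\<C>" using vcorrD(3)[OF el(1)[OF T(1)] T(2,3)] T(1) by blast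
    qed
    thus "\<Union>\<C> \<in> \<A>" using C(1) el(2) unfolding \<A>_def by blast
  qed
  then obtain M where MA: "M \<in> \<A>" and max: "\<And>S. S \<in> \<A> \<Longrightarrow> M \<subseteq> S \<Longrightarrow> S = M" by blast
  have M: "vcorr M" "R0 \<subseteq> M" using MA by (auto simp: \<A>_def)
  have dom: "x \<in> Domain M" for x
  proof -
    obtain S where S: "vcorr S" "M \<subseteq> S" "x \<in> Domain S" using vcorr_extend[OF M(1)] by blast
    hence "S = M" using M(2) by (intro max) (auto simp: \<A>_def)
    thus ?thesis using S by simp
  qed
  obtain \<sigma> where hom: "fld_hom (Domain M) \<sigma>" and iff: "\<And>x y. (x, y) \<in> M \<longleftrightarrow> x \<in> Domain M \<and> y = \<sigma> x"
    and "range to_ac \<subseteq> Domain M" and K: "\<And>a. \<sigma> (to_ac a) = to_ac a"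
    by (rule vcorr_hom[OF M(1)]) (rule that)
  interpret fld_hom "Domain M" \<sigma> by fact
  have inj: "inj \<sigma>" using hom_inj[OF dom dom] by (auto simp: inj_def)
  \<comment> \<open>An injective map of the finite root set of a polynomial over K into itself is
    onto.\<close>
  have ex: "\<exists>x. \<sigma> x = y" for y
    proof -
      obtain p where p: "p \<noteq> 0" "poly (ac_poly p) y = 0" using alg_closure_algebraic by blast
      define S where "S = {z. poly (ac_poly p) z = 0}"
      have "finite S" unfolding S_def using p to_ac.mp_eq_0_iff[of p] by (intro poly_roots_finite) auto
      moreover have "\<sigma> z \<in> S" if "z \<in> S" for z
      proof -
        have "mp (ac_poly p) = ac_poly p" by (rule poly_eqI) (simp add: K)
        moreover have "ac_poly p \<in> polys_over (Domain M)" using dom by (auto simp: polys_over_def)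
        ultimately show ?thesis using poly_mp[of "ac_poly p" z] that dom by (simp add: S_def)
      qed
      ultimately have "\<sigma> ` S = S" using inj by (intro endo_inj_surj) (auto simp: inj_on_def inj_def)
      moreover have "y \<in> S" using p by (simp add: S_def)
      ultimately have "y \<in> \<sigma> ` S" by simp
      thus ?thesis by auto
    qed
  have "surj \<sigma>" unfolding surj_def using ex by metis
  moreover have "vb (\<sigma> x) = vb x" for x using iff[of x "\<sigma> x"] dom[of x] vcorrD(4)[OF M(1), of x "\<sigma> x"] by simp
  ultimately have "\<sigma> \<in> decomposition_group vb"
    unfolding decomposition_group_def using inj K hom_add[OF dom dom] hom_mult[OF dom dom]
    by (intro CollectI conjI allI) (simp_all add: bij_def fun_eq_iff)
  moreover have "(\<theta>, \<theta>') \<in> R0" unfolding R0_def by (auto intro!: exI[of _ "[:0, 1:]"])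
  hence "\<sigma> \<theta> = \<theta>'" using M(2) iff[of \<theta> \<theta>'] by blast
  ultimately show ?thesis by blast
qed

end

section \<open>Separable elements\<close>

lemma irreducible_iff_Irr_over:
  fixes g :: "'a :: field poly"
  assumes "lead_coeff g = 1"
  shows "irreducible g \<longleftrightarrow> g \<in> Irr_over UNIV"
proof
  assume irr: "irreducible g"
  have "degree g > 0"
    using irr is_unit_iff_degree[of g] by (auto simp: irreducible_def)
  moreover have "degree A = 0 \<or> degree B = 0" if "g = A * B" for A B
  proof -
    have "g \<noteq> 0" using assms by auto
    hence nz: "A \<noteq> 0" "B \<noteq> 0" using that by (metis mult_zero_left, metis mult_zero_right)
    have "is_unit A \<or> is_unit B" using irreducibleD[OF irr that] .
    thus ?thesis unfolding is_unit_iff_degree[OF nz(1)] is_unit_iff_degree[OF nz(2)] .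
  qed
  ultimately show "g \<in> Irr_over UNIV" using assms by (simp add: Irr_over_def)
next
  assume g: "g \<in> Irr_over UNIV"
  show "irreducible g"
  proof (rule irreducibleI)
    show g0: "g \<noteq> 0" using assms by auto
    show "\<not> is_unit g" unfolding is_unit_iff_degree[OF g0] using g by (simp add: Irr_over_def)
    fix A B assume *: "g = A * B"
    hence "degree A = 0 \<or> degree B = 0" using g by (simp add: Irr_over_def)
    moreover have nz: "A \<noteq> 0" "B \<noteq> 0" using * g0 by (metis mult_zero_left, metis mult_zero_right)
    ultimately show "is_unit A \<or> is_unit B"
      unfolding is_unit_iff_degree[OF nz(1)] is_unit_iff_degree[OF nz(2)] by simp
  qed
qed

lemma Irr_over_ac_poly:
  "ac_poly p \<in> Irr_over (range to_ac) \<longleftrightarrow> p \<in> Irr_over UNIV"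
proof -
  have deg: "degree (ac_poly q) = degree q" for q :: "'a poly" by (simp add: to_ac.degree_mp)
  have eq: "ac_poly p = ac_poly q \<longleftrightarrow> p = q" for p q :: "'a poly"
    by (simp add: poly_eq_iff coeff_map_poly)
  have ball: "(\<forall>A\<in>polys_over (range to_ac). P A) \<longleftrightarrow> (\<forall>A. P (ac_poly A))"
    for P :: "'a alg_closure poly \<Rightarrow> bool"
    by (metis polys_over_range_to_ac)
  have "(\<forall>A\<in>polys_over (range to_ac). \<forall>B\<in>polys_over (range to_ac). ac_poly p = A * B \<longrightarrow> degree A = 0 \<or> degree B = 0)
     \<longleftrightarrow> (\<forall>A B. ac_poly p = ac_poly A * ac_poly B \<longrightarrow> degree A = 0 \<or> degree B = 0)"
    by (simp only: ball deg)
  also have "\<dots> \<longleftrightarrow> (\<forall>A B. p = A * B \<longrightarrow> degree A = 0 \<or> degree B = 0)"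
    by (simp add: eq flip: to_ac.mp_mult)
  finally show ?thesis
    by (simp add: Irr_over_def ac_poly_in deg coeff_map_poly)
qed

lemma minpoly_ac_poly:
  fixes x :: "'a :: field alg_closure"
  obtains m where "is_minpoly (range to_ac) (ac_poly m) x" "m \<in> Irr_over UNIV"
    "\<And>q. poly (ac_poly q) x = 0 \<longleftrightarrow> m dvd q"
proof -
  obtain m' where m': "is_minpoly (range to_ac) m' x" using ex_minpoly_alg_closure[OF subfld_range_to_ac] by blast
  hence m'I: "m' \<in> Irr_over (range to_ac)" by (simp add: is_minpoly_def[OF subfld_range_to_ac])
  obtain m where m: "m' = ac_poly m"
    using Irr_overD(1)[OF subfld_range_to_ac m'I] by (auto simp: polys_over_range_to_ac)
  have mI: "m \<in> Irr_over UNIV" using m'I m Irr_over_ac_poly by blast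
  have m0: "poly (ac_poly m) x = 0" using m' m by (simp add: is_minpoly_def[OF subfld_range_to_ac])
  have "poly (ac_poly q) x = 0 \<longleftrightarrow> m dvd q" for q
  proof
    assume q: "poly (ac_poly q) x = 0"
    show "m dvd q"
    proof (rule ccontr)
      assume "\<not> m dvd q"
      then obtain a b where "a * m + b * q = 1" using bezout_over[OF subfld_UNIV mI, of q] by auto
      hence "ac_poly a * ac_poly m + ac_poly b * ac_poly q = 1"
        by (metis UNIV_I polys_over_UNIV to_ac.mp_1 to_ac.mp_add to_ac.mp_mult)
      hence "poly (ac_poly a * ac_poly m + ac_poly b * ac_poly q) x = 1" by simp
      thus False using m0 q by simp
    qed
  next
    assume "m dvd q"
    then obtain k where "q = m * k" by blast
    thus "poly (ac_poly q) x = 0" using m0 by (simp add: to_ac.mp_mult)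
  qed
  thus ?thesis using that m' m mI by blast
qed

lemma double_root_dvd:
  fixes p :: "'c :: field poly"
  shows "[:-a, 1:] ^ 2 dvd p \<longleftrightarrow> poly p a = 0 \<and> poly (pderiv p) a = 0"
proof
  assume "[:-a, 1:] ^ 2 dvd p"
  then obtain q where "p = [:-a, 1:] ^ 2 * q" by blast
  hence "p = [:-a, 1:] * ([:-a, 1:] * q)" by (simp only: power2_eq_square mult.assoc)
  thus "poly p a = 0 \<and> poly (pderiv p) a = 0" by (simp only: pderiv_mult) (simp add: pderiv_pCons)
next
  assume *: "poly p a = 0 \<and> poly (pderiv p) a = 0"
  then obtain q where q: "p = [:-a, 1:] * q" by (meson poly_eq_0_iff_dvd dvdE)
  have "pderiv p = q + [:-a, 1:] * pderiv q" unfolding q by (simp only: pderiv_mult) (simp add: pderiv_pCons)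
  hence "poly q a = 0" using * by simp
  then obtain r where r: "q = [:-a, 1:] * r" by (meson poly_eq_0_iff_dvd dvdE)
  hence "p = [:-a, 1:] ^ 2 * r" using q by (simp only: power2_eq_square mult.assoc)
  thus "[:-a, 1:] ^ 2 dvd p" by (rule dvdI)
qed

lemma rsquarefree_iff_no_double_root:
  fixes p :: "'c :: field poly"
  assumes "p \<noteq> 0"
  shows "rsquarefree p \<longleftrightarrow> (\<forall>a. \<not> (poly p a = 0 \<and> poly (pderiv p) a = 0))"
proof -
  have "(order a p = 0 \<or> order a p = 1) \<longleftrightarrow> \<not> [:-a, 1:] ^ 2 dvd p" for a
    using assms by (auto simp: order_divides)
  thus ?thesis using assms by (simp add: rsquarefree_def double_root_dvd)
qed

text \<open>As \<open>m\<close> divides \<open>q\<close>, the product rule keeps the derivative of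
  \<open>m\<close> nonzero at \<open>x\<close>. Hence \<open>m\<close> does not divide its
  derivative, and Bezout's identity excludes double roots everywhere.\<close>

lemma minpoly_rsquarefree:
  assumes E: "subfld E" and m: "is_minpoly E m x" and q: "q \<in> polys_over E" "poly q x = 0" "poly (pderiv q) x \<noteq> 0"
  shows "rsquarefree m" "poly (pderiv m) x \<noteq> 0"
proof -
  have mI: "m \<in> Irr_over E" "poly m x = 0" using m by (auto simp: is_minpoly_def[OF E])
  note mD = Irr_overD[OF E mI(1)]
  have "m dvd q" using minpoly_dvd_iff[OF E m q(1)] q(2) by blast
  then obtain k where k: "q = m * k" by blast
  have "poly (pderiv q) x = poly (pderiv m) x * poly k x"
    unfolding k pderiv_mult using mI(2) by simp
  thus *: "poly (pderiv m) x \<noteq> 0" using q(3) by auto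
  have dE: "pderiv m \<in> polys_over E" using polys_over_pderiv[OF E mD(1)] .
  hence "\<not> m dvd pderiv m" using minpoly_dvd_iff[OF E m dE] * by blast
  then obtain a b where "a * m + b * pderiv m = 1" using bezout_over[OF E mI(1) dE] by blast
  hence "poly a z * poly m z + poly b z * poly (pderiv m) z = 1" for z
    by (metis poly_1 poly_add poly_mult)
  hence "\<not> (poly m z = 0 \<and> poly (pderiv m) z = 0)" for z
    by (metis add.right_neutral mult_zero_right zero_neq_one)
  thus "rsquarefree m" using rsquarefree_iff_no_double_root[OF mD(4)] by blast
qed

text \<open>A simple root of any polynomial over K suffices; this criterion needs no irreducible
  polynomial and passes to larger base fields.\<close>

lemma separable_over_base_iff:
  "separable_over_base x \<longleftrightarrow> (\<exists>q. poly (ac_poly q) x = 0 \<and> poly (pderiv (ac_poly q)) x \<noteq> 0)"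
proof
  assume "separable_over_base x"
  then obtain p where p: "poly (ac_poly p) x = 0" "rsquarefree (ac_poly p)"
    unfolding separable_over_base_def by blast
  thus "\<exists>q. poly (ac_poly q) x = 0 \<and> poly (pderiv (ac_poly q)) x \<noteq> 0"
    using rsquarefree_iff_no_double_root[of "ac_poly p"] by (auto simp: rsquarefree_def)
next
  assume "\<exists>q. poly (ac_poly q) x = 0 \<and> poly (pderiv (ac_poly q)) x \<noteq> 0"
  then obtain q where q: "poly (ac_poly q) x = 0" "poly (pderiv (ac_poly q)) x \<noteq> 0" by blast
  obtain m where m: "is_minpoly (range to_ac) (ac_poly m) x" "m \<in> Irr_over UNIV"
    using minpoly_ac_poly by blast
  have "irreducible m" using irreducible_iff_Irr_over m(2) Irr_overD(2)[OF subfld_UNIV] by blast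
  moreover have "poly (ac_poly m) x = 0" using m(1) by (simp add: is_minpoly_def[OF subfld_range_to_ac])
  moreover have "rsquarefree (ac_poly m)"
    using minpoly_rsquarefree(1)[OF subfld_range_to_ac m(1) ac_poly_in[OF order_refl] q] .
  ultimately show "separable_over_base x" unfolding separable_over_base_def by blast
qed

lemma degree_pderiv_less:
  fixes p :: "'c :: idom poly"
  assumes "degree p > 0"
  shows "degree (pderiv p) < degree p"
proof -
  have "degree (pderiv p) \<le> degree p - 1"
    by (rule degree_le) (auto simp: coeff_pderiv coeff_eq_0)
  thus ?thesis using assms by simp
qed

lemma separable_char_0:
  fixes x :: "'a :: field alg_closure"
  assumes "CHAR('a) = 0"
  shows "separable_over_base x"
proof -
  obtain m where m: "is_minpoly (range to_ac) (ac_poly m) x" "m \<in> Irr_over UNIV"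
    "\<And>q. poly (ac_poly q) x = 0 \<longleftrightarrow> m dvd q"
    using minpoly_ac_poly by blast
  note mD = Irr_overD[OF subfld_UNIV m(2)]
  have "coeff (pderiv m) (degree m - 1) = of_nat (degree m)"
    using mD by (simp add: coeff_pderiv del: of_nat_Suc)
  hence "pderiv m \<noteq> 0" using mD assms by (auto simp: of_nat_eq_0_iff_char_dvd)
  moreover have "degree (pderiv m) < degree m"
    using mD degree_pderiv_less by blast
  ultimately have "\<not> m dvd pderiv m" using dvd_imp_degree_le[of m "pderiv m"] by auto
  hence "poly (pderiv (ac_poly m)) x \<noteq> 0" using m(3) by (simp flip: to_ac.mp_pderiv)
  moreover have "poly (ac_poly m) x = 0" using m(3)[of m] by simp
  ultimately show ?thesis unfolding separable_over_base_iff by blast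
qed

lemma rsquarefree_dvdI:
  fixes m h :: "'c :: alg_closed_field poly"
  assumes "rsquarefree m" "lead_coeff m = 1" "\<And>x. poly m x = 0 \<Longrightarrow> poly h x = 0"
  shows "m dvd h"
proof -
  have "m \<noteq> 0" using assms by auto
  then obtain A where A: "m = (\<Prod>x\<in>#A. [:-x, 1:])"
    using alg_closed_imp_factorization[of m] assms(2) by auto
  have "(\<Prod>x\<in>#A. [:-x, 1:]) dvd h" if "\<And>a. \<not> [:-a, 1:] ^ 2 dvd (\<Prod>x\<in>#A. [:-x, 1:])" "\<And>x. x \<in># A \<Longrightarrow> poly h x = 0"
    using that
  proof (induction A arbitrary: h)
    case (add x A)
    obtain k where k: "h = [:-x, 1:] * k" using add(3)[of x] by (auto simp: poly_eq_0_iff_dvd)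
    have nd: "\<not> [:-a, 1:] ^ 2 dvd (\<Prod>x\<in>#A. [:-x, 1:])" for a
      using add(2)[of a] dvd_mult[of "[:-a, 1:] ^ 2" "(\<Prod>x\<in>#A. [:-x, 1:])" "[:-x, 1:]"] by auto
    have "x \<notin># A"
    proof
      assume "x \<in># A"
      then obtain A' where "A = add_mset x A'" by (metis multi_member_split)
      hence "(\<Prod>x\<in>#add_mset x A. [:-x, 1:]) = [:-x, 1:] ^ 2 * (\<Prod>x\<in>#A'. [:-x, 1:])"
        by (simp only: \<open>A = add_mset x A'\<close> image_mset_add_mset prod_mset.add_mset power2_eq_square mult.assoc)
      thus False using add(2)[of x] by (metis dvd_triv_left)
    qed
    hence "poly k y = 0" if "y \<in># A" for y
      using add(3)[of y] that k by auto
    hence "(\<Prod>x\<in>#A. [:-x, 1:]) dvd k" using add(1) nd by blast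
    thus ?case unfolding k image_mset_add_mset prod_mset.add_mset by (rule mult_dvd_mono[OF dvd_refl])
  qed simp
  moreover have "poly m x = 0" if "x \<in># A" for x
    unfolding A using that by (induction A) auto
  moreover have "\<not> [:-a, 1:] ^ 2 dvd m" for a
    using assms(1) rsquarefree_iff_no_double_root[OF \<open>m \<noteq> 0\<close>] double_root_dvd by blast
  ultimately show ?thesis using assms(3) A by auto
qed

text \<open>If \<open>z\<close> lies in a separable extension \<open>F(a)\<close> and is purely inseparable over \<open>F\<close>, then it is in \<open>F\<close>:
  a polynomial expression of \<open>a\<close> for \<open>z\<close> takes the same value at all conjugates of \<open>a\<close>.\<close>

lemma separable_inseparable:
  fixes a z :: "'a :: field alg_closure"
  assumes char: "CHAR('a) > 0" and F: "subfld F" "range to_ac \<subseteq> F" and a: "separable_over_base a"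
    and s: "s \<in> polys_over F" "z = poly s a" and z: "z ^ CHAR('a) \<in> F"
  shows "z \<in> F"
proof -
  define p where "p = CHAR('a)"
  have prime: "prime CHAR('a alg_closure)" "CHAR('a alg_closure) = p"
    using prime_CHAR_semidom[where ?'a = 'a] char by (auto simp: p_def)
  obtain m where m: "is_minpoly F m a" using ex_minpoly_alg_closure[OF F] by blast
  hence mI: "m \<in> Irr_over F" by (simp add: is_minpoly_def[OF F(1)])
  note mD = Irr_overD[OF F(1) mI]
  obtain q where q: "poly (ac_poly q) a = 0" "poly (pderiv (ac_poly q)) a \<noteq> 0"
    using a separable_over_base_iff by blast
  have sqf: "rsquarefree m" using minpoly_rsquarefree(1)[OF F(1) m ac_poly_in[OF F(2)] q] .
  have root: "poly s b = z" if b: "poly m b = 0" for b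
  proof -
    have "s ^ p - [:z ^ p:] \<in> polys_over F"
      using s z polys_over_power[OF F(1)] polys_over_const[OF F(1)] polys_over_diff[OF F(1)] by (simp add: p_def)
    moreover have "poly (s ^ p - [:z ^ p:]) a = 0" using s(2) by simp
    ultimately have "m dvd s ^ p - [:z ^ p:]" using minpoly_dvd_iff[OF F(1) m] by blast
    hence "poly (s ^ p - [:z ^ p:]) b = 0" using b by (metis dvdE mult_zero_left poly_mult)
    hence "(poly s b) ^ p = z ^ p" by simp
    \<comment> \<open>The p-th power is additive, so elements with equal p-th powers
      coincide.\<close>
    moreover have "((poly s b - z) + z) ^ p = (poly s b - z) ^ p + z ^ p"
      by (rule freshmans_dream) (use prime in auto)
    ultimately have "(poly s b - z) ^ p = 0" by simp
    thus ?thesis by simp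
  qed
  define t where "t = s mod m"
  have t: "t \<in> polys_over F" unfolding t_def using polys_over_div_mod(2)[OF F(1) s(1) mD(1)] .
  have rt: "poly t b = z" if "poly m b = 0" for b
    using root[OF that] that by (simp add: t_def poly_mod)
  \<comment> \<open>The polynomial \<open>t - [:z:]\<close> vanishes at all roots of
    \<open>m\<close>, which are simple, but has smaller degree than \<open>m\<close>. So it is 0,
    and \<open>z\<close> is a coefficient of \<open>t\<close>.\<close>
  have "m dvd t - [:z:]" using rsquarefree_dvdI[OF sqf mD(2), of "t - [:z:]"] rt by simp
  moreover have "degree (t - [:z:]) < degree m"
  proof -
    have "degree t < degree m" unfolding t_def using mD degree_mod_less'[of m s] by (cases "s mod m = 0") auto
    thus ?thesis using mD by (intro degree_diff_less) auto
  qed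
  ultimately have "t - [:z:] = 0" using dvd_imp_degree_le[of m "t - [:z:]"] by (cases "t - [:z:] = 0") auto
  hence "z = coeff t 0" by simp
  thus ?thesis using t by (simp add: polys_over_def)
qed

definition adjoin :: "'a :: field alg_closure \<Rightarrow> 'a alg_closure set" where
  "adjoin x = {poly (ac_poly q) x | q. True}"

lemma adjoin_subfld: "subfld (adjoin x)" and adjoin_K: "range to_ac \<subseteq> adjoin x" and adjoin_self: "x \<in> adjoin x"
  and adjoin_poly: "poly (ac_poly q) x \<in> adjoin x"
proof -
  show K: "range to_ac \<subseteq> adjoin x" unfolding adjoin_def by (auto intro!: exI[of _ "[:_:]"])
  show "poly (ac_poly q) x \<in> adjoin x" for q unfolding adjoin_def by blast
  show "x \<in> adjoin x" unfolding adjoin_def by (auto intro!: exI[of _ "[:0, 1:]"])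
  have 1: "y + z \<in> adjoin x" "y * z \<in> adjoin x" if yz: "y \<in> adjoin x" "z \<in> adjoin x" for y z
  proof -
    obtain p q where pq: "y = poly (ac_poly p) x" "z = poly (ac_poly q) x" using yz by (auto simp: adjoin_def)
    have "y + z = poly (ac_poly (p + q)) x" "y * z = poly (ac_poly (p * q)) x"
      unfolding pq by (simp_all add: to_ac.mp_add to_ac.mp_mult)
    thus "y + z \<in> adjoin x" "y * z \<in> adjoin x" unfolding adjoin_def by blast+
  qed
  have 2: "poly (ac_poly q) y \<in> adjoin x" if "y \<in> adjoin x" for q y
    using that K 1 by (induction q rule: pCons_induct) (auto intro!: 1 simp: image_subset_iff, metis to_ac_0)
  have 3: "- y \<in> adjoin x" if "y \<in> adjoin x" for y
    using 2[OF that, of "[:0, -1:]"] by simp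
  have 4: "inverse y \<in> adjoin x" if "y \<in> adjoin x" for y
    using inverse_alg_closure_poly[of y] 2[OF that] by metis
  have "0 \<in> adjoin x" "1 \<in> adjoin x" using K to_ac_0 to_ac_1 by (metis rangeI subsetD)+
  thus "subfld (adjoin x)" by (simp add: subfld_def 1 3 4)
qed

text \<open>Over K(z^p) the element z is purely inseparable, so separability forces it into that
  field. Conversely, z = q(z^p) makes z a root of X - q(X^p), whose derivative is 1.\<close>

lemma separable_iff_power:
  fixes z :: "'a :: field alg_closure"
  assumes char: "CHAR('a) > 0"
  shows "separable_over_base z \<longleftrightarrow> z \<in> adjoin (z ^ CHAR('a))"
proof
  assume sep: "separable_over_base z"
  show "z \<in> adjoin (z ^ CHAR('a))"
    using separable_inseparable[where a = z and z = z and s = "[:0, 1:]" and F = "adjoin (z ^ CHAR('a))",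
        OF char adjoin_subfld adjoin_K sep polys_over_X[OF adjoin_subfld] _ adjoin_self] by simp
next
  assume "z \<in> adjoin (z ^ CHAR('a))"
  then obtain q where q: "z = poly (ac_poly q) (z ^ CHAR('a))" by (auto simp: adjoin_def)
  define r where "r = [:0, 1:] - pcompose q (monom 1 CHAR('a))"
  have ac_r: "ac_poly r = [:0, 1:] - pcompose (ac_poly q) (monom 1 CHAR('a))"
    unfolding r_def by (simp add: to_ac.mp_diff to_ac.mp_pcompose map_poly_monom)
  have "pderiv (monom (1 :: 'a alg_closure) CHAR('a)) = 0"
    using of_nat_CHAR[where ?'a = "'a alg_closure"] by (simp add: pderiv_monom)
  hence "pderiv (ac_poly r) = 1"
    unfolding ac_r by (simp add: pderiv_diff pderiv_pcompose pderiv_pCons)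
  moreover have "poly (ac_poly r) z = 0"
    unfolding ac_r using q[symmetric] by (simp add: poly_pcompose poly_monom)
  ultimately show "separable_over_base z" unfolding separable_over_base_iff by force
qed

lemma separable_simple_extension:
  fixes a z :: "'a :: field alg_closure"
  assumes a: "separable_over_base a" and "z \<in> adjoin a"
  shows "separable_over_base z"
proof (cases "CHAR('a) = 0")
  case False
  obtain s where s: "z = poly (ac_poly s) a" using assms by (auto simp: adjoin_def)
  show ?thesis
    using separable_inseparable[OF _ adjoin_subfld adjoin_K a ac_poly_in[OF adjoin_K] s adjoin_self]
      separable_iff_power[of z] False by simp
qed (rule separable_char_0)

text \<open>Common core of the cases of sums and products. Put F = K(z^p). By assumption b^p lies in
  F(a), hence so does b, which is a polynomial in b^p; thus z lies in F(a), and
  \<open>separable_inseparable\<close> moves it into F.\<close>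

lemma separable_combine:
  fixes a b z :: "'a :: field alg_closure"
  assumes a: "separable_over_base a" and b: "separable_over_base b"
    and z: "\<And>F. CHAR('a) > 0 \<Longrightarrow> subfld F \<Longrightarrow> range to_ac \<subseteq> F \<Longrightarrow> z ^ CHAR('a) \<in> F \<Longrightarrow>
       \<exists>t\<in>polys_over F. b ^ CHAR('a) = poly t a"
    and z': "\<And>F. subfld F \<Longrightarrow> range to_ac \<subseteq> F \<Longrightarrow> \<exists>s\<in>polys_over F. \<exists>t\<in>polys_over F. z = poly s a + poly t a * b"
  shows "separable_over_base z"
proof (cases "CHAR('a) = 0")
  case False
  define F where "F = adjoin (z ^ CHAR('a))"
  have F: "subfld F" "range to_ac \<subseteq> F" "z ^ CHAR('a) \<in> F"
    unfolding F_def by (rule adjoin_subfld adjoin_K adjoin_self)+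
  obtain t where t: "t \<in> polys_over F" "b ^ CHAR('a) = poly t a" using z F False by blast
  obtain s r where sr: "s \<in> polys_over F" "r \<in> polys_over F" "z = poly s a + poly r a * b" using z' F by blast
  obtain q where q: "b = poly (ac_poly q) (b ^ CHAR('a))"
    using b separable_iff_power[of b] False by (auto simp: adjoin_def)
  have "poly (pcompose (ac_poly q) t) a = b"
    unfolding poly_pcompose t(2)[symmetric] by (rule q[symmetric])
  hence "z = poly (s + r * pcompose (ac_poly q) t) a"
    using sr(3) by (simp only: poly_add poly_mult)
  moreover have "s + r * pcompose (ac_poly q) t \<in> polys_over F"
    by (intro polys_over_add[OF F(1)] polys_over_mult[OF F(1)] polys_over_pcompose[OF F(1)] sr t ac_poly_in[OF F(2)])
  moreover have "CHAR('a) > 0" using False by simp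
  ultimately have "z \<in> F" using separable_inseparable[OF _ F(1,2) a _ _ F(3)] by metis
  thus ?thesis unfolding F_def using separable_iff_power[of z] False by simp
qed (rule separable_char_0)

section \<open>Closure of the separable elements under field operations\<close>

lemma separable_add:
  fixes a b :: "'a :: field alg_closure"
  assumes "separable_over_base a" "separable_over_base b"
  shows "separable_over_base (a + b)"
proof (rule separable_combine[OF assms])
  fix F :: "'a alg_closure set" assume F: "subfld F" "range to_ac \<subseteq> F"
  show "\<exists>s\<in>polys_over F. \<exists>t\<in>polys_over F. a + b = poly s a + poly t a * b"
    by (rule bexI[of _ "[:0, 1:]"], rule bexI[of _ 1]) (simp_all add: polys_over_X[OF F(1)] polys_over_1[OF F(1)])
  assume char: "CHAR('a) > 0" and z: "(a + b) ^ CHAR('a) \<in> F"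
  have "(a + b) ^ CHAR('a) = a ^ CHAR('a) + b ^ CHAR('a)"
    by (rule freshmans_dream) (use prime_CHAR_semidom[where ?'a = 'a] char in auto)
  hence "b ^ CHAR('a) = poly ([:(a + b) ^ CHAR('a):] - [:0, 1:] ^ CHAR('a)) a" by simp
  moreover have "[:(a + b) ^ CHAR('a):] - [:0, 1:] ^ CHAR('a) \<in> polys_over F"
    by (intro polys_over_diff[OF F(1)] polys_over_const[OF F(1)] z polys_over_power[OF F(1)] polys_over_X[OF F(1)])
  ultimately show "\<exists>t\<in>polys_over F. b ^ CHAR('a) = poly t a" by blast
qed

lemma separable_mult:
  fixes a b :: "'a :: field alg_closure"
  assumes "separable_over_base a" "separable_over_base b"
  shows "separable_over_base (a * b)"
proof (cases "a = 0")
  case True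
  thus ?thesis using assms by simp
next
  case False
  obtain r where r: "inverse a = poly (ac_poly r) a" using inverse_alg_closure_poly by blast
  show ?thesis
  proof (rule separable_combine[OF assms])
    fix F :: "'a alg_closure set" assume F: "subfld F" "range to_ac \<subseteq> F"
    show "\<exists>s\<in>polys_over F. \<exists>t\<in>polys_over F. a * b = poly s a + poly t a * b"
      by (rule bexI[of _ 0], rule bexI[of _ "[:0, 1:]"]) (simp_all add: polys_over_X[OF F(1)] polys_over_0[OF F(1)])
    assume char: "CHAR('a) > 0" and z: "(a * b) ^ CHAR('a) \<in> F"
    have "b ^ CHAR('a) = (a * b) ^ CHAR('a) * (inverse a) ^ CHAR('a)"
      using False by (simp add: power_mult_distrib field_simps)
    hence "b ^ CHAR('a) = poly ([:(a * b) ^ CHAR('a):] * (ac_poly r) ^ CHAR('a)) a" using r by simp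
    moreover have "[:(a * b) ^ CHAR('a):] * (ac_poly r) ^ CHAR('a) \<in> polys_over F"
      by (intro polys_over_mult[OF F(1)] polys_over_const[OF F(1)] z polys_over_power[OF F(1)] ac_poly_in[OF F(2)])
    ultimately show "\<exists>t\<in>polys_over F. b ^ CHAR('a) = poly t a" by blast
  qed
qed

lemma separable_to_ac: "separable_over_base (to_ac c)"
  unfolding separable_over_base_iff by (rule exI[of _ "[:-c, 1:]"]) (simp add: pderiv_pCons)

lemma separable_inverse_uminus:
  assumes "separable_over_base a"
  shows "separable_over_base (inverse a)" "separable_over_base (- a)"
  using separable_simple_extension[OF assms] subfldD(5,6)[OF adjoin_subfld adjoin_self] by blast+

text \<open>A polynomial over K of least degree annihilating an inseparable x has derivative 0, so
  it has the form f(X^p), and f annihilates x^p in smaller degree.\<close>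

lemma power_separable:
  fixes x :: "'a :: field alg_closure"
  shows "\<exists>k. separable_over_base (x ^ (CHAR('a) ^ k))"
proof (cases "CHAR('a) = 0")
  case True
  thus ?thesis using separable_char_0 by blast
next
  case char: False
  define p where "p = CHAR('a)"
  have p: "p > 0" using char p_def by simp
  show ?thesis
  proof (induction "LEAST d. \<exists>q. q \<noteq> 0 \<and> poly (ac_poly q) x = 0 \<and> degree q = d" arbitrary: x rule: less_induct)
    case less
    define P where "P x d \<longleftrightarrow> (\<exists>q. q \<noteq> 0 \<and> poly (ac_poly q) x = 0 \<and> degree q = d)" for x :: "'a alg_closure" and d
    show ?case
    proof (cases "separable_over_base x")
      case True
      thus ?thesis by (intro exI[of _ 0]) simp
    next
      case False
      have "\<exists>d. P x d" using alg_closure_algebraic[of x] unfolding P_def by metis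
      hence PL: "P x (LEAST d. P x d)" by (rule LeastI_ex)
      then obtain q where q: "q \<noteq> 0" "poly (ac_poly q) x = 0" "degree q = (LEAST d. P x d)" unfolding P_def by blast
      have "degree q > 0"
      proof (rule ccontr)
        assume "\<not> degree q > 0"
        then obtain c where "q = [:c:]" by (metis degree_eq_zeroE neq0_conv)
        thus False using q by simp
      qed
      have "pderiv q = 0"
      proof (rule ccontr)
        assume nz: "pderiv q \<noteq> 0"
        have "poly (ac_poly (pderiv q)) x = 0"
          using False q(2) unfolding separable_over_base_iff by (auto simp: to_ac.mp_pderiv)
        hence "P x (degree (pderiv q))" unfolding P_def using nz by blast
        hence "degree q \<le> degree (pderiv q)" using q(3) Least_le[of "P x"] by simp
        thus False using degree_pderiv_less[of q] \<open>degree q > 0\<close> by simp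
      qed
      have cf: "coeff q i = 0" if "\<not> p dvd i" for i
      proof -
        obtain j where j: "i = Suc j" using \<open>\<not> p dvd i\<close> by (cases i) auto
        have "of_nat i * coeff q i = 0" using \<open>pderiv q = 0\<close> coeff_pderiv[of q j] j by (simp del: of_nat_Suc)
        moreover have "of_nat i \<noteq> (0 :: 'a)" using that by (simp add: of_nat_eq_0_iff_char_dvd p_def)
        ultimately show ?thesis by simp
      qed
      define f where "f = Poly (map (\<lambda>i. coeff q (p * i)) [0..<Suc (degree q)])"
      have cff: "coeff f i = coeff q (p * i)" for i
      proof (cases "i \<le> degree q")
        case False
        have "degree q < p * i" using False p by (metis less_le_trans mult_le_mono1 nat_mult_1 not_le Suc_le_eq One_nat_def)
        thus ?thesis using False by (simp add: f_def nth_default_def coeff_eq_0)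
      qed (simp add: f_def nth_default_def del: upt_Suc)
      have qf: "pcompose f (monom 1 p) = q"
      proof (rule poly_eqI)
        fix i
        have "pcompose f (monom 1 p) = (\<Sum>j\<le>degree f. monom (coeff f j) (p * j))"
          by (simp add: pcompose_altdef poly_altdef coeff_map_poly degree_map_poly monom_power smult_monom mult.commute)
        hence "coeff (pcompose f (monom 1 p)) i = (\<Sum>j\<le>degree f. if p * j = i then coeff f j else 0)"
          by (simp add: coeff_sum)
        also have "\<dots> = coeff q i"
        proof (cases "p dvd i")
          case True
          then obtain k where k: "i = p * k" by blast
          have "(\<Sum>j\<le>degree f. if p * j = i then coeff f j else 0) = (\<Sum>j\<le>degree f. if j = k then coeff f j else 0)"
            using p k by (intro sum.cong) auto
          also have "\<dots> = coeff f k" by (auto simp: coeff_eq_0)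
          finally show ?thesis using k cff by simp
        next
          case False
          hence "(\<Sum>j\<le>degree f. if p * j = i then coeff f j else 0) = 0" by (intro sum.neutral) auto
          thus ?thesis using cf[OF False] by simp
        qed
        finally show "coeff (pcompose f (monom 1 p)) i = coeff q i" .
      qed
      have "f \<noteq> 0" using qf q by auto
      have dq: "degree q = degree f * p" using qf by (metis degree_monom_eq degree_pcompose one_neq_zero)
      have "p \<noteq> 1" using CHAR_not_1'[where ?'a = 'a] by (simp add: p_def)
      hence "degree f < degree q" using dq p \<open>degree q > 0\<close> by auto
      have "poly (ac_poly f) (x ^ p) = 0"
        using q(2) qf to_ac.mp_pcompose[of f "monom 1 p"] by (simp add: poly_pcompose map_poly_monom poly_monom)
      hence "P (x ^ p) (degree f)" unfolding P_def using \<open>f \<noteq> 0\<close> by blast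
      hence "(LEAST d. P (x ^ p) d) \<le> degree f" by (rule Least_le)
      hence "(LEAST d. P (x ^ p) d) < (LEAST d. P x d)" using \<open>degree f < degree q\<close> q(3) by simp
      from less[OF this[unfolded P_def]] obtain k where "separable_over_base ((x ^ p) ^ (CHAR('a) ^ k))" by blast
      thus ?thesis by (intro exI[of _ "Suc k"]) (simp add: p_def flip: power_mult)
    qed
  qed
qed

section \<open>The henselization is an immediate extension\<close>

text \<open>Elimination of one unknown \<open>i0\<close> with a nonzero entry in the equation
  \<open>k\<close>. It is applied over the henselization and, with \<open>E = UNIV\<close>, over
  K.\<close>

lemma homogeneous_system:
  fixes a :: "'i \<Rightarrow> 'j \<Rightarrow> 'c :: field"
  assumes E: "subfld E" and fin: "finite J" "finite I" and "card J < card I"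
    and a: "\<And>i j. i \<in> I \<Longrightarrow> j \<in> J \<Longrightarrow> a i j \<in> E"
  shows "\<exists>c. (\<forall>i\<in>I. c i \<in> E) \<and> (\<exists>i\<in>I. c i \<noteq> 0) \<and> (\<forall>j\<in>J. (\<Sum>i\<in>I. c i * a i j) = 0)"
  using fin(1,2) assms(4) a
proof (induction J arbitrary: I a rule: finite_induct)
  case empty
  have "I \<noteq> {}" using empty by auto
  thus ?case by (intro exI[of _ "\<lambda>_. 1"]) (auto simp: subfldD[OF E])
next
  case (insert k J)
  show ?case
  proof (cases "\<forall>i\<in>I. a i k = 0")
    case True
    have "card J < card I" using insert by simp
    from insert.IH[OF insert.prems(1) this] insert.prems(3) obtain c where
      "\<forall>i\<in>I. c i \<in> E" "\<exists>i\<in>I. c i \<noteq> 0" "\<forall>j\<in>J. (\<Sum>i\<in>I. c i * a i j) = 0" by blast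
    thus ?thesis using True by (intro exI[of _ c]) auto
  next
    case False
    then obtain i0 where i0: "i0 \<in> I" "a i0 k \<noteq> 0" by blast
    define b where "b i j = a i j - a i k / a i0 k * a i0 j" for i j
    have "card J < card (I - {i0})" using insert i0 by auto
    moreover have "b i j \<in> E" if "i \<in> I - {i0}" "j \<in> J" for i j
      unfolding b_def using that i0 insert.prems(3) by (intro subfldD[OF E]) auto
    ultimately obtain c where c: "\<forall>i\<in>I-{i0}. c i \<in> E" "\<exists>i\<in>I-{i0}. c i \<noteq> 0"
      "\<forall>j\<in>J. (\<Sum>i\<in>I-{i0}. c i * b i j) = 0"
      using insert.IH[of "I - {i0}" b] insert.prems(1) by blast
    define t where "t = (\<Sum>i\<in>I-{i0}. c i * (a i k / a i0 k))"
    define d where "d i = (if i = i0 then - t else c i)" for i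
    have sum_d: "(\<Sum>i\<in>I. d i * a i j) = (\<Sum>i\<in>I-{i0}. c i * a i j) - t * a i0 j" for j
      using i0 insert.prems(1) by (subst sum.remove[of _ i0]) (auto simp: d_def)
    have "t \<in> E" unfolding t_def using c(1) i0 insert.prems(3)
      by (intro subfld_sum[OF E] subfldD(4,8)[OF E]) auto
    hence "\<forall>i\<in>I. d i \<in> E" using c(1) by (auto simp: d_def subfldD[OF E])
    moreover have "\<exists>i\<in>I. d i \<noteq> 0" using c(2) by (auto simp: d_def)
    moreover have "(\<Sum>i\<in>I. d i * a i j) = 0" if j: "j \<in> insert k J" for j
    proof (cases "j = k")
      case True
      show ?thesis unfolding sum_d True t_def using i0 by (simp add: sum_distrib_right)
    next
      case False
      have "(\<Sum>i\<in>I-{i0}. c i * b i j) = (\<Sum>i\<in>I-{i0}. c i * a i j) - t * a i0 j"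
        unfolding b_def t_def by (simp add: sum_distrib_right right_diff_distrib sum_subtractf mult.assoc)
      thus ?thesis unfolding sum_d using c(3) j False by simp
    qed
    ultimately show ?thesis by blast
  qed
qed

section \<open>The decomposition field and its conjugates\<close>

context valued_closure
begin

abbreviation "Kh \<equiv> henselization vb"

lemma decompositionD:
  assumes "\<sigma> \<in> decomposition_group vb"
  shows "fld_hom UNIV \<sigma>" "inj \<sigma>" "\<sigma> (to_ac a) = to_ac a" "vb (\<sigma> x) = vb x"
    "\<sigma> (poly (ac_poly q) x) = poly (ac_poly q) (\<sigma> x)"
proof -
  have *: "bij \<sigma>" "\<And>x y. \<sigma> (x + y) = \<sigma> x + \<sigma> y" "\<And>x y. \<sigma> (x * y) = \<sigma> x * \<sigma> y"
    "\<And>a. \<sigma> (to_ac a) = to_ac a" "vb \<circ> \<sigma> = vb"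
    using assms by (auto simp: decomposition_group_def)
  show "inj \<sigma>" using *(1) by (simp add: bij_def)
  show c: "\<sigma> (to_ac a) = to_ac a" for a by (rule *(4))
  show "vb (\<sigma> x) = vb x" using fun_cong[OF *(5), of x] by simp
  show h: "fld_hom UNIV \<sigma>" using c[of 0] c[of 1] by unfold_locales (simp_all add: *)
  interpret fld_hom UNIV \<sigma> by (rule h)
  have "mp (ac_poly q) = ac_poly q" by (rule poly_eqI) (simp add: c)
  thus "\<sigma> (poly (ac_poly q) x) = poly (ac_poly q) (\<sigma> x)" using poly_mp[of "ac_poly q" x] by simp
qed

lemma henselization_iff:
  "x \<in> Kh \<longleftrightarrow> separable_over_base x \<and> (\<forall>\<sigma>\<in>decomposition_group vb. \<sigma> x = x)"
  by (simp add: henselization_def)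

lemma henselization_fixed: "x \<in> Kh \<Longrightarrow> \<sigma> \<in> decomposition_group vb \<Longrightarrow> \<sigma> x = x"
  by (simp add: henselization_iff)

lemma Kh_subfld: "subfld Kh" and K_Kh: "range to_ac \<subseteq> Kh"
proof -
  show K: "range to_ac \<subseteq> Kh"
    using separable_to_ac decompositionD(3) by (auto simp: henselization_iff)
  have "x + y \<in> Kh \<and> x * y \<in> Kh" if "x \<in> Kh" "y \<in> Kh" for x y
  proof -
    have "\<sigma> (x + y) = x + y \<and> \<sigma> (x * y) = x * y" if s: "\<sigma> \<in> decomposition_group vb" for \<sigma>
      using fld_hom.hom_add[OF decompositionD(1)[OF s], of x y] fld_hom.hom_mult[OF decompositionD(1)[OF s], of x y]
        henselization_fixed[OF \<open>x \<in> Kh\<close> s] henselization_fixed[OF \<open>y \<in> Kh\<close> s] by simp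
    thus ?thesis using that separable_add[of x y] separable_mult[of x y] by (simp add: henselization_iff)
  qed
  moreover have "- x \<in> Kh \<and> inverse x \<in> Kh" if x: "x \<in> Kh" for x
  proof -
    have "\<sigma> (inverse x) = inverse x" if s: "\<sigma> \<in> decomposition_group vb" for \<sigma>
    proof -
      obtain q where q: "inverse x = poly (ac_poly q) x" using inverse_alg_closure_poly by blast
      show ?thesis unfolding q decompositionD(5)[OF s] henselization_fixed[OF x s] ..
    qed
    moreover have "\<sigma> (- x) = - x" if s: "\<sigma> \<in> decomposition_group vb" for \<sigma>
      using fld_hom.hom_uminus[OF decompositionD(1)[OF s], of x] henselization_fixed[OF x s] by simp
    ultimately show ?thesis using x separable_inverse_uminus[of x] by (simp add: henselization_iff)
  qed
  moreover have "0 \<in> Kh" "1 \<in> Kh" using K to_ac_0 to_ac_1 by (metis rangeI subsetD)+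
  ultimately show "subfld Kh" by (simp add: subfld_def)
qed

lemma (in fld_hom) mp_prod:
  "(\<And>i. i \<in> I \<Longrightarrow> f i \<in> polys_over E) \<Longrightarrow> mp (prod f I) = (\<Prod>i\<in>I. mp (f i)) \<and> prod f I \<in> polys_over E"
  by (induction I rule: infinite_finite_induct) (auto simp: mp_mult polys_over_1[OF E] intro: polys_over_mult[OF E])

text \<open>A power of the polynomial whose roots are the conjugates of \<open>\<theta>\<close> under the decomposition group
  has separable, hence henselian, coefficients.\<close>

lemma henselian_conjugates:
  assumes Q: "Q \<in> Irr_over Kh" and \<theta>: "poly Q \<theta> = 0" and \<theta>': "poly Q \<theta>' = 0"
  shows "\<exists>\<sigma>\<in>decomposition_group vb. \<sigma> \<theta> = \<theta>'"
proof -
  define D where "D = decomposition_group vb"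
  define O' where "O' = (\<lambda>\<sigma>. \<sigma> \<theta>) ` D"
  have idD: "id \<in> D" unfolding D_def decomposition_group_def by auto
  have comp: "\<tau> \<circ> \<sigma> \<in> D" if "\<tau> \<in> D" "\<sigma> \<in> D" for \<tau> \<sigma>
  proof -
    have "vb \<circ> (\<tau> \<circ> \<sigma>) = vb" using that by (simp add: D_def decomposition_group_def flip: comp_assoc)
    thus ?thesis using that by (auto simp: D_def decomposition_group_def intro: bij_comp)
  qed
  have fin: "finite O'"
  proof -
    obtain p where p: "p \<noteq> 0" "poly (ac_poly p) \<theta> = 0" using alg_closure_algebraic by blast
    have "O' \<subseteq> {z. poly (ac_poly p) z = 0}"
      unfolding O'_def D_def using decompositionD(5)[of _ p \<theta>, symmetric] p decompositionD(3)[of _ 0] by auto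
    thus ?thesis using p to_ac.mp_eq_0_iff[of p] poly_roots_finite[of "ac_poly p"] finite_subset by auto
  qed
  define e where "e = (\<Prod>x\<in>O'. [:-x, 1:])"
  have fixed: "\<tau> (coeff e j) = coeff e j" if t: "\<tau> \<in> D" for \<tau> j
  proof -
    interpret t: fld_hom UNIV \<tau> using decompositionD(1) t by (simp add: D_def)
    have inj: "inj_on \<tau> O'" using decompositionD(2) t unfolding D_def by (meson inj_on_subset subset_UNIV)
    have "\<tau> z \<in> O'" if zO: "z \<in> O'" for z
    proof -
      obtain \<sigma> where "\<sigma> \<in> D" "z = \<sigma> \<theta>" using zO unfolding O'_def by blast
      hence "\<tau> \<circ> \<sigma> \<in> D" "\<tau> z = (\<tau> \<circ> \<sigma>) \<theta>" using comp[OF t] by auto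
      thus ?thesis unfolding O'_def by (metis image_eqI)
    qed
    hence "\<tau> ` O' \<subseteq> O'" by blast
    hence im: "\<tau> ` O' = O'" using endo_inj_surj[OF fin _ inj] by blast
    have "t.mp e = (\<Prod>x\<in>O'. [:- \<tau> x, 1:])"
      unfolding e_def using t.mp_prod[of O' "\<lambda>x. [:-x, 1:]"] by (simp add: t.hom_uminus)
    also have "\<dots> = (\<Prod>x\<in>\<tau> ` O'. [:- x, 1:])" by (simp add: prod.reindex[OF inj])
    finally have "t.mp e = e" by (simp add: im e_def)
    thus ?thesis by (metis t.coeff_mp)
  qed
  have sepp: "separable_over_base (x ^ n)" if "separable_over_base x" for x :: "'a alg_closure" and n
    using separable_simple_extension[OF that subfld_power[OF adjoin_subfld adjoin_self]] .
  have "\<exists>k. \<forall>j\<le>n. separable_over_base (coeff e j ^ (CHAR('a) ^ k))" for n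
  proof (induction n)
    case 0
    show ?case using power_separable[of "coeff e 0"] by auto
  next
    case (Suc n)
    then obtain k where k: "\<forall>j\<le>n. separable_over_base (coeff e j ^ (CHAR('a) ^ k))" by blast
    obtain l where l: "separable_over_base (coeff e (Suc n) ^ (CHAR('a) ^ l))" using power_separable by blast
    have 1: "separable_over_base (coeff e j ^ (CHAR('a) ^ (k + l)))" if "j \<le> n" for j
      using sepp[OF k[rule_format, OF that], of "CHAR('a) ^ l"] by (simp add: power_add flip: power_mult)
    have 2: "separable_over_base (coeff e (Suc n) ^ (CHAR('a) ^ (k + l)))"
      using sepp[OF l, of "CHAR('a) ^ k"] by (simp add: power_add mult.commute flip: power_mult)
    show ?case using 1 2 by (intro exI[of _ "k + l"]) (auto simp: le_Suc_eq)
  qed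
  then obtain k where k: "\<And>j. j \<le> degree e \<Longrightarrow> separable_over_base (coeff e j ^ (CHAR('a) ^ k))" by blast
  have "\<exists>q>0. e ^ q \<in> polys_over Kh"
  proof (cases "CHAR('a) = 0")
    case True
    have "e ^ 1 \<in> polys_over Kh"
      using fixed separable_char_0[OF True] by (auto simp: polys_over_def henselization_iff D_def)
    thus ?thesis using zero_less_one by blast
  next
    case False
    define q where "q = CHAR('a) ^ k"
    have "prime CHAR('a alg_closure poly)" using prime_CHAR_semidom[where ?'a = 'a] False by simp
    hence "(\<Sum>j\<le>degree e. monom (coeff e j) j) ^ q = (\<Sum>j\<le>degree e. monom (coeff e j) j ^ q)"
      by (rule freshmans_dream_sum') (simp add: q_def)
    hence eq: "e ^ q = (\<Sum>j\<le>degree e. monom (coeff e j ^ q) (j * q))"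
      by (simp add: poly_as_sum_of_monoms monom_power)
    have "coeff e j ^ q \<in> Kh" if "j \<le> degree e" for j
    proof -
      have "\<tau> (coeff e j ^ q) = coeff e j ^ q" if t: "\<tau> \<in> decomposition_group vb" for \<tau>
      proof -
        interpret t: fld_hom UNIV \<tau> using decompositionD(1)[OF t] .
        have "\<tau> (x ^ n) = \<tau> x ^ n" for x n by (induction n) (simp_all add: t.hom_mult)
        thus ?thesis using fixed[of \<tau> j] t by (simp add: D_def)
      qed
      thus ?thesis using k[OF that] by (simp add: henselization_iff q_def)
    qed
    hence "e ^ q \<in> polys_over Kh"
      unfolding eq by (intro polys_over_sum[OF Kh_subfld] polys_over_monom[OF Kh_subfld]) auto
    moreover have "q > 0" using False by (simp add: q_def)
    ultimately show ?thesis by blast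
  qed
  then obtain q where q: "q > 0" "e ^ q \<in> polys_over Kh" by blast
  have root: "poly e x = 0 \<longleftrightarrow> x \<in> O'" for x
    unfolding e_def using fin by (simp add: poly_prod prod_zero_iff)
  \<comment> \<open>The polynomial \<open>Q\<close> is minimal for \<open>\<theta>\<close> over the
    henselization and so divides \<open>e ^ q\<close>; its roots therefore lie in the orbit
    \<open>O'\<close>.\<close>
  have "\<theta> \<in> O'" unfolding O'_def using idD by (metis id_apply image_eqI)
  hence "poly (e ^ q) \<theta> = 0" using root q(1) by simp
  moreover have m: "is_minpoly Kh Q \<theta>" using Q \<theta> by (simp add: is_minpoly_def[OF Kh_subfld])
  ultimately have "Q dvd e ^ q" using minpoly_dvd_iff[OF Kh_subfld m q(2)] by blast
  hence "poly (e ^ q) \<theta>' = 0" using \<theta>' by (metis dvdE mult_zero_left poly_mult)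
  hence "\<theta>' \<in> O'" using root by simp
  thus ?thesis unfolding O'_def D_def by auto
qed

text \<open>The decomposition group preserves \<open>vb\<close> and, by
  \<open>henselian_conjugates\<close>, acts transitively on the roots of \<open>Q\<close>.\<close>

lemma w_of_eq:
  assumes Q: "Q \<in> Irr_over Kh" and \<theta>: "poly Q \<theta> = 0"
  shows "w_of vb Q f = vb (poly (ac_poly f) \<theta>)"
proof -
  have "poly Q (SOME \<theta>. poly Q \<theta> = 0) = 0" using \<theta> by (rule someI)
  then obtain \<sigma> where "\<sigma> \<in> decomposition_group vb" "\<sigma> \<theta> = (SOME \<theta>. poly Q \<theta> = 0)"
    using henselian_conjugates[OF Q \<theta>] by blast
  thus ?thesis unfolding w_of_def using decompositionD(4,5) by metis
qed

text \<open>The vertex of the Newton polygon at slope \<open>\<gamma>\<close> of a polynomial without roots of value \<open>\<gamma>\<close>.\<close>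

lemma newton_vertex:
  assumes "\<And>x. x \<in># A \<Longrightarrow> vb x \<noteq> Val \<gamma>"
  shows "\<exists>k. \<forall>i. i \<noteq> k \<longrightarrow> vb (coeff (\<Prod>x\<in>#A. [:-x, 1:]) k) + nmul k (Val \<gamma>)
            < vb (coeff (\<Prod>x\<in>#A. [:-x, 1:]) i) + nmul i (Val \<gamma>)"
  using assms
proof (induction A)
  case empty
  show ?case by (intro exI[of _ 0]) (auto simp: coeff_1 val_zero[OF vb] val_one[OF vb])
next
  case (add x A)
  define r where "r = (\<Prod>x\<in>#A. [:-x, 1:])"
  define W where "W i = vb (coeff r i) + nmul i (Val \<gamma>)" for i
  obtain k where k: "\<And>i. i \<noteq> k \<Longrightarrow> W k < W i"
    using add unfolding W_def r_def by auto
  have Wk: "W k \<noteq> Infty" using k[of "Suc k"] by auto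
  have W_le: "W k \<le> W i" for i using k[of i] by (cases "i = k") auto
  define s where "s i = (if i = 0 then 0 else coeff r (i - 1))" for i
  define T1 where "T1 i = vb (s i) + nmul i (Val \<gamma>)" for i
  define T2 where "T2 i = vb (x * coeff r i) + nmul i (Val \<gamma>)" for i
  have T1: "T1 (Suc i) = W i + Val \<gamma>" "T1 0 = Infty" for i
    by (auto simp: T1_def W_def s_def val_zero[OF vb] algebra_simps simp del: nmul_Val)
  have T2: "T2 i = vb x + W i" for i
    by (simp add: T2_def W_def val_mult[OF vb] algebra_simps del: nmul_Val)
  have cf: "coeff ([:-x, 1:] * r) i = s i - x * coeff r i" for i
    by (cases i) (auto simp: s_def)
  define V where "V i = vb (coeff ([:-x, 1:] * r) i) + nmul i (Val \<gamma>)" for i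
  have V1: "V i = T1 i" if "T1 i < T2 i" for i
    using that unfolding V_def T1_def T2_def cf by (simp add: val_diff_eq[OF vb])
  have V2: "V i = T2 i" if "T2 i < T1 i" for i
    using that unfolding V_def T1_def T2_def cf by (simp add: val_diff_eq'[OF vb])
  have V3: "c < V i" if "c < T1 i" "c < T2 i" for c i
  proof -
    have "min (T1 i) (T2 i) \<le> V i"
      unfolding V_def T1_def T2_def cf
      using val_diff_ge[OF vb, of "min (vb (s i)) (vb (x * coeff r i))" "s i" "x * coeff r i"]
      by (cases "vb (s i) \<le> vb (x * coeff r i)") (auto simp: min_def)
    thus ?thesis using that by (auto simp: min_def split: if_splits)
  qed
  \<comment> \<open>A further root of value below \<open>\<gamma>\<close> leaves the vertex in
    place, one of larger value moves it up by one.\<close>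
  have "\<exists>k. \<forall>i. i \<noteq> k \<longrightarrow> V k < V i"
  proof (cases "vb x < Val \<gamma>")
    case True
    have fx: "vb x \<noteq> Infty" using True by auto
    have lt: "vb x + W k < T1 i" for i
    proof (cases i)
      case (Suc j)
      show ?thesis unfolding Suc T1 using vinf_add_strict_mono(1)[OF True W_le Wk, of j] by (simp add: add.commute)
    qed (use fx Wk in \<open>auto simp: T1\<close>)
    have "V k = vb x + W k" using V2[of k] lt by (simp add: T2)
    moreover have "vb x + W k < V i" if "i \<noteq> k" for i
      using V3[OF lt, of i] k[OF that] fx by (simp add: T2)
    ultimately show ?thesis by (intro exI[of _ k]) auto
  next
    case False
    hence gt: "Val \<gamma> < vb x" using add(2)[of x] by auto
    have lt: "W k + Val \<gamma> < T2 i" for i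
      unfolding T2 using vinf_add_strict_mono(1)[OF gt W_le Wk, of i] by (simp add: add.commute)
    have "V (Suc k) = W k + Val \<gamma>" using V1[of "Suc k"] lt by (simp add: T1)
    moreover have "W k + Val \<gamma> < V i" if "i \<noteq> Suc k" for i
    proof (rule V3[OF _ lt])
      show "W k + Val \<gamma> < T1 i"
      proof (cases i)
        case (Suc j)
        thus ?thesis using k[of j] that by (simp add: T1)
      qed (use Wk in \<open>auto simp: T1\<close>)
    qed
    ultimately show ?thesis by (intro exI[of _ "Suc k"]) auto
  qed
  thus ?case by (simp add: V_def r_def del: mult_pCons_left)
qed

text \<open>Put \<xi> = s(c), of value \<gamma>. The minimal polynomial of \<xi> is (X - \<xi>) r,
  and \<open>ne\<close> says that no root of r has value \<gamma>; so r has one dominant coefficient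
  r_k at slope \<gamma>. The coefficients k + 1 and k of the minimal polynomial then have the
  leading parts r_k and -\<xi> r_k, and the negative of their quotient approximates \<xi>.\<close>

lemma approximation_aux:
  assumes c: "separable_over_base c" and nz: "poly (ac_poly s) c \<noteq> 0"
    and m: "\<And>q. poly (ac_poly q) c = 0 \<longleftrightarrow> m dvd q"
    and ne: "\<And>c'. poly (ac_poly m) c' = 0 \<Longrightarrow> c' \<noteq> c \<Longrightarrow> vb (poly (ac_poly s) c') \<noteq> vb (poly (ac_poly s) c)"
  shows "\<exists>a. vb (poly (ac_poly s) c) < vb (poly (ac_poly s) c - to_ac a)"
proof -
  interpret id: fld_hom "range to_ac" id by unfold_locales (auto simp: subfld_range_to_ac)
  have idp: "id.mp p = p" for p :: "'a alg_closure poly" by (rule poly_eqI) (simp add: coeff_map_poly)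
  define \<xi> where "\<xi> = poly (ac_poly s) c"
  obtain \<gamma> where \<gamma>: "vb \<xi> = Val \<gamma>" using nz vb_eq_Infty[of \<xi>] by (cases "vb \<xi>") (auto simp: \<xi>_def)
  obtain n where n: "is_minpoly (range to_ac) (ac_poly n) \<xi>" "n \<in> Irr_over UNIV" using minpoly_ac_poly by blast
  have nI: "ac_poly n \<in> Irr_over (range to_ac)" "poly (ac_poly n) \<xi> = 0"
    using n by (auto simp: is_minpoly_def[OF subfld_range_to_ac])
  note nD = Irr_overD[OF subfld_range_to_ac nI(1)]
  obtain m' where m': "is_minpoly (range to_ac) (ac_poly m') c" "m' \<in> Irr_over UNIV"
    "\<And>q. poly (ac_poly q) c = 0 \<longleftrightarrow> m' dvd q" using minpoly_ac_poly by blast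
  have "m' dvd m" using m'(3)[of m] m[of m] by simp
  hence mroot: "poly (ac_poly m) z = 0" if "poly (ac_poly m') z = 0" for z
    using that by (auto simp: to_ac.mp_mult)
  have "separable_over_base \<xi>" unfolding \<xi>_def by (rule separable_simple_extension[OF c adjoin_poly])
  then obtain q where q: "poly (ac_poly q) \<xi> = 0" "poly (pderiv (ac_poly q)) \<xi> \<noteq> 0"
    using separable_over_base_iff by blast
  have sqf: "poly (pderiv (ac_poly n)) \<xi> \<noteq> 0"
    by (rule minpoly_rsquarefree(2)[OF subfld_range_to_ac n(1) ac_poly_in[OF order_refl] q])
  obtain A where A: "ac_poly n = (\<Prod>x\<in>#A. [:-x, 1:])"
    using alg_closed_imp_factorization[OF nD(4)] nD(2) by auto
  have Aroot: "poly (\<Prod>x\<in>#B. [:-x, 1:]) x = 0 \<longleftrightarrow> x \<in># B" for x and B :: "'a alg_closure multiset"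
    by (induction B) auto
  have "\<xi> \<in># A" using nI(2) Aroot[of A] A by simp
  then obtain B where B: "A = add_mset \<xi> B" by (metis multi_member_split)
  define r where "r = (\<Prod>x\<in>#B. [:-x, 1:])"
  have nr: "ac_poly n = [:-\<xi>, 1:] * r" unfolding A B r_def by (simp only: image_mset_add_mset prod_mset.add_mset)
  \<comment> \<open>By separability \<xi> is a simple root of its minimal polynomial.\<close>
  have "poly r \<xi> \<noteq> 0"
    using sqf unfolding nr by (simp only: pderiv_mult) (simp add: pderiv_pCons)
  hence nB: "\<xi> \<notin># B" using Aroot[of B \<xi>] by (simp add: r_def)
  have vB: "vb x \<noteq> Val \<gamma>" if x: "x \<in># B" for x
  proof -
    have "poly (ac_poly n) x = 0" using Aroot[of A] A B x by simp
    hence "poly (id.mp (ac_poly n)) x = 0" by (simp only: idp)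
    from id.conjugate_of_value[OF alg_closed_imp_poly_has_root m'(1) ac_poly_in[OF order_refl] n(1)[unfolded \<xi>_def] this]
    obtain y where y: "poly (ac_poly m') y = 0" "poly (ac_poly s) y = x" unfolding idp by blast
    have "y \<noteq> c" using y(2) nB x by (auto simp: \<xi>_def)
    thus ?thesis using ne[OF mroot[OF y(1)]] y(2) \<gamma> by (simp add: \<xi>_def)
  qed
  obtain k where k: "\<And>i. i \<noteq> k \<Longrightarrow> vb (coeff r k) + nmul k (Val \<gamma>) < vb (coeff r i) + nmul i (Val \<gamma>)"
    using newton_vertex[of B \<gamma>] vB unfolding r_def by blast
  have rk: "vb (coeff r k) \<noteq> Infty" using k[of "Suc k"] by auto
  have up: "vb (coeff r k) < vb (coeff r (Suc k)) + Val \<gamma>"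
  proof -
    have "vb (coeff r k) + nmul k (Val \<gamma>) < (vb (coeff r (Suc k)) + Val \<gamma>) + nmul k (Val \<gamma>)"
      using k[of "Suc k"] by (simp add: ac_simps del: nmul_Val)
    thus ?thesis by simp
  qed
  \<comment> \<open>The coefficient of \<open>r\<close> just below the vertex, read as 0 if the
    vertex is at 0.\<close>
  define t where "t = (if k = 0 then 0 else coeff r (k - 1))"
  have down: "vb (coeff r k) + Val \<gamma> < vb t"
  proof (cases k)
    case 0
    thus ?thesis using rk by (auto simp: t_def val_zero[OF vb])
  next
    case (Suc j)
    have "(vb (coeff r k) + Val \<gamma>) + nmul j (Val \<gamma>) < vb (coeff r j) + nmul j (Val \<gamma>)"
      using k[of j] Suc by (simp add: ac_simps del: nmul_Val)
    thus ?thesis using Suc by (simp add: t_def)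
  qed
  define N1 where "N1 = coeff n (Suc k)"
  define N0 where "N0 = coeff n k"
  have N1: "to_ac N1 = coeff r k - \<xi> * coeff r (Suc k)"
    using arg_cong[OF nr, of "\<lambda>p. coeff p (Suc k)"] by (simp add: N1_def)
  have N0: "to_ac N0 = t - \<xi> * coeff r k"
    using arg_cong[OF nr, of "\<lambda>p. coeff p k"] by (cases k) (simp_all add: N0_def t_def)
  have vN1: "vb (to_ac N1) = vb (coeff r k)"
    unfolding N1 using up \<gamma> by (intro val_diff_eq[OF vb]) (simp add: val_mult[OF vb] add.commute)
  have nzN: "to_ac N1 \<noteq> 0"
  proof
    assume "to_ac N1 = 0"
    hence "vb (to_ac N1) = Infty" by (simp only: val_zero[OF vb])
    thus False unfolding vN1 using rk by blast
  qed
  define a where "a = - N0 / N1"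
  have "(\<xi> - to_ac a) * to_ac N1 = \<xi> * to_ac N1 + to_ac N0"
    using nzN by (simp add: a_def distrib_right)
  also have "\<dots> = t - \<xi> * (\<xi> * coeff r (Suc k))" unfolding N1 N0 by (simp add: algebra_simps)
  finally have eq: "(\<xi> - to_ac a) * to_ac N1 = t - \<xi> * (\<xi> * coeff r (Suc k))" .
  have "Val \<gamma> + vb (coeff r k) < vb (t - \<xi> * (\<xi> * coeff r (Suc k)))"
  proof (rule val_diff_gt[OF vb])
    show "Val \<gamma> + vb (coeff r k) < vb t" using down by (simp add: add.commute)
    show "Val \<gamma> + vb (coeff r k) < vb (\<xi> * (\<xi> * coeff r (Suc k)))"
      using up \<gamma> by (simp add: val_mult[OF vb] add.commute)
  qed
  hence "Val \<gamma> + vb (coeff r k) < vb (\<xi> - to_ac a) + vb (coeff r k)"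
    using vN1 by (simp add: val_mult[OF vb] flip: eq)
  hence "Val \<gamma> < vb (\<xi> - to_ac a)" using rk by simp
  thus ?thesis using \<gamma> unfolding \<xi>_def[symmetric] by auto
qed

text \<open>The separating element \<open>h(c)\<close> makes \<open>h(c)\<^sup>n c\<close> the only conjugate of its value, for a suitable
  \<open>n\<close>, so that it is approximated by a quotient of coefficients of its minimal polynomial.\<close>

theorem henselization_immediate:
  assumes c: "c \<in> Kh" and c0: "c \<noteq> 0"
  shows "\<exists>a. vb c < vb (c - to_ac a)"
proof -
  have sep: "separable_over_base c" and fixed: "\<And>\<sigma>. \<sigma> \<in> decomposition_group vb \<Longrightarrow> \<sigma> c = c"
    using c by (auto simp: henselization_iff)
  obtain m where m: "is_minpoly (range to_ac) (ac_poly m) c" "m \<in> Irr_over UNIV"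
    "\<And>q. poly (ac_poly q) c = 0 \<longleftrightarrow> m dvd q" using minpoly_ac_poly by blast
  define S where "S = {z. poly (ac_poly m) z = 0}"
  have m0: "m \<noteq> 0" using Irr_overD[OF subfld_UNIV m(2)] by simp
  have fin: "finite S" unfolding S_def using m0 to_ac.mp_eq_0_iff[of m] by (intro poly_roots_finite) auto
  have cS: "c \<in> S" using m(3)[of m] by (simp add: S_def)
  define u where "u z q = vb (poly (ac_poly q) z)" for z and q :: "'a poly"
  have val: "val_on UNIV (u z)" for z
    by unfold_locales (auto simp: u_def to_ac.mp_add to_ac.mp_mult val_zero[OF vb] val_one[OF vb] val_mult[OF vb] intro: val_add_ge[OF vb])
  have inv: "\<exists>y\<in>UNIV. \<forall>j\<in>S. u j x + u j y = 0" if x: "z \<in> S" "u z x \<noteq> Infty" for x z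
  proof -
    have "\<not> m dvd x" using x by (auto simp: u_def S_def to_ac.mp_mult val_zero[OF vb])
    then obtain a b where ab: "a * m + b * x = 1" using bezout_over[OF subfld_UNIV m(2), of x] by auto
    have "u j x + u j b = 0" if j: "j \<in> S" for j
    proof -
      have "poly (ac_poly a * ac_poly m + ac_poly b * ac_poly x) j = 1"
        using arg_cong[OF ab, of "\<lambda>p. poly (ac_poly p) j"] by (simp add: to_ac.mp_add to_ac.mp_mult)
      hence "poly (ac_poly x) j * poly (ac_poly b) j = 1" using j by (simp add: S_def mult.commute)
      thus ?thesis unfolding u_def using val_mult[OF vb] val_one[OF vb] by metis
    qed
    thus ?thesis by blast
  qed
  have tor: "\<exists>n>0. \<exists>e\<in>UNIV. \<forall>j\<in>S. u j e = Val (nmul n a)" for a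
  proof -
    obtain n e where "n > 0" "v e = Val (nmul n a)" using torsion by blast
    thus ?thesis by (intro exI[of _ n] conjI bexI[of _ "[:e:]"]) (auto simp: u_def)
  qed
  \<comment> \<open>Equal valuations would make \<open>z\<close> a conjugate of \<open>c\<close>
    under the decomposition group, which fixes \<open>c\<close>.\<close>
  have ne: "\<exists>x\<in>UNIV. u c x \<noteq> u z x" if z: "z \<in> S" "z \<noteq> c" for z
  proof (rule ccontr)
    assume "\<not> ?thesis"
    hence "vb (poly (ac_poly q) c) = vb (poly (ac_poly q) z)" for q by (simp add: u_def)
    then obtain \<sigma> where "\<sigma> \<in> decomposition_group vb" "\<sigma> c = z" using conjugate_elements by blast
    thus False using fixed z by auto
  qed
  have "\<exists>y\<in>UNIV. u c y = 0 \<and> (\<forall>j\<in>S. j \<noteq> c \<longrightarrow> u j y > 0)"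
    by (rule separate_valuations[OF fin cS val]) (use inv tor ne in simp_all)
  then obtain h where h: "u c h = 0" "\<And>z. z \<in> S \<Longrightarrow> z \<noteq> c \<Longrightarrow> u z h > 0" by blast
  \<comment> \<open>Exponents for which \<open>z\<close> would share the value of \<open>c\<close>
    after twisting by \<open>h\<close>: at most one for each other conjugate. The exponent 0 is
    excluded too, so that the power of \<open>h\<close> separates by itself.\<close>
  define bad where "bad z = {n. nmul n (u z h) + vb z = vb c}" for z
  have "finite (bad z)" if z: "z \<in> S" "z \<noteq> c" for z
  proof (cases "u z h = Infty \<or> vb z = Infty")
    case True
    have "vb c \<noteq> Infty" using c0 vb_eq_Infty by simp
    hence "bad z \<subseteq> {0}" using True by (auto simp: bad_def nmul_eq_Infty_iff gr0_conv_Suc) (metis gr0I nmul_Infty plus_eq_Infty_iff)+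
    thus ?thesis using finite_subset by blast
  next
    case False
    then obtain a b where ab: "u z h = Val a" "vb z = Val b" by (cases "u z h"; cases "vb z") auto
    have "a \<noteq> 0" using h(2)[OF z] ab by auto
    have "i = j" if "i \<in> bad z" "j \<in> bad z" for i j
    proof -
      have "nmul i a + b = nmul j a + b" using that ab unfolding bad_def by (metis (mono_tags, lifting) mem_Collect_eq nmul_Val plus_vinf.simps(1) vinf.inject)
      thus ?thesis using nmul_nat_inj[OF \<open>a \<noteq> 0\<close>] by simp
    qed
    thus ?thesis by (metis finite.simps finite_subset insertCI subsetI)
  qed
  hence "finite (insert 0 (\<Union>z\<in>S-{c}. bad z))" using fin by simp
  then obtain n where n: "n \<notin> insert 0 (\<Union>z\<in>S-{c}. bad z)" using infinite_UNIV_nat by (metis ex_new_if_finite)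
  \<comment> \<open>\<open>approximation_aux\<close> applies to h(c)^n and to h(c)^n c and gives
    approximations \<open>a2\<close> and \<open>a1\<close> in K. As h(c)^n has value 0, the quotient
    \<open>a1 / a2\<close> approximates \<open>c\<close>.\<close>
  define \<alpha> where "\<alpha> = poly (ac_poly (h ^ n)) c"
  have va: "u z (h ^ n) = nmul n (u z h)" for z using val_on.power[OF val] by blast
  have va1: "vb \<alpha> = 0" using va[of c] h(1) by (simp add: \<alpha>_def u_def)
  hence a0: "\<alpha> \<noteq> 0" using vb_eq_Infty[of \<alpha>] by auto
  have ex1: "\<exists>a. vb (poly (ac_poly (h ^ n)) c) < vb (poly (ac_poly (h ^ n)) c - to_ac a)"
  proof (rule approximation_aux[OF sep _ m(3)])
    show "poly (ac_poly (h ^ n)) c \<noteq> 0" using a0 by (simp add: \<alpha>_def)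
    fix z assume z: "poly (ac_poly m) z = 0" "z \<noteq> c"
    have "u z h > 0" using h(2) z by (simp add: S_def)
    hence "nmul n (u z h) \<noteq> 0" using n by (cases "u z h") (auto simp: nmul_sgn)
    thus "vb (poly (ac_poly (h ^ n)) z) \<noteq> vb (poly (ac_poly (h ^ n)) c)"
      using va[of z] va1 by (simp add: u_def \<alpha>_def)
  qed
  have hX: "poly (ac_poly (h ^ n * [:0, 1:])) z = poly (ac_poly (h ^ n)) z * z" for z
    by (subst to_ac.mp_mult) auto
  have ex2: "\<exists>a. vb (poly (ac_poly (h ^ n * [:0, 1:])) c) < vb (poly (ac_poly (h ^ n * [:0, 1:])) c - to_ac a)"
  proof (rule approximation_aux[OF sep _ m(3)])
    show "poly (ac_poly (h ^ n * [:0, 1:])) c \<noteq> 0" unfolding hX using a0 c0 by (simp add: \<alpha>_def)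
    fix z assume z: "poly (ac_poly m) z = 0" "z \<noteq> c"
    have "vb (poly (ac_poly (h ^ n)) z * z) = nmul n (u z h) + vb z"
      using va[of z] by (simp add: u_def val_mult[OF vb])
    also have "\<dots> \<noteq> vb c" using n z by (auto simp: bad_def S_def)
    finally show "vb (poly (ac_poly (h ^ n * [:0, 1:])) z) \<noteq> vb (poly (ac_poly (h ^ n * [:0, 1:])) c)"
      unfolding hX using va1 by (simp add: val_mult[OF vb] \<alpha>_def)
  qed
  obtain a2 where a2: "0 < vb (\<alpha> - to_ac a2)" using ex1 va1 by (auto simp: \<alpha>_def)
  obtain a1 where a1: "vb c < vb (\<alpha> * c - to_ac a1)" using ex2 va1 unfolding hX by (auto simp: \<alpha>_def val_mult[OF vb])
  have v2: "vb (to_ac a2) = 0" using val_eq_of_diff[OF vb, of \<alpha> "to_ac a2"] va1 a2 by simp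
  hence nz2: "to_ac a2 \<noteq> 0" using vb_eq_Infty[of "to_ac a2"] by auto
  have "(c - to_ac (a1 / a2)) * to_ac a2 = (\<alpha> * c - to_ac a1) - (\<alpha> - to_ac a2) * c"
    using nz2 by (simp add: algebra_simps)
  moreover have "vb c < vb ((\<alpha> - to_ac a2) * c)"
    using a2 c0 vb_eq_Infty[of c] vinf_add_strict_mono(1)[of 0 "vb (\<alpha> - to_ac a2)" "vb c" "vb c"]
    by (simp add: val_mult[OF vb])
  ultimately have "vb c < vb ((c - to_ac (a1 / a2)) * to_ac a2)"
    using val_diff_gt[OF vb a1] by simp
  hence "vb c < vb (c - to_ac (a1 / a2))" using v2 by (simp add: val_mult[OF vb])
  thus ?thesis by blast
qed

text \<open>The fundamental inequality, for a family which is orthogonal over the base field.\<close>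

theorem orthogonal_family_bound:
  assumes G: "G \<in> Irr_over Kh" and \<theta>: "poly G \<theta> = 0" and fin: "finite I"
    and z: "\<And>i. i \<in> I \<Longrightarrow> poly (ac_poly (z i)) \<theta> \<noteq> 0"
    and orth: "\<And>c i. i \<in> I \<Longrightarrow> vb (\<Sum>i\<in>I. to_ac (c i) * poly (ac_poly (z i)) \<theta>) \<le> v (c i) + vb (poly (ac_poly (z i)) \<theta>)"
  shows "card I \<le> degree G"
proof (rule ccontr)
  assume "\<not> card I \<le> degree G"
  note E = Kh_subfld
  note GD = Irr_overD[OF E G]
  \<comment> \<open>More than \<open>degree G\<close> remainders modulo \<open>G\<close> are
    linearly dependent over the henselization.\<close>
  define a where "a i j = coeff (ac_poly (z i) mod G) j" for i j
  have aE: "a i j \<in> Kh" for i j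
    using polys_over_div_mod(2)[OF E ac_poly_in[OF K_Kh] GD(1), of "z i"] by (simp add: a_def polys_over_def)
  obtain c where c: "\<forall>i\<in>I. c i \<in> Kh" "\<exists>i\<in>I. c i \<noteq> 0" "\<forall>j\<in>{..<degree G}. (\<Sum>i\<in>I. c i * a i j) = 0"
    using homogeneous_system[OF E, of "{..<degree G}" I a] fin aE \<open>\<not> card I \<le> degree G\<close> by auto
  define Z where "Z i = poly (ac_poly (z i)) \<theta>" for i
  have Zm: "Z i = poly (ac_poly (z i) mod G) \<theta>" for i
    unfolding Z_def using \<theta> by (simp add: poly_mod)
  have "(\<Sum>i\<in>I. smult (c i) (ac_poly (z i) mod G)) = 0"
  proof (rule poly_eqI)
    fix j
    have "coeff (\<Sum>i\<in>I. smult (c i) (ac_poly (z i) mod G)) j = (\<Sum>i\<in>I. c i * a i j)"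
      by (simp add: coeff_sum a_def)
    also have "\<dots> = 0"
    proof (cases "j < degree G")
      case False
      have "degree (ac_poly (z i) mod G) < degree G" for i
        using GD degree_mod_less'[of G "ac_poly (z i)"] by (cases "ac_poly (z i) mod G = 0") auto
      hence "degree (ac_poly (z i) mod G) < j" for i using False by (metis less_le_trans not_le)
      hence "a i j = 0" for i unfolding a_def by (rule coeff_eq_0)
      thus ?thesis by simp
    qed (use c(3) in auto)
    finally show "coeff (\<Sum>i\<in>I. smult (c i) (ac_poly (z i) mod G)) j = coeff 0 j" by simp
  qed
  hence "poly (\<Sum>i\<in>I. smult (c i) (ac_poly (z i) mod G)) \<theta> = 0" by simp
  hence rel: "(\<Sum>i\<in>I. c i * Z i) = 0" by (simp add: poly_sum Zm)
  define f where "f i = vb (c i) + vb (Z i)" for i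
  have Ine: "I \<noteq> {}" using c(2) by auto
  obtain k where k: "k \<in> I" "\<And>i. i \<in> I \<Longrightarrow> f k \<le> f i"
  proof -
    have "Min (f ` I) \<in> f ` I" using fin Ine by simp
    then obtain k where "k \<in> I" "Min (f ` I) = f k" by auto
    thus ?thesis using that fin by (metis Min_le finite_imageI imageI)
  qed
  have fk: "f k \<noteq> Infty"
  proof -
    obtain i where i: "i \<in> I" "c i \<noteq> 0" using c(2) by blast
    have "f i \<noteq> Infty" using i z by (simp add: f_def Z_def vb_eq_Infty)
    thus ?thesis using k(2)[OF i(1)] by auto
  qed
  \<comment> \<open>Replacing every coefficient by an element of K with the same leading part turns
    the relation into a sum whose value exceeds the least value of its terms, against orthogonality
    over K.\<close>
  have "\<exists>a. c i = 0 \<and> a = 0 \<or> c i \<noteq> 0 \<and> vb (c i) < vb (c i - to_ac a)" if "i \<in> I" for i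
    using henselization_immediate[of "c i"] c(1) that by blast
  then obtain b where b: "\<And>i. i \<in> I \<Longrightarrow> c i = 0 \<and> b i = 0 \<or> c i \<noteq> 0 \<and> vb (c i) < vb (c i - to_ac (b i))" by metis
  have "f k < vb (\<Sum>i\<in>I. (to_ac (b i) - c i) * Z i)"
  proof (rule val_sum_gt[OF vb fk])
    fix i assume i: "i \<in> I"
    show "f k < vb ((to_ac (b i) - c i) * Z i)"
    proof (cases "c i = 0")
      case True
      thus ?thesis using b[OF i] fk by (simp add: val_zero[OF vb])
    next
      case False
      have "vb (c i) < vb (to_ac (b i) - c i)"
        using b[OF i] False val_uminus[OF vb, of "c i - to_ac (b i)"] by simp
      hence "f i < vb ((to_ac (b i) - c i) * Z i)"
        using z[OF i] by (simp add: f_def val_mult[OF vb] Z_def vb_eq_Infty)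
      thus ?thesis using k(2)[OF i] by simp
    qed
  qed
  also have "(\<Sum>i\<in>I. (to_ac (b i) - c i) * Z i) = (\<Sum>i\<in>I. to_ac (b i) * Z i)"
    using rel by (simp add: left_diff_distrib sum_subtractf)
  also have "vb (\<Sum>i\<in>I. to_ac (b i) * Z i) \<le> v (b k) + vb (Z k)"
    using orth[OF k(1), of b] by (simp add: Z_def)
  also have "\<dots> = f k"
  proof -
    have "c k \<noteq> 0" using fk by (auto simp: f_def val_zero[OF vb])
    hence "vb (to_ac (b k)) = vb (c k)"
      using b[OF k(1)] val_eq_of_diff[OF vb, of "c k" "to_ac (b k)"] by simp
    thus ?thesis by (simp add: f_def)
  qed
  finally show False by simp
qed

section \<open>The irreducible factor attached to a valuation with nonzero support\<close>

text \<open>The case E = K, \<sigma> = id of \<open>conjugate_valuation\<close>; \<open>ofp\<close>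
  transports \<open>w\<close> to polynomials whose coefficients lie in the copy of K in its
  closure.\<close>

lemma ex_root_of_valuation:
  assumes w: "valuation w" "\<And>a. w [:a:] = v a" and \<phi>: "\<phi> \<in> Irr_over UNIV"
    and supp: "\<And>f. w f = Infty \<longleftrightarrow> \<phi> dvd f"
  shows "\<exists>\<theta>. poly (ac_poly \<phi>) \<theta> = 0 \<and> (\<forall>f. w f = vb (poly (ac_poly f) \<theta>))"
proof -
  define ofp where "ofp = (map_poly of_ac :: 'a alg_closure poly \<Rightarrow> 'a poly)"
  have of_ac: "ofp (ac_poly p) = p" for p unfolding ofp_def by (rule poly_eqI) (simp add: coeff_map_poly)
  have ex: "\<exists>q. p = ac_poly q" if "p \<in> polys_over (range to_ac)" for p using that polys_over_range_to_ac by blast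
  have idp: "map_poly id p = p" for p :: "'a alg_closure poly" by (rule poly_eqI) (simp add: coeff_map_poly)
  have h: "fld_hom (range to_ac) id" by unfold_locales (auto simp: subfld_range_to_ac)
  have A1: "val_on (polys_over (range to_ac)) (w \<circ> ofp)"
  proof
    show "0 \<in> polys_over (range to_ac)" "1 \<in> polys_over (range to_ac)"
      by (simp_all add: polys_over_0[OF subfld_range_to_ac] polys_over_1[OF subfld_range_to_ac])
    show "(w \<circ> ofp) 0 = Infty" "(w \<circ> ofp) 1 = 0" using of_ac[of 0] of_ac[of 1] val_zero[OF w(1)] val_one[OF w(1)] by simp_all
    fix x y :: "'a alg_closure poly" assume x: "x \<in> polys_over (range to_ac)"
    then obtain p where p: "x = ac_poly p" using ex by blast
    show "- x \<in> polys_over (range to_ac)" using polys_over_uminus[OF subfld_range_to_ac x] .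
    assume y: "y \<in> polys_over (range to_ac)"
    then obtain q where q: "y = ac_poly q" using ex by blast
    show "x + y \<in> polys_over (range to_ac)" "x * y \<in> polys_over (range to_ac)"
      using polys_over_add[OF subfld_range_to_ac x y] polys_over_mult[OF subfld_range_to_ac x y] by simp_all
    have "ofp (x + y) = p + q" "ofp (x * y) = p * q"
      using of_ac[of "p + q"] of_ac[of "p * q"] unfolding p q by (simp_all add: to_ac.mp_add to_ac.mp_mult)
    thus "(w \<circ> ofp) (x * y) = (w \<circ> ofp) x + (w \<circ> ofp) y" "min ((w \<circ> ofp) x) ((w \<circ> ofp) y) \<le> (w \<circ> ofp) (x + y)"
      using w(1) unfolding p q by (simp_all add: of_ac val_mult valuation_def)
  qed
  have A2: "(w \<circ> ofp) P = Infty \<longleftrightarrow> ac_poly \<phi> dvd P" if P: "P \<in> polys_over (range to_ac)" for P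
  proof -
    obtain q where q: "P = ac_poly q" using ex[OF P] by blast
    have "ac_poly \<phi> dvd ac_poly q \<longleftrightarrow> \<phi> dvd q"
    proof
      assume d: "ac_poly \<phi> dvd ac_poly q"
      have \<phi>I: "ac_poly \<phi> \<in> Irr_over (range to_ac)" using \<phi> Irr_over_ac_poly by blast
      obtain x where x: "poly (ac_poly \<phi>) x = 0"
        using alg_closed_imp_poly_has_root[OF Irr_overD(3)[OF subfld_range_to_ac \<phi>I]] by blast
      show "\<phi> dvd q"
      proof (rule ccontr)
        assume "\<not> \<phi> dvd q"
        then obtain a b where ab: "a * \<phi> + b * q = 1" using bezout_over[OF subfld_UNIV \<phi>, of q] by auto
        have "poly (ac_poly q) x = 0" using d x by (metis dvdE mult_zero_left poly_mult)
        thus False using arg_cong[OF ab, of "\<lambda>p. poly (ac_poly p) x"] x by (simp add: to_ac.mp_add to_ac.mp_mult)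
      qed
    qed (auto simp: to_ac.mp_mult)
    thus ?thesis using supp q by (simp add: of_ac)
  qed
  have A3: "(w \<circ> ofp) [:e:] = vb (id e)" if "e \<in> range to_ac" for e
    using that w(2) of_ac[of "[:_:]"] by auto
  have A4: "ac_poly \<phi> \<in> Irr_over (range to_ac)" using \<phi> Irr_over_ac_poly by blast
  have "\<exists>\<theta>. poly (map_poly id (ac_poly \<phi>)) \<theta> = 0 \<and>
      (\<forall>P\<in>polys_over (range to_ac). (w \<circ> ofp) P = vb (poly (map_poly id P) \<theta>))"
    by (rule conjugate_valuation[OF h order_refl id_apply A4 A1 A2 A3])
  then obtain \<theta> where \<theta>: "poly (ac_poly \<phi>) \<theta> = 0" "\<And>P. P \<in> polys_over (range to_ac) \<Longrightarrow> (w \<circ> ofp) P = vb (poly P \<theta>)"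
    unfolding idp by blast
  have "w f = vb (poly (ac_poly f) \<theta>)" for f using \<theta>(2)[OF ac_poly_in[OF order_refl], of f] by (simp add: of_ac)
  thus ?thesis using \<theta>(1) by blast
qed

lemma irr_factors_henselization:
  assumes "lead_coeff g = 1"
  shows "set_mset (irr_factors Kh (ac_poly g)) \<subseteq> Irr_over Kh" "prod_mset (irr_factors Kh (ac_poly g)) = ac_poly g"
proof -
  have "lead_coeff (ac_poly g) = 1" using assms by (simp add: to_ac.degree_mp)
  thus "set_mset (irr_factors Kh (ac_poly g)) \<subseteq> Irr_over Kh" "prod_mset (irr_factors Kh (ac_poly g)) = ac_poly g"
    using irr_factors[OF Kh_subfld ac_poly_in[OF K_Kh]] by blast+
qed

text \<open>The description in \<open>Q_factor\<close> has a solution, the factor belonging to a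
  root that realises the valuation. It is unique: roots of two solutions are conjugate under the
  decomposition group, which fixes the coefficients of the factors.\<close>

lemma Q_factor_degree_le:
  assumes w: "valuation (augment \<mu> \<phi> Infty)" "\<And>a. augment \<mu> \<phi> Infty [:a:] = v a" and \<phi>: "\<phi> \<in> Irr_over UNIV"
    and supp: "\<And>f. augment \<mu> \<phi> Infty f = Infty \<longleftrightarrow> \<phi> dvd f"
  shows "degree (Q_factor vb \<mu> \<phi>) \<le> degree \<phi>"
proof -
  define M where "M = irr_factors Kh (ac_poly \<phi>)"
  have \<phi>1: "lead_coeff \<phi> = 1" using Irr_overD(2)[OF subfld_UNIV \<phi>] .
  have M: "set_mset M \<subseteq> Irr_over Kh" "prod_mset M = ac_poly \<phi>"
    unfolding M_def using irr_factors_henselization[OF \<phi>1] by blast+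
  obtain \<theta> where \<theta>: "poly (ac_poly \<phi>) \<theta> = 0" "\<And>f. augment \<mu> \<phi> Infty f = vb (poly (ac_poly f) \<theta>)"
    using ex_root_of_valuation[OF w \<phi> supp] by blast
  have "\<exists>Q\<in>#M. poly Q \<theta> = 0" using \<theta>(1) unfolding M(2)[symmetric] by (induction M) auto
  then obtain Q where Q: "Q \<in># M" "poly Q \<theta> = 0" by blast
  have QI: "Q \<in> Irr_over Kh" using Q(1) M(1) by blast
  define P where "P Q' \<longleftrightarrow> Q' \<in># M \<and> augment \<mu> \<phi> Infty = w_of vb Q'" for Q'
  have "P Q" unfolding P_def using Q(1) w_of_eq[OF QI Q(2)] \<theta>(2) by auto
  have "Q' = Q" if "P Q'" for Q'
  proof -
    have Q'I: "Q' \<in> Irr_over Kh" using that M(1) by (auto simp: P_def)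
    obtain \<theta>' where \<theta>': "poly Q' \<theta>' = 0" using alg_closed_imp_poly_has_root[OF Irr_overD(3)[OF Kh_subfld Q'I]] by blast
    have "augment \<mu> \<phi> Infty f = vb (poly (ac_poly f) \<theta>')" for f
      using that w_of_eq[OF Q'I \<theta>'] by (simp add: P_def)
    hence "vb (poly (ac_poly f) \<theta>) = vb (poly (ac_poly f) \<theta>')" for f using \<theta>(2) by metis
    then obtain \<sigma> where s: "\<sigma> \<in> decomposition_group vb" "\<sigma> \<theta> = \<theta>'" using conjugate_elements by blast
    interpret s: fld_hom UNIV \<sigma> using decompositionD(1)[OF s(1)] .
    have "s.mp Q = Q"
      using Irr_overD(1)[OF Kh_subfld QI] s(1) by (intro poly_eqI) (auto simp: polys_over_def henselization_iff)
    hence "poly Q \<theta>' = 0" using s.poly_mp[of Q \<theta>] Q(2) s(2) by simp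
    thus "Q' = Q"
      using minpoly_unique[OF Kh_subfld, of Q' \<theta>' Q] QI Q'I \<theta>' unfolding is_minpoly_def[OF Kh_subfld] by blast
  qed
  hence "Q_factor vb \<mu> \<phi> = Q"
    unfolding Q_factor_def M_def[symmetric] P_def[symmetric] using \<open>P Q\<close> by (rule the_equality[rotated])
  moreover have "degree Q \<le> degree (ac_poly \<phi>)"
    using Irr_overD(4)[OF subfld_UNIV \<phi>] to_ac.mp_eq_0_iff[of \<phi>] Q(1) unfolding M(2)[symmetric]
    by (intro dvd_imp_degree_le dvd_prod_mset) auto
  ultimately show ?thesis by (simp add: to_ac.degree_mp)
qed

end

section \<open>Expansions in powers of a polynomial\<close>

lemma digit_0_right [simp]: "digit \<phi> 0 n = 0"
  by (simp add: digit_def)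

lemma digit_add: "digit \<phi> (f + g) n = digit \<phi> f n + digit \<phi> g n"
  for \<phi> :: "'a :: field poly"
  by (simp add: digit_def poly_div_add_left poly_mod_add_left)

lemma digit_sum: "digit \<phi> (sum f I) n = (\<Sum>i\<in>I. digit \<phi> (f i) n)"
  for \<phi> :: "'a :: field poly"
  by (induction I rule: infinite_finite_induct) (simp_all add: digit_add)

lemma digit_monomial:
  fixes \<phi> :: "'a :: field poly"
  assumes "degree a < degree \<phi>"
  shows "digit \<phi> (a * \<phi> ^ k) n = (if n = k then a else 0)"
proof -
  have nz: "\<phi> \<noteq> 0" using assms by auto
  consider "n < k" | "n = k" | "n > k" by linarith
  thus ?thesis
  proof cases
    case 1
    hence "a * \<phi> ^ k = (a * \<phi> ^ (k - n)) * \<phi> ^ n" by (simp add: mult.assoc flip: power_add)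
    hence "a * \<phi> ^ k div \<phi> ^ n = a * \<phi> ^ (k - n)"
      using nz by (metis nonzero_mult_div_cancel_right power_not_zero)
    also have "\<dots> mod \<phi> = 0" using 1 by (simp add: mod_eq_0_iff_dvd dvd_power)
    finally show ?thesis using 1 by (simp add: digit_def)
  next
    case 2
    thus ?thesis using nz assms by (simp add: digit_def mod_poly_less)
  next
    case 3
    hence "a * \<phi> ^ k div \<phi> ^ n = a div \<phi> ^ (n - k)"
      using nz by (metis div_mult_mult2 le_add_diff_inverse2 less_imp_le power_add power_not_zero)
    moreover have "1 \<le> n - k" using 3 by simp
    hence "1 * degree \<phi> \<le> (n - k) * degree \<phi>" by (rule mult_le_mono1)
    hence "degree \<phi> \<le> degree (\<phi> ^ (n - k))" by (simp only: degree_power_eq[OF nz] nat_mult_1)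
    ultimately have "a * \<phi> ^ k div \<phi> ^ n = 0" using assms by (simp add: div_poly_less)
    thus ?thesis using 3 by (simp add: digit_def)
  qed
qed

lemma digit_eq_0:
  fixes \<phi> :: "'a :: field poly"
  assumes "degree \<phi> > 0" "n > degree f"
  shows "digit \<phi> f n = 0"
proof -
  have "\<phi> \<noteq> 0" using assms by auto
  have "n \<le> n * degree \<phi>" using assms by simp
  hence "degree f < n * degree \<phi>" using assms(2) by linarith
  hence "degree f < degree (\<phi> ^ n)" using \<open>\<phi> \<noteq> 0\<close> by (simp add: degree_power_eq)
  thus ?thesis by (simp add: digit_def div_poly_less)
qed

lemma digit_less_degree:
  fixes \<phi> :: "'a :: field poly"
  assumes "degree f < degree \<phi>"
  shows "digit \<phi> f n = (if n = 0 then f else 0)"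
  using digit_monomial[OF assms, of 0 n] by simp

lemma digit_zero: "digit \<phi> f 0 = f mod \<phi>"
  for \<phi> :: "'a :: field poly"
  by (simp add: digit_def)

text \<open>A product of two digits has degree less than 2 deg(\<open>\<phi>\<close>), so it splits
  into a remainder at place i + j (the flag \<open>True\<close>) and a carry at place i + j + 1 (the
  flag \<open>False\<close>). A single sum over all contributions lets one dominant summand decide
  the value.\<close>

lemma digit_mult:
  fixes \<phi> :: "'a :: field poly"
  assumes "degree \<phi> > 0"
  shows "digit \<phi> (f * g) n = (\<Sum>(i, j, b) \<in> {..degree f} \<times> {..degree g} \<times> UNIV.
     if b then if n = i + j then (digit \<phi> f i * digit \<phi> g j) mod \<phi> else 0
     else if n = Suc (i + j) then (digit \<phi> f i * digit \<phi> g j) div \<phi> else 0)"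
proof -
  have nz: "\<phi> \<noteq> 0" using assms by auto
  have ab: "digit \<phi> (digit \<phi> f i * digit \<phi> g j * \<phi> ^ (i + j)) n =
      (if n = i + j then (digit \<phi> f i * digit \<phi> g j) mod \<phi> else 0) +
      (if n = Suc (i + j) then (digit \<phi> f i * digit \<phi> g j) div \<phi> else 0)" for i j
  proof -
    define P where "P = digit \<phi> f i * digit \<phi> g j"
    have "degree P \<le> degree (digit \<phi> f i) + degree (digit \<phi> g j)" unfolding P_def by (rule degree_mult_le)
    hence dP: "degree P < 2 * degree \<phi>"
      using degree_digit_less[OF assms, of f i] degree_digit_less[OF assms, of g j] by linarith
    have dm: "degree (P mod \<phi>) < degree \<phi>" using assms nz degree_mod_less[of \<phi> P] by auto
    have dd: "degree (P div \<phi>) < degree \<phi>"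
    proof (cases "P div \<phi> = 0")
      case False
      have le: "degree (P div \<phi>) + degree \<phi> = degree (P div \<phi> * \<phi>)" using False nz by (simp add: degree_mult_eq)
      have "P div \<phi> * \<phi> = P - P mod \<phi>" by (simp add: minus_mod_eq_div_mult)
      hence "degree (P div \<phi> * \<phi>) \<le> max (degree P) (degree (P mod \<phi>))" by (simp add: degree_diff_le_max)
      thus ?thesis using le dP dm by auto
    qed (use assms in auto)
    have "P * \<phi> ^ (i + j) = (P mod \<phi>) * \<phi> ^ (i + j) + (P div \<phi>) * \<phi> ^ Suc (i + j)"
      by (metis (no_types, lifting) add.commute distrib_right div_mult_mod_eq mult.assoc power_Suc)
    thus ?thesis unfolding P_def[symmetric] by (simp only: digit_add digit_monomial[OF dm] digit_monomial[OF dd])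
  qed
  have "f * g = (\<Sum>i\<le>degree f. digit \<phi> f i * \<phi> ^ i) * (\<Sum>j\<le>degree g. digit \<phi> g j * \<phi> ^ j)"
    using digit_expansion[OF assms] by metis
  also have "\<dots> = (\<Sum>i\<le>degree f. \<Sum>j\<le>degree g. digit \<phi> f i * digit \<phi> g j * \<phi> ^ (i + j))"
    by (simp add: sum_product power_add mult_ac)
  finally have "digit \<phi> (f * g) n = (\<Sum>i\<le>degree f. \<Sum>j\<le>degree g.
      (if n = i + j then (digit \<phi> f i * digit \<phi> g j) mod \<phi> else 0) +
      (if n = Suc (i + j) then (digit \<phi> f i * digit \<phi> g j) div \<phi> else 0))"
    by (simp only: digit_sum ab)
  also have "\<dots> = (\<Sum>(i, j, b) \<in> {..degree f} \<times> {..degree g} \<times> UNIV.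
     if b then if n = i + j then (digit \<phi> f i * digit \<phi> g j) mod \<phi> else 0
     else if n = Suc (i + j) then (digit \<phi> f i * digit \<phi> g j) div \<phi> else 0)"
    by (subst sum.cartesian_product[symmetric], subst sum.cartesian_product[symmetric]) (simp add: UNIV_bool add.commute)
  finally show ?thesis .
qed

section \<open>Inductive valuations\<close>

text \<open>The valuation \<open>w\<close> with support \<open>\<phi>\<close> plays the role of \<open>[\<mu>; \<phi>, \<infinity>]\<close>, and \<open>mu\<close> that of
  \<open>[\<mu>; \<phi>, \<gamma>]\<close>. This also covers depth zero, with \<open>w f = v (f(a))\<close>.\<close>

locale limit_val =
  fixes v :: "'a :: field \<Rightarrow> 'g :: linordered_ab_group_add vinf" and w :: "'a poly \<Rightarrow> 'g vinf"
    and \<phi> :: "'a poly"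
  assumes w: "valuation w" and w_const: "w [:c:] = v c"
    and monic: "lead_coeff \<phi> = 1" and deg: "degree \<phi> > 0"
    and supp: "w f = Infty \<longleftrightarrow> \<phi> dvd f"
begin

lemma v: "valuation v"
proof -
  have "v (a * b) = v a + v b" for a b using val_mult[OF w, of "[:a:]" "[:b:]"] by (simp add: w_const mult.commute)
  moreover have "min (v a) (v b) \<le> v (a + b)" for a b
    using w[unfolded valuation_def] w_const by (metis add_pCons add_0)
  ultimately show ?thesis
    unfolding valuation_def using w_const[of 0] w_const[of 1] val_zero[OF w] val_one[OF w] by (simp add: one_pCons)
qed

lemma v_eq_Infty: "v a = Infty \<longleftrightarrow> a = 0"
  using valuation_field_eq_Infty_iff[OF v] .

lemma phi_nz: "\<phi> \<noteq> 0" using deg by auto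

lemma w_eq_Infty: "degree f < degree \<phi> \<Longrightarrow> w f = Infty \<longleftrightarrow> f = 0"
  using supp[of f] dvd_imp_degree_le[of \<phi> f] by auto

lemma w_mod: "w (f mod \<phi>) = w f"
proof -
  have "w (f div \<phi> * \<phi>) = Infty" using supp by simp
  moreover have "f mod \<phi> = f - f div \<phi> * \<phi>" by (simp add: minus_div_mult_eq_mod)
  ultimately show ?thesis
    using val_diff_eq[OF w, of f "f div \<phi> * \<phi>"] val_diff_ge[OF w, of Infty f "f div \<phi> * \<phi>"]
    by (cases "w f") auto
qed

lemma degree_mod: "degree (f mod \<phi>) < degree \<phi>"
  using degree_digit_less[OF deg, of f 0] by (simp add: digit_zero)

end

text \<open>The axiom \<open>strict\<close> says that carries have larger value than the products
  they come from. It encodes \<gamma> > \<mu>(\<phi>) without mentioning the previous valuation,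
  which does not exist at depth zero.\<close>

locale level = limit_val v w \<phi>
  for v :: "'a :: field \<Rightarrow> 'g :: linordered_ab_group_add vinf" and w \<phi> +
  fixes \<gamma> :: 'g
  assumes strict: "a \<noteq> 0 \<Longrightarrow> b \<noteq> 0 \<Longrightarrow> degree a < degree \<phi> \<Longrightarrow> degree b < degree \<phi> \<Longrightarrow>
      w a + w b < w ((a * b) div \<phi>) + Val \<gamma>"
begin

definition T :: "'a poly \<Rightarrow> nat \<Rightarrow> 'g vinf" where
  "T f n = w (digit \<phi> f n) + nmul n (Val \<gamma>)"

definition mu :: "'a poly \<Rightarrow> 'g vinf" where
  "mu f = (MIN n\<in>{..degree f}. w (digit \<phi> f n) + nmul n (Val \<gamma>))"

lemma mu_le: "mu f \<le> T f n"
proof (cases "n \<le> degree f")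
  case True
  thus ?thesis unfolding mu_def T_def by (intro Min_le) auto
next
  case False
  thus ?thesis using digit_eq_0[OF deg, of f n] by (simp add: T_def val_zero[OF w])
qed

lemma mu_attained: "\<exists>n\<le>degree f. mu f = T f n"
proof -
  have "mu f \<in> (\<lambda>n. w (digit \<phi> f n) + nmul n (Val \<gamma>)) ` {..degree f}"
    unfolding mu_def by (rule Min_in) auto
  thus ?thesis by (auto simp: T_def)
qed

lemma mu_geI: "(\<And>n. c \<le> T f n) \<Longrightarrow> c \<le> mu f"
  using mu_attained[of f] by metis

lemma T_eq_Infty: "T f n = Infty \<longleftrightarrow> digit \<phi> f n = 0"
  using w_eq_Infty[OF degree_digit_less[OF deg]] by (simp add: T_def)

lemma mu_eq_Infty: "mu f = Infty \<longleftrightarrow> f = 0"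
proof
  assume inf: "mu f = Infty"
  have "T f n = Infty" for n using mu_le[of f n] inf by simp
  hence "digit \<phi> f n = 0" for n using T_eq_Infty by blast
  thus "f = 0" using digit_expansion[OF deg, of f] by simp
next
  assume "f = 0"
  thus "mu f = Infty" by (auto simp: mu_def val_zero[OF w])
qed

lemma mu_monomial:
  assumes "degree a < degree \<phi>" shows "mu (a * \<phi> ^ n) = w a + nmul n (Val \<gamma>)"
proof -
  have T: "T (a * \<phi> ^ n) k = (if k = n then w a + nmul n (Val \<gamma>) else Infty)" for k
    by (simp add: T_def digit_monomial[OF assms] val_zero[OF w])
  show ?thesis using mu_le[of "a * \<phi> ^ n" n] mu_geI[of "w a + nmul n (Val \<gamma>)" "a * \<phi> ^ n"] unfolding T
    by (auto intro: antisym)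
qed

lemma mu_eq_w: "degree a < degree \<phi> \<Longrightarrow> mu a = w a"
  using mu_monomial[of a 0] by simp

lemma mu_const: "mu [:a:] = v a"
  using mu_eq_w[of "[:a:]"] deg by (simp add: w_const)

lemma mu_phi: "mu \<phi> = Val \<gamma>"
  using mu_monomial[of 1 1] deg by (simp add: val_one[OF w])

lemma mu_le_w: "mu f \<le> w f"
  using mu_le[of f 0] by (simp add: T_def digit_zero w_mod)

definition contr :: "'a poly \<Rightarrow> 'a poly \<Rightarrow> nat \<Rightarrow> nat \<times> nat \<times> bool \<Rightarrow> 'a poly" where
  "contr f g n = (\<lambda>(i, j, b). if b then if n = i + j then (digit \<phi> f i * digit \<phi> g j) mod \<phi> else 0
     else if n = Suc (i + j) then (digit \<phi> f i * digit \<phi> g j) div \<phi> else 0)"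

lemma digit_mult_contr: "digit \<phi> (f * g) n = sum (contr f g n) ({..degree f} \<times> {..degree g} \<times> UNIV)"
  unfolding digit_mult[OF deg] contr_def by simp

lemma contr_True:
  "w (contr f g n (i, j, True)) + nmul n (Val \<gamma>) = (if n = i + j then T f i + T g j else Infty)"
  by (simp add: contr_def T_def w_mod val_mult[OF w] nmul_add val_zero[OF w] ac_simps del: nmul_Val)

lemma contr_False:
  "n = Suc (i + j) \<Longrightarrow> T f i + T g j \<noteq> Infty \<Longrightarrow> T f i + T g j < w (contr f g n (i, j, False)) + nmul n (Val \<gamma>)"
  "n \<noteq> Suc (i + j) \<or> T f i + T g j = Infty \<Longrightarrow> w (contr f g n (i, j, False)) + nmul n (Val \<gamma>) = Infty"
proof -
  let ?a = "digit \<phi> f i" and ?b = "digit \<phi> g j"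
  assume n: "n = Suc (i + j)" and fin: "T f i + T g j \<noteq> Infty"
  have nz: "?a \<noteq> 0" "?b \<noteq> 0" using fin T_eq_Infty by auto
  have "(w ?a + w ?b) + nmul (i + j) (Val \<gamma>) < (w ((?a * ?b) div \<phi>) + Val \<gamma>) + nmul (i + j) (Val \<gamma>)"
    using strict[OF nz degree_digit_less[OF deg] degree_digit_less[OF deg]] by simp
  thus "T f i + T g j < w (contr f g n (i, j, False)) + nmul n (Val \<gamma>)"
    using n by (simp add: contr_def T_def nmul_add ac_simps del: nmul_Val)
next
  assume "n \<noteq> Suc (i + j) \<or> T f i + T g j = Infty"
  thus "w (contr f g n (i, j, False)) + nmul n (Val \<gamma>) = Infty"
    by (auto simp: contr_def val_zero[OF w] T_eq_Infty)
qed

lemma contr_ge: "mu f + mu g \<le> w (contr f g n ijb) + nmul n (Val \<gamma>)"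
proof -
  obtain i j b where ijb: "ijb = (i, j, b)" by (metis prod_cases3)
  have "mu f + mu g \<le> T f i + T g j" by (intro add_mono mu_le)
  thus ?thesis
    using contr_True[of f g n i j] contr_False[of n i j f g] unfolding ijb
    by (cases b; cases "n = Suc (i + j) \<and> T f i + T g j \<noteq> Infty") (auto split: if_splits)
qed

lemma mu_mult_ge: "mu f + mu g \<le> mu (f * g)"
proof (rule mu_geI)
  fix n
  have "w (contr f g n t) + nmul n (Val \<gamma>) \<ge> mu f + mu g" for t by (rule contr_ge)
  then show "mu f + mu g \<le> T (f * g) n"
  proof (cases "mu f + mu g = Infty")
    case False
    \<comment> \<open>Shifting by n times \<gamma> turns the bound for \<open>T\<close> into a bound
      for \<open>w\<close>, and finiteness makes the shift possible.\<close>
    then obtain c where c: "mu f + mu g = c + nmul n (Val \<gamma>)" "c \<noteq> Infty"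
      by (cases "mu f + mu g") (auto intro!: that[of "Val (_ - nmul n \<gamma>)"])
    have "c \<le> w (contr f g n t)" for t using contr_ge[of f g n t] unfolding c(1) by simp
    hence "c \<le> w (digit \<phi> (f * g) n)" unfolding digit_mult_contr by (intro val_sum_ge[OF w])
    thus ?thesis unfolding c(1) T_def by simp
  qed (auto simp: mu_eq_Infty T_def val_zero[OF w])
qed

text \<open>The degree of the initial form of \<open>f\<close> as a polynomial in the initial form
  of \<open>\<phi>\<close>. Accordingly it is additive on products and depends only on the initial
  form.\<close>

definition smax :: "'a poly \<Rightarrow> nat" where
  "smax f = Max {n. n \<le> degree f \<and> T f n = mu f}"

lemma smax:
  assumes "f \<noteq> 0"
  shows "T f (smax f) = mu f" "smax f \<le> degree f" "smax f < n \<Longrightarrow> mu f < T f n"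
proof -
  have "smax f \<in> {n. n \<le> degree f \<and> T f n = mu f}"
    unfolding smax_def using mu_attained[of f] by (intro Max_in) auto
  thus "T f (smax f) = mu f" "smax f \<le> degree f" by auto
  assume n: "smax f < n"
  have "T f n \<noteq> mu f"
  proof
    assume eq: "T f n = mu f"
    hence "digit \<phi> f n \<noteq> 0" using assms mu_eq_Infty T_eq_Infty by metis
    hence "n \<le> degree f" using digit_eq_0[OF deg, of f n] by (cases "n \<le> degree f") auto
    hence "n \<le> smax f" unfolding smax_def using eq by (intro Max_ge) auto
    thus False using n by simp
  qed
  thus "mu f < T f n" using mu_le[of f n] by simp
qed

lemma smax_unique:
  assumes "f \<noteq> 0" "T f k = mu f" "\<And>n. n > k \<Longrightarrow> mu f < T f n"
  shows "smax f = k"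
  using smax[OF assms(1)] assms(2,3) by (metis linorder_neqE_nat order_less_irrefl)

text \<open>The argument of Gauss's lemma. At place \<open>smax f + smax g\<close> the product of
  the two top digits is the only contribution of least value, and beyond that place every
  contribution has larger value.\<close>

lemma mu_mult_smax:
  assumes nz: "f \<noteq> 0" "g \<noteq> 0"
  shows "mu (f * g) = mu f + mu g" "smax (f * g) = smax f + smax g"
proof -
  let ?I = "{..degree f} \<times> {..degree g} \<times> (UNIV :: bool set)"
  let ?A = "mu f + mu g"
  have fin: "?A \<noteq> Infty" "mu f \<noteq> Infty" "mu g \<noteq> Infty" using nz by (auto simp: mu_eq_Infty)
  have big: "?A < T f i + T g j" if "i > smax f \<or> j > smax g" for i j
  proof -
    from that show ?thesis
    proof
      assume "i > smax f"
      thus ?thesis using vinf_add_strict_mono(1)[OF smax(3)[OF nz(1)] mu_le fin(3)] by blast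
    next
      assume "j > smax g"
      thus ?thesis using vinf_add_strict_mono(2)[OF smax(3)[OF nz(2)] mu_le fin(2)] by blast
    qed
  qed
  have gt: "?A < w (contr f g n t) + nmul n (Val \<gamma>)"
    if "n \<ge> smax f + smax g" "t \<in> ?I" "n = smax f + smax g \<Longrightarrow> t \<noteq> (smax f, smax g, True)" for n t
  proof -
    obtain i j b where t: "t = (i, j, b)" by (metis prod_cases3)
    show ?thesis
    proof (cases b)
      case True
      show ?thesis
      proof (cases "n = i + j")
        case nij: True
        have "i > smax f \<or> j > smax g"
        proof (rule ccontr)
          assume "\<not> ?thesis"
          hence "i = smax f" "j = smax g" using that(1) nij by linarith+
          thus False using that(3) nij t True by simp
        qed
        thus ?thesis using big[of i j] contr_True[of f g n i j] nij t True by simp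
      next
        case False
        thus ?thesis using contr_True[of f g n i j] t True fin by simp
      qed
    next
      case False
      show ?thesis
      proof (cases "n = Suc (i + j) \<and> T f i + T g j \<noteq> Infty")
        case c: True
        have "?A \<le> T f i + T g j" by (intro add_mono mu_le)
        also have "\<dots> < w (contr f g n t) + nmul n (Val \<gamma>)" using contr_False(1)[of n i j f g] c t False by simp
        finally show ?thesis .
      next
        case c: False
        thus ?thesis using contr_False(2)[of n i j f g] t False fin by simp
      qed
    qed
  qed
  define N where "N = smax f + smax g"
  let ?t = "(smax f, smax g, True)"
  have tI: "?t \<in> ?I" using smax(2) nz by simp
  have wt: "w (contr f g N ?t) + nmul N (Val \<gamma>) = ?A"
    using contr_True[of f g N "smax f" "smax g"] smax(1) nz by (simp add: N_def)
  have "w (sum (contr f g N) ?I) = w (contr f g N ?t)"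
  proof (rule val_sum_dominant[OF w _ tI])
    fix t assume "t \<in> ?I" "t \<noteq> ?t"
    hence "w (contr f g N ?t) + nmul N (Val \<gamma>) < w (contr f g N t) + nmul N (Val \<gamma>)"
      unfolding wt by (intro gt) (auto simp: N_def)
    thus "w (contr f g N ?t) < w (contr f g N t)" by simp
  qed simp
  hence TN: "T (f * g) N = ?A" unfolding T_def digit_mult_contr using wt by simp
  thus eq: "mu (f * g) = mu f + mu g" using mu_mult_ge[of f g] mu_le[of "f * g" N] by simp
  have "mu (f * g) < T (f * g) n" if n: "n > N" for n
  proof -
    obtain c where c: "?A = c + nmul n (Val \<gamma>)" "c \<noteq> Infty"
      using fin(1) by (cases "mu f + mu g") (auto intro!: that[of "Val (_ - nmul n \<gamma>)"])
    have "c < w (contr f g n t)" if "t \<in> ?I" for t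
      using gt[of n t] that n unfolding c(1) by (simp add: N_def)
    hence "c < w (digit \<phi> (f * g) n)" unfolding digit_mult_contr by (intro val_sum_gt[OF w c(2)]) auto
    thus ?thesis unfolding eq c(1) T_def by simp
  qed
  thus "smax (f * g) = smax f + smax g" using smax_unique[of "f * g" N] TN eq nz by (simp add: N_def)
qed

lemma T_add: "min (T f n) (T g n) \<le> T (f + g) n"
proof -
  have "min (w (digit \<phi> f n)) (w (digit \<phi> g n)) \<le> w (digit \<phi> f n + digit \<phi> g n)"
    using w by (simp add: valuation_def)
  thus ?thesis by (simp add: T_def digit_add min_def split: if_splits)
qed

theorem mu: "valuation mu"
  unfolding valuation_def
proof (intro conjI allI)
  show "mu 0 = Infty" by (simp add: mu_eq_Infty)
  show "mu 1 = 0" using mu_const[of 1] val_one[OF v] by (simp add: one_pCons)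
  fix f g
  show "mu (f * g) = mu f + mu g"
    using mu_mult_smax(1)[of f g] mu_eq_Infty[of 0] by (cases "f = 0 \<or> g = 0") auto
  show "min (mu f) (mu g) \<le> mu (f + g)"
  proof (rule mu_geI)
    fix n
    have "min (mu f) (mu g) \<le> min (T f n) (T g n)" by (intro min.mono mu_le)
    also have "\<dots> \<le> T (f + g) n" by (rule T_add)
    finally show "min (mu f) (mu g) \<le> T (f + g) n" .
  qed
qed

lemma smax_less_degree: "f \<noteq> 0 \<Longrightarrow> degree f < degree \<phi> \<Longrightarrow> smax f = 0"
proof (rule smax_unique)
  assume f: "f \<noteq> 0" "degree f < degree \<phi>"
  show "T f 0 = mu f" using f by (simp add: T_def digit_less_degree mu_eq_w)
  show "mu f < T f n" if "n > 0" for n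
    using that f by (simp add: T_def digit_less_degree val_zero[OF w] mu_eq_Infty)
qed

lemma smax_cong:
  assumes "mu f < mu (f - g)" shows "smax g = smax f"
proof -
  have fin: "mu f \<noteq> Infty" using assms by auto
  have fg: "mu g = mu f" using val_eq_of_diff[OF mu assms] .
  have nz: "f \<noteq> 0" "g \<noteq> 0" using fin mu_eq_Infty[of f] mu_eq_Infty[of g] unfolding fg by blast+
  have Td: "mu f < T (f - g) n" for n using assms mu_le[of "f - g" n] by (rule less_le_trans)
  have eq: "T g n = mu f" if "T f n = mu f" for n
  proof -
    have "digit \<phi> (g + (f - g)) n = digit \<phi> g n + digit \<phi> (f - g) n" by (rule digit_add)
    hence g: "digit \<phi> g n = digit \<phi> f n - digit \<phi> (f - g) n"
      by (simp only: add_diff_cancel_left' diff_add_cancel add.commute[of g] add_diff_cancel_right')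
    have "T f n < T (f - g) n" using Td[of n] that by (simp only:)
    hence "w (digit \<phi> f n) < w (digit \<phi> (f - g) n)" unfolding T_def by simp
    hence "w (digit \<phi> g n) = w (digit \<phi> f n)" unfolding g by (rule val_diff_eq[OF w])
    thus ?thesis unfolding that[symmetric] T_def by (simp only:)
  qed
  show ?thesis
  proof (rule smax_unique[OF nz(2)])
    show "T g (smax f) = mu g" using eq[OF smax(1)[OF nz(1)]] fg by simp
    fix n assume n: "smax f < n"
    have "T (f - (f - g)) n \<ge> min (T f n) (T (g - f) n)" using T_add[of f n "g - f"] by simp
    moreover have "T (g - f) n = T (f - g) n"
    proof -
      have "digit \<phi> (g - f) n + digit \<phi> (f - g) n = 0" by (simp flip: digit_add)
      hence "digit \<phi> (g - f) n = - digit \<phi> (f - g) n" by (simp add: eq_neg_iff_add_eq_0)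
      thus ?thesis by (simp add: T_def val_uminus[OF w])
    qed
    moreover have "mu f < T f n" using smax(3)[OF nz(1) n] .
    ultimately show "mu g < T g n" using Td[of n] fg by (auto simp: min_def split: if_splits)
  qed
qed

end

section \<open>The graded algebra and key polynomials\<close>

locale poly_valuation =
  fixes \<mu> :: "'a :: field poly \<Rightarrow> 'g :: linordered_ab_group_add vinf"
  assumes val: "valuation \<mu>" and trivial: "\<mu> f = Infty \<longleftrightarrow> f = 0"
begin

abbreviation "\<G> \<equiv> gr_ring \<mu>"

lemma mem_gr_plus: "h \<in> gr_plus \<mu> \<alpha> \<longleftrightarrow> Val \<alpha> < \<mu> h"
  by (simp add: gr_plus_def)

lemma mem_gr_class: "h \<in> gr_class \<mu> \<alpha> f \<longleftrightarrow> Val \<alpha> < \<mu> (h - f)"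
proof
  assume "Val \<alpha> < \<mu> (h - f)"
  hence "f + (h - f) \<in> gr_class \<mu> \<alpha> f" unfolding gr_class_def by (intro imageI) (simp add: gr_plus_def)
  thus "h \<in> gr_class \<mu> \<alpha> f" by simp
qed (auto simp: gr_class_def gr_plus_def)

lemma gr_class_self: "f \<in> gr_class \<mu> \<alpha> f"
  by (simp add: mem_gr_class val_zero[OF val])

lemma minus_commute: "\<mu> (f - g) = \<mu> (g - f)"
  using val_uminus[OF val, of "g - f"] by simp

lemma gr_class_eq: "gr_class \<mu> \<alpha> f = gr_class \<mu> \<alpha> g \<longleftrightarrow> Val \<alpha> < \<mu> (f - g)"
proof
  assume "gr_class \<mu> \<alpha> f = gr_class \<mu> \<alpha> g"
  thus "Val \<alpha> < \<mu> (f - g)" using gr_class_self[of f \<alpha>] by (simp add: mem_gr_class)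
next
  assume fg: "Val \<alpha> < \<mu> (f - g)"
  have "Val \<alpha> < \<mu> (h - f) \<longleftrightarrow> Val \<alpha> < \<mu> (h - g)" for h
    using val_add_gt[OF val _ fg, of "h - f"] val_diff_gt[OF val _ fg, of "h - g"] by auto
  thus "gr_class \<mu> \<alpha> f = gr_class \<mu> \<alpha> g" by (auto simp: mem_gr_class)
qed

lemma gr_class_zero: "gr_class \<mu> \<alpha> 0 = gr_plus \<mu> \<alpha>"
  by (auto simp: mem_gr_class mem_gr_plus)

lemma gr_class_eq_plus: "gr_class \<mu> \<alpha> f = gr_plus \<mu> \<alpha> \<longleftrightarrow> Val \<alpha> < \<mu> f"
  using gr_class_eq[of \<alpha> f 0] by (simp add: gr_class_zero)

definition gr_supp :: "('g \<Rightarrow> 'a poly set) \<Rightarrow> 'g set" where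
  "gr_supp z = {\<beta>. z \<beta> \<noteq> gr_plus \<mu> \<beta>}"

lemma gr_carrier: "z \<in> carrier \<G> \<longleftrightarrow> (\<forall>\<alpha>. \<exists>f. Val \<alpha> \<le> \<mu> f \<and> z \<alpha> = gr_class \<mu> \<alpha> f) \<and> finite (gr_supp z)"
  by (auto simp: gr_ring_def gr_supp_def gr_filt_def image_iff)

lemma gr_rep:
  assumes "z \<in> carrier \<G>" "s \<in> z \<alpha>" shows "Val \<alpha> \<le> \<mu> s" "z \<alpha> = gr_class \<mu> \<alpha> s"
proof -
  obtain f where f: "Val \<alpha> \<le> \<mu> f" "z \<alpha> = gr_class \<mu> \<alpha> f" using assms(1) gr_carrier by blast
  have lt: "Val \<alpha> < \<mu> (s - f)" using assms(2) f(2) by (simp add: mem_gr_class)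
  thus "z \<alpha> = gr_class \<mu> \<alpha> s" using gr_class_eq[of \<alpha> s f] f(2) by simp
  show "Val \<alpha> \<le> \<mu> s" using val_add_ge[OF val, of "Val \<alpha>" "s - f" f] lt f(1) by simp
qed

lemma gr_section: "z \<in> carrier \<G> \<Longrightarrow> \<exists>s. \<forall>\<alpha>. s \<alpha> \<in> z \<alpha>"
proof -
  assume z: "z \<in> carrier \<G>"
  have "\<exists>f. f \<in> z \<alpha>" for \<alpha> using z gr_carrier[of z] gr_class_self by metis
  thus ?thesis by metis
qed

lemma not_gr_supp: "z \<in> carrier \<G> \<Longrightarrow> s \<in> z \<alpha> \<Longrightarrow> \<alpha> \<notin> gr_supp z \<longleftrightarrow> Val \<alpha> < \<mu> s"
  using gr_rep(2)[of z s \<alpha>] gr_class_eq_plus[of \<alpha> s] by (simp add: gr_supp_def)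

text \<open>Changing a representative changes the sum by an element of larger value, so one choice
  replaces the union over all choices.\<close>

lemma gr_mult:
  assumes z: "z \<in> carrier \<G>" "z' \<in> carrier \<G>" and s: "\<And>\<beta>. s \<beta> \<in> z \<beta>" and t: "\<And>\<beta>. t \<beta> \<in> z' \<beta>"
  shows "(z \<otimes>\<^bsub>\<G>\<^esub> z') \<alpha> = gr_class \<mu> \<alpha> (\<Sum>\<beta>\<in>gr_supp z. s \<beta> * t (\<alpha> - \<beta>))"
proof -
  have wd: "gr_class \<mu> \<alpha> (\<Sum>\<beta>\<in>gr_supp z. s' \<beta> * t' (\<alpha> - \<beta>)) = gr_class \<mu> \<alpha> (\<Sum>\<beta>\<in>gr_supp z. s \<beta> * t (\<alpha> - \<beta>))"
    if s': "\<forall>\<beta>. s' \<beta> \<in> z \<beta>" and t': "\<forall>\<beta>. t' \<beta> \<in> z' \<beta>" for s' t'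
  proof -
    have "Val \<alpha> < \<mu> (\<Sum>\<beta>\<in>gr_supp z. s' \<beta> * t' (\<alpha> - \<beta>) - s \<beta> * t (\<alpha> - \<beta>))"
    proof (rule val_sum_gt[OF val])
      fix \<beta>
      have ds: "Val \<beta> < \<mu> (s' \<beta> - s \<beta>)"
        using gr_rep(2)[OF z(1) s, of \<beta>] s'[rule_format, of \<beta>] by (simp add: mem_gr_class)
      have dt: "Val (\<alpha> - \<beta>) < \<mu> (t' (\<alpha> - \<beta>) - t (\<alpha> - \<beta>))"
        using gr_rep(2)[OF z(2) t, of "\<alpha> - \<beta>"] t'[rule_format, of "\<alpha> - \<beta>"] by (simp add: mem_gr_class)
      have gs: "Val \<beta> \<le> \<mu> (s \<beta>)" using gr_rep(1)[OF z(1) s] .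
      have gt: "Val (\<alpha> - \<beta>) \<le> \<mu> (t' (\<alpha> - \<beta>))" using gr_rep(1)[OF z(2)] t' by blast
      have sum: "Val \<alpha> = Val \<beta> + Val (\<alpha> - \<beta>)" by simp
      have "Val \<alpha> < \<mu> ((s' \<beta> - s \<beta>) * t' (\<alpha> - \<beta>))"
        unfolding sum val_mult[OF val] by (rule vinf_add_strict_mono(1)[OF ds gt]) simp
      moreover have "Val \<alpha> < \<mu> (s \<beta> * (t' (\<alpha> - \<beta>) - t (\<alpha> - \<beta>)))"
        unfolding sum val_mult[OF val] by (rule vinf_add_strict_mono(2)[OF dt gs]) simp
      moreover have "s' \<beta> * t' (\<alpha> - \<beta>) - s \<beta> * t (\<alpha> - \<beta>) =
          (s' \<beta> - s \<beta>) * t' (\<alpha> - \<beta>) + s \<beta> * (t' (\<alpha> - \<beta>) - t (\<alpha> - \<beta>))" by (simp add: algebra_simps)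
      ultimately show "Val \<alpha> < \<mu> (s' \<beta> * t' (\<alpha> - \<beta>) - s \<beta> * t (\<alpha> - \<beta>))"
        using val_add_gt[OF val] by metis
    qed simp
    thus ?thesis by (simp add: gr_class_eq sum_subtractf)
  qed
  have "(z \<otimes>\<^bsub>\<G>\<^esub> z') \<alpha> = \<Union>{gr_class \<mu> \<alpha> (\<Sum>\<beta>\<in>gr_supp z. s \<beta> * t (\<alpha> - \<beta>)) | s t.
      (\<forall>\<beta>. s \<beta> \<in> z \<beta>) \<and> (\<forall>\<beta>. t \<beta> \<in> z' \<beta>)}"
    by (simp add: gr_ring_def gr_supp_def)
  also have "{gr_class \<mu> \<alpha> (\<Sum>\<beta>\<in>gr_supp z. s \<beta> * t (\<alpha> - \<beta>)) | s t. (\<forall>\<beta>. s \<beta> \<in> z \<beta>) \<and> (\<forall>\<beta>. t \<beta> \<in> z' \<beta>)} =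
      {gr_class \<mu> \<alpha> (\<Sum>\<beta>\<in>gr_supp z. s \<beta> * t (\<alpha> - \<beta>))}" (is "?L = {?r}")
  proof (rule equalityI[OF subsetI])
    fix y assume "y \<in> ?L"
    then obtain s' t' where "y = gr_class \<mu> \<alpha> (\<Sum>\<beta>\<in>gr_supp z. s' \<beta> * t' (\<alpha> - \<beta>))"
      "\<forall>\<beta>. s' \<beta> \<in> z \<beta>" "\<forall>\<beta>. t' \<beta> \<in> z' \<beta>" by blast
    thus "y \<in> {?r}" using wd by simp
  next
    show "{?r} \<subseteq> ?L" using s t by blast
  qed
  finally show ?thesis by simp
qed

lemma gr_in_rep: "(if \<mu> f = Val \<beta> then f else 0) \<in> gr_in \<mu> f \<beta>"
  by (simp add: gr_in_def gr_class_self mem_gr_plus val_zero[OF val])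

lemma gr_supp_gr_in: "gr_supp (gr_in \<mu> f) = {\<beta>. \<mu> f = Val \<beta>}"
  by (auto simp: gr_supp_def gr_in_def gr_class_eq_plus)

lemma gr_in_carrier: "gr_in \<mu> f \<in> carrier \<G>"
proof -
  have "\<exists>h. Val \<alpha> \<le> \<mu> h \<and> gr_in \<mu> f \<alpha> = gr_class \<mu> \<alpha> h" for \<alpha>
    by (rule exI[of _ "if \<mu> f = Val \<alpha> then f else 0"]) (auto simp: gr_in_def val_zero[OF val] gr_class_zero)
  moreover have "finite {\<beta>. \<mu> f = Val \<beta>}" by (cases "\<mu> f") auto
  ultimately show ?thesis by (simp add: gr_carrier gr_supp_gr_in)
qed

lemma gr_in_mult_component:
  assumes z: "z \<in> carrier \<G>" and t: "\<And>\<beta>. t \<beta> \<in> z \<beta>" and f: "\<mu> f = Val \<delta>"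
  shows "(gr_in \<mu> f \<otimes>\<^bsub>\<G>\<^esub> z) \<alpha> = gr_class \<mu> \<alpha> (f * t (\<alpha> - \<delta>))"
proof -
  have "(gr_in \<mu> f \<otimes>\<^bsub>\<G>\<^esub> z) \<alpha> =
      gr_class \<mu> \<alpha> (\<Sum>\<beta>\<in>gr_supp (gr_in \<mu> f). (if \<mu> f = Val \<beta> then f else 0) * t (\<alpha> - \<beta>))"
    by (rule gr_mult[OF gr_in_carrier z gr_in_rep t])
  thus ?thesis by (simp add: gr_supp_gr_in f)
qed

lemma gr_in_zero: "f = 0 \<Longrightarrow> gr_in \<mu> f = gr_plus \<mu>"
  by (simp add: gr_in_def trivial val_zero[OF val])

lemma gr_in_mult: "gr_in \<mu> f \<otimes>\<^bsub>\<G>\<^esub> gr_in \<mu> g = gr_in \<mu> (f * g)"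
proof (cases "\<mu> f")
  case (Val \<delta>)
  show ?thesis
  proof
    fix \<alpha>
    have "(gr_in \<mu> f \<otimes>\<^bsub>\<G>\<^esub> gr_in \<mu> g) \<alpha> = gr_class \<mu> \<alpha> (f * (if \<mu> g = Val (\<alpha> - \<delta>) then g else 0))"
      by (rule gr_in_mult_component[OF gr_in_carrier gr_in_rep Val])
    also have "\<dots> = gr_in \<mu> (f * g) \<alpha>"
      using Val by (cases "\<mu> g") (auto simp: gr_in_def val_mult[OF val] gr_class_zero)
    finally show "(gr_in \<mu> f \<otimes>\<^bsub>\<G>\<^esub> gr_in \<mu> g) \<alpha> = gr_in \<mu> (f * g) \<alpha>" .
  qed
next
  case Infty
  hence f: "f = 0" using trivial by blast
  show ?thesis
  proof
    fix \<alpha>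
    have "(gr_in \<mu> f \<otimes>\<^bsub>\<G>\<^esub> gr_in \<mu> g) \<alpha> = gr_class \<mu> \<alpha>
        (\<Sum>\<beta>\<in>gr_supp (gr_in \<mu> f). (if \<mu> f = Val \<beta> then f else 0) * (if \<mu> g = Val (\<alpha> - \<beta>) then g else 0))"
      by (rule gr_mult[OF gr_in_carrier gr_in_carrier gr_in_rep gr_in_rep])
    also have "\<dots> = gr_plus \<mu> \<alpha>" using Infty by (simp add: gr_supp_gr_in gr_class_zero)
    finally show "(gr_in \<mu> f \<otimes>\<^bsub>\<G>\<^esub> gr_in \<mu> g) \<alpha> = gr_in \<mu> (f * g) \<alpha>" using gr_in_zero f by simp
  qed
qed

lemma gr_in_cong: "\<mu> f < \<mu> (f - g) \<Longrightarrow> gr_in \<mu> f = gr_in \<mu> g"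
  using val_eq_of_diff[OF val, of f g] by (auto simp: gr_in_def gr_class_eq fun_eq_iff)

lemma gr_one: "\<one>\<^bsub>\<G>\<^esub> = gr_in \<mu> 1"
  by (auto simp: gr_ring_def gr_in_def val_one[OF val] fun_eq_iff simp flip: Val_zero)

lemma gr_in_unit: "0 < \<mu> (f * g - 1) \<Longrightarrow> gr_in \<mu> f \<in> Units \<G>"
proof -
  assume "0 < \<mu> (f * g - 1)"
  hence "gr_in \<mu> 1 = gr_in \<mu> (f * g)"
    by (intro gr_in_cong) (simp add: val_one[OF val] minus_commute[of 1])
  thus ?thesis unfolding Units_def gr_one using gr_in_carrier gr_in_mult[of f g] gr_in_mult[of g f]
    by (auto simp: mult.commute intro!: bexI[of _ "gr_in \<mu> g"])
qed

lemma gr_one_mult: "z \<in> carrier \<G> \<Longrightarrow> \<one>\<^bsub>\<G>\<^esub> \<otimes>\<^bsub>\<G>\<^esub> z = z"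
proof
  fix \<alpha> assume z: "z \<in> carrier \<G>"
  then obtain s where s: "\<And>\<beta>. s \<beta> \<in> z \<beta>" using gr_section by blast
  have "(gr_in \<mu> 1 \<otimes>\<^bsub>\<G>\<^esub> z) \<alpha> = gr_class \<mu> \<alpha> (1 * s (\<alpha> - 0))"
    by (rule gr_in_mult_component[OF z s]) (simp add: val_one[OF val])
  thus "(\<one>\<^bsub>\<G>\<^esub> \<otimes>\<^bsub>\<G>\<^esub> z) \<alpha> = z \<alpha>" using gr_rep(2)[OF z s, of \<alpha>] by (simp add: gr_one)
qed

lemma gr_inv_one: "inv\<^bsub>\<G>\<^esub> \<one>\<^bsub>\<G>\<^esub> = \<one>\<^bsub>\<G>\<^esub>"
  unfolding m_inv_def
proof (rule the_equality)
  have one: "\<one>\<^bsub>\<G>\<^esub> \<in> carrier \<G>" by (simp add: gr_one gr_in_carrier)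
  show "\<one>\<^bsub>\<G>\<^esub> \<in> carrier \<G> \<and> \<one>\<^bsub>\<G>\<^esub> \<otimes>\<^bsub>\<G>\<^esub> \<one>\<^bsub>\<G>\<^esub> = \<one>\<^bsub>\<G>\<^esub> \<and> \<one>\<^bsub>\<G>\<^esub> \<otimes>\<^bsub>\<G>\<^esub> \<one>\<^bsub>\<G>\<^esub> = \<one>\<^bsub>\<G>\<^esub>"
    using one gr_one_mult[OF one] by blast
  show "y = \<one>\<^bsub>\<G>\<^esub>" if "y \<in> carrier \<G> \<and> \<one>\<^bsub>\<G>\<^esub> \<otimes>\<^bsub>\<G>\<^esub> y = \<one>\<^bsub>\<G>\<^esub> \<and> y \<otimes>\<^bsub>\<G>\<^esub> \<one>\<^bsub>\<G>\<^esub> = \<one>\<^bsub>\<G>\<^esub>" for y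
    using that gr_one_mult[of y] by simp
qed

text \<open>The quotient may be taken homogeneous: its component in degree \<mu>(h) - \<mu>(f) has a
  representative, which is \<open>q\<close>.\<close>

lemma mu_divides_iff:
  assumes "h \<noteq> 0" "f \<noteq> 0"
  shows "mu_divides \<mu> f h \<longleftrightarrow> (\<exists>q. \<mu> h < \<mu> (h - f * q))"
proof
  assume "mu_divides \<mu> f h"
  then obtain z where z: "z \<in> carrier \<G>" "gr_in \<mu> h = gr_in \<mu> f \<otimes>\<^bsub>\<G>\<^esub> z"
    by (auto simp: mu_divides_def factor_def)
  obtain s where s: "\<And>\<beta>. s \<beta> \<in> z \<beta>" using gr_section[OF z(1)] by blast
  obtain \<alpha> where \<alpha>: "\<mu> h = Val \<alpha>" using assms trivial by (cases "\<mu> h") auto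
  obtain \<delta> where \<delta>: "\<mu> f = Val \<delta>" using assms trivial by (cases "\<mu> f") auto
  have "gr_class \<mu> \<alpha> h = gr_class \<mu> \<alpha> (f * s (\<alpha> - \<delta>))"
    using fun_cong[OF z(2), of \<alpha>] gr_in_mult_component[OF z(1) s \<delta>, of \<alpha>] \<alpha> by (simp add: gr_in_def)
  thus "\<exists>q. \<mu> h < \<mu> (h - f * q)" unfolding gr_class_eq \<alpha> by blast
next
  assume "\<exists>q. \<mu> h < \<mu> (h - f * q)"
  then obtain q where "gr_in \<mu> h = gr_in \<mu> f \<otimes>\<^bsub>\<G>\<^esub> gr_in \<mu> q" using gr_in_cong gr_in_mult by metis
  thus "mu_divides \<mu> f h" unfolding mu_divides_def factor_def using gr_in_carrier by blast
qed

text \<open>The last two conclusions express minimality and primality as inequalities between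
  values. Most later arguments use key polynomials in this form instead of the graded ring.\<close>

lemma KP_D:
  assumes "\<phi> \<in> KP \<mu>"
  shows "lead_coeff \<phi> = 1" "\<phi> \<noteq> 0" "degree \<phi> > 0" "gr_in \<mu> \<phi> \<notin> Units \<G>"
    "a \<noteq> 0 \<Longrightarrow> degree a < degree \<phi> \<Longrightarrow> \<mu> (a - \<phi> * q) \<le> \<mu> a"
    "\<mu> (f * g) < \<mu> (f * g - \<phi> * q) \<Longrightarrow> \<exists>q. \<mu> f < \<mu> (f - \<phi> * q) \<or> \<mu> g < \<mu> (g - \<phi> * q)"
proof -
  have *: "lead_coeff \<phi> = 1" "Divisibility.prime \<G> (gr_in \<mu> \<phi>)"
    "\<And>f. f \<noteq> 0 \<Longrightarrow> degree f < degree \<phi> \<Longrightarrow> \<not> mu_divides \<mu> \<phi> f"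
    using assms by (auto simp: KP_def ring_prime_def)
  show "lead_coeff \<phi> = 1" by (rule *)
  thus nz: "\<phi> \<noteq> 0" by auto
  show nu: "gr_in \<mu> \<phi> \<notin> Units \<G>" using *(2) by (simp add: Divisibility.prime_def)
  show "degree \<phi> > 0"
  proof (rule ccontr)
    assume "\<not> degree \<phi> > 0"
    hence "\<phi> = 1" using *(1) by (metis degree_eq_zeroE lead_coeff_pCons(2) neq0_conv one_pCons)
    thus False using gr_in_unit[of 1 1] nu by (simp add: val_zero[OF val])
  qed
  show "\<mu> (a - \<phi> * q) \<le> \<mu> a" if "a \<noteq> 0" "degree a < degree \<phi>"
    using *(3)[OF that] mu_divides_iff[OF that(1) nz] by (metis not_le)
  assume lt: "\<mu> (f * g) < \<mu> (f * g - \<phi> * q)"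
  hence "f * g \<noteq> 0" using val_zero[OF val] by auto
  hence fg: "f \<noteq> 0" "g \<noteq> 0" by auto
  have "gr_in \<mu> f \<otimes>\<^bsub>\<G>\<^esub> gr_in \<mu> g = gr_in \<mu> \<phi> \<otimes>\<^bsub>\<G>\<^esub> gr_in \<mu> q"
    using gr_in_cong[OF lt] by (simp add: gr_in_mult)
  hence "gr_in \<mu> \<phi> divides\<^bsub>\<G>\<^esub> (gr_in \<mu> f \<otimes>\<^bsub>\<G>\<^esub> gr_in \<mu> g)"
    unfolding factor_def using gr_in_carrier by blast
  hence "mu_divides \<mu> \<phi> f \<or> mu_divides \<mu> \<phi> g"
    using *(2) gr_in_carrier by (simp add: Divisibility.prime_def mu_divides_def)
  thus "\<exists>q. \<mu> f < \<mu> (f - \<phi> * q) \<or> \<mu> g < \<mu> (g - \<phi> * q)"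
    using mu_divides_iff[OF fg(1) nz] mu_divides_iff[OF fg(2) nz] by blast
qed

text \<open>Cancellation between \<open>a\<close> and \<open>q * \<phi>\<close> would make the
  initial form of \<open>\<phi>\<close> divide that of a polynomial of smaller degree.\<close>

lemma KP_distribute:
  assumes "\<phi> \<in> KP \<mu>" "degree a < degree \<phi>"
  shows "\<mu> (a + q * \<phi>) \<le> \<mu> a" "\<mu> (a + q * \<phi>) \<le> \<mu> (q * \<phi>)"
proof -
  have 1: "\<mu> (a + q * \<phi>) \<le> \<mu> a"
  proof (cases "a = 0")
    case False
    thus ?thesis using KP_D(5)[OF assms(1) False assms(2), of "- q"] by (simp add: mult.commute)
  qed (simp add: val_zero[OF val])
  thus "\<mu> (a + q * \<phi>) \<le> \<mu> a" .
  thus "\<mu> (a + q * \<phi>) \<le> \<mu> (q * \<phi>)"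
    using val_diff_ge[OF val order_refl 1] by simp
qed

text \<open>If the remainder had larger value, the initial form of \<open>\<phi>\<close> would
  divide that of \<open>a * b\<close>, hence by primality that of \<open>a\<close> or of
  \<open>b\<close>, against minimality.\<close>

lemma KP_mod:
  assumes \<phi>: "\<phi> \<in> KP \<mu>" and a: "a \<noteq> 0" "degree a < degree \<phi>" and b: "b \<noteq> 0" "degree b < degree \<phi>"
  shows "\<mu> ((a * b) mod \<phi>) = \<mu> (a * b)" "\<mu> (a * b) \<le> \<mu> ((a * b) div \<phi> * \<phi>)"
proof -
  have eq: "a * b = (a * b) mod \<phi> + (a * b) div \<phi> * \<phi>" by simp
  have d: "degree ((a * b) mod \<phi>) < degree \<phi>"
    using KP_D(3)[OF \<phi>] degree_digit_less[of \<phi> "a * b" 0] by (simp add: digit_zero)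
  show 2: "\<mu> (a * b) \<le> \<mu> ((a * b) div \<phi> * \<phi>)" using KP_distribute(2)[OF \<phi> d, of "(a * b) div \<phi>"] by simp
  have 1: "\<mu> (a * b) \<le> \<mu> ((a * b) mod \<phi>)" using KP_distribute(1)[OF \<phi> d, of "(a * b) div \<phi>"] by simp
  have "\<not> \<mu> (a * b) < \<mu> ((a * b) mod \<phi>)"
  proof
    assume "\<mu> (a * b) < \<mu> ((a * b) mod \<phi>)"
    moreover have "(a * b) mod \<phi> = a * b - \<phi> * ((a * b) div \<phi>)" by (simp add: minus_mult_div_eq_mod)
    ultimately have "\<mu> (a * b) < \<mu> (a * b - \<phi> * ((a * b) div \<phi>))" by metis
    from KP_D(6)[OF \<phi> this] obtain q where "\<mu> a < \<mu> (a - \<phi> * q) \<or> \<mu> b < \<mu> (b - \<phi> * q)" by blast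
    thus False using KP_D(5)[OF \<phi> a, of q] KP_D(5)[OF \<phi> b, of q] by auto
  qed
  thus "\<mu> ((a * b) mod \<phi>) = \<mu> (a * b)" using 1 by simp
qed

lemma augment_Infty:
  assumes "degree \<phi> > 0"
  shows "augment \<mu> \<phi> Infty f = \<mu> (f mod \<phi>)"
  unfolding augment_def
proof (rule Min_eqI)
  fix y assume "y \<in> (\<lambda>n. \<mu> (digit \<phi> f n) + nmul n Infty) ` {..degree f}"
  then obtain n where n: "y = \<mu> (digit \<phi> f n) + nmul n Infty" by blast
  show "\<mu> (f mod \<phi>) \<le> y" unfolding n by (cases n) (auto simp: digit_zero)
next
  show "\<mu> (f mod \<phi>) \<in> (\<lambda>n. \<mu> (digit \<phi> f n) + nmul n Infty) ` {..degree f}"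
    by (rule image_eqI[of _ _ 0]) (auto simp: digit_zero)
qed simp

text \<open>Values are those of remainders modulo \<open>\<phi>\<close>, and \<open>KP_mod\<close>
  makes them multiplicative.\<close>

lemma limit_valuation:
  assumes \<phi>: "\<phi> \<in> KP \<mu>"
  defines "w \<equiv> augment \<mu> \<phi> Infty"
  shows "valuation w" "w f = Infty \<longleftrightarrow> \<phi> dvd f" "\<mu> f \<le> w f" "degree f < degree \<phi> \<Longrightarrow> w f = \<mu> f"
proof -
  have w: "w f = \<mu> (f mod \<phi>)" for f unfolding w_def using augment_Infty[OF KP_D(3)[OF \<phi>]] .
  have dm: "degree (f mod \<phi>) < degree \<phi>" for f
    using KP_D(3)[OF \<phi>] degree_digit_less[of \<phi> f 0] by (simp add: digit_zero)
  show low: "w f = \<mu> f" if "degree f < degree \<phi>" for f using that by (simp add: w mod_poly_less)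
  show supp: "w f = Infty \<longleftrightarrow> \<phi> dvd f" for f by (simp add: w trivial dvd_eq_mod_eq_0)
  show "\<mu> f \<le> w f" for f
    using KP_distribute(1)[OF \<phi> dm, of f "f div \<phi>"] by (simp add: w)
  show "valuation w"
    unfolding valuation_def
  proof (intro conjI allI)
    show "w 0 = Infty" by (simp add: supp)
    show "w 1 = 0" using KP_D(3)[OF \<phi>] by (simp add: low val_one[OF val])
    fix f g
    show "min (w f) (w g) \<le> w (f + g)"
      using val by (simp add: w poly_mod_add_left valuation_def)
    show "w (f * g) = w f + w g"
    proof (cases "f mod \<phi> = 0 \<or> g mod \<phi> = 0")
      case True
      hence d: "\<phi> dvd f \<or> \<phi> dvd g" by (simp add: dvd_eq_mod_eq_0)
      have "\<phi> dvd f * g" using d dvd_mult[of \<phi> g f] dvd_mult2[of \<phi> f g] by blast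
      hence "w (f * g) = Infty" using supp[of "f * g"] by blast
      moreover have "w f = Infty \<or> w g = Infty" using d supp[of f] supp[of g] by blast
      ultimately show ?thesis using plus_eq_Infty_iff[of "w f" "w g"] by metis
    next
      case False
      have "w (f * g) = \<mu> ((f mod \<phi> * (g mod \<phi>)) mod \<phi>)" by (simp add: w mod_mult_eq)
      also have "\<dots> = \<mu> (f mod \<phi> * (g mod \<phi>))" using KP_mod(1)[OF \<phi> _ dm _ dm] False by blast
      finally show ?thesis by (simp add: w val_mult[OF val])
    qed
  qed
qed

lemma next_limit:
  assumes \<phi>: "\<phi> \<in> KP \<mu>" and const: "\<And>c. \<mu> [:c:] = v c"
  shows "limit_val v (augment \<mu> \<phi> Infty) \<phi>"
proof
  note lim = limit_valuation[OF \<phi>]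
  show "valuation (augment \<mu> \<phi> Infty)" by (rule lim)
  show "augment \<mu> \<phi> Infty [:c:] = v c" for c using lim(4)[of "[:c:]"] KP_D(3)[OF \<phi>] const by simp
  show "lead_coeff \<phi> = 1" "0 < degree \<phi>" using KP_D[OF \<phi>] by auto
  show "augment \<mu> \<phi> Infty f = Infty \<longleftrightarrow> \<phi> dvd f" for f by (rule lim)
qed

text \<open>For the axiom \<open>strict\<close>: by \<open>KP_mod\<close> the carry times
  \<open>\<phi>\<close> has value at least that of the product, and \<gamma> exceeds
  \<mu>(\<phi>).\<close>

lemma next_level:
  assumes \<phi>: "\<phi> \<in> KP \<mu>" and const: "\<And>c. \<mu> [:c:] = v c" and \<gamma>: "\<mu> \<phi> < Val \<gamma>"
  shows "level v (augment \<mu> \<phi> Infty) \<phi> \<gamma>" "level.mu (augment \<mu> \<phi> Infty) \<phi> \<gamma> = augment \<mu> \<phi> (Val \<gamma>)"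
proof -
  note lim = limit_valuation[OF \<phi>]
  show lev: "level v (augment \<mu> \<phi> Infty) \<phi> \<gamma>"
  proof (rule level.intro[OF next_limit[OF \<phi> const]], unfold_locales)
    fix a b :: "'a poly" assume ab: "a \<noteq> 0" "b \<noteq> 0" "degree a < degree \<phi>" "degree b < degree \<phi>"
    define c where "c = (a * b) div \<phi>"
    have dc: "degree c < degree \<phi>"
    proof (cases "c = 0")
      case False
      have "degree (c * \<phi>) = degree c + degree \<phi>" using False KP_D(2)[OF \<phi>] by (simp add: degree_mult_eq)
      moreover have "c * \<phi> = a * b - (a * b) mod \<phi>" by (simp add: c_def minus_mod_eq_div_mult)
      hence "degree (c * \<phi>) \<le> max (degree (a * b)) (degree ((a * b) mod \<phi>))" by (simp add: degree_diff_le_max)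
      moreover have "degree ((a * b) mod \<phi>) < degree \<phi>"
        using KP_D(3)[OF \<phi>] degree_digit_less[of \<phi> "a * b" 0] by (simp add: digit_zero)
      moreover have "degree (a * b) = degree a + degree b" using ab by (simp add: degree_mult_eq)
      ultimately show ?thesis using ab(3,4) by auto
    qed (use KP_D(3)[OF \<phi>] in simp)
    have fin: "\<mu> (a * b) \<noteq> Infty" using trivial ab by simp
    have "\<mu> (a * b) < \<mu> c + Val \<gamma>"
    proof (cases "c = 0")
      case False
      have "\<mu> (a * b) \<le> \<mu> c + \<mu> \<phi>" using KP_mod(2)[OF \<phi> ab(1,3,2,4)] by (simp add: c_def val_mult[OF val])
      also have "\<dots> < \<mu> c + Val \<gamma>" using \<gamma> False trivial[of c] by simp
      finally show ?thesis .
    qed (use fin in \<open>simp add: val_zero[OF val]\<close>)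
    thus "augment \<mu> \<phi> Infty a + augment \<mu> \<phi> Infty b < augment \<mu> \<phi> Infty ((a * b) div \<phi>) + Val \<gamma>"
      using lim(4) ab dc by (simp add: val_mult[OF val] flip: c_def)
  qed
  show "level.mu (augment \<mu> \<phi> Infty) \<phi> \<gamma> = augment \<mu> \<phi> (Val \<gamma>)"
    unfolding level.mu_def[OF lev] augment_def[of \<mu> \<phi> "Val \<gamma>"]
    using lim(4)[OF degree_digit_less[OF KP_D(3)[OF \<phi>]]] by (simp add: fun_eq_iff)
qed

end

section \<open>The polynomial defining a level is a key polynomial\<close>

context limit_val
begin

text \<open>The support of a valuation is a prime ideal.\<close>

lemma irreducible_phi: "\<phi> \<in> Irr_over UNIV"
proof -
  have "degree A = 0 \<or> degree B = 0" if AB: "\<phi> = A * B" for A B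
  proof -
    have nz: "A \<noteq> 0" "B \<noteq> 0" using AB phi_nz by (metis mult_zero_left, metis mult_zero_right)
    have dg: "degree \<phi> = degree A + degree B" unfolding AB using nz by (rule degree_mult_eq)
    have "w \<phi> = w A + w B" unfolding AB by (rule val_mult[OF w])
    hence "w A = Infty \<or> w B = Infty" using supp[of \<phi>] by simp
    hence "degree \<phi> \<le> degree A \<or> degree \<phi> \<le> degree B"
      using supp dvd_imp_degree_le nz by blast
    thus ?thesis using dg by auto
  qed
  thus ?thesis unfolding Irr_over_def using monic deg by simp
qed

lemma ex_inverse:
  assumes "\<not> \<phi> dvd f"
  shows "\<exists>b. degree b < degree \<phi> \<and> b \<noteq> 0 \<and> w (f * b - 1) = Infty"
proof -
  obtain a b where ab: "a * \<phi> + b * f = 1" using bezout_over[OF subfld_UNIV irreducible_phi, of f] assms by auto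
  define c where "c = b mod \<phi>"
  have "f * c - 1 = \<phi> * (- a - f * (b div \<phi>))"
  proof -
    have "f * c = f * (b - b div \<phi> * \<phi>)" unfolding c_def by (simp only: minus_div_mult_eq_mod)
    also have "\<dots> = b * f - f * (b div \<phi>) * \<phi>" by (simp add: right_diff_distrib mult_ac)
    also have "b * f = 1 - a * \<phi>" using ab by (simp add: eq_diff_eq add.commute)
    finally show ?thesis by (simp add: algebra_simps)
  qed
  hence 1: "w (f * c - 1) = Infty" using supp by simp
  have "c \<noteq> 0"
  proof
    assume "c = 0"
    hence "w (- 1) = Infty" using 1 by simp
    thus False by (simp add: val_minus_one[OF w])
  qed
  thus ?thesis using 1 degree_mod unfolding c_def by blast
qed

end

context level
begin

sublocale mu: poly_valuation mu
  by unfold_locales (rule mu, rule mu_eq_Infty)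

text \<open>For an inverse \<open>b\<close> modulo \<open>\<phi>\<close>, the difference
  \<open>a * b - 1\<close> is a carry times \<open>\<phi>\<close>, so \<open>strict\<close> gives it
  positive value. Thus nonzero polynomials of degree below that of \<open>\<phi>\<close> have unit
  initial forms.\<close>

lemma mu_inverse:
  assumes "a \<noteq> 0" "degree a < degree \<phi>"
  shows "\<exists>b. b \<noteq> 0 \<and> degree b < degree \<phi> \<and> 0 < mu (a * b - 1) \<and> w a + w b = 0"
proof -
  have "\<not> \<phi> dvd a" using assms dvd_imp_degree_le[of \<phi> a] by auto
  then obtain b where b: "degree b < degree \<phi>" "b \<noteq> 0" "w (a * b - 1) = Infty" using ex_inverse by blast
  have w1: "w (a * b) = 0" using val_eq_of_diff[OF w, of 1 "a * b"] b(3) val_uminus[OF w, of "a * b - 1"]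
    by (simp add: val_one[OF w])
  hence ws: "w a + w b = 0" by (simp add: val_mult[OF w])
  have "\<phi> dvd a * b - 1" using b(3) supp by simp
  hence "(a * b) mod \<phi> = 1 mod \<phi>" by (simp add: mod_eq_dvd_iff)
  also have "1 mod \<phi> = 1" using deg by (simp add: mod_poly_less)
  finally have "a * b - 1 = (a * b) div \<phi> * \<phi>" by (metis minus_mod_eq_div_mult)
  moreover have "degree ((a * b) div \<phi>) < degree \<phi>"
  proof (cases "(a * b) div \<phi> = 0")
    case False
    have "degree ((a * b) div \<phi>) + degree \<phi> = degree (a * b - 1)"
      unfolding calculation using False phi_nz by (simp add: degree_mult_eq)
    also have "\<dots> \<le> max (degree (a * b)) (degree (1 :: 'a poly))" by (rule degree_diff_le_max)
    also have "\<dots> \<le> degree a + degree b" using degree_mult_le[of a b] by simp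
    finally show ?thesis using assms b by simp
  qed (use deg in simp)
  hence "mu ((a * b) div \<phi> * \<phi>) = w ((a * b) div \<phi>) + Val \<gamma>" using mu_monomial[of _ 1] by simp
  ultimately have "0 < mu (a * b - 1)" using strict[OF assms(1) b(2) assms(2) b(1)] ws by simp
  thus ?thesis using b ws by blast
qed

lemma KP_degree_ge: "\<psi> \<in> KP mu \<Longrightarrow> degree \<phi> \<le> degree \<psi>"
proof (rule ccontr)
  assume \<psi>: "\<psi> \<in> KP mu" and "\<not> degree \<phi> \<le> degree \<psi>"
  then obtain b where "0 < mu (\<psi> * b - 1)" using mu_inverse[of \<psi>] mu.KP_D(2)[OF \<psi>] by auto
  thus False using mu.gr_in_unit mu.KP_D(4)[OF \<psi>] by blast
qed

text \<open>Divisibility means that in each degree the remainder modulo \<open>\<phi>\<close> has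
  larger value, and \<open>w\<close> measures this remainder. Inhomogeneous \<open>z\<close> are
  included because primality refers to all elements of the ring.\<close>

lemma divides_iff:
  assumes z: "z \<in> carrier (gr_ring mu)"
  shows "gr_in mu \<phi> divides\<^bsub>gr_ring mu\<^esub> z \<longleftrightarrow> (\<forall>\<alpha>. \<forall>f\<in>z \<alpha>. Val \<alpha> < w f)"
proof
  assume "gr_in mu \<phi> divides\<^bsub>gr_ring mu\<^esub> z"
  then obtain y where y: "y \<in> carrier (gr_ring mu)" "z = gr_in mu \<phi> \<otimes>\<^bsub>gr_ring mu\<^esub> y" by (auto simp: factor_def)
  obtain s where s: "\<And>\<beta>. s \<beta> \<in> y \<beta>" using mu.gr_section[OF y(1)] by blast
  have "Val \<alpha> < w f" if "f \<in> z \<alpha>" for \<alpha> f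
  proof -
    have "z \<alpha> = gr_class mu \<alpha> (\<phi> * s (\<alpha> - \<gamma>))"
      unfolding y(2) by (rule mu.gr_in_mult_component[OF y(1) s mu_phi])
    hence "Val \<alpha> < mu (f - \<phi> * s (\<alpha> - \<gamma>))" using that by (simp add: mu.mem_gr_class)
    hence "Val \<alpha> < w (f - \<phi> * s (\<alpha> - \<gamma>))" using mu_le_w less_le_trans by blast
    moreover have "w (\<phi> * s (\<alpha> - \<gamma>)) = Infty" using supp by simp
    ultimately show ?thesis using val_add_gt[OF w, of "Val \<alpha>" "f - \<phi> * s (\<alpha> - \<gamma>)" "\<phi> * s (\<alpha> - \<gamma>)"] by simp
  qed
  thus "\<forall>\<alpha>. \<forall>f\<in>z \<alpha>. Val \<alpha> < w f" by blast
next
  assume P: "\<forall>\<alpha>. \<forall>f\<in>z \<alpha>. Val \<alpha> < w f"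
  obtain s where s: "\<And>\<beta>. s \<beta> \<in> z \<beta>" using mu.gr_section[OF z] by blast
  define q where "q \<alpha> = s (\<alpha> + \<gamma>) div \<phi>" for \<alpha>
  define y where "y \<alpha> = gr_class mu \<alpha> (q \<alpha>)" for \<alpha>
  have muq: "mu (q \<alpha> * \<phi>) = mu (q \<alpha>) + Val \<gamma>" for \<alpha> by (simp add: val_mult[OF mu] mu_phi)
  have qphi: "q \<alpha> * \<phi> = s (\<alpha> + \<gamma>) - s (\<alpha> + \<gamma>) mod \<phi>" for \<alpha> by (simp add: q_def minus_mod_eq_div_mult)
  have r: "Val (\<alpha> + \<gamma>) < mu (s (\<alpha> + \<gamma>) mod \<phi>)" for \<alpha>
    using P s by (simp add: mu_eq_w degree_mod w_mod)
  have ge: "Val \<alpha> \<le> mu (q \<alpha>)" for \<alpha>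
  proof -
    have "Val (\<alpha> + \<gamma>) \<le> mu (q \<alpha> * \<phi>)" unfolding qphi
      using mu.gr_rep(1)[OF z s] r[of \<alpha>] by (intro val_diff_ge[OF mu]) (auto simp: less_imp_le)
    thus ?thesis unfolding muq by (cases "mu (q \<alpha>)") auto
  qed
  have "mu.gr_supp y \<subseteq> (\<lambda>\<beta>. \<beta> - \<gamma>) ` mu.gr_supp z"
  proof
    fix \<alpha> assume \<alpha>: "\<alpha> \<in> mu.gr_supp y"
    have "\<alpha> + \<gamma> \<in> mu.gr_supp z"
    proof (rule ccontr)
      assume "\<alpha> + \<gamma> \<notin> mu.gr_supp z"
      hence "Val (\<alpha> + \<gamma>) < mu (s (\<alpha> + \<gamma>))" using mu.not_gr_supp[OF z s] by blast
      hence "Val (\<alpha> + \<gamma>) < mu (q \<alpha> * \<phi>)" unfolding qphi using r by (rule val_diff_gt[OF mu])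
      hence "Val \<alpha> < mu (q \<alpha>)" unfolding muq by (cases "mu (q \<alpha>)") auto
      thus False using \<alpha> by (simp add: mu.gr_supp_def y_def mu.gr_class_eq_plus)
    qed
    thus "\<alpha> \<in> (\<lambda>\<beta>. \<beta> - \<gamma>) ` mu.gr_supp z" by (intro image_eqI[of _ _ "\<alpha> + \<gamma>"]) auto
  qed
  moreover have "finite (mu.gr_supp z)" using z mu.gr_carrier by blast
  ultimately have "finite (mu.gr_supp y)" using finite_subset by blast
  hence y: "y \<in> carrier (gr_ring mu)" unfolding mu.gr_carrier y_def using ge by blast
  have "gr_in mu \<phi> \<otimes>\<^bsub>gr_ring mu\<^esub> y = z"
  proof
    fix \<alpha>
    have "(gr_in mu \<phi> \<otimes>\<^bsub>gr_ring mu\<^esub> y) \<alpha> = gr_class mu \<alpha> (\<phi> * q (\<alpha> - \<gamma>))"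
      by (rule mu.gr_in_mult_component[OF y _ mu_phi]) (simp add: y_def mu.gr_class_self)
    also have "\<dots> = gr_class mu \<alpha> (s \<alpha>)"
    proof -
      have "s \<alpha> - \<phi> * q (\<alpha> - \<gamma>) = s \<alpha> mod \<phi>" using qphi[of "\<alpha> - \<gamma>"] by (simp add: mult.commute)
      thus ?thesis using r[of "\<alpha> - \<gamma>"] by (simp add: mu.gr_class_eq mu.minus_commute[of _ "s \<alpha>"])
    qed
    also have "\<dots> = z \<alpha>" using mu.gr_rep(2)[OF z s] by simp
    finally show "(gr_in mu \<phi> \<otimes>\<^bsub>gr_ring mu\<^esub> y) \<alpha> = z \<alpha>" .
  qed
  thus "gr_in mu \<phi> divides\<^bsub>gr_ring mu\<^esub> z" unfolding factor_def using y by blast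
qed

text \<open>Take the lowest degrees in which \<open>a\<close> and \<open>b\<close> violate the
  condition. In the component of the product at their sum, one summand has exactly this value under
  \<open>w\<close> and all others have larger value.\<close>

lemma prime_phi:
  assumes a: "a \<in> carrier (gr_ring mu)" and b: "b \<in> carrier (gr_ring mu)"
    and P: "\<forall>\<alpha>. \<forall>f\<in>(a \<otimes>\<^bsub>gr_ring mu\<^esub> b) \<alpha>. Val \<alpha> < w f"
  shows "(\<forall>\<alpha>. \<forall>f\<in>a \<alpha>. Val \<alpha> < w f) \<or> (\<forall>\<alpha>. \<forall>f\<in>b \<alpha>. Val \<alpha> < w f)"
proof (rule ccontr)
  assume contra: "\<not> ?thesis"
  have lowest: "\<exists>\<alpha>0\<in>mu.gr_supp z. (\<forall>f\<in>z \<alpha>0. w f = Val \<alpha>0) \<and> (\<forall>\<alpha><\<alpha>0. \<forall>f\<in>z \<alpha>. Val \<alpha> < w f)"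
    if z: "z \<in> carrier (gr_ring mu)" and np: "\<not> (\<forall>\<alpha>. \<forall>f\<in>z \<alpha>. Val \<alpha> < w f)" for z
  proof -
    define A where "A = {\<alpha>. \<exists>f\<in>z \<alpha>. \<not> Val \<alpha> < w f}"
    have sub: "A \<subseteq> mu.gr_supp z"
    proof
      fix \<alpha> assume "\<alpha> \<in> A"
      then obtain f where "f \<in> z \<alpha>" "\<not> Val \<alpha> < w f" by (auto simp: A_def)
      thus "\<alpha> \<in> mu.gr_supp z" using mu.not_gr_supp[OF z] mu_le_w less_le_trans by blast
    qed
    have fin: "finite A" using sub z mu.gr_carrier finite_subset by blast
    have ne: "A \<noteq> {}" using np by (auto simp: A_def)
    have 1: "Min A \<in> A" using fin ne by simp
    have "\<forall>f\<in>z \<alpha>. Val \<alpha> < w f" if "\<alpha> < Min A" for \<alpha>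
    proof (intro ballI, rule ccontr)
      fix f assume "f \<in> z \<alpha>" "\<not> Val \<alpha> < w f"
      hence "\<alpha> \<in> A" unfolding A_def by blast
      thus False using that Min_le[OF fin, of \<alpha>] by simp
    qed
    moreover have "w f = Val (Min A)" if f: "f \<in> z (Min A)" for f
    proof -
      obtain h where h: "h \<in> z (Min A)" "\<not> Val (Min A) < w h" using 1 by (auto simp: A_def)
      have "Val (Min A) < mu (h - f)" using mu.gr_rep(2)[OF z f] h(1) by (simp add: mu.mem_gr_class)
      hence "Val (Min A) < w (h - f)" using mu_le_w less_le_trans by blast
      hence "\<not> Val (Min A) < w f" using val_add_gt[OF w, of "Val (Min A)" "h - f" f] h(2) by auto
      moreover have "Val (Min A) \<le> w f" using mu.gr_rep(1)[OF z f] mu_le_w order_trans by blast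
      ultimately show ?thesis by simp
    qed
    ultimately show ?thesis using 1 sub by blast
  qed
  obtain \<alpha>0 where \<alpha>0: "\<alpha>0 \<in> mu.gr_supp a" "\<And>f. f \<in> a \<alpha>0 \<Longrightarrow> w f = Val \<alpha>0" "\<And>\<alpha> f. \<alpha> < \<alpha>0 \<Longrightarrow> f \<in> a \<alpha> \<Longrightarrow> Val \<alpha> < w f"
    using lowest[OF a] contra by blast
  obtain \<beta>0 where \<beta>0: "\<And>f. f \<in> b \<beta>0 \<Longrightarrow> w f = Val \<beta>0" "\<And>\<alpha> f. \<alpha> < \<beta>0 \<Longrightarrow> f \<in> b \<alpha> \<Longrightarrow> Val \<alpha> < w f"
    using lowest[OF b] contra by blast
  obtain s where s: "\<And>\<beta>. s \<beta> \<in> a \<beta>" using mu.gr_section[OF a] by blast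
  obtain t where t: "\<And>\<beta>. t \<beta> \<in> b \<beta>" using mu.gr_section[OF b] by blast
  have ge: "Val \<beta> \<le> w (s \<beta>)" "Val \<beta> \<le> w (t \<beta>)" for \<beta>
    using mu.gr_rep(1)[OF a s] mu.gr_rep(1)[OF b t] mu_le_w order_trans by blast+
  define x where "x = (\<lambda>\<beta>. s \<beta> * t (\<alpha>0 + \<beta>0 - \<beta>))"
  have wx0: "w (x \<alpha>0) = Val (\<alpha>0 + \<beta>0)" using \<alpha>0(2)[OF s] \<beta>0(1)[OF t] by (simp add: x_def val_mult[OF w])
  have "w (sum x (mu.gr_supp a)) = w (x \<alpha>0)"
  proof (rule val_sum_dominant[OF w _ \<alpha>0(1)])
    show "finite (mu.gr_supp a)" using a mu.gr_carrier by blast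
    fix \<beta> assume ne: "\<beta> \<noteq> \<alpha>0"
    have eq: "Val (\<alpha>0 + \<beta>0) = Val \<beta> + Val (\<alpha>0 + \<beta>0 - \<beta>)" by simp
    show "w (x \<alpha>0) < w (x \<beta>)"
    proof (cases "\<beta> < \<alpha>0")
      case True
      show ?thesis unfolding wx0 unfolding eq x_def val_mult[OF w]
        by (rule vinf_add_strict_mono(1)[OF \<alpha>0(3)[OF True s] ge(2)]) simp
    next
      case False
      hence "\<alpha>0 + \<beta>0 - \<beta> < \<beta>0" using ne by (simp add: less_le algebra_simps)
      from \<beta>0(2)[OF this t] show ?thesis unfolding wx0 unfolding eq x_def val_mult[OF w]
        by (rule vinf_add_strict_mono(2)[OF _ ge(1)]) simp
    qed
  qed
  moreover have "sum x (mu.gr_supp a) \<in> (a \<otimes>\<^bsub>gr_ring mu\<^esub> b) (\<alpha>0 + \<beta>0)"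
    unfolding mu.gr_mult[OF a b s t] x_def by (rule mu.gr_class_self)
  ultimately show False using P wx0 by force
qed

theorem phi_KP: "\<phi> \<in> KP mu"
proof -
  let ?G = "gr_ring mu"
  have one: "\<one>\<^bsub>?G\<^esub> \<in> carrier ?G" by (simp add: mu.gr_one mu.gr_in_carrier)
  have "gr_in mu \<phi> \<notin> Units ?G"
  proof
    assume "gr_in mu \<phi> \<in> Units ?G"
    then obtain y where "y \<in> carrier ?G" "gr_in mu \<phi> \<otimes>\<^bsub>?G\<^esub> y = \<one>\<^bsub>?G\<^esub>" by (auto simp: Units_def)
    hence "gr_in mu \<phi> divides\<^bsub>?G\<^esub> \<one>\<^bsub>?G\<^esub>" unfolding factor_def by metis
    hence "\<forall>f\<in>\<one>\<^bsub>?G\<^esub> 0. Val 0 < w f" using divides_iff[OF one] by blast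
    moreover have "1 \<in> \<one>\<^bsub>?G\<^esub> 0" by (simp add: gr_ring_def mu.gr_class_self)
    ultimately show False by (auto simp: val_one[OF w])
  qed
  moreover have "gr_in mu \<phi> divides\<^bsub>?G\<^esub> a \<or> gr_in mu \<phi> divides\<^bsub>?G\<^esub> b"
    if ab: "a \<in> carrier ?G" "b \<in> carrier ?G" and d: "gr_in mu \<phi> divides\<^bsub>?G\<^esub> (a \<otimes>\<^bsub>?G\<^esub> b)" for a b
  proof -
    obtain y where y: "y \<in> carrier ?G" "a \<otimes>\<^bsub>?G\<^esub> b = gr_in mu \<phi> \<otimes>\<^bsub>?G\<^esub> y" using d by (auto simp: factor_def)
    obtain s where s: "\<And>\<beta>. s \<beta> \<in> y \<beta>" using mu.gr_section[OF y(1)] by blast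
    have "\<forall>\<alpha>. \<forall>f\<in>(a \<otimes>\<^bsub>?G\<^esub> b) \<alpha>. Val \<alpha> < w f"
    proof (intro allI ballI)
      fix \<alpha> f assume "f \<in> (a \<otimes>\<^bsub>?G\<^esub> b) \<alpha>"
      hence "Val \<alpha> < mu (f - \<phi> * s (\<alpha> - \<gamma>))"
        unfolding y(2) mu.gr_in_mult_component[OF y(1) s mu_phi] by (simp add: mu.mem_gr_class)
      hence "Val \<alpha> < w (f - \<phi> * s (\<alpha> - \<gamma>))" using mu_le_w less_le_trans by blast
      moreover have "w (\<phi> * s (\<alpha> - \<gamma>)) = Infty" using supp by simp
      ultimately show "Val \<alpha> < w f"
        using val_add_gt[OF w, of "Val \<alpha>" "f - \<phi> * s (\<alpha> - \<gamma>)" "\<phi> * s (\<alpha> - \<gamma>)"] by simp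
    qed
    from prime_phi[OF ab this] show ?thesis using divides_iff ab by blast
  qed
  ultimately have "Divisibility.prime ?G (gr_in mu \<phi>)" by (simp add: Divisibility.prime_def)
  moreover have "gr_in mu \<phi> \<noteq> \<zero>\<^bsub>?G\<^esub>"
  proof
    assume "gr_in mu \<phi> = \<zero>\<^bsub>?G\<^esub>"
    hence "gr_class mu \<gamma> \<phi> = gr_plus mu \<gamma>" by (simp add: gr_ring_def gr_in_def mu_phi fun_eq_iff) metis
    thus False by (simp add: mu.gr_class_eq_plus mu_phi)
  qed
  moreover have "\<not> mu_divides mu \<phi> f" if f: "f \<noteq> 0" "degree f < degree \<phi>" for f
  proof
    assume "mu_divides mu \<phi> f"
    hence P: "\<forall>\<alpha>. \<forall>h\<in>gr_in mu f \<alpha>. Val \<alpha> < w h"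
      unfolding mu_divides_def using divides_iff[OF mu.gr_in_carrier] by blast
    obtain \<alpha> where \<alpha>: "mu f = Val \<alpha>" using f mu_eq_Infty by (cases "mu f") auto
    hence "f \<in> gr_in mu f \<alpha>" by (simp add: gr_in_def mu.gr_class_self)
    thus False using P \<alpha> mu_eq_w[OF f(2)] by force
  qed
  ultimately show ?thesis unfolding KP_def ring_prime_def using monic by blast
qed

text \<open>This turns the strict growth of the degrees of the valuations in a chain into strict
  growth of the degrees of its key polynomials.\<close>

lemma KP_degree: "KP_degree mu = degree \<phi>"
  unfolding KP_degree_def
proof (rule Least_equality)
  show "\<exists>\<psi>\<in>KP mu. degree \<psi> = degree \<phi>" using phi_KP by blast
qed (use KP_degree_ge in blast)

end

section \<open>Orthogonal bases\<close>

text \<open>Together with the ultrametric inequality this says that the value of a combination is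
  the minimum of the values of its terms; the upper bound alone is the part that has to be
  proved.\<close>

definition orthogonal :: "('a :: field \<Rightarrow> 'g :: linordered_ab_group_add vinf) \<Rightarrow> ('a poly \<Rightarrow> 'g vinf) \<Rightarrow>
    nat \<Rightarrow> (nat \<Rightarrow> 'a poly) \<Rightarrow> bool" where
  "orthogonal v u N b \<longleftrightarrow> (\<forall>c. \<forall>i<N. u (\<Sum>j<N. smult (c j) (b j)) \<le> v (c i) + u (b i))"

lemma monic_basis_span:
  fixes b :: "nat \<Rightarrow> 'a :: field poly"
  assumes "\<And>i. lead_coeff (b i) = 1" "\<And>i. degree (b i) = i" and "degree f < N \<or> f = 0"
  shows "\<exists>c. f = (\<Sum>i<N. smult (c i) (b i))"
  using assms(3)
proof (induction N arbitrary: f)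
  case 0
  thus ?case by auto
next
  case (Suc N)
  define h where "h = f - smult (coeff f N) (b N)"
  have "coeff h i = 0" if "i \<ge> N" for i
  proof (cases "i = N")
    case True
    thus ?thesis using assms(1,2)[of N] by (simp add: h_def)
  next
    case False
    hence "i > degree (b N)" "i > degree f \<or> f = 0" using that assms(2)[of N] Suc.prems by auto
    thus ?thesis by (auto simp: h_def coeff_eq_0)
  qed
  hence "degree h < N \<or> h = 0"
    by (metis leading_coeff_0_iff not_le)
  then obtain c where c: "h = (\<Sum>i<N. smult (c i) (b i))" using Suc.IH by blast
  have "f = (\<Sum>i<Suc N. smult ((c(N := coeff f N)) i) (b i))"
    using c by (simp add: h_def algebra_simps)
  thus ?case by blast
qed

lemma mod_poly_sum: "sum f I mod \<phi> = (\<Sum>i\<in>I. f i mod \<phi>)"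
  for \<phi> :: "'a :: field poly"
  by (induction I rule: infinite_finite_induct) (simp_all add: poly_mod_add_left)

lemma smult_sum_right: "smult a (sum f I) = (\<Sum>i\<in>I. smult a (f i))"
  by (induction I rule: infinite_finite_induct) (simp_all add: smult_add_right)

lemma smult_sum_left: "smult (sum a I) p = (\<Sum>i\<in>I. smult (a i) p)"
  by (induction I rule: infinite_finite_induct) (simp_all add: smult_add_left)

lemma subgroup_coset_eq:
  fixes \<Gamma> :: "'g :: ab_group_add set"
  assumes "0 \<in> \<Gamma>" "\<And>x y. x \<in> \<Gamma> \<Longrightarrow> y \<in> \<Gamma> \<Longrightarrow> x - y \<in> \<Gamma>"
  shows "(+) a ` \<Gamma> = (+) b ` \<Gamma> \<longleftrightarrow> a - b \<in> \<Gamma>"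
proof
  assume "(+) a ` \<Gamma> = (+) b ` \<Gamma>"
  hence "a + 0 \<in> (+) b ` \<Gamma>" using assms(1) by blast
  thus "a - b \<in> \<Gamma>" by auto
next
  have neg: "- x \<in> \<Gamma>" if "x \<in> \<Gamma>" for x using assms(2)[OF assms(1) that] by simp
  have add: "x + y \<in> \<Gamma>" if "x \<in> \<Gamma>" "y \<in> \<Gamma>" for x y using assms(2)[OF that(1) neg[OF that(2)]] by simp
  have *: "(+) a ` \<Gamma> \<subseteq> (+) b ` \<Gamma>" if ab: "a - b \<in> \<Gamma>" for a b
  proof
    fix x assume "x \<in> (+) a ` \<Gamma>"
    then obtain y where "y \<in> \<Gamma>" "x = a + y" by blast
    hence "(a - b) + y \<in> \<Gamma>" "x = b + ((a - b) + y)" using add[OF ab] by auto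
    thus "x \<in> (+) b ` \<Gamma>" by blast
  qed
  assume "a - b \<in> \<Gamma>"
  thus "(+) a ` \<Gamma> = (+) b ` \<Gamma>" using *[of a b] *[of b a] neg[of "a - b"] by auto
qed

text \<open>On a field this is the value group. For a valuation of polynomials it is a priori only a
  monoid, and has to be shown to be a group.\<close>

definition vals :: "('r \<Rightarrow> 'g vinf) \<Rightarrow> 'g set" where
  "vals u = {\<alpha>. \<exists>x. u x = Val \<alpha>}"

lemma vals_group:
  fixes v :: "'a :: field \<Rightarrow> 'g :: linordered_ab_group_add vinf"
  assumes v: "valuation v"
  shows "0 \<in> vals v" "x \<in> vals v \<Longrightarrow> y \<in> vals v \<Longrightarrow> x - y \<in> vals v"
    "x \<in> vals v \<Longrightarrow> y \<in> vals v \<Longrightarrow> x + y \<in> vals v" "x \<in> vals v \<Longrightarrow> - x \<in> vals v"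
proof -
  show 0: "0 \<in> vals v" unfolding vals_def using val_one[OF v] by (auto intro!: exI[of _ 1])
  have neg: "- x \<in> vals v" if x: "x \<in> vals v" for x
  proof -
    obtain a where a: "v a = Val x" using x by (auto simp: vals_def)
    hence "a \<noteq> 0" using val_zero[OF v] by auto
    hence "v a + v (inverse a) = 0" using val_mult[OF v, of a "inverse a"] val_one[OF v] by simp
    hence "v (inverse a) = Val (- x)" using a by (cases "v (inverse a)") (auto simp: add_eq_0_iff)
    thus ?thesis by (auto simp: vals_def)
  qed
  have add: "x + y \<in> vals v" if xy: "x \<in> vals v" "y \<in> vals v" for x y
  proof -
    obtain a b where "v a = Val x" "v b = Val y" using xy by (auto simp: vals_def)
    hence "v (a * b) = Val (x + y)" using val_mult[OF v, of a b] by simp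
    thus ?thesis by (auto simp: vals_def)
  qed
  show "x \<in> vals v \<Longrightarrow> y \<in> vals v \<Longrightarrow> x - y \<in> vals v" using add[of x "- y"] neg[of y] by simp
  show "x \<in> vals v \<Longrightarrow> y \<in> vals v \<Longrightarrow> x + y \<in> vals v" "x \<in> vals v \<Longrightarrow> - x \<in> vals v" using add neg by blast+
qed

lemma orthogonal_attained:
  assumes u: "valuation u" "\<And>a. u [:a:] = v a" and orth: "orthogonal v u N b" and "N > 0"
  shows "\<exists>i<N. u (\<Sum>j<N. smult (c j) (b j)) = v (c i) + u (b i)"
proof -
  let ?f = "\<lambda>i. v (c i) + u (b i)"
  have sm: "u (smult a f) = v a + u f" for a f using val_mult[OF u(1), of "[:a:]" f] u(2) by simp
  have "Min (?f ` {..<N}) \<in> ?f ` {..<N}" using assms(4) by (intro Min_in) auto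
  then obtain i where i: "i < N" "Min (?f ` {..<N}) = ?f i" by auto
  have "?f i \<le> u (\<Sum>j<N. smult (c j) (b j))"
    using i(2) by (intro val_sum_ge[OF u(1)]) (auto simp: sm simp flip: i(2) intro!: Min_le)
  moreover have "u (\<Sum>j<N. smult (c j) (b j)) \<le> ?f i" using orth i(1) unfolding orthogonal_def by blast
  ultimately show ?thesis using i(1) by auto
qed

locale orthogonal_limit = limit_val v w \<phi>
  for v :: "'a :: field \<Rightarrow> 'g :: linordered_ab_group_add vinf" and w \<phi> +
  fixes b :: "nat \<Rightarrow> 'a poly"
  assumes b_monic: "lead_coeff (b i) = 1" and b_degree: "degree (b i) = i"
    and b_orth: "orthogonal v w (degree \<phi>) b"
begin

lemma b_nz: "b i \<noteq> 0" using b_monic[of i] by auto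

lemma w_smult: "w (smult a f) = v a + w f"
  using val_mult[OF w, of "[:a:]" f] by (simp add: w_const)

lemma span: "degree f < degree \<phi> \<Longrightarrow> \<exists>c. f = (\<Sum>i<degree \<phi>. smult (c i) (b i))"
  using monic_basis_span[of b f "degree \<phi>"] b_monic b_degree by blast

definition \<beta> :: "nat \<Rightarrow> 'g" where "\<beta> i = (THE x. w (b i) = Val x)"

lemma w_b: "i < degree \<phi> \<Longrightarrow> w (b i) = Val (\<beta> i)"
  using w_eq_Infty[of "b i"] b_nz[of i] by (cases "w (b i)") (auto simp: \<beta>_def b_degree)

lemma value_form:
  assumes "\<not> \<phi> dvd f" "f mod \<phi> = (\<Sum>i<degree \<phi>. smult (c i) (b i))"
  shows "\<exists>i<degree \<phi>. c i \<noteq> 0 \<and> w f = v (c i) + Val (\<beta> i)"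
proof -
  obtain i where i: "i < degree \<phi>" "w f = v (c i) + w (b i)"
    using orthogonal_attained[OF w w_const b_orth deg, of c] w_mod[of f] assms(2) by auto
  moreover have "w f \<noteq> Infty" using supp[of f] assms by blast
  hence "c i \<noteq> 0" using i val_zero[OF v] by auto
  ultimately show ?thesis using w_b[of i] by auto
qed

lemma vals_w: "vals w = {\<alpha>. \<exists>i<degree \<phi>. \<alpha> - \<beta> i \<in> vals v}"
proof (intro equalityI subsetI)
  fix \<alpha> assume "\<alpha> \<in> vals w"
  then obtain f where f: "w f = Val \<alpha>" by (auto simp: vals_def)
  hence nd: "\<not> \<phi> dvd f" using supp[of f] by auto
  obtain c where c: "f mod \<phi> = (\<Sum>i<degree \<phi>. smult (c i) (b i))" using span[OF degree_mod] by blast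
  obtain i where i: "i < degree \<phi>" "c i \<noteq> 0" "w f = v (c i) + Val (\<beta> i)" using value_form[OF nd c] by blast
  hence "v (c i) = Val (\<alpha> - \<beta> i)" using f by (cases "v (c i)") auto
  thus "\<alpha> \<in> {\<alpha>. \<exists>i<degree \<phi>. \<alpha> - \<beta> i \<in> vals v}" using i(1) by (auto simp: vals_def)
next
  fix \<alpha> assume "\<alpha> \<in> {\<alpha>. \<exists>i<degree \<phi>. \<alpha> - \<beta> i \<in> vals v}"
  then obtain i a where "i < degree \<phi>" "v a = Val (\<alpha> - \<beta> i)" by (auto simp: vals_def)
  hence "w (smult a (b i)) = Val \<alpha>" by (simp add: w_smult w_b)
  thus "\<alpha> \<in> vals w" by (auto simp: vals_def)
qed

lemma vals_w_group: "0 \<in> vals w" "x \<in> vals w \<Longrightarrow> y \<in> vals w \<Longrightarrow> x - y \<in> vals w"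
  "x \<in> vals w \<Longrightarrow> y \<in> vals w \<Longrightarrow> x + y \<in> vals w"
proof -
  show "0 \<in> vals w" unfolding vals_def using val_one[OF w] by (auto intro!: exI[of _ 1])
  have neg: "- x \<in> vals w" if x: "x \<in> vals w" for x
  proof -
    obtain f where f: "w f = Val x" using x by (auto simp: vals_def)
    hence "\<not> \<phi> dvd f" using supp[of f] by auto
    then obtain h where h: "w (f * h - 1) = Infty" using ex_inverse by blast
    have "w (f * h) = 0" using val_eq_of_diff[OF w, of 1 "f * h"] h val_uminus[OF w, of "f * h - 1"]
      by (simp add: val_one[OF w])
    hence "w h = Val (- x)" using f by (cases "w h") (auto simp: val_mult[OF w] add_eq_0_iff)
    thus ?thesis by (auto simp: vals_def)
  qed
  have add: "x + y \<in> vals w" if xy: "x \<in> vals w" "y \<in> vals w" for x y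
  proof -
    obtain f h where "w f = Val x" "w h = Val y" using xy by (auto simp: vals_def)
    hence "w (f * h) = Val (x + y)" by (simp add: val_mult[OF w])
    thus ?thesis by (auto simp: vals_def)
  qed
  show "x \<in> vals w \<Longrightarrow> y \<in> vals w \<Longrightarrow> x - y \<in> vals w" using add[of x "- y"] neg[of y] by simp
  show "x \<in> vals w \<Longrightarrow> y \<in> vals w \<Longrightarrow> x + y \<in> vals w" using add by blast
qed

lemma vals_v_sub: "vals v \<subseteq> vals w"
  using w_const by (auto simp: vals_def) metis

lemma vals_low: "\<alpha> \<in> vals w \<longleftrightarrow> (\<exists>a. a \<noteq> 0 \<and> degree a < degree \<phi> \<and> w a = Val \<alpha>)"
proof
  assume "\<alpha> \<in> vals w"
  then obtain f where f: "w f = Val \<alpha>" by (auto simp: vals_def)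
  hence "w (f mod \<phi>) = Val \<alpha>" by (simp add: w_mod)
  moreover have "f mod \<phi> \<noteq> 0" using calculation val_zero[OF w] by auto
  ultimately show "\<exists>a. a \<noteq> 0 \<and> degree a < degree \<phi> \<and> w a = Val \<alpha>"
    using degree_mod by (intro exI[of _ "f mod \<phi>"]) simp
qed (auto simp: vals_def)

definition cls :: "'g \<Rightarrow> nat set" where
  "cls \<delta> = {i. i < degree \<phi> \<and> \<beta> i - \<delta> \<in> vals v}"

text \<open>If one coset had more basis elements than another one, some combination of the former would be
  sent by multiplication with a suitable \<open>t\<close> to a polynomial without components in the latter.\<close>

lemma card_cls_le:
  assumes "\<delta> \<in> vals w" "\<delta>' \<in> vals w"
  shows "card (cls \<delta>) \<le> card (cls \<delta>')"
proof (rule ccontr)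
  assume "\<not> ?thesis"
  hence lt: "card (cls \<delta>') < card (cls \<delta>)" by simp
  have fin: "finite (cls \<delta>)" for \<delta> by (simp add: cls_def)
  obtain t where t: "w t = Val (\<delta>' - \<delta>)" using vals_w_group(2)[OF assms(2,1)] by (auto simp: vals_def)
  have "\<exists>c. (t * b i) mod \<phi> = (\<Sum>j<degree \<phi>. smult (c j) (b j))" for i using span[OF degree_mod] by blast
  then obtain a where a: "\<And>i. (t * b i) mod \<phi> = (\<Sum>j<degree \<phi>. smult (a i j) (b j))" by metis
  obtain c where c: "\<exists>i\<in>cls \<delta>. c i \<noteq> 0" "\<forall>j\<in>cls \<delta>'. (\<Sum>i\<in>cls \<delta>. c i * a i j) = 0"
    using homogeneous_system[OF subfld_UNIV fin fin lt, of a] by auto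
  define c' where "c' i = (if i \<in> cls \<delta> then c i else 0)" for i
  define z where "z = (\<Sum>i<degree \<phi>. smult (c' i) (b i))"
  have z_eq: "z = (\<Sum>i\<in>cls \<delta>. smult (c i) (b i))"
    unfolding z_def by (rule sum.mono_neutral_cong_right) (auto simp: c'_def cls_def)
  have dz: "degree z < degree \<phi>"
    unfolding z_def using deg b_degree degree_smult_le
    by (intro degree_sum_less) (auto intro: le_less_trans)
  have z0: "w z \<noteq> Infty"
  proof -
    obtain i where i: "i \<in> cls \<delta>" "c i \<noteq> 0" using c(1) by blast
    hence i': "i < degree \<phi>" by (simp add: cls_def)
    have "w z \<le> v (c' i) + w (b i)" unfolding z_def using b_orth i' by (simp add: orthogonal_def)
    moreover have "v (c' i) + w (b i) \<noteq> Infty" using i i' w_b v_eq_Infty by (simp add: c'_def)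
    ultimately show ?thesis by auto
  qed
  hence nd: "\<not> \<phi> dvd z" using supp by blast
  have zm: "z mod \<phi> = (\<Sum>i<degree \<phi>. smult (c' i) (b i))" using dz by (simp add: mod_poly_less z_def[symmetric])
  obtain i where i: "i < degree \<phi>" "c' i \<noteq> 0" "w z = v (c' i) + Val (\<beta> i)" using value_form[OF nd zm] by blast
  have "i \<in> cls \<delta>" using i(2) by (auto simp: c'_def split: if_splits)
  obtain \<alpha> where \<alpha>: "v (c' i) = Val \<alpha>" using i(2) v_eq_Infty by (cases "v (c' i)") auto
  have tz: "w (t * z) = Val (\<delta>' - \<delta> + (\<alpha> + \<beta> i))" using t i(3) \<alpha> by (simp add: val_mult[OF w])
  define d where "d j = (\<Sum>i\<in>cls \<delta>. c i * a i j)" for j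
  have "(t * z) mod \<phi> = (\<Sum>i\<in>cls \<delta>. smult (c i) ((t * b i) mod \<phi>))"
    unfolding z_eq by (simp add: sum_distrib_left mod_poly_sum mod_smult_left)
  also have "\<dots> = (\<Sum>j<degree \<phi>. smult (d j) (b j))"
    by (simp add: a smult_sum_right smult_sum_left d_def sum.swap[of _ "cls \<delta>"])
  finally have tzm: "(t * z) mod \<phi> = (\<Sum>j<degree \<phi>. smult (d j) (b j))" .
  have "\<not> \<phi> dvd t * z" using supp[of "t * z"] tz by auto
  \<comment> \<open>The value of \<open>t * z\<close> lies in the coset of \<open>\<delta>'\<close>,
    so an index attaining it belongs to \<open>cls \<delta>'\<close>, where all \<open>d j\<close>
    vanish by the choice of \<open>c\<close>.\<close>
  then obtain j where j: "j < degree \<phi>" "d j \<noteq> 0" "w (t * z) = v (d j) + Val (\<beta> j)" using value_form tzm by blast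
  obtain \<eta> where \<eta>: "v (d j) = Val \<eta>" using j(2) v_eq_Infty by (cases "v (d j)") auto
  have "\<beta> j - \<delta>' = (\<alpha> + (\<beta> i - \<delta>)) - \<eta>" using tz j(3) \<eta> by (simp add: algebra_simps)
  moreover have "\<alpha> \<in> vals v" "\<eta> \<in> vals v" using \<alpha> \<eta> by (auto simp: vals_def)
  moreover have "\<beta> i - \<delta> \<in> vals v" using \<open>i \<in> cls \<delta>\<close> by (simp add: cls_def)
  ultimately have "\<beta> j - \<delta>' \<in> vals v" using vals_group[OF v] by metis
  hence "j \<in> cls \<delta>'" using j(1) by (simp add: cls_def)
  hence "d j = 0" using c(2) by (simp add: d_def)
  thus False using j(2) by simp
qed

section \<open>The degree as a product of ramification index and residual degree\<close>

definition EE :: nat where "EE = grp_index (vals w) (vals v)"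
text \<open>A residual degree, as \<open>dimension_low_residues\<close> shows: the basis elements
  with values in \<Gamma> can be scaled to value 0, and their residues form a basis.\<close>

definition FF :: nat where "FF = card (cls 0)"

text \<open>By \<open>card_cls_le\<close>, used in both directions, every coset contains the same
  number of basis elements.\<close>

lemma cosets_finite: "finite ((\<lambda>a. (+) a ` vals v) ` vals w)"
  and degree_eq: "degree \<phi> = EE * FF" and EE_pos: "EE > 0" and FF_pos: "FF > 0"
proof -
  note coset = subgroup_coset_eq[of "vals v", OF vals_group(1,2)[OF v]]
  let ?C = "\<lambda>a. (+) a ` vals v"
  have im: "?C ` vals w = (\<lambda>i. ?C (\<beta> i)) ` {..<degree \<phi>}"
  proof (intro equalityI subsetI)
    fix x assume "x \<in> ?C ` vals w"
    then obtain \<alpha> where \<alpha>: "\<alpha> \<in> vals w" "x = ?C \<alpha>" by blast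
    then obtain i where "i < degree \<phi>" "\<alpha> - \<beta> i \<in> vals v" using vals_w by auto
    thus "x \<in> (\<lambda>i. ?C (\<beta> i)) ` {..<degree \<phi>}" using \<alpha>(2) coset[of \<alpha> "\<beta> i"] by auto
  next
    fix x assume "x \<in> (\<lambda>i. ?C (\<beta> i)) ` {..<degree \<phi>}"
    then obtain i where i: "i < degree \<phi>" "x = ?C (\<beta> i)" by blast
    have "\<beta> i \<in> vals w" using w_b[OF i(1)] by (auto simp: vals_def)
    thus "x \<in> ?C ` vals w" using i(2) by blast
  qed
  show fin: "finite (?C ` vals w)" unfolding im by simp
  have "degree \<phi> = (\<Sum>i<degree \<phi>. 1)" by simp
  also have "\<dots> = (\<Sum>x\<in>(\<lambda>i. ?C (\<beta> i)) ` {..<degree \<phi>}. \<Sum>i\<in>{i\<in>{..<degree \<phi>}. ?C (\<beta> i) = x}. 1)"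
    by (rule sum.image_gen) simp
  also have "\<dots> = (\<Sum>x\<in>?C ` vals w. FF)"
    unfolding im[symmetric]
  proof (rule sum.cong[OF refl])
    fix x assume "x \<in> ?C ` vals w"
    then obtain \<delta> where \<delta>: "\<delta> \<in> vals w" "x = ?C \<delta>" by blast
    have "{i\<in>{..<degree \<phi>}. ?C (\<beta> i) = x} = cls \<delta>"
      unfolding \<delta>(2) cls_def by (auto simp: coset)
    moreover have "card (cls \<delta>) = FF"
      unfolding FF_def using card_cls_le[OF \<delta>(1) vals_w_group(1)] card_cls_le[OF vals_w_group(1) \<delta>(1)] by simp
    ultimately show "(\<Sum>i\<in>{i\<in>{..<degree \<phi>}. ?C (\<beta> i) = x}. 1) = FF" by simp
  qed
  also have "\<dots> = EE * FF" by (simp add: EE_def grp_index_def)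
  finally show eq: "degree \<phi> = EE * FF" .
  show "EE > 0" "FF > 0" using deg unfolding eq by auto
qed

text \<open>Polynomials of value zero inducing a basis of the residue field of \<open>w\<close>.\<close>

definition h :: "nat \<Rightarrow> 'a poly" where
  "h i = smult (SOME e. v e = Val (- \<beta> i)) (b i)"

lemma h:
  assumes "i \<in> cls 0"
  shows "w (h i) = 0" "degree (h i) < degree \<phi>" "\<exists>e. v e = Val (- \<beta> i) \<and> h i = smult e (b i)"
proof -
  have "- \<beta> i \<in> vals v" using assms vals_group(4)[OF v] by (simp add: cls_def)
  hence "\<exists>e. v e = Val (- \<beta> i)" by (auto simp: vals_def)
  from someI_ex[OF this] have e: "v (SOME e. v e = Val (- \<beta> i)) = Val (- \<beta> i)" .
  show 1: "\<exists>e. v e = Val (- \<beta> i) \<and> h i = smult e (b i)" using e h_def by blast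
  have i: "i < degree \<phi>" using assms by (simp add: cls_def)
  show "w (h i) = 0" using e w_b[OF i] by (simp add: h_def w_smult)
  show "degree (h i) < degree \<phi>" unfolding h_def using i b_degree[of i] degree_smult_le[of _ "b i"] by (metis le_less_trans)
qed

lemma finite_cls: "finite (cls \<delta>)"
  by (simp add: cls_def)

lemma h_orth:
  assumes "i \<in> cls 0"
  shows "w (\<Sum>j\<in>cls 0. smult (c j) (h j)) \<le> v (c i)"
proof -
  obtain e where e: "\<And>j. j \<in> cls 0 \<Longrightarrow> v (e j) = Val (- \<beta> j) \<and> h j = smult (e j) (b j)" using h(3) by metis
  define d where "d j = (if j \<in> cls 0 then c j * e j else 0)" for j
  have "(\<Sum>j\<in>cls 0. smult (c j) (h j)) = (\<Sum>j<degree \<phi>. smult (d j) (b j))"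
    by (rule sum.mono_neutral_cong_left) (auto simp: d_def cls_def[of 0] e[unfolded cls_def[of 0]])
  moreover have "w (\<Sum>j<degree \<phi>. smult (d j) (b j)) \<le> v (d i) + w (b i)"
    using b_orth assms by (simp add: orthogonal_def cls_def)
  moreover have "v (d i) + w (b i) = v (c i)"
    using assms e[OF assms] w_b[of i] by (cases "v (c i)") (auto simp: d_def val_mult[OF v] cls_def)
  ultimately show ?thesis by simp
qed

text \<open>Basis elements outside \<open>cls 0\<close> cannot be scaled to value 0, so their terms
  in an element of nonnegative value have positive value.\<close>

lemma h_span:
  assumes f: "degree f < degree \<phi>" "0 \<le> w f"
  shows "\<exists>c. (\<forall>j\<in>cls 0. 0 \<le> v (c j)) \<and> 0 < w (f - (\<Sum>j\<in>cls 0. smult (c j) (h j)))"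
proof -
  obtain e where e: "\<And>j. j \<in> cls 0 \<Longrightarrow> v (e j) = Val (- \<beta> j) \<and> h j = smult (e j) (b j)" using h(3) by metis
  obtain d where d: "f = (\<Sum>i<degree \<phi>. smult (d i) (b i))" using span[OF f(1)] by blast
  have ge: "0 \<le> v (d i) + Val (\<beta> i)" if "i < degree \<phi>" for i
  proof -
    have "w f \<le> v (d i) + w (b i)" using b_orth that unfolding d orthogonal_def by blast
    thus ?thesis using f(2) w_b[OF that] by simp
  qed
  have enz: "e j \<noteq> 0" if "j \<in> cls 0" for j using e[OF that] val_zero[OF v] by auto
  define c where "c j = d j / e j" for j
  have ce: "c j * e j = d j" if "j \<in> cls 0" for j using enz[OF that] by (simp add: c_def)
  have "0 \<le> v (c j)" if j: "j \<in> cls 0" for j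
  proof -
    have "v (d j) = v (c j) + Val (- \<beta> j)" using ce[OF j, symmetric] e[OF j] by (simp add: val_mult[OF v])
    thus ?thesis using ge[of j] j by (cases "v (c j)") (auto simp: cls_def)
  qed
  moreover have "f - (\<Sum>j\<in>cls 0. smult (c j) (h j)) = (\<Sum>i\<in>{..<degree \<phi>} - cls 0. smult (d i) (b i))"
  proof -
    have "(\<Sum>j\<in>cls 0. smult (c j) (h j)) = (\<Sum>j\<in>cls 0. smult (d j) (b j))"
      by (rule sum.cong) (auto simp: e ce)
    moreover have "f = (\<Sum>i\<in>{..<degree \<phi>} - cls 0. smult (d i) (b i)) + (\<Sum>j\<in>cls 0. smult (d j) (b j))"
      unfolding d by (rule sum.subset_diff) (auto simp: cls_def)
    ultimately show ?thesis by simp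
  qed
  moreover have "0 < w (\<Sum>i\<in>{..<degree \<phi>} - cls 0. smult (d i) (b i))"
  proof (rule val_sum_gt[OF w])
    fix i assume i: "i \<in> {..<degree \<phi>} - cls 0"
    have "v (d i) + Val (\<beta> i) \<noteq> 0"
    proof
      assume eq: "v (d i) + Val (\<beta> i) = 0"
      hence "v (d i) = Val (- \<beta> i)" by (cases "v (d i)") (auto simp: eq_neg_iff_add_eq_0)
      hence "- \<beta> i \<in> vals v" by (auto simp: vals_def)
      from vals_group(4)[OF v this] show False using i by (simp add: cls_def)
    qed
    thus "0 < w (smult (d i) (b i))" using ge[of i] i w_b[of i] by (simp add: w_smult)
  qed simp
  ultimately show ?thesis by (intro exI[of _ c]) simp
qed

end

locale orthogonal_level = level v w \<phi> \<gamma> + orthogonal_limit v w \<phi> b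
  for v :: "'a :: field \<Rightarrow> 'g :: linordered_ab_group_add vinf" and w \<phi> \<gamma> b
begin

definition B :: "nat \<Rightarrow> 'a poly" where
  "B i = b (i mod degree \<phi>) * \<phi> ^ (i div degree \<phi>)"

lemma B_monic: "lead_coeff (B i) = 1"
  unfolding B_def lead_coeff_mult using b_monic monic by (simp add: lead_coeff_power)

lemma B_degree: "degree (B i) = i"
  unfolding B_def using b_nz phi_nz by (simp add: degree_mult_eq degree_power_eq b_degree)

lemma b_small: "degree (b (i mod degree \<phi>)) < degree \<phi>"
  using deg by (simp add: b_degree)

lemma mu_B: "mu (B i) = w (b (i mod degree \<phi>)) + nmul (i div degree \<phi>) (Val \<gamma>)"
  unfolding B_def by (rule mu_monomial[OF b_small])

text \<open>For a fixed \<open>i\<close> it is enough to look at the one digit to which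
  \<open>B i\<close> contributes; there the combination is one of the \<open>b j\<close>, for which
  orthogonality is known.\<close>

lemma B_orth: "orthogonal v mu N B"
  unfolding orthogonal_def
proof (intro allI impI)
  fix c :: "nat \<Rightarrow> 'a" and i assume i: "i < N"
  define m where "m = degree \<phi>"
  have m: "m > 0" using deg by (simp add: m_def)
  define n where "n = i div m"
  \<comment> \<open>The block of indices forming this digit may be cut off by \<open>N\<close>; the
    missing coefficients are 0.\<close>
  define d where "d j = (if n * m + j < N then c (n * m + j) else 0)" for j
  have dg: "digit \<phi> (smult (c k) (B k)) n = (if k div m = n then smult (c k) (b (k mod m)) else 0)" for k
  proof -
    have "smult (c k) (B k) = smult (c k) (b (k mod m)) * \<phi> ^ (k div m)" by (simp add: B_def m_def)
    moreover have "degree (smult (c k) (b (k mod m))) < degree \<phi>"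
      using b_small[of k] degree_smult_le[of "c k" "b (k mod m)"] by (simp add: m_def)
    ultimately show ?thesis using digit_monomial by (metis (no_types, lifting))
  qed
  have inj: "inj_on (\<lambda>j. n * m + j) {..<m}" by (auto simp: inj_on_def)
  have "digit \<phi> (\<Sum>k<N. smult (c k) (B k)) n = (\<Sum>k<N. if k div m = n then smult (c k) (b (k mod m)) else 0)"
    by (simp only: digit_sum dg)
  also have "\<dots> = (\<Sum>k\<in>{k. k < N \<and> k div m = n}. smult (c k) (b (k mod m)))"
    by (intro sum.mono_neutral_cong_right) auto
  also have "\<dots> = (\<Sum>k\<in>(\<lambda>j. n * m + j) ` {..<m}. if k < N then smult (c k) (b (k mod m)) else 0)"
  proof (rule sum.mono_neutral_cong_left)
    show "{k. k < N \<and> k div m = n} \<subseteq> (\<lambda>j. n * m + j) ` {..<m}"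
    proof
      fix k assume "k \<in> {k. k < N \<and> k div m = n}"
      hence "k = n * m + k mod m" by (metis (mono_tags, lifting) div_mult_mod_eq mem_Collect_eq)
      thus "k \<in> (\<lambda>j. n * m + j) ` {..<m}" using m by (intro image_eqI[of _ _ "k mod m"]) auto
    qed
    show "\<forall>k\<in>(\<lambda>j. n * m + j) ` {..<m} - {k. k < N \<and> k div m = n}. (if k < N then smult (c k) (b (k mod m)) else 0) = 0"
      using m by auto
  qed auto
  also have "\<dots> = (\<Sum>j<m. smult (d j) (b j))"
    by (subst sum.reindex[OF inj]) (auto intro!: sum.cong simp: d_def)
  finally have dig: "digit \<phi> (\<Sum>k<N. smult (c k) (B k)) n = (\<Sum>j<m. smult (d j) (b j))" .
  have di: "d (i mod m) = c i" using i by (simp add: d_def n_def)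
  have "mu (\<Sum>k<N. smult (c k) (B k)) \<le> T (\<Sum>k<N. smult (c k) (B k)) n" by (rule mu_le)
  also have "\<dots> = w (\<Sum>j<m. smult (d j) (b j)) + nmul n (Val \<gamma>)" by (simp only: T_def dig)
  also have "\<dots> \<le> (v (d (i mod m)) + w (b (i mod m))) + nmul n (Val \<gamma>)"
    using b_orth m unfolding orthogonal_def m_def[symmetric] by (intro add_right_mono) auto
  also have "\<dots> = v (c i) + mu (B i)" by (simp only: di mu_B m_def[symmetric] n_def add.assoc)
  finally show "mu (\<Sum>k<N. smult (c k) (B k)) \<le> v (c i) + mu (B i)" .
qed

lemma next_orthogonal_limit:
  assumes \<psi>: "\<psi> \<in> KP mu"
  shows "orthogonal_limit v (augment mu \<psi> Infty) \<psi> B"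
proof (rule orthogonal_limit.intro[OF mu.next_limit[OF \<psi> mu_const]], unfold_locales)
  show "lead_coeff (B i) = 1" "degree (B i) = i" for i by (rule B_monic, rule B_degree)
  show "orthogonal v (augment mu \<psi> Infty) (degree \<psi>) B"
    unfolding orthogonal_def
  proof (intro allI impI)
    fix c :: "nat \<Rightarrow> 'a" and i assume i: "i < degree \<psi>"
    have "degree (\<Sum>j<degree \<psi>. smult (c j) (B j)) < degree \<psi>"
      using mu.KP_D(3)[OF \<psi>] by (intro degree_sum_less) (auto intro: le_less_trans[OF degree_smult_le] simp: B_degree)
    hence "augment mu \<psi> Infty (\<Sum>j<degree \<psi>. smult (c j) (B j)) = mu (\<Sum>j<degree \<psi>. smult (c j) (B j))"
      by (rule mu.limit_valuation(4)[OF \<psi>])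
    also have "\<dots> \<le> v (c i) + mu (B i)" using B_orth i unfolding orthogonal_def by blast
    also have "mu (B i) = augment mu \<psi> Infty (B i)"
      using mu.limit_valuation(4)[OF \<psi>, of "B i"] i by (simp add: B_degree)
    finally show "augment mu \<psi> Infty (\<Sum>j<degree \<psi>. smult (c j) (B j)) \<le> v (c i) + augment mu \<psi> Infty (B i)" .
  qed
qed

end

section \<open>Indices of value groups\<close>

text \<open>The map sending a coset of \<open>C\<close> to the coset of \<open>B\<close> around it
  has fibres that are translates of the set of cosets of \<open>C\<close> in
  \<open>B\<close>.\<close>

lemma grp_index_mult:
  fixes A B C :: "'g :: ab_group_add set"
  assumes A: "\<And>x y. x \<in> A \<Longrightarrow> y \<in> A \<Longrightarrow> x + y \<in> A"
    and B: "0 \<in> B" "\<And>x y. x \<in> B \<Longrightarrow> y \<in> B \<Longrightarrow> x - y \<in> B"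
    and C: "0 \<in> C" "\<And>x y. x \<in> C \<Longrightarrow> y \<in> C \<Longrightarrow> x - y \<in> C"
    and sub: "B \<subseteq> A" "C \<subseteq> B" and fin: "finite ((\<lambda>a. (+) a ` C) ` A)"
  shows "grp_index A C = grp_index A B * grp_index B C"
proof -
  let ?c = "\<lambda>a. (+) a ` C" and ?b = "\<lambda>a. (+) a ` B"
  have cB: "(+) a ` B = (+) b ` B \<longleftrightarrow> a - b \<in> B" for a b
    by (rule subgroup_coset_eq) (fact B)+
  define g where "g S = (\<Union>x\<in>S. (+) x ` B)" for S
  have Badd: "x + y \<in> B" if "x \<in> B" "y \<in> B" for x y using B(2)[OF that(1) B(2)[OF B(1) that(2)]] by simp
  have g: "g (?c a) = ?b a" for a
  proof
    show "g (?c a) \<subseteq> ?b a"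
    proof
      fix y assume "y \<in> g (?c a)"
      then obtain c b where "c \<in> C" "b \<in> B" "y = a + (c + b)" by (auto simp: g_def add.assoc)
      thus "y \<in> ?b a" using Badd sub(2) by blast
    qed
    show "?b a \<subseteq> g (?c a)" unfolding g_def using C(1) by force
  qed
  have img: "g ` ?c ` A = ?b ` A" by (simp add: image_image g)
  have "grp_index A C = (\<Sum>S\<in>?c ` A. 1)" by (simp add: grp_index_def)
  also have "\<dots> = (\<Sum>S1\<in>?b ` A. \<Sum>S\<in>{S\<in>?c ` A. g S = S1}. 1)"
    unfolding img[symmetric] by (rule sum.image_gen[OF fin])
  also have "\<dots> = (\<Sum>S1\<in>?b ` A. grp_index B C)"
  proof (rule sum.cong[OF refl])
    fix S1 assume "S1 \<in> ?b ` A"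
    then obtain a where a: "a \<in> A" "S1 = ?b a" by blast
    have "{S\<in>?c ` A. g S = S1} = (\<lambda>S. (+) a ` S) ` ?c ` B"
    proof (intro equalityI subsetI)
      fix S assume "S \<in> {S\<in>?c ` A. g S = S1}"
      then obtain x where x: "x \<in> A" "S = ?c x" "?b x = ?b a" using a g by auto
      hence "x - a \<in> B" using cB by blast
      moreover have "(+) a ` ?c (x - a) = S" unfolding x(2) by (simp add: image_image algebra_simps)
      ultimately show "S \<in> (\<lambda>S. (+) a ` S) ` ?c ` B" by blast
    next
      fix S assume "S \<in> (\<lambda>S. (+) a ` S) ` ?c ` B"
      then obtain b where b: "b \<in> B" "S = ?c (a + b)" by (auto simp: image_image add.assoc)
      have "a + b - a = b" by simp
      hence "a + b - a \<in> B" using b(1) by metis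
      hence "?b (a + b) = ?b a" by (rule iffD2[OF cB])
      hence "g S = ?b a" unfolding b(2) g .
      moreover note b
      ultimately show "S \<in> {S\<in>?c ` A. g S = S1}" using A[OF a(1)] sub(1) a(2) by blast
    qed
    moreover have "inj_on (\<lambda>S. (+) a ` S) (?c ` B)" by (rule inj_onI) (simp add: inj_image_eq_iff)
    ultimately have "card {S\<in>?c ` A. g S = S1} = grp_index B C" by (simp add: card_image grp_index_def)
    thus "(\<Sum>S\<in>{S\<in>?c ` A. g S = S1}. 1) = grp_index B C" by simp
  qed
  finally show ?thesis by (simp add: grp_index_def)
qed

section \<open>The shape of key polynomials\<close>

context orthogonal_level
begin

lemma vals_mu: "\<alpha> \<in> vals mu \<longleftrightarrow> (\<exists>\<delta>\<in>vals w. \<exists>n. \<alpha> = \<delta> + nmul n \<gamma>)"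
proof
  assume "\<alpha> \<in> vals mu"
  then obtain f where f: "mu f = Val \<alpha>" by (auto simp: vals_def)
  obtain n where n: "mu f = T f n" using mu_attained by blast
  then obtain \<delta> where \<delta>: "w (digit \<phi> f n) = Val \<delta>" using f by (cases "w (digit \<phi> f n)") (auto simp: T_def)
  hence "\<alpha> = \<delta> + nmul n \<gamma>" using f n by (simp add: T_def)
  thus "\<exists>\<delta>\<in>vals w. \<exists>n. \<alpha> = \<delta> + nmul n \<gamma>" using \<delta> by (auto simp: vals_def)
next
  assume "\<exists>\<delta>\<in>vals w. \<exists>n. \<alpha> = \<delta> + nmul n \<gamma>"
  then obtain \<delta> n where \<alpha>: "\<delta> \<in> vals w" "\<alpha> = \<delta> + nmul n \<gamma>" by blast
  then obtain a where "degree a < degree \<phi>" "w a = Val \<delta>" using vals_low by blast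
  hence "mu (a * \<phi> ^ n) = Val \<alpha>" using \<alpha>(2) by (simp add: mu_monomial)
  thus "\<alpha> \<in> vals mu" by (auto simp: vals_def)
qed

text \<open>Since \<open>\<phi>\<close> has smaller degree than \<open>\<psi>\<close>, it keeps its
  value \<gamma>, and so do the digits; hence every value of \<open>mu\<close> is still
  attained.\<close>

lemma vals_next:
  assumes \<psi>: "\<psi> \<in> KP mu" and less: "degree \<phi> < degree \<psi>"
  shows "vals (augment mu \<psi> Infty) = vals mu"
proof -
  interpret n: orthogonal_limit v "augment mu \<psi> Infty" \<psi> B by (rule next_orthogonal_limit[OF \<psi>])
  note low = mu.limit_valuation(4)[OF \<psi>]
  show ?thesis
  proof (intro equalityI subsetI)
    fix \<alpha> assume "\<alpha> \<in> vals (augment mu \<psi> Infty)"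
    then obtain a where "degree a < degree \<psi>" "augment mu \<psi> Infty a = Val \<alpha>" using n.vals_low by blast
    thus "\<alpha> \<in> vals mu" using low[of a] by (auto simp: vals_def)
  next
    fix \<alpha> assume "\<alpha> \<in> vals mu"
    then obtain \<delta> n where \<alpha>: "\<delta> \<in> vals w" "\<alpha> = \<delta> + nmul n \<gamma>" using vals_mu by blast
    obtain a where a: "degree a < degree \<phi>" "w a = Val \<delta>" using vals_low \<alpha>(1) by blast
    have "augment mu \<psi> Infty a = Val \<delta>" using low[of a] a less mu_eq_w by simp
    moreover have "augment mu \<psi> Infty \<phi> = Val \<gamma>" using low[of \<phi>] less mu_phi by simp
    ultimately have "augment mu \<psi> Infty (a * \<phi> ^ n) = Val \<alpha>"
      using \<alpha>(2) by (simp add: val_mult[OF n.w] val_power[OF n.w])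
    thus "\<alpha> \<in> vals (augment mu \<psi> Infty)" by (auto simp: vals_def)
  qed
qed

text \<open>Otherwise the initial form of \<open>\<psi>\<close> would equal that of a product of
  \<open>\<phi>\<close> and a polynomial \<open>q\<close>, both nonzero and of smaller degree, which
  primality forbids.\<close>

lemma key_first_digit:
  assumes \<psi>: "\<psi> \<in> KP mu" and less: "degree \<phi> < degree \<psi>"
  shows "T \<psi> 0 = mu \<psi>"
proof (rule ccontr)
  assume "T \<psi> 0 \<noteq> mu \<psi>"
  hence gt: "mu \<psi> < T \<psi> 0" using mu_le[of \<psi> 0] by simp
  define q where "q = \<psi> div \<phi>"
  have "T \<psi> 0 = mu (\<psi> mod \<phi>)" by (simp add: T_def digit_zero mu_eq_w degree_mod)
  hence gt': "mu \<psi> < mu (\<psi> - \<phi> * q)" using gt by (simp add: q_def minus_mult_div_eq_mod)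
  have "mu (\<phi> * q) = mu \<psi>" by (rule val_eq_of_diff[OF mu gt'])
  hence "mu (\<phi> * q) < mu (\<phi> * q - \<psi> * 1)" using gt' by (simp add: mu.minus_commute[of "\<phi> * q"])
  from mu.KP_D(6)[OF \<psi> this] obtain p where p: "mu \<phi> < mu (\<phi> - \<psi> * p) \<or> mu q < mu (q - \<psi> * p)" by blast
  have "q * \<phi> = \<psi> - \<psi> mod \<phi>" by (simp add: q_def minus_mod_eq_div_mult)
  have "q \<noteq> 0"
  proof
    assume "q = 0"
    hence "\<psi> mod \<phi> = \<psi>" using \<open>q * \<phi> = \<psi> - \<psi> mod \<phi>\<close> by simp
    thus False using degree_mod[of \<psi>] less by simp
  qed
  moreover have "degree q < degree \<psi>"
  proof -
    have "degree q + degree \<phi> = degree (\<psi> - \<psi> mod \<phi>)"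
      using \<open>q \<noteq> 0\<close> phi_nz \<open>q * \<phi> = \<psi> - \<psi> mod \<phi>\<close> by (metis degree_mult_eq)
    also have "\<dots> \<le> max (degree \<psi>) (degree (\<psi> mod \<phi>))" by (rule degree_diff_le_max)
    also have "\<dots> = degree \<psi>" using degree_mod[of \<psi>] less by simp
    finally show ?thesis using deg by simp
  qed
  ultimately show False
    using p mu.KP_D(5)[OF \<psi> phi_nz less, of p] mu.KP_D(5)[OF \<psi>, of q p] by auto
qed

text \<open>Put l = \<open>smax \<psi>\<close>. Dividing by the digit at l gives an equivalent
  polynomial \<open>f\<close> of degree at most l deg(\<open>\<phi>\<close>), whose initial form is
  still a multiple of that of \<open>\<psi>\<close>; minimality bounds deg(\<open>\<psi>\<close>) by
  l deg(\<open>\<phi>\<close>). Equality of degrees makes the digit at l a constant, which is 1 as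
  all polynomials involved are monic.\<close>

lemma key_leading_digit:
  assumes \<psi>: "\<psi> \<in> KP mu"
  shows "degree \<psi> = smax \<psi> * degree \<phi>" "digit \<phi> \<psi> (smax \<psi>) = 1"
proof -
  note nz = mu.KP_D(2)[OF \<psi>]
  define l where "l = smax \<psi>"
  define a where "a = digit \<phi> \<psi> l"
  have Tl: "T \<psi> l = mu \<psi>" using smax(1)[OF nz] by (simp add: l_def)
  have a0: "a \<noteq> 0" using Tl nz mu_eq_Infty[of \<psi>] T_eq_Infty[of \<psi> l] by (auto simp: a_def)
  have da: "degree a < degree \<phi>" unfolding a_def by (rule degree_digit_less[OF deg])
  obtain b where b: "b \<noteq> 0" "degree b < degree \<phi>" "0 < mu (a * b - 1)" "w a + w b = 0"
    using mu_inverse[OF a0 da] by blast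
  have mb: "mu b = w b" by (rule mu_eq_w[OF b(2)])
  have val: "mu (b * \<psi>) = nmul l (Val \<gamma>)"
  proof -
    have "mu (b * \<psi>) = w b + (w a + nmul l (Val \<gamma>))"
      using Tl by (simp add: val_mult[OF mu] mb T_def a_def)
    thus ?thesis using b(4) by (simp add: add.commute[of "w b"] flip: add.assoc)
  qed
  \<comment> \<open>Obtained from \<open>b * \<psi>\<close> by reducing the digits below l,
    replacing the digit at l by 1 and dropping the higher ones.\<close>
  define f where "f = \<phi> ^ l + (\<Sum>n<l. (b * digit \<phi> \<psi> n) mod \<phi> * \<phi> ^ n)"
  define E where "E n = (if n < l then (b * digit \<phi> \<psi> n) mod \<phi> else if n = l then 1 else 0)" for n
  have l_le: "l \<le> degree \<psi>" using smax(2)[OF nz] by (simp add: l_def)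
  have f_eq: "f = (\<Sum>n\<le>degree \<psi>. E n * \<phi> ^ n)"
  proof -
    have "(\<Sum>n\<le>degree \<psi>. E n * \<phi> ^ n) = (\<Sum>n\<le>l. E n * \<phi> ^ n)"
      using l_le by (intro sum.mono_neutral_right) (auto simp: E_def)
    also have "\<dots> = (\<Sum>n<l. E n * \<phi> ^ n) + \<phi> ^ l" by (simp add: E_def flip: lessThan_Suc_atMost)
    also have "(\<Sum>n<l. E n * \<phi> ^ n) = (\<Sum>n<l. (b * digit \<phi> \<psi> n) mod \<phi> * \<phi> ^ n)"
      by (intro sum.cong) (auto simp: E_def)
    finally show ?thesis by (simp add: f_def add.commute)
  qed
  have diff: "b * \<psi> - f = (\<Sum>n\<le>degree \<psi>. (b * digit \<phi> \<psi> n - E n) * \<phi> ^ n)"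
  proof -
    have "b * \<psi> = (\<Sum>n\<le>degree \<psi>. b * digit \<phi> \<psi> n * \<phi> ^ n)"
      using arg_cong[OF digit_expansion[OF deg, of \<psi>], of "\<lambda>p. b * p"] by (simp add: sum_distrib_left mult.assoc)
    thus ?thesis unfolding f_eq by (simp add: left_diff_distrib sum_subtractf)
  qed
  have fin: "nmul l (Val \<gamma>) \<noteq> Infty" by simp
  have Tb: "mu (b * digit \<phi> \<psi> n * \<phi> ^ n) = w b + T \<psi> n" for n
    by (simp add: val_mult[OF mu] mb T_def mu_eq_w degree_digit_less[OF deg] val_power[OF mu] mu_phi add.assoc del: nmul_Val)
  have mpsi: "nmul l (Val \<gamma>) = w b + mu \<psi>" using val by (simp add: val_mult[OF mu] mb)
  have wb: "w b \<noteq> Infty" using b(4) by auto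
  \<comment> \<open>Above l the terms are too large by maximality of l, at l by the choice of
    \<open>b\<close>, and below l only carries remain, which \<open>strict\<close> controls.\<close>
  have lt: "nmul l (Val \<gamma>) < mu (b * \<psi> - f)"
    unfolding diff
  proof (rule val_sum_gt[OF mu fin])
    fix n
    consider "n > l" | "n = l" | "n < l" by linarith
    thus "nmul l (Val \<gamma>) < mu ((b * digit \<phi> \<psi> n - E n) * \<phi> ^ n)"
    proof cases
      case 1
      have "mu \<psi> < T \<psi> n" using smax(3)[OF nz] 1 by (simp add: l_def)
      hence "w b + mu \<psi> < w b + T \<psi> n" using wb by simp
      thus ?thesis using 1 Tb[of n] unfolding mpsi by (simp add: E_def)
    next
      case 2
      have "mu ((b * digit \<phi> \<psi> n - E n) * \<phi> ^ n) = mu (a * b - 1) + nmul l (Val \<gamma>)"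
        using 2 by (simp add: E_def val_mult[OF mu] val_power[OF mu] mu_phi mult.commute[of b] flip: a_def)
      thus ?thesis using vinf_add_strict_mono(1)[OF b(3) order_refl fin] by simp
    next
      case 3
      define d where "d = digit \<phi> \<psi> n"
      have dd: "degree d < degree \<phi>" unfolding d_def by (rule degree_digit_less[OF deg])
      show ?thesis
      proof (cases "d = 0")
        case True
        thus ?thesis using 3 fin by (simp add: E_def val_zero[OF mu] flip: d_def)
      next
        case False
        define c where "c = (b * d) div \<phi>"
        have "(b * d - E n) * \<phi> ^ n = c * \<phi> ^ Suc n"
          using 3 by (simp add: E_def c_def d_def minus_mod_eq_div_mult mult.assoc)
        moreover have "mu (c * \<phi> ^ Suc n) = mu c + nmul (Suc n) (Val \<gamma>)"
          by (simp only: val_mult[OF mu] val_power[OF mu] mu_phi)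
        moreover have "degree c < degree \<phi>"
        proof (cases "c = 0")
          case cn: False
          have "degree c + degree \<phi> = degree (c * \<phi>)" using cn phi_nz by (simp add: degree_mult_eq)
          also have "c * \<phi> = b * d - (b * d) mod \<phi>" by (simp add: c_def minus_mod_eq_div_mult)
          also have "degree \<dots> \<le> max (degree (b * d)) (degree ((b * d) mod \<phi>))" by (rule degree_diff_le_max)
          finally show ?thesis using degree_mult_le[of b d] degree_mod[of "b * d"] b(2) dd by linarith
        qed (use deg in simp)
        hence "mu c = w c" by (rule mu_eq_w)
        moreover have "w b + w d < w c + Val \<gamma>" unfolding c_def by (rule strict[OF b(1) False b(2) dd])
        hence "(w b + w d) + nmul n (Val \<gamma>) < (w c + Val \<gamma>) + nmul n (Val \<gamma>)" by simp
        hence "w b + T \<psi> n < w c + nmul (Suc n) (Val \<gamma>)" by (simp add: T_def d_def ac_simps del: nmul_Val)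
        moreover have "nmul l (Val \<gamma>) \<le> w b + T \<psi> n" unfolding mpsi by (intro add_left_mono mu_le)
        ultimately show ?thesis unfolding d_def[symmetric] by (metis le_less_trans)
      qed
    qed
  qed
  hence "mu (b * \<psi>) < mu (b * \<psi> - f)" using val by simp
  moreover from this have "mu f = mu (b * \<psi>)" using val_eq_of_diff[OF mu] by blast
  ultimately have ltf: "mu f < mu (f - \<psi> * b)" by (simp add: mu.minus_commute[of f] mult.commute)
  have f0: "f \<noteq> 0" using \<open>mu f = mu (b * \<psi>)\<close> val mu_eq_Infty[of f] fin by auto
  have dlow: "degree (\<Sum>n<l. (b * digit \<phi> \<psi> n) mod \<phi> * \<phi> ^ n) \<le> l * degree \<phi>"
  proof (rule degree_sum_le)
    fix n assume "n \<in> {..<l}"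
    hence "Suc n \<le> l" by simp
    have "degree ((b * digit \<phi> \<psi> n) mod \<phi> * \<phi> ^ n) \<le> degree ((b * digit \<phi> \<psi> n) mod \<phi>) + degree (\<phi> ^ n)"
      by (rule degree_mult_le)
    also have "\<dots> \<le> degree \<phi> + n * degree \<phi>"
      using degree_mod[of "b * digit \<phi> \<psi> n"] phi_nz by (simp add: degree_power_eq)
    also have "\<dots> = Suc n * degree \<phi>" by simp
    also have "\<dots> \<le> l * degree \<phi>" using \<open>Suc n \<le> l\<close> by (rule mult_le_mono1)
    finally show "degree ((b * digit \<phi> \<psi> n) mod \<phi> * \<phi> ^ n) \<le> l * degree \<phi>" .
  qed simp
  have "degree f \<le> l * degree \<phi>"
    unfolding f_def using dlow phi_nz by (intro degree_add_le) (auto simp: degree_power_eq)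
  moreover have "\<not> degree f < degree \<psi>" using mu.KP_D(5)[OF \<psi> f0, of b] ltf by auto
  ultimately have ge: "degree \<psi> \<le> l * degree \<phi>" by simp
  have "\<psi> div \<phi> ^ l \<noteq> 0" using a0 by (auto simp: a_def digit_def)
  define Q where "Q = \<psi> div \<phi> ^ l"
  have Q0: "Q \<noteq> 0" using \<open>\<psi> div \<phi> ^ l \<noteq> 0\<close> by (simp add: Q_def)
  have dphil: "degree (\<phi> ^ l) = l * degree \<phi>" using phi_nz by (simp add: degree_power_eq)
  have "\<not> degree \<psi> < l * degree \<phi>"
    using Q0 div_poly_less[of \<psi> "\<phi> ^ l"] dphil by (auto simp: Q_def)
  hence eq: "degree \<psi> = l * degree \<phi>" using ge by simp
  thus "degree \<psi> = smax \<psi> * degree \<phi>" by (simp add: l_def)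
  have mlt: "\<psi> mod \<phi> ^ l = 0 \<or> degree (\<psi> mod \<phi> ^ l) < degree (\<phi> ^ l)"
    using phi_nz degree_mod_less[of "\<phi> ^ l" \<psi>] by simp
  have psi: "\<psi> = Q * \<phi> ^ l + \<psi> mod \<phi> ^ l" unfolding Q_def by (rule div_mult_mod_eq[symmetric])
  have dQ: "degree Q = 0"
  proof -
    have "Q * \<phi> ^ l = \<psi> - \<psi> mod \<phi> ^ l" by (simp add: Q_def minus_mod_eq_div_mult)
    hence "degree (Q * \<phi> ^ l) \<le> max (degree \<psi>) (degree (\<psi> mod \<phi> ^ l))" by (simp add: degree_diff_le_max)
    also have "\<dots> \<le> l * degree \<phi>" using mlt eq dphil by auto
    finally show ?thesis using Q0 phi_nz dphil by (simp add: degree_mult_eq)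
  qed
  then obtain c where c: "Q = [:c:]" by (metis degree_eq_zeroE)
  have "coeff \<psi> (l * degree \<phi>) = c * lead_coeff (\<phi> ^ l)"
  proof -
    have "coeff \<psi> (l * degree \<phi>) = coeff (Q * \<phi> ^ l) (l * degree \<phi>) + coeff (\<psi> mod \<phi> ^ l) (l * degree \<phi>)"
      by (subst psi) simp
    moreover have "coeff (\<psi> mod \<phi> ^ l) (l * degree \<phi>) = 0" using mlt dphil by (auto intro: coeff_eq_0)
    ultimately show ?thesis by (simp add: c dphil)
  qed
  hence "c = 1" using mu.KP_D(1)[OF \<psi>] monic eq by (simp add: lead_coeff_power)
  hence "Q = 1" using c by (simp add: one_pCons)
  thus "digit \<phi> \<psi> (smax \<psi>) = 1" using deg by (simp add: digit_def mod_poly_less flip: l_def Q_def)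
qed

lemma vals_mu_group: "x \<in> vals mu \<Longrightarrow> y \<in> vals mu \<Longrightarrow> x + y \<in> vals mu" "vals w \<subseteq> vals mu"
proof -
  assume "x \<in> vals mu" "y \<in> vals mu"
  then obtain f g where "mu f = Val x" "mu g = Val y" by (auto simp: vals_def)
  hence "mu (f * g) = Val (x + y)" by (simp add: val_mult[OF mu])
  thus "x + y \<in> vals mu" by (auto simp: vals_def)
next
  show "vals w \<subseteq> vals mu"
  proof
    fix \<delta> assume "\<delta> \<in> vals w"
    moreover have "\<delta> = \<delta> + nmul 0 \<gamma>" by simp
    ultimately show "\<delta> \<in> vals mu" unfolding vals_mu by blast
  qed
qed

section \<open>Relative ramification index and residue degree\<close>

context
  assumes torsion: "\<exists>n>0. nmul n \<gamma> \<in> vals v"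
begin

lemma rel_index:
  shows "rel_index mu \<phi> > 0" "nmul (rel_index mu \<phi>) \<gamma> \<in> vals w"
    "nmul n \<gamma> \<in> vals w \<longleftrightarrow> rel_index mu \<phi> dvd n"
proof -
  define P where "P e \<longleftrightarrow> e > 0 \<and> nmul e \<gamma> \<in> vals w" for e
  have iff: "nmul e (mu \<phi>) \<in> {mu a | a. a \<noteq> 0 \<and> degree a < degree \<phi>} \<longleftrightarrow> nmul e \<gamma> \<in> vals w" for e
    unfolding vals_low mu_phi nmul_Val using mu_eq_w by (auto simp: eq_commute[of "Val _"]) metis+
  have def: "rel_index mu \<phi> = (LEAST e. P e)" unfolding rel_index_def P_def iff ..
  have "\<exists>e. P e" using torsion vals_v_sub by (auto simp: P_def)
  hence PL: "P (rel_index mu \<phi>)" unfolding def by (rule LeastI_ex)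
  thus pos: "rel_index mu \<phi> > 0" and mem: "nmul (rel_index mu \<phi>) \<gamma> \<in> vals w" by (auto simp: P_def)
  have mult: "nmul (k * rel_index mu \<phi>) \<gamma> \<in> vals w" for k
    by (induction k) (auto simp: vals_w_group nmul_add intro: vals_w_group(3) mem)
  show "nmul n \<gamma> \<in> vals w \<longleftrightarrow> rel_index mu \<phi> dvd n"
  proof
    assume n: "nmul n \<gamma> \<in> vals w"
    define k where "k = n div rel_index mu \<phi>"
    have "n = k * rel_index mu \<phi> + n mod rel_index mu \<phi>" unfolding k_def by (rule div_mult_mod_eq[symmetric])
    hence "nmul n \<gamma> = nmul (k * rel_index mu \<phi>) \<gamma> + nmul (n mod rel_index mu \<phi>) \<gamma>"
      by (metis nmul_add)
    hence "nmul (n mod rel_index mu \<phi>) \<gamma> = nmul n \<gamma> - nmul (k * rel_index mu \<phi>) \<gamma>" by simp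
    hence m: "nmul (n mod rel_index mu \<phi>) \<gamma> \<in> vals w" using vals_w_group(2)[OF n mult] by simp
    have "n mod rel_index mu \<phi> = 0"
    proof (rule ccontr)
      assume "n mod rel_index mu \<phi> \<noteq> 0"
      hence "P (n mod rel_index mu \<phi>)" using m by (simp add: P_def)
      hence "rel_index mu \<phi> \<le> n mod rel_index mu \<phi>" unfolding def by (rule Least_le)
      thus False using mod_less_divisor[OF pos, of n] by simp
    qed
    thus "rel_index mu \<phi> dvd n" by (simp only: mod_eq_0_iff_dvd)
  next
    assume "rel_index mu \<phi> dvd n"
    then obtain k where "n = k * rel_index mu \<phi>" by (metis dvd_div_mult_self)
    thus "nmul n \<gamma> \<in> vals w" using mult by simp
  qed
qed

text \<open>Every coset is represented by a multiple of \<gamma>, and two multiples are congruent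
  exactly if their difference is divisible by the relative index.\<close>

lemma grp_index_rel: "grp_index (vals mu) (vals w) = rel_index mu \<phi>"
proof -
  have coset: "(+) a ` vals w = (+) b ` vals w \<longleftrightarrow> a - b \<in> vals w" for a b
    by (rule subgroup_coset_eq) (fact vals_w_group)+
  let ?e = "rel_index mu \<phi>"
  let ?c = "\<lambda>a. (+) a ` vals w"
  have eq: "?c (nmul i \<gamma>) = ?c (nmul j \<gamma>) \<longleftrightarrow> ?e dvd j - i" if "i \<le> j" for i j
  proof -
    have "nmul j \<gamma> - nmul i \<gamma> = nmul (j - i) \<gamma>" using nmul_add[of "j - i" i \<gamma>] that by simp
    thus ?thesis using coset[of "nmul j \<gamma>" "nmul i \<gamma>"] rel_index(3)[of "j - i"] by (simp add: eq_commute[of "?c (nmul i \<gamma>)"])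
  qed
  have "?c ` vals mu = (\<lambda>n. ?c (nmul n \<gamma>)) ` {..<?e}"
  proof (intro equalityI subsetI)
    fix S assume "S \<in> ?c ` vals mu"
    then obtain \<alpha> where \<alpha>: "\<alpha> \<in> vals mu" "S = ?c \<alpha>" by blast
    then obtain \<delta> n where d: "\<delta> \<in> vals w" "\<alpha> = \<delta> + nmul n \<gamma>" using vals_mu by blast
    have "\<delta> + nmul n \<gamma> - nmul n \<gamma> = \<delta>" by simp
    hence "\<delta> + nmul n \<gamma> - nmul n \<gamma> \<in> vals w" using d(1) by metis
    hence "?c (\<delta> + nmul n \<gamma>) = ?c (nmul n \<gamma>)" by (rule iffD2[OF coset])
    hence "S = ?c (nmul n \<gamma>)" unfolding \<alpha>(2) d(2) .
    also have "\<dots> = ?c (nmul (n mod ?e) \<gamma>)"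
      using eq[of "n mod ?e" n] by (simp add: minus_mod_eq_mult_div)
    finally show "S \<in> (\<lambda>n. ?c (nmul n \<gamma>)) ` {..<?e}" using rel_index(1) by auto
  next
    fix S assume "S \<in> (\<lambda>n. ?c (nmul n \<gamma>)) ` {..<?e}"
    then obtain n where "S = ?c (nmul n \<gamma>)" by blast
    moreover have "nmul n \<gamma> \<in> vals mu" unfolding vals_mu using vals_w_group(1) by force
    ultimately show "S \<in> ?c ` vals mu" by blast
  qed
  moreover have "inj_on (\<lambda>n. ?c (nmul n \<gamma>)) {..<?e}"
  proof (rule linorder_inj_onI)
    fix i j assume ij: "i < j" "i \<in> {..<?e}" "j \<in> {..<?e}"
    hence "\<not> ?e dvd j - i" by (auto dest: dvd_imp_le)
    thus "?c (nmul i \<gamma>) \<noteq> ?c (nmul j \<gamma>)" using eq[of i j] ij by simp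
  qed auto
  ultimately show ?thesis by (simp add: grp_index_def card_image)
qed

text \<open>Compare \<open>deg \<phi> = EE FF\<close> with the corresponding formula for the key polynomial.\<close>

lemma next_FF:
  assumes \<psi>: "\<psi> \<in> KP mu" and less: "degree \<phi> < degree \<psi>"
  shows "orthogonal_limit.FF v (augment mu \<psi> Infty) \<psi> B = (smax \<psi> div rel_index mu \<phi>) * FF"
    "rel_index mu \<phi> dvd smax \<psi>"
proof -
  interpret n: orthogonal_limit v "augment mu \<psi> Infty" \<psi> B by (rule next_orthogonal_limit[OF \<psi>])
  let ?e = "rel_index mu \<phi>" and ?l = "smax \<psi>"
  \<comment> \<open>The digit at l is 1, so the lowest digit has value l times \<gamma>; this lies
    in the value group of \<open>w\<close>, and the relative index divides l.\<close>
  have "T \<psi> 0 = T \<psi> ?l" using key_first_digit[OF \<psi> less] smax(1)[OF mu.KP_D(2)[OF \<psi>]] by simp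
  hence "w (digit \<phi> \<psi> 0) = Val (nmul ?l \<gamma>)"
    using key_leading_digit(2)[OF \<psi>] by (simp add: T_def val_one[OF w])
  hence "nmul ?l \<gamma> \<in> vals w" by (auto simp: vals_def)
  thus d: "?e dvd ?l" using rel_index(3) by blast
  have vn: "vals (augment mu \<psi> Infty) = vals mu" by (rule vals_next[OF \<psi> less])
  \<comment> \<open>The ramification index of the new level is that of the old one times the
    relative index; the residual degree then follows by division from the two degree
    formulas.\<close>
  have "n.EE = grp_index (vals mu) (vals w) * grp_index (vals w) (vals v)"
    unfolding n.EE_def vn
    by (rule grp_index_mult)
      (use vals_mu_group vals_w_group vals_group[OF v] vals_v_sub n.cosets_finite[unfolded vn] in auto)
  hence E: "n.EE = ?e * EE" by (simp add: grp_index_rel EE_def)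
  have "?l * degree \<phi> = n.EE * n.FF" using n.degree_eq key_leading_digit(1)[OF \<psi>] by simp
  hence "?l * (EE * FF) = ?e * EE * n.FF" using degree_eq E by simp
  hence "EE * (?l * FF) = EE * (?e * n.FF)" by (simp add: ac_simps)
  hence "?l * FF = ?e * n.FF" using EE_pos by simp
  moreover obtain k where k: "?l = ?e * k" using d by blast
  ultimately have "?e * (k * FF) = ?e * n.FF" by (simp add: mult.assoc)
  thus "n.FF = (?l div ?e) * FF" using rel_index(1) k by simp
qed

end

end

section \<open>Residues of polynomials\<close>

text \<open>Spans are described by lists of coefficients; this replaces a list of residues by the
  residues of a coefficient function on the indices.\<close>

lemma set_subset_image_map:
  assumes "length Ks = length js" "distinct js" "set Ks \<subseteq> f ` S"
  shows "\<exists>c. (\<forall>i\<in>set js. c i \<in> S) \<and> Ks = map (\<lambda>i. f (c i)) js"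
  using assms
proof (induction Ks js rule: list_induct2)
  case (Cons k Ks j js)
  then obtain c where c: "\<forall>i\<in>set js. c i \<in> S" "Ks = map (\<lambda>i. f (c i)) js" by auto
  obtain s where "s \<in> S" "k = f s" using Cons.prems by auto
  thus ?case using c Cons.prems(1) by (intro exI[of _ "c(j := s)"]) auto
qed simp

text \<open>A finite list generating over \<open>K\<close> also generates over
  \<open>F\<close>.\<close>

lemma (in ring) finite_dimension_overfield:
  assumes K: "subfield K R" and F: "subfield F R" and E: "subfield E R"
    and sub: "K \<subseteq> F" "F \<subseteq> E" and fin: "finite_dimension K E"
  shows "finite_dimension F E"
proof -
  obtain n where "dimension n K E" using fin by blast
  then obtain Us where Us: "set Us \<subseteq> carrier R" "Span K Us = E" using exists_base[OF K] by blast
  have UE: "set Us \<subseteq> E" using Span_base_incl[OF K Us(1)] Us(2) by simp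
  have alg: "subalgebra F E R"
  proof (rule subalgebra.intro)
    show "subgroup E (add_monoid R)" using subring.axioms(1)[OF subfieldE(1)[OF E]] .
    show "subalgebra_axioms F E R"
      using subringE(6)[OF subfieldE(1)[OF E]] sub(2) by unfold_locales blast
  qed
  have "K <#> set Us \<subseteq> F <#> set Us" using sub(1) by (auto simp: set_mult_def)
  also have "\<dots> \<subseteq> Span F Us" by (rule Span_incl[OF F Us(1)])
  finally have "Span K Us \<subseteq> Span F Us" using Span_min[OF K Us(1) Span_is_add_subgroup[OF F Us(1)]] by blast
  hence "Span F Us = E" using subalgebra_Span_incl[OF F alg UE] Us(2) by blast
  thus ?thesis using Span_finite_dimension[OF F Us(1)] by simp
qed

text \<open>An abstract residue map on polynomials of nonnegative value, so that the same arguments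
  serve the residue fields of K(x) and of K[x]/(g).\<close>

locale residue_map = field R
  for R :: "('r, 'm) ring_scheme" (structure) +
  fixes v :: "'a :: field \<Rightarrow> 'g :: linordered_ab_group_add vinf" and u :: "'a poly \<Rightarrow> 'g vinf"
    and \<rho> :: "'a poly \<Rightarrow> 'r"
  assumes v_val: "valuation v" and u_val: "valuation u" and u_const: "u [:a:] = v a"
    and res_closed: "0 \<le> u f \<Longrightarrow> \<rho> f \<in> carrier R"
    and res_add: "0 \<le> u f \<Longrightarrow> 0 \<le> u h \<Longrightarrow> \<rho> (f + h) = \<rho> f \<oplus> \<rho> h"
    and res_mult: "0 \<le> u f \<Longrightarrow> 0 \<le> u h \<Longrightarrow> \<rho> (f * h) = \<rho> f \<otimes> \<rho> h"
    and res_one: "\<rho> 1 = \<one>"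
    and res_eq: "0 \<le> u f \<Longrightarrow> 0 \<le> u h \<Longrightarrow> \<rho> f = \<rho> h \<longleftrightarrow> 0 < u (f - h)"
begin

definition constants :: "'r set" where "constants = {\<rho> [:a:] | a. 0 \<le> v a}"

lemma u_smult: "u (smult a f) = v a + u f"
  using val_mult[OF u_val, of "[:a:]" f] by (simp add: u_const)

lemma u_zero: "u 0 = Infty" and u_one: "u 1 = 0" using val_zero[OF u_val] val_one[OF u_val] by auto

lemma res_zero: "\<rho> 0 = \<zero>"
proof -
  have "\<rho> 0 \<oplus> \<rho> 0 = \<rho> 0" using res_add[of 0 0] by (simp add: u_zero)
  thus ?thesis using res_closed[of 0] by (simp add: u_zero)
qed

lemma res_eq_zero: "0 \<le> u f \<Longrightarrow> \<rho> f = \<zero> \<longleftrightarrow> 0 < u f"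
  using res_eq[of f 0] by (simp add: u_zero res_zero)

lemma res_uminus: "0 \<le> u f \<Longrightarrow> \<rho> (- f) = \<ominus> \<rho> f"
proof -
  assume f: "0 \<le> u f"
  hence "\<rho> (- f) \<oplus> \<rho> f = \<zero>" using res_add[of "- f" f] by (simp add: val_uminus[OF u_val] res_zero)
  thus ?thesis using f res_closed[of f] res_closed[of "- f"] by (simp add: minus_equality val_uminus[OF u_val])
qed

text \<open>In the applications \<open>V\<close> consists of the constants or of the polynomials of
  degree less than that of \<open>\<phi>\<close>; the latter are closed under products only up to
  terms of positive value.\<close>

lemma subfield_residues:
  assumes one: "1 \<in> V" and uminus: "\<And>f. f \<in> V \<Longrightarrow> 0 \<le> u f \<Longrightarrow> - f \<in> V"
    and add: "\<And>f h. f \<in> V \<Longrightarrow> h \<in> V \<Longrightarrow> f + h \<in> V"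
    and mult: "\<And>f h. f \<in> V \<Longrightarrow> h \<in> V \<Longrightarrow> 0 \<le> u f \<Longrightarrow> 0 \<le> u h \<Longrightarrow> \<exists>s\<in>V. 0 < u (f * h - s)"
    and inverse: "\<And>f. f \<in> V \<Longrightarrow> u f = 0 \<Longrightarrow> \<exists>h\<in>V. 0 < u (f * h - 1)"
  shows "subfield {\<rho> f | f. f \<in> V \<and> 0 \<le> u f} R" (is "subfield ?E R")
proof (rule subfieldI'[OF subringI])
  show "?E \<subseteq> carrier R" using res_closed by blast
  show "\<one> \<in> ?E" using one u_one res_one by (intro CollectI exI[of _ 1]) simp
  fix y assume "y \<in> ?E"
  then obtain f where f: "y = \<rho> f" "f \<in> V" "0 \<le> u f" by blast
  show "\<ominus> y \<in> ?E" using f uminus[OF f(2,3)] res_uminus[OF f(3)]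
    by (intro CollectI exI[of _ "- f"]) (simp add: val_uminus[OF u_val])
next
  fix y y' assume "y \<in> ?E" "y' \<in> ?E"
  then obtain f f' where f: "y = \<rho> f" "f \<in> V" "0 \<le> u f" "y' = \<rho> f'" "f' \<in> V" "0 \<le> u f'" by blast
  have p: "0 \<le> u (f * f')" using f by (simp add: val_mult[OF u_val] add_nonneg_nonneg)
  obtain s where s: "s \<in> V" "0 < u (f * f' - s)" using mult[OF f(2,5,3,6)] by blast
  have "0 \<le> u (f * f' - (f * f' - s))" by (rule val_diff_ge[OF u_val]) (use p s(2) in auto)
  hence s0: "0 \<le> u s" by (simp add: algebra_simps)
  have "y \<otimes> y' = \<rho> s" using res_mult[OF f(3,6)] res_eq[OF p s0] s(2) f(1,4) by simp
  thus "y \<otimes> y' \<in> ?E" using s(1) s0 by blast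
  have "0 \<le> u (f + f')" using f by (intro val_add_ge[OF u_val])
  thus "y \<oplus> y' \<in> ?E" using f add[OF f(2,5)] res_add[OF f(3,6)] by (intro CollectI exI[of _ "f + f'"]) simp
next
  fix y assume y: "y \<in> ?E - {\<zero>}"
  then obtain f where f: "y = \<rho> f" "f \<in> V" "0 \<le> u f" by blast
  hence f0: "u f = 0" using y res_eq_zero[OF f(3)] by auto
  obtain h where h: "h \<in> V" "0 < u (f * h - 1)" using inverse[OF f(2) f0] by blast
  have "u (f * h) = 0" using val_eq_of_diff[OF u_val, of 1 "f * h"] h(2) val_uminus[OF u_val, of "f * h - 1"]
    by (simp add: u_one)
  hence h0: "u h = 0" by (simp add: val_mult[OF u_val] f0)
  have "y \<otimes> \<rho> h = \<one>"
    using res_mult[of f h] res_eq[of "f * h" 1] h(2) by (simp add: f f0 h0 u_one res_one \<open>u (f * h) = 0\<close>)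
  hence "inv y = \<rho> h" using comm_inv_char[of y "\<rho> h"] res_closed[of f] res_closed[of h] by (simp add: f f0 h0)
  thus "inv y \<in> ?E" using h(1) h0 by auto
qed

lemma subfield_constants: "subfield constants R"
proof -
  have "subfield {\<rho> f | f. f \<in> range (\<lambda>a. [:a:]) \<and> 0 \<le> u f} R"
  proof (rule subfield_residues)
    show "1 \<in> range (\<lambda>a. [:a::'a:])" by (simp add: one_pCons)
  next
    fix f h assume "f \<in> range (\<lambda>a. [:a::'a:])" "h \<in> range (\<lambda>a. [:a::'a:])"
    then obtain a b where ab: "f = [:a:]" "h = [:b:]" by blast
    show "f + h \<in> range (\<lambda>a. [:a::'a:])" using ab by simp
    show "\<exists>s\<in>range (\<lambda>a. [:a::'a:]). 0 < u (f * h - s)"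
    proof (rule bexI)
      have "f * h - [:a * b:] = 0" unfolding ab by simp
      thus "0 < u (f * h - [:a * b:])" by (simp add: u_zero)
    qed simp
  next
    fix f assume "f \<in> range (\<lambda>a. [:a::'a:])" "u f = 0"
    then obtain a where a: "f = [:a:]" by blast
    have "a \<noteq> 0"
    proof
      assume "a = 0"
      hence "u f = Infty" using a u_zero by simp
      thus False using \<open>u f = 0\<close> by simp
    qed
    hence "f * [:inverse a:] - 1 = 0" unfolding a by simp
    hence "0 < u (f * [:inverse a:] - 1)" by (simp add: u_zero)
    thus "\<exists>h\<in>range (\<lambda>a. [:a::'a:]). 0 < u (f * h - 1)" by (rule bexI[of _ "[:inverse a:]"]) simp
  next
    show "- f \<in> range (\<lambda>a. [:a::'a:])" if "f \<in> range (\<lambda>a. [:a::'a:])" for f using that by force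
  qed
  moreover have "constants = {\<rho> f | f. f \<in> range (\<lambda>a. [:a:]) \<and> 0 \<le> u f}"
    by (auto simp: constants_def u_const)
  ultimately show ?thesis by simp
qed

lemma combine_residues:
  assumes "distinct js" "\<And>j. j \<in> set js \<Longrightarrow> 0 \<le> u (z j) \<and> 0 \<le> v (c j)"
  shows "combine (map (\<lambda>j. \<rho> [:c j:]) js) (map (\<lambda>j. \<rho> (z j)) js) = \<rho> (\<Sum>j\<in>set js. smult (c j) (z j))"
    "0 \<le> u (\<Sum>j\<in>set js. smult (c j) (z j))"
proof -
  have nn: "0 \<le> u (\<Sum>j\<in>set is. smult (c j) (z j))" if "set is \<subseteq> set js" for "is"
    using that assms(2) by (intro val_sum_ge[OF u_val]) (auto simp: u_smult intro!: add_nonneg_nonneg)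
  show "0 \<le> u (\<Sum>j\<in>set js. smult (c j) (z j))" by (rule nn) simp
  have "combine (map (\<lambda>j. \<rho> [:c j:]) is) (map (\<lambda>j. \<rho> (z j)) is) = \<rho> (\<Sum>j\<in>set is. smult (c j) (z j))"
    if "set is \<subseteq> set js" "distinct is" for "is"
    using that
  proof (induction "is")
    case (Cons i "is")
    have i: "0 \<le> u (z i)" "0 \<le> u [:c i:]" using Cons.prems assms(2) by (auto simp: u_const)
    have "(\<Sum>j\<in>set (i # is). smult (c j) (z j)) = [:c i:] * z i + (\<Sum>j\<in>set is. smult (c j) (z j))"
      using Cons.prems by simp
    moreover have "0 \<le> u ([:c i:] * z i)" unfolding val_mult[OF u_val] using i by (intro add_nonneg_nonneg)
    ultimately show ?case using Cons res_mult[OF i(2,1)] nn[of "is"] by (simp add: res_add)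
  qed (simp add: res_zero)
  thus "combine (map (\<lambda>j. \<rho> [:c j:]) js) (map (\<lambda>j. \<rho> (z j)) js) = \<rho> (\<Sum>j\<in>set js. smult (c j) (z j))"
    using assms(1) by blast
qed

text \<open>A residue in the span of others lifts to a combination of positive value in which one
  coefficient is 1, against orthogonality.\<close>

lemma independent_residues:
  assumes fin: "finite J" and z: "\<And>j. j \<in> J \<Longrightarrow> 0 \<le> u (z j)"
    and orth: "\<And>c i. i \<in> J \<Longrightarrow> u (\<Sum>j\<in>J. smult (c j) (z j)) \<le> v (c i)"
  shows "distinct js \<Longrightarrow> set js \<subseteq> J \<Longrightarrow> independent constants (map (\<lambda>j. \<rho> (z j)) js)"
proof (induction js)
  case (Cons j js)
  have car: "set (map (\<lambda>j. \<rho> (z j)) js) \<subseteq> carrier R" using Cons.prems z res_closed by auto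
  have "\<rho> (z j) \<notin> Span constants (map (\<lambda>j. \<rho> (z j)) js)"
  proof
    assume "\<rho> (z j) \<in> Span constants (map (\<lambda>j. \<rho> (z j)) js)"
    then obtain Ks where Ks: "\<rho> (z j) = combine Ks (map (\<lambda>j. \<rho> (z j)) js)" "length Ks = length js" "set Ks \<subseteq> constants"
      using Span_eq_combine_set_length_version[OF subfield_constants car] by auto
    have "constants = (\<lambda>a. \<rho> [:a:]) ` {a. 0 \<le> v a}" by (auto simp: constants_def)
    then obtain c where c: "\<forall>i\<in>set js. c i \<in> {a. 0 \<le> v a}" "Ks = map (\<lambda>i. \<rho> [:c i:]) js"
      using set_subset_image_map[OF Ks(2), of "\<lambda>a. \<rho> [:a:]" "{a. 0 \<le> v a}"] Cons.prems(1) Ks(3) by auto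
    have dj: "distinct js" "set js \<subseteq> J" using Cons.prems by auto
    have comb: "\<rho> (z j) = \<rho> (\<Sum>i\<in>set js. smult (c i) (z i))" "0 \<le> u (\<Sum>i\<in>set js. smult (c i) (z i))"
      using combine_residues[OF dj(1), of z c] Ks(1) c z dj(2) by auto
    have zj: "0 \<le> u (z j)" using z Cons.prems by simp
    have less: "0 < u (z j - (\<Sum>i\<in>set js. smult (c i) (z i)))" using comb res_eq[OF zj comb(2)] by simp
    define d where "d i = (if i = j then 1 else if i \<in> set js then - c i else 0)" for i
    have "(\<Sum>i\<in>J. smult (d i) (z i)) = (\<Sum>i\<in>insert j (set js). smult (d i) (z i))"
      using fin Cons.prems by (intro sum.mono_neutral_right) (auto simp: d_def)
    also have "\<dots> = z j + (\<Sum>i\<in>set js. smult (d i) (z i))" using Cons.prems by (simp add: d_def)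
    also have "(\<Sum>i\<in>set js. smult (d i) (z i)) = (\<Sum>i\<in>set js. - smult (c i) (z i))"
      using Cons.prems by (intro sum.cong) (auto simp: d_def)
    finally have "0 < u (\<Sum>i\<in>J. smult (d i) (z i))" using less by (simp add: sum_negf)
    moreover have "u (\<Sum>i\<in>J. smult (d i) (z i)) \<le> v (d j)" using Cons.prems by (intro orth) auto
    ultimately show False by (simp add: d_def val_one[OF v_val])
  qed
  thus ?case using Cons li_Cons[of "\<rho> (z j)"] z res_closed by simp
qed simp

text \<open>After division by a coefficient of least value, a combination of too large a value would
  reduce to a nontrivial relation between the residues.\<close>

lemma independent_residues_imp:
  assumes ind: "independent constants (map (\<lambda>j. \<rho> (z j)) js)" and dist: "distinct js"
    and z: "\<And>j. j \<in> set js \<Longrightarrow> 0 \<le> u (z j)" and i: "i \<in> set js"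
  shows "u (\<Sum>j\<in>set js. smult (c j) (z j)) \<le> v (c i)"
proof -
  obtain k where k: "k \<in> set js" "\<And>j. j \<in> set js \<Longrightarrow> v (c k) \<le> v (c j)"
    using ex_is_arg_min_if_finite[OF finite_set, of js "\<lambda>j. v (c j)"] i unfolding is_arg_min_linorder by (metis empty_iff)
  have "u (\<Sum>j\<in>set js. smult (c j) (z j)) \<le> v (c k)"
  proof (rule ccontr)
    assume "\<not> u (\<Sum>j\<in>set js. smult (c j) (z j)) \<le> v (c k)"
    hence less: "v (c k) < u (\<Sum>j\<in>set js. smult (c j) (z j))" by simp
    hence ck: "c k \<noteq> 0" using val_zero[OF v_val] by (auto simp: not_less)
    define d where "d j = inverse (c k) * c j" for j
    have vinv: "v (inverse (c k)) + v (c k) = 0" using val_mult[OF v_val, of "inverse (c k)" "c k"] ck by (simp add: val_one[OF v_val])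
    hence vf: "v (inverse (c k)) \<noteq> Infty" by auto
    have d0: "0 \<le> v (d j)" if "j \<in> set js" for j
    proof -
      have "0 = v (inverse (c k)) + v (c k)" using vinv by simp
      also have "\<dots> \<le> v (d j)" unfolding d_def val_mult[OF v_val] by (rule add_left_mono[OF k(2)[OF that]])
      finally show ?thesis .
    qed
    have "(\<Sum>j\<in>set js. smult (d j) (z j)) = smult (inverse (c k)) (\<Sum>j\<in>set js. smult (c j) (z j))"
      by (simp add: smult_sum_right d_def)
    hence "u (\<Sum>j\<in>set js. smult (d j) (z j)) = v (inverse (c k)) + u (\<Sum>j\<in>set js. smult (c j) (z j))"
      by (simp add: u_smult)
    moreover have "v (inverse (c k)) + v (c k) < v (inverse (c k)) + u (\<Sum>j\<in>set js. smult (c j) (z j))"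
      using vinf_add_strict_mono(2)[OF less _ vf] by simp
    ultimately have pos: "0 < u (\<Sum>j\<in>set js. smult (d j) (z j))" using vinv by simp
    have comb: "combine (map (\<lambda>j. \<rho> [:d j:]) js) (map (\<lambda>j. \<rho> (z j)) js) = \<zero>"
      using combine_residues[OF dist, of z d] z d0 pos res_eq_zero by simp
    have "set (map (\<lambda>j. \<rho> [:d j:]) js) \<subseteq> constants" using d0 by (auto simp: constants_def)
    from independent_imp_trivial_combine[OF subfield_constants ind this comb]
    have "\<rho> [:d k:] = \<zero>" using k(1) by auto
    moreover have "[:d k:] = 1" using ck by (simp add: d_def)
    ultimately show False using res_one one_not_zero by simp
  qed
  thus ?thesis using k(2)[OF i] by simp
qed

end

text \<open>The residues of polynomials of small degree can be read in any valuation
  \<open>u\<close> that agrees with \<open>w\<close> there and in which products may be reduced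
  modulo \<open>\<phi>\<close> without changing residues. This covers the valuation of the same
  level, that of the next level, and the one attached to \<open>G\<close>.\<close>

locale orthogonal_residue =
  orthogonal_limit v w \<phi> b + residue_map R v u \<rho>
  for v :: "'a :: field \<Rightarrow> 'g :: linordered_ab_group_add vinf" and w \<phi> b and R :: "('r, 'm) ring_scheme" (structure)
    and u \<rho> +
  assumes u_low: "degree f < degree \<phi> \<Longrightarrow> u f = w f"
    and u_prod: "degree f < degree \<phi> \<Longrightarrow> degree s < degree \<phi> \<Longrightarrow> 0 \<le> w f \<Longrightarrow> 0 \<le> w s \<Longrightarrow> 0 < u (f * s - (f * s) mod \<phi>)"
begin

definition residues :: "'r set" where "residues = {\<rho> f | f. degree f < degree \<phi> \<and> 0 \<le> w f}"

lemma residues_eq: "residues = {\<rho> f | f. f \<in> {f. degree f < degree \<phi>} \<and> 0 \<le> u f}"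
  unfolding residues_def using u_low by auto

lemma subfield_low_residues: "subfield residues R"
  unfolding residues_eq
proof (rule subfield_residues)
  show "1 \<in> {f. degree f < degree \<phi>}" using deg by simp
next
  fix f q :: "'a poly" assume fh: "f \<in> {f. degree f < degree \<phi>}" "q \<in> {f. degree f < degree \<phi>}"
  thus "f + q \<in> {f. degree f < degree \<phi>}" using degree_add_less by auto
  assume "0 \<le> u f" "0 \<le> u q"
  thus "\<exists>s\<in>{f. degree f < degree \<phi>}. 0 < u (f * q - s)"
    using fh u_prod[of f q] u_low degree_mod[of "f * q"] by (intro bexI[of _ "(f * q) mod \<phi>"]) auto
next
  fix f :: "'a poly" assume f: "f \<in> {f. degree f < degree \<phi>}" "u f = 0"
  hence wf: "w f = 0" using u_low by simp
  hence "\<not> \<phi> dvd f" using supp[of f] by auto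
  then obtain q where q: "degree q < degree \<phi>" "w (f * q - 1) = Infty" using ex_inverse by blast
  have wfh: "w (f * q) = 0" using val_eq_of_diff[OF w, of 1 "f * q"] val_uminus[OF w, of "f * q - 1"] q(2)
    by (simp add: val_one[OF w])
  hence wh: "w q = 0" using wf by (simp add: val_mult[OF w])
  have "\<phi> dvd f * q - 1" using q(2) supp by blast
  hence "(f * q) mod \<phi> = 1 mod \<phi>" by (simp add: mod_eq_dvd_iff)
  hence "(f * q) mod \<phi> = 1" using deg by (simp add: mod_poly_less)
  thus "\<exists>q\<in>{f. degree f < degree \<phi>}. 0 < u (f * q - 1)" using u_prod[of f q] f q wf wh by auto
qed (use deg in auto)

text \<open>The residues of the \<open>h j\<close> form a basis: \<open>h_orth\<close> gives
  independence and \<open>h_span\<close> generation.\<close>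

lemma dimension_low_residues: "dimension FF constants residues"
proof -
  obtain js where js: "set js = cls 0" "distinct js" using finite_distinct_list[OF finite_cls] by blast
  let ?Us = "map (\<lambda>j. \<rho> (h j)) js"
  have uh: "u (h j) = 0" if "j \<in> cls 0" for j using h(1,2)[OF that] u_low by simp
  have low: "degree (\<Sum>j\<in>cls 0. smult (c j) (h j)) < degree \<phi>" for c
    using deg h(2) by (intro degree_sum_less) (auto intro: le_less_trans[OF degree_smult_le])
  have ind: "independent constants ?Us"
  proof (rule independent_residues[OF finite_cls])
    show "u (\<Sum>j\<in>cls 0. smult (c j) (h j)) \<le> v (c i)" if "i \<in> cls 0" for c i
      using h_orth[OF that, of c] u_low[OF low] by simp
  qed (use js uh in auto)
  have car: "set ?Us \<subseteq> carrier R" using js uh res_closed by auto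
  have "Span constants ?Us = residues"
  proof (intro equalityI subsetI)
    fix y assume "y \<in> Span constants ?Us"
    then obtain Ks where Ks: "y = combine Ks ?Us" "length Ks = length js" "set Ks \<subseteq> constants"
      using Span_eq_combine_set_length_version[OF subfield_constants car] by auto
    have "constants = (\<lambda>a. \<rho> [:a:]) ` {a. 0 \<le> v a}" by (auto simp: constants_def)
    then obtain c where c: "\<forall>i\<in>set js. c i \<in> {a. 0 \<le> v a}" "Ks = map (\<lambda>i. \<rho> [:c i:]) js"
      using set_subset_image_map[OF Ks(2) js(2), of "\<lambda>a. \<rho> [:a:]" "{a. 0 \<le> v a}"] Ks(3) by auto
    have "y = \<rho> (\<Sum>i\<in>cls 0. smult (c i) (h i))" "0 \<le> u (\<Sum>i\<in>cls 0. smult (c i) (h i))"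
      using combine_residues[OF js(2), of h c] Ks(1) c uh js(1) by auto
    thus "y \<in> residues" using low u_low by (auto simp: residues_def)
  next
    fix y assume "y \<in> residues"
    then obtain f where f: "y = \<rho> f" "degree f < degree \<phi>" "0 \<le> w f" by (auto simp: residues_def)
    obtain c where c: "\<forall>j\<in>cls 0. 0 \<le> v (c j)" "0 < w (f - (\<Sum>j\<in>cls 0. smult (c j) (h j)))"
      using h_span[OF f(2,3)] by blast
    have comb: "combine (map (\<lambda>j. \<rho> [:c j:]) js) ?Us = \<rho> (\<Sum>j\<in>cls 0. smult (c j) (h j))"
      "0 \<le> u (\<Sum>j\<in>cls 0. smult (c j) (h j))"
      using combine_residues[OF js(2), of h c] c uh js(1) by auto
    have "0 < u (f - (\<Sum>j\<in>cls 0. smult (c j) (h j)))" using c(2) u_low degree_diff_less[OF f(2) low] by simp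
    hence "y = combine (map (\<lambda>j. \<rho> [:c j:]) js) ?Us"
      using comb res_eq[of f] f u_low by simp
    moreover have "set (map (\<lambda>j. \<rho> [:c j:]) js) \<subseteq> constants" using c(1) js(1) by (auto simp: constants_def)
    ultimately show "y \<in> Span constants ?Us"
      unfolding Span_eq_combine_set_length_version[OF subfield_constants car]
      by (intro CollectI exI[of _ "map (\<lambda>j. \<rho> [:c j:]) js"]) simp
  qed
  moreover have "length ?Us = FF" using js by (simp add: FF_def distinct_card[symmetric])
  ultimately show ?thesis using dimensionI[OF subfield_constants ind] by simp
qed

lemma constants_sub_residues: "constants \<subseteq> residues"
proof
  fix y assume "y \<in> constants"
  then obtain a where "y = \<rho> [:a:]" "0 \<le> v a" by (auto simp: constants_def)
  thus "y \<in> residues" unfolding residues_def using deg w_const by (intro CollectI exI[of _ "[:a:]"]) simp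
qed

end

section \<open>The bound for products of representatives of values and of residues\<close>

context valued_closure
begin

text \<open>Inner sums over \<open>J\<close> have values in \<Gamma> (or vanish in value), while the
  \<open>f i\<close> lie in different cosets of \<Gamma>; hence outer terms of finite value have
  pairwise different values. So the products form an orthogonal family, to which
  \<open>orthogonal_family_bound\<close> applies.\<close>

lemma orthogonal_product_bound:
  fixes f :: "'c \<Rightarrow> 'a poly" and z :: "'d \<Rightarrow> 'a poly"
  assumes G: "G \<in> Irr_over Kh" and w: "valuation (w_of vb G)"
    and fin: "finite I" "finite J"
    and f: "\<And>i. i \<in> I \<Longrightarrow> w_of vb G (f i) = Val (\<alpha> i)"
    and coset: "\<And>i j. i \<in> I \<Longrightarrow> j \<in> I \<Longrightarrow> i \<noteq> j \<Longrightarrow> \<alpha> i - \<alpha> j \<notin> vals v"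
    and z: "\<And>j. j \<in> J \<Longrightarrow> 0 \<le> w_of vb G (z j)"
    and orth: "\<And>c i. i \<in> J \<Longrightarrow> w_of vb G (\<Sum>j\<in>J. smult (c j) (z j)) \<le> v (c i)"
  shows "card I * card J \<le> degree G"
proof -
  let ?w = "w_of vb G"
  have "degree G > 0" using G by (simp add: Irr_over_def)
  then obtain \<theta> where \<theta>: "poly G \<theta> = 0" using alg_closed_imp_poly_has_root by blast
  note w_eq = w_of_eq[OF G \<theta>]
  have w_const: "?w [:c:] = v c" for c by (simp add: w_eq vb_to_ac)
  have w_smult: "?w (smult c h) = v c + ?w h" for c h
    using val_mult[OF w, of "[:c:]" h] by (simp add: w_const)
  have zv: "?w (z j) = 0" if "j \<in> J" for j
  proof -
    have "(\<Sum>i\<in>J. smult (if i = j then 1 else 0) (z i)) = (\<Sum>i\<in>J. if i = j then z i else 0)"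
      by (intro sum.cong) auto
    also have "\<dots> = z j" using fin(2) that by simp
    finally have "?w (z j) \<le> v 1" using orth[OF that, of "\<lambda>i. if i = j then 1 else 0"] by simp
    thus ?thesis using z[OF that] by (simp add: val_one[OF v])
  qed
  define S where "S c i = (\<Sum>j\<in>J. smult (c (i, j)) (z j))" for c :: "'c \<times> 'd \<Rightarrow> 'a" and i
  have S_le: "?w (S c i) \<le> v (c (i, j))" if "j \<in> J" for c i j
    unfolding S_def using orth[OF that, of "\<lambda>j. c (i, j)"] .
  \<comment> \<open>The value of an inner sum is the least value of its coefficients, since all
    \<open>z j\<close> have value 0.\<close>
  have S_val: "?w (S c i) = Infty \<or> (\<exists>\<delta>\<in>vals v. ?w (S c i) = Val \<delta>)" for c i
  proof (cases "J = {}")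
    case True thus ?thesis by (simp add: S_def val_zero[OF w])
  next
    case False
    then obtain k where k: "k \<in> J" "\<And>j. j \<in> J \<Longrightarrow> v (c (i, k)) \<le> v (c (i, j))"
      using ex_is_arg_min_if_finite[OF fin(2), of "\<lambda>j. v (c (i, j))"] unfolding is_arg_min_linorder by blast
    have "v (c (i, k)) \<le> ?w (S c i)"
      unfolding S_def using k(2) by (intro val_sum_ge[OF w]) (auto simp: w_smult zv)
    hence "?w (S c i) = v (c (i, k))" using S_le[OF k(1), of c i] by simp
    thus ?thesis by (cases "v (c (i, k))") (auto simp: vals_def)
  qed
  have main: "?w (\<Sum>i\<in>I. f i * S c i) \<le> ?w (f i * S c i)" if i: "i \<in> I" for c i
  proof (cases "\<forall>i\<in>I. ?w (f i * S c i) = Infty")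
    case True thus ?thesis using i by simp
  next
    case False
    obtain k where k: "k \<in> I" "\<And>i. i \<in> I \<Longrightarrow> ?w (f k * S c k) \<le> ?w (f i * S c i)"
      using ex_is_arg_min_if_finite[OF fin(1), of "\<lambda>i. ?w (f i * S c i)"] i unfolding is_arg_min_linorder by (metis empty_iff)
    have kf: "?w (f k * S c k) \<noteq> Infty" using False k(2) by (metis less_eq_vinf.elims(2) less_eq_vinf.simps(2) vinf.exhaust)
    have strict: "?w (f k * S c k) < ?w (f i * S c i)" if i: "i \<in> I" "i \<noteq> k" for i
    proof (rule ccontr)
      assume "\<not> ?w (f k * S c k) < ?w (f i * S c i)"
      hence eq: "?w (f k * S c k) = ?w (f i * S c i)" using k(2)[OF i(1)] by simp
      obtain \<delta> \<epsilon> where d: "\<delta> \<in> vals v" "\<epsilon> \<in> vals v" "?w (S c k) = Val \<delta>" "?w (S c i) = Val \<epsilon>"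
        using S_val[of c k] S_val[of c i] kf eq by (auto simp: val_mult[OF w] f[OF k(1)] f[OF i(1)])
      have "\<alpha> k + \<delta> = \<alpha> i + \<epsilon>" using eq by (simp add: val_mult[OF w] f[OF k(1)] f[OF i(1)] d)
      hence "\<alpha> i - \<alpha> k = \<delta> - \<epsilon>" by (simp add: algebra_simps)
      moreover have "\<delta> - \<epsilon> \<in> vals v" using d(1,2) vals_group(2)[OF v] by blast
      ultimately show False using coset[OF i(1) k(1) i(2)] by simp
    qed
    have "?w (\<Sum>i\<in>I. f i * S c i) = ?w (f k * S c k)"
      by (rule val_sum_dominant[OF w fin(1) k(1)]) (rule strict)
    thus ?thesis using k(2)[OF i] by simp
  qed
  have "card (I \<times> J) \<le> degree G"
  proof (rule orthogonal_family_bound[OF G \<theta>, of "I \<times> J" "\<lambda>(i, j). f i * z j"])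
    fix p assume p: "p \<in> I \<times> J"
    show "poly (ac_poly (case p of (i, j) \<Rightarrow> f i * z j)) \<theta> \<noteq> 0"
    proof
      assume "poly (ac_poly (case p of (i, j) \<Rightarrow> f i * z j)) \<theta> = 0"
      hence "?w (case p of (i, j) \<Rightarrow> f i * z j) = Infty" by (simp add: w_eq vb_eq_Infty)
      thus False using p f zv by (auto simp: val_mult[OF w])
    qed
    fix c :: "'c \<times> 'd \<Rightarrow> 'a"
    have "(\<Sum>q\<in>I \<times> J. to_ac (c q) * poly (ac_poly (case q of (i, j) \<Rightarrow> f i * z j)) \<theta>)
        = poly (ac_poly (\<Sum>i\<in>I. f i * S c i)) \<theta>"
    proof -
      have sm: "ac_poly (smult a p) = smult (to_ac a) (ac_poly p)" for a p
        by (rule poly_eqI) (simp add: coeff_map_poly)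
      have "poly (ac_poly (\<Sum>i\<in>I. f i * S c i)) \<theta> = (\<Sum>i\<in>I. \<Sum>j\<in>J. to_ac (c (i, j)) * poly (ac_poly (f i * z j)) \<theta>)"
        unfolding S_def
        by (simp add: to_ac.mp_sum poly_sum to_ac.mp_mult sum_distrib_left sm polys_over_def)
      also have "\<dots> = (\<Sum>(i, j)\<in>I \<times> J. to_ac (c (i, j)) * poly (ac_poly (f i * z j)) \<theta>)"
        by (rule sum.cartesian_product)
      also have "\<dots> = (\<Sum>q\<in>I \<times> J. to_ac (c q) * poly (ac_poly (case q of (i, j) \<Rightarrow> f i * z j)) \<theta>)"
        by (rule sum.cong) auto
      finally show ?thesis by (rule sym)
    qed
    hence "vb (\<Sum>q\<in>I \<times> J. to_ac (c q) * poly (ac_poly (case q of (i, j) \<Rightarrow> f i * z j)) \<theta>) = ?w (\<Sum>i\<in>I. f i * S c i)"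
      by (simp add: w_eq)
    also have "\<dots> \<le> ?w (f (fst p) * S c (fst p))" using p by (intro main) auto
    also have "\<dots> \<le> ?w (f (fst p)) + v (c p)"
      unfolding val_mult[OF w] using S_le[of "snd p" c "fst p"] p by (intro add_left_mono) auto
    also have "\<dots> = v (c p) + vb (poly (ac_poly (case p of (i, j) \<Rightarrow> f i * z j)) \<theta>)"
      using p zv by (auto simp: w_eq[symmetric] val_mult[OF w] add.commute)
    finally show "vb (\<Sum>q\<in>I \<times> J. to_ac (c q) * poly (ac_poly (case q of (i, j) \<Rightarrow> f i * z j)) \<theta>)
        \<le> v (c p) + vb (poly (ac_poly (case p of (i, j) \<Rightarrow> f i * z j)) \<theta>)" .
  qed (use fin in simp)
  thus ?thesis by (simp add: card_cartesian_product)
qed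

end

section \<open>Residue fields\<close>

locale valued_field = field L for L :: "('r, 'm) ring_scheme" (structure) +
  fixes w :: "'r \<Rightarrow> 'g :: linordered_ab_group_add vinf"
  assumes w_zero: "w \<zero> = Infty" and w_one: "w \<one> = 0"
    and w_mult: "x \<in> carrier L \<Longrightarrow> y \<in> carrier L \<Longrightarrow> w (x \<otimes> y) = w x + w y"
    and w_add: "x \<in> carrier L \<Longrightarrow> y \<in> carrier L \<Longrightarrow> min (w x) (w y) \<le> w (x \<oplus> y)"
begin

abbreviation "\<O> \<equiv> val_ring L w"
abbreviation "\<mm> \<equiv> val_ideal L w"

lemma w_uminus: "x \<in> carrier L \<Longrightarrow> w (\<ominus> x) = w x"
proof -
  assume x: "x \<in> carrier L"
  have "w (\<ominus> \<one>) + w (\<ominus> \<one>) = 0" using w_mult[of "\<ominus> \<one>" "\<ominus> \<one>"] by (simp add: w_one l_minus)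
  hence "w (\<ominus> \<one>) = 0" by (cases "w (\<ominus> \<one>)") (auto simp: double_zero)
  thus ?thesis using w_mult[of "\<ominus> \<one>" x] x by (simp add: l_minus)
qed

lemma carrier_O: "carrier \<O> = {x \<in> carrier L. 0 \<le> w x}" by (simp add: val_ring_def)

lemma O_simps: "x \<otimes>\<^bsub>\<O>\<^esub> y = x \<otimes> y" "x \<oplus>\<^bsub>\<O>\<^esub> y = x \<oplus> y" "\<one>\<^bsub>\<O>\<^esub> = \<one>" "\<zero>\<^bsub>\<O>\<^esub> = \<zero>"
  by (simp_all add: val_ring_def)

lemma O_subring: "subring {x \<in> carrier L. 0 \<le> w x} L"
proof (rule subringI)
  fix x y assume "x \<in> {x \<in> carrier L. 0 \<le> w x}" "y \<in> {x \<in> carrier L. 0 \<le> w x}"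
  thus "x \<otimes> y \<in> {x \<in> carrier L. 0 \<le> w x}" "x \<oplus> y \<in> {x \<in> carrier L. 0 \<le> w x}"
    using w_add[of x y] by (auto simp: w_mult add_nonneg_nonneg min_def split: if_splits)
qed (auto simp: w_one w_uminus)

lemma O_cring: "cring \<O>"
  unfolding val_ring_def using O_subring subcring_iff[of "{x \<in> carrier L. 0 \<le> w x}"] subcringI'[OF O_subring] by simp

lemma O_uminus: "y \<in> carrier \<O> \<Longrightarrow> \<ominus>\<^bsub>\<O>\<^esub> y = \<ominus> y"
proof -
  assume y: "y \<in> carrier \<O>"
  interpret O: cring \<O> by (rule O_cring)
  have "\<ominus>\<^bsub>\<O>\<^esub> y \<oplus>\<^bsub>\<O>\<^esub> y = \<zero>\<^bsub>\<O>\<^esub>" "\<ominus>\<^bsub>\<O>\<^esub> y \<in> carrier \<O>" using y O.l_neg by simp_all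
  thus ?thesis using y minus_equality[of "\<ominus>\<^bsub>\<O>\<^esub> y" y] by (simp add: O_simps carrier_O)
qed

lemma O_minus: "y \<in> carrier \<O> \<Longrightarrow> x \<ominus>\<^bsub>\<O>\<^esub> y = x \<ominus> y"
  by (simp add: a_minus_def O_simps O_uminus)

lemma m_ideal: "ideal \<mm> \<O>"
proof (rule idealI)
  show "ring \<O>" using O_cring by (simp add: cring_def)
  interpret O: cring \<O> by (rule O_cring)
  show "subgroup \<mm> (add_monoid \<O>)"
  proof (rule O.add.subgroupI)
    show "\<mm> \<subseteq> carrier \<O>" by (auto simp: val_ideal_def carrier_O)
    show "\<mm> \<noteq> {}" using w_zero by (auto simp: val_ideal_def intro!: exI[of _ \<zero>])
    fix x assume x: "x \<in> \<mm>"
    hence xO: "x \<in> carrier \<O>" by (auto simp: val_ideal_def carrier_O)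
    show "\<ominus>\<^bsub>\<O>\<^esub> x \<in> \<mm>" using x by (simp add: O_uminus[OF xO] val_ideal_def w_uminus)
  next
    fix x y assume "x \<in> \<mm>" "y \<in> \<mm>"
    thus "x \<oplus>\<^bsub>\<O>\<^esub> y \<in> \<mm>" using w_add[of x y] by (auto simp: val_ideal_def O_simps min_def split: if_splits)
  qed
  have prod: "x \<otimes> a \<in> \<mm>" if "a \<in> \<mm>" "x \<in> carrier \<O>" for a x
  proof -
    have "0 + 0 < w a + w x" using that by (intro vinf_add_strict_mono(1)) (auto simp: val_ideal_def carrier_O)
    thus ?thesis using that by (auto simp: val_ideal_def carrier_O w_mult add.commute)
  qed
  fix a x assume a: "a \<in> \<mm>" "x \<in> carrier \<O>"
  show "x \<otimes>\<^bsub>\<O>\<^esub> a \<in> \<mm>" using prod[OF a] by (simp add: O_simps)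
  thus "a \<otimes>\<^bsub>\<O>\<^esub> x \<in> \<mm>" using a m_comm[of a x] by (simp add: O_simps val_ideal_def carrier_O)
qed

lemma m_maximal: "maximalideal \<mm> \<O>"
proof (rule maximalidealI[OF m_ideal])
  show "carrier \<O> \<noteq> \<mm>"
  proof
    assume "carrier \<O> = \<mm>"
    moreover have "\<one> \<in> carrier \<O>" by (simp add: carrier_O w_one)
    ultimately show False by (simp add: val_ideal_def w_one)
  qed
  fix J assume J: "ideal J \<O>" "\<mm> \<subseteq> J" "J \<subseteq> carrier \<O>"
  show "J = \<mm> \<or> J = carrier \<O>"
  proof (cases "J = \<mm>")
    case False
    then obtain x where x: "x \<in> J" "x \<notin> \<mm>" using J(2) by blast
    hence xL: "x \<in> carrier L" "w x = 0" using J(3) by (auto simp: val_ideal_def carrier_O)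
    have nz: "x \<noteq> \<zero>" using xL(2) w_zero by auto
    have inv: "inv x \<in> carrier L" "x \<otimes> inv x = \<one>" using xL(1) nz field_Units by auto
    hence "w (inv x) = 0" using w_mult[OF xL(1) inv(1)] xL(2) by (simp add: w_one)
    hence "inv x \<in> carrier \<O>" using inv by (simp add: carrier_O)
    hence "\<one> \<in> J" using ideal.I_r_closed[OF J(1) x(1), of "inv x"] inv(2) by (simp add: O_simps)
    hence "J = carrier \<O>" using ideal.one_imp_carrier[OF J(1)] by (simp add: O_simps)
    thus ?thesis by simp
  qed simp
qed

lemma residue_field_field: "field (residue_field L w)"
  unfolding residue_field_def by (rule maximalideal.quotient_is_field[OF m_maximal O_cring])

lemma carrier_residue_field: "carrier (residue_field L w) = {res_class L w x | x. x \<in> carrier L \<and> 0 \<le> w x}"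
  by (auto simp: residue_field_def FactRing_def A_RCOSETS_def' res_class_def carrier_O)

lemma res_class_add: "x \<in> carrier L \<Longrightarrow> y \<in> carrier L \<Longrightarrow> 0 \<le> w x \<Longrightarrow> 0 \<le> w y \<Longrightarrow>
    res_class L w (x \<oplus> y) = res_class L w x \<oplus>\<^bsub>residue_field L w\<^esub> res_class L w y"
  and res_class_mult: "x \<in> carrier L \<Longrightarrow> y \<in> carrier L \<Longrightarrow> 0 \<le> w x \<Longrightarrow> 0 \<le> w y \<Longrightarrow>
    res_class L w (x \<otimes> y) = res_class L w x \<otimes>\<^bsub>residue_field L w\<^esub> res_class L w y"
  and res_class_one: "res_class L w \<one> = \<one>\<^bsub>residue_field L w\<^esub>"
  using ring_hom_memE(2-4)[OF ideal.rcos_ring_hom[OF m_ideal]]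
  by (auto simp: res_class_def residue_field_def carrier_O O_simps)

lemma res_class_eq:
  assumes "x \<in> carrier L" "y \<in> carrier L" "0 \<le> w x" "0 \<le> w y"
  shows "res_class L w x = res_class L w y \<longleftrightarrow> 0 < w (x \<ominus> y)"
proof -
  have xy: "x \<in> carrier \<O>" "y \<in> carrier \<O>" using assms by (auto simp: carrier_O)
  interpret O: cring \<O> by (rule O_cring)
  show ?thesis
    using O.quotient_eq_iff_same_a_r_cos[OF m_ideal xy] O_minus[OF xy(2)] assms
    by (simp add: res_class_def val_ideal_def)
qed

text \<open>In the applications \<open>\<pi>\<close> is the inclusion of K[x] in K(x) or the
  projection onto K[x]/(g).\<close>

lemma residue_map_comp:
  assumes v: "valuation v" and u: "valuation u" and const: "\<And>a. u [:a:] = v a"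
    and hom: "\<And>f. \<pi> f \<in> carrier L" "\<And>f h. \<pi> (f + h) = \<pi> f \<oplus> \<pi> h" "\<And>f h. \<pi> (f * h) = \<pi> f \<otimes> \<pi> h"
      "\<pi> 1 = \<one>" and u_eq: "\<And>f. w (\<pi> f) = u f"
  shows "residue_map (residue_field L w) v u (\<lambda>f. res_class L w (\<pi> f))"
proof (rule residue_map.intro[OF residue_field_field], unfold_locales)
  have diff: "\<pi> f \<ominus> \<pi> h = \<pi> (f - h)" for f h
  proof -
    have "\<pi> (f - h) \<oplus> \<pi> h = \<pi> f" using hom(2)[of "f - h" h] by simp
    thus ?thesis using hom(1) by (metis a_minus_def add.inv_solve_right)
  qed
  show "valuation v" "valuation u" "u [:a:] = v a" for a by fact+
  show "res_class L w (\<pi> 1) = \<one>\<^bsub>residue_field L w\<^esub>" by (simp add: hom(4) res_class_one)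
  fix f assume f: "0 \<le> u f"
  thus "res_class L w (\<pi> f) \<in> carrier (residue_field L w)"
    using hom(1)[of f] u_eq[of f] by (auto simp: carrier_residue_field)
  fix h assume h: "0 \<le> u h"
  show "res_class L w (\<pi> (f + h)) = res_class L w (\<pi> f) \<oplus>\<^bsub>residue_field L w\<^esub> res_class L w (\<pi> h)"
    "res_class L w (\<pi> (f * h)) = res_class L w (\<pi> f) \<otimes>\<^bsub>residue_field L w\<^esub> res_class L w (\<pi> h)"
    using f h by (simp_all add: hom res_class_add res_class_mult u_eq)
  show "res_class L w (\<pi> f) = res_class L w (\<pi> h) \<longleftrightarrow> 0 < u (f - h)"
    using res_class_eq[of "\<pi> f" "\<pi> h"] f h by (simp add: hom(1) u_eq diff)
qed

end

lemma type_ring_simps: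
  "carrier (ring_of_type_algebra :: 'r :: comm_ring_1 ring) = UNIV"
  "x \<otimes>\<^bsub>(ring_of_type_algebra :: 'r ring)\<^esub> y = x * y" "x \<oplus>\<^bsub>(ring_of_type_algebra :: 'r ring)\<^esub> y = x + y"
  "\<one>\<^bsub>(ring_of_type_algebra :: 'r ring)\<^esub> = 1" "\<zero>\<^bsub>(ring_of_type_algebra :: 'r ring)\<^esub> = 0"
  by (simp_all add: ring_of_type_algebra_def)

lemma value_group_base_field: "value_group base_field v = vals v"
  by (auto simp: value_group_def vals_def type_ring_simps)

section \<open>The field of fractions\<close>

context poly_valuation
begin

lemma frac_val_Fract:
  assumes h: "h \<noteq> 0"
  shows "frac_val \<mu> (Fract f h) + \<mu> h = \<mu> f"
proof -
  obtain b where b: "\<mu> h = Val b" using trivial[of h] h by (cases "\<mu> h") auto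
  define c where "c = (case \<mu> f of Infty \<Rightarrow> Infty | Val a \<Rightarrow> Val (a - b))"
  have c: "c + \<mu> h = \<mu> f" by (cases "\<mu> f") (auto simp: c_def b)
  have "frac_val \<mu> (Fract f h) = c"
    unfolding frac_val_def
  proof (rule the_equality)
    show "\<exists>f' h'. h' \<noteq> 0 \<and> Fract f h = Fract f' h' \<and> c + \<mu> h' = \<mu> f'" using c h by blast
    fix d assume "\<exists>f' h'. h' \<noteq> 0 \<and> Fract f h = Fract f' h' \<and> d + \<mu> h' = \<mu> f'"
    then obtain f' h' where d: "h' \<noteq> 0" "Fract f h = Fract f' h'" "d + \<mu> h' = \<mu> f'" by blast
    obtain b' where b': "\<mu> h' = Val b'" using trivial[of h'] d(1) by (cases "\<mu> h'") auto
    have "f * h' = f' * h" using d(1,2) h by (simp add: eq_fract)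
    hence "\<mu> f + \<mu> h' = \<mu> f' + \<mu> h" by (metis val_mult[OF val])
    hence "c + \<mu> h + \<mu> h' = d + \<mu> h' + \<mu> h" by (simp only: c d(3))
    thus "d = c" by (cases c; cases d) (auto simp: b b')
  qed
  thus ?thesis using c by simp
qed

lemma frac_val_to_fract: "frac_val \<mu> (to_fract f) = \<mu> f"
  using frac_val_Fract[of 1 f] by (simp add: to_fract_def val_one[OF val])

lemma frac_val_valued_field: "valued_field (ring_of_type_algebra :: 'a poly fract ring) (frac_val \<mu>)"
proof (rule valued_field.intro[OF field_from_type_algebra], unfold_locales, unfold type_ring_simps)
  show "frac_val \<mu> 0 = Infty" "frac_val \<mu> 1 = 0"
    using frac_val_to_fract[of 0] frac_val_to_fract[of 1] by (simp_all add: val_zero[OF val] val_one[OF val])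
  fix x y :: "'a poly fract"
  obtain f h where x: "x = Fract f h" "h \<noteq> 0" by (cases x) auto
  obtain f' h' where y: "y = Fract f' h'" "h' \<noteq> 0" by (cases y) auto
  obtain b where b: "\<mu> h = Val b" using trivial[of h] x(2) by (cases "\<mu> h") auto
  obtain b' where b': "\<mu> h' = Val b'" using trivial[of h'] y(2) by (cases "\<mu> h'") auto
  have fx: "\<mu> f = frac_val \<mu> x + \<mu> h" and fy: "\<mu> f' = frac_val \<mu> y + \<mu> h'"
    using frac_val_Fract[OF x(2), of f] frac_val_Fract[OF y(2), of f'] x y by auto
  have hh: "h * h' \<noteq> 0" using x y by simp
  have "frac_val \<mu> (x * y) + \<mu> (h * h') = \<mu> f + \<mu> f'"
    using frac_val_Fract[OF hh, of "f * f'"] x y by (simp add: val_mult[OF val])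
  also have "\<dots> = (frac_val \<mu> x + frac_val \<mu> y) + \<mu> (h * h')"
    unfolding fx fy val_mult[OF val] by (simp only: ac_simps)
  finally show "frac_val \<mu> (x * y) = frac_val \<mu> x + frac_val \<mu> y"
    by (cases "frac_val \<mu> (x * y)"; cases "frac_val \<mu> x + frac_val \<mu> y") (auto simp: val_mult[OF val] b b')
  have "min (\<mu> (f * h')) (\<mu> (f' * h)) \<le> \<mu> (f * h' + f' * h)" using val[unfolded valuation_def] by blast
  also have "\<dots> = frac_val \<mu> (x + y) + \<mu> (h * h')"
    using frac_val_Fract[OF hh, of "f * h' + f' * h"] x y by simp
  also have "\<mu> (f * h') = frac_val \<mu> x + \<mu> (h * h')" unfolding val_mult[OF val] fx by (simp only: ac_simps)
  also have "\<mu> (f' * h) = frac_val \<mu> y + \<mu> (h * h')" unfolding val_mult[OF val] fy by (simp only: ac_simps)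
  finally show "min (frac_val \<mu> x) (frac_val \<mu> y) \<le> frac_val \<mu> (x + y)"
    by (cases "frac_val \<mu> x"; cases "frac_val \<mu> y"; cases "frac_val \<mu> (x + y)")
      (auto simp: val_mult[OF val] b b' min_def split: if_splits)
qed

lemma mu_value_group:
  assumes "\<And>x y. x \<in> vals \<mu> \<Longrightarrow> y \<in> vals \<mu> \<Longrightarrow> x - y \<in> vals \<mu>"
  shows "mu_value_group \<mu> = vals \<mu>"
proof (intro equalityI subsetI)
  fix \<alpha> assume "\<alpha> \<in> mu_value_group \<mu>"
  then obtain q where q: "frac_val \<mu> q = Val \<alpha>" by (auto simp: mu_value_group_def value_group_def)
  obtain f h where x: "q = Fract f h" "h \<noteq> 0" by (cases q) auto
  obtain b where b: "\<mu> h = Val b" using trivial[of h] x(2) by (cases "\<mu> h") auto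
  have "\<mu> f = Val (\<alpha> + b)" using frac_val_Fract[OF x(2), of f] q x(1) b by simp
  hence "\<alpha> + b - b \<in> vals \<mu>" using b by (intro assms) (auto simp: vals_def)
  thus "\<alpha> \<in> vals \<mu>" by simp
next
  fix \<alpha> assume "\<alpha> \<in> vals \<mu>"
  then obtain f where "\<mu> f = Val \<alpha>" by (auto simp: vals_def)
  hence "frac_val \<mu> (to_fract f) = Val \<alpha>" by (simp add: frac_val_to_fract)
  thus "\<alpha> \<in> mu_value_group \<mu>" by (auto simp: mu_value_group_def value_group_def type_ring_simps)
qed

lemma mu_residue_map:
  assumes "valuation v" "\<And>a. \<mu> [:a:] = v a"
  shows "residue_map (mu_residue_field \<mu>) v \<mu> (mu_res_class \<mu>)"
proof -
  interpret F: valued_field "ring_of_type_algebra :: 'a poly fract ring" "frac_val \<mu>" by (rule frac_val_valued_field)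
  have "residue_map (mu_residue_field \<mu>) v \<mu> (\<lambda>f. mu_res_class \<mu> f)"
    unfolding mu_residue_field_def mu_res_class_def
    by (rule F.residue_map_comp) (use assms val frac_val_to_fract in \<open>auto simp: type_ring_simps\<close>)
  thus ?thesis by simp
qed

end

section \<open>The field \<open>K[x]/(g)\<close>\<close>

locale poly_field =
  fixes g :: "'a :: field poly" and w :: "'a poly \<Rightarrow> 'g :: linordered_ab_group_add vinf"
  assumes monic: "lead_coeff g = 1" and irr: "irreducible g" and w_valuation: "valuation w" and w_support: "w f = Infty \<longleftrightarrow> g dvd f"
begin

abbreviation "\<P> \<equiv> ring_of_type_algebra :: 'a poly ring"
abbreviation "\<I> \<equiv> PIdl\<^bsub>\<P>\<^esub> g"

lemma PIdl_iff: "f \<in> \<I> \<longleftrightarrow> g dvd f"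
  by (auto simp: cgenideal_def type_ring_simps dvd_def mult.commute)

lemma I_ideal: "ideal \<I> \<P>"
  by (rule cring.cgenideal_ideal[OF cring_from_type_algebra]) (simp add: type_ring_simps)

lemma I_maximal: "maximalideal \<I> \<P>"
proof (rule maximalidealI[OF I_ideal])
  show "carrier \<P> \<noteq> \<I>"
  proof
    assume "carrier \<P> = \<I>"
    hence "g dvd 1" using PIdl_iff[of 1] by (simp add: type_ring_simps)
    thus False using irr by (simp add: irreducible_def)
  qed
  fix J assume J: "ideal J \<P>" "\<I> \<subseteq> J" "J \<subseteq> carrier \<P>"
  show "J = \<I> \<or> J = carrier \<P>"
  proof (cases "J = \<I>")
    case False
    then obtain f where f: "f \<in> J" "\<not> g dvd f" using J(2) PIdl_iff by blast
    obtain a b where ab: "a * g + b * f = 1" using bezout_over[OF subfld_UNIV, of g f] irr f(2) by (auto simp: irreducible_iff_Irr_over[OF monic])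
    have "a * g \<in> J" using J(2) PIdl_iff by auto
    moreover have "b * f \<in> J" using ideal.I_l_closed[OF J(1) f(1), of b] by (simp add: type_ring_simps)
    ultimately have "a * g + b * f \<in> J"
      using additive_subgroup.a_closed[OF ideal.axioms(1)[OF J(1)], of "a * g" "b * f"] by (simp add: type_ring_simps)
    hence "J = carrier \<P>" using ideal.one_imp_carrier[OF J(1)] ab by (simp add: type_ring_simps)
    thus ?thesis by simp
  qed simp
qed

lemma poly_quot_field: "field (poly_quot g)"
  unfolding poly_quot_def by (rule maximalideal.quotient_is_field[OF I_maximal cring_from_type_algebra])

lemma class_hom: "poly_quot_class g f \<in> carrier (poly_quot g)"
  "poly_quot_class g (f + h) = poly_quot_class g f \<oplus>\<^bsub>poly_quot g\<^esub> poly_quot_class g h"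
  "poly_quot_class g (f * h) = poly_quot_class g f \<otimes>\<^bsub>poly_quot g\<^esub> poly_quot_class g h"
  "poly_quot_class g 1 = \<one>\<^bsub>poly_quot g\<^esub>"
  using ring_hom_memE[OF ideal.rcos_ring_hom[OF I_ideal]]
  by (simp_all add: poly_quot_class_def poly_quot_def type_ring_simps)

lemma class_surj: "carrier (poly_quot g) = range (poly_quot_class g)"
  by (auto simp: poly_quot_def FactRing_def A_RCOSETS_def' poly_quot_class_def type_ring_simps)

lemma class_zero: "poly_quot_class g 0 = \<zero>\<^bsub>poly_quot g\<^esub>"
proof -
  interpret Q: field "poly_quot g" by (rule poly_quot_field)
  have "poly_quot_class g 0 \<oplus>\<^bsub>poly_quot g\<^esub> poly_quot_class g 0 = poly_quot_class g 0"
    using class_hom(2)[of 0 0] by simp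
  thus ?thesis using class_hom(1)[of 0] by simp
qed

lemma quot_val_class: "quot_val w (poly_quot_class g f) = w f"
proof -
  have mem: "h \<in> poly_quot_class g f \<longleftrightarrow> g dvd h - f" for h
  proof -
    have "poly_quot_class g f = {s + f | s. g dvd s}"
      by (auto simp: poly_quot_class_def a_r_coset_def' type_ring_simps PIdl_iff)
    thus ?thesis by (auto intro: exI[of _ "h - f"])
  qed
  have same: "w h = w f" if "g dvd h - f" for h
  proof -
    have "w (h - f) = Infty" using that w_support by blast
    hence "w f = w h" if "w h \<noteq> Infty"
      using val_eq_of_diff[OF w_valuation, of h f] that by (cases "w h") auto
    moreover have "w f = Infty" if "w h = Infty"
      using that \<open>g dvd h - f\<close> w_support by (metis dvd_diff_right_iff dvd_diff_commute)
    ultimately show ?thesis by metis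
  qed
  show ?thesis unfolding quot_val_def
  proof (rule the_equality)
    show "\<exists>h\<in>poly_quot_class g f. w f = w h" using mem[of f] by (intro bexI[of _ f]) auto
  next
    fix c assume "\<exists>h\<in>poly_quot_class g f. c = w h"
    then obtain h where h: "h \<in> poly_quot_class g f" "c = w h" by blast
    have "g dvd h - f" using h(1) mem[of h] by simp
    thus "c = w f" unfolding h(2) by (rule same)
  qed
qed

lemma quot_valued_field: "valued_field (poly_quot g) (quot_val w)"
proof (rule valued_field.intro[OF poly_quot_field], unfold_locales)
  show "quot_val w \<zero>\<^bsub>poly_quot g\<^esub> = Infty" "quot_val w \<one>\<^bsub>poly_quot g\<^esub> = 0"
    by (simp_all add: quot_val_class val_zero[OF w_valuation] val_one[OF w_valuation] flip: class_zero class_hom(4))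
  fix x y assume "x \<in> carrier (poly_quot g)" "y \<in> carrier (poly_quot g)"
  then obtain f h where fh: "x = poly_quot_class g f" "y = poly_quot_class g h" by (auto simp: class_surj)
  show "quot_val w (x \<otimes>\<^bsub>poly_quot g\<^esub> y) = quot_val w x + quot_val w y"
    by (simp add: fh quot_val_class val_mult[OF w_valuation] flip: class_hom(3))
  show "min (quot_val w x) (quot_val w y) \<le> quot_val w (x \<oplus>\<^bsub>poly_quot g\<^esub> y)"
    using w_valuation by (simp add: fh quot_val_class valuation_def flip: class_hom(2))
qed

lemma quot_value_group: "value_group (poly_quot g) (quot_val w) = vals w"
  by (auto simp: value_group_def vals_def class_surj quot_val_class)

abbreviation "quot_residue \<equiv> \<lambda>f. res_class (poly_quot g) (quot_val w) (poly_quot_class g f)"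

lemma quot_residue_map:
  assumes "valuation v" "\<And>a. w [:a:] = v a"
  shows "residue_map (residue_field (poly_quot g) (quot_val w)) v w quot_residue"
  by (rule valued_field.residue_map_comp[OF quot_valued_field])
    (use assms w_valuation class_hom quot_val_class in auto)

lemma quot_residue_surj:
  "carrier (residue_field (poly_quot g) (quot_val w)) = {quot_residue f | f. 0 \<le> w f}"
  unfolding valued_field.carrier_residue_field[OF quot_valued_field] class_surj
  by (auto simp: quot_val_class)

end

section \<open>Algebraic residues\<close>

context level
begin

text \<open>At the place of the largest \<open>smax\<close> only one summand attains the common
  value \<open>d\<close>, so nothing cancels there.\<close>

lemma mu_sum_smax:
  assumes fin: "finite I" and ne: "I \<noteq> {}" and D: "\<And>i. i \<in> I \<Longrightarrow> mu (t i) = Val d" and inj: "inj_on (\<lambda>i. smax (t i)) I"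
  shows "mu (\<Sum>i\<in>I. t i) \<le> Val d"
proof -
  obtain k where k: "k \<in> I" "\<And>i. i \<in> I \<Longrightarrow> smax (t i) \<le> smax (t k)"
  proof -
    have "Max ((\<lambda>i. smax (t i)) ` I) \<in> (\<lambda>i. smax (t i)) ` I" using fin ne by (intro Max_in) auto
    then obtain k where "k \<in> I" "smax (t k) = Max ((\<lambda>i. smax (t i)) ` I)" by force
    thus ?thesis using that[of k] fin by simp
  qed
  define s where "s = smax (t k)"
  have nz: "t i \<noteq> 0" if "i \<in> I" for i using D[OF that] by (auto simp: val_zero[OF mu])
  have Tk: "T (t k) s = Val d" using smax(1)[OF nz[OF k(1)]] D[OF k(1)] by (simp add: s_def)
  have less: "w (digit \<phi> (t k) s) < w (digit \<phi> (t i) s)" if i: "i \<in> I" "i \<noteq> k" for i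
  proof -
    have "smax (t i) < s" using k(2)[OF i(1)] inj i k(1) by (metis inj_onD le_neq_implies_less s_def)
    hence "Val d < T (t i) s" using smax(3)[OF nz[OF i(1)]] D[OF i(1)] by simp
    hence "T (t k) s < T (t i) s" using Tk by simp
    thus ?thesis unfolding T_def nmul_Val by (cases "w (digit \<phi> (t k) s)"; cases "w (digit \<phi> (t i) s)") auto
  qed
  have "w (digit \<phi> (\<Sum>i\<in>I. t i) s) = w (digit \<phi> (t k) s)"
    unfolding digit_sum by (rule val_sum_dominant[OF w fin k(1)]) (rule less)
  hence "T (\<Sum>i\<in>I. t i) s = Val d" using Tk by (simp add: T_def)
  thus ?thesis using mu_le[of "\<Sum>i\<in>I. t i" s] by simp
qed

lemma mu_power_smax: "f \<noteq> 0 \<Longrightarrow> smax (f ^ n) = n * smax f"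
  by (induction n) (simp_all add: mu_mult_smax(2) smax_less_degree deg)

text \<open>The term with index i has \<open>smax\<close> equal to i \<open>smax f\<close> + (N - i)
  \<open>smax h\<close>. If \<open>smax f\<close> and \<open>smax h\<close> differed, these numbers
  would be distinct and the terms could not cancel.\<close>

lemma smax_eq_of_relation:
  assumes f: "f \<noteq> 0" and h: "h \<noteq> 0" and eq: "mu f = mu h" and c: "\<exists>i<N. c i \<noteq> 0"
    and c0: "\<And>i. i < N \<Longrightarrow> c i = 0 \<or> v (c i) = 0"
    and rel: "nmul N (mu h) < mu (\<Sum>i<N. smult (c i) (f ^ i * h ^ (N - i)))"
  shows "smax f = smax h"
proof (rule ccontr)
  assume ne: "smax f \<noteq> smax h"
  obtain b where b: "mu h = Val b" using h mu_eq_Infty by (cases "mu h") auto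
  define I where "I = {i. i < N \<and> c i \<noteq> 0}"
  let ?t = "\<lambda>i. smult (c i) (f ^ i * h ^ (N - i))"
  have sm: "smax (?t i) = i * smax f + (N - i) * smax h" if i: "i \<in> I" for i
  proof -
    have "smax ([:c i:] * (f ^ i * h ^ (N - i))) = smax [:c i:] + smax (f ^ i * h ^ (N - i))"
      using i f h by (intro mu_mult_smax(2)) (auto simp: I_def)
    thus ?thesis using i f h by (simp add: I_def mu_mult_smax(2) mu_power_smax smax_less_degree deg)
  qed
  have "mu (\<Sum>i\<in>I. ?t i) \<le> Val (nmul N b)"
  proof (rule mu_sum_smax)
    show "finite I" "I \<noteq> {}" using c by (auto simp: I_def)
    fix i assume i: "i \<in> I"
    have "mu (?t i) = v (c i) + (nmul i (mu h) + nmul (N - i) (mu h))"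
      using val_mult[OF mu, of "[:c i:]" "f ^ i * h ^ (N - i)"] by (simp add: mu_const val_mult[OF mu] val_power[OF mu] eq)
    also have "\<dots> = nmul N (mu h)" using i c0[of i] nmul_add[of i "N - i" "mu h"] by (simp add: I_def)
    finally show "mu (?t i) = Val (nmul N b)" by (simp add: b)
  next
    show "inj_on (\<lambda>i. smax (?t i)) I"
    proof (rule inj_onI)
      fix i j assume ij: "i \<in> I" "j \<in> I" "smax (?t i) = smax (?t j)"
      hence "i * smax f + (N - i) * smax h = j * smax f + (N - j) * smax h"
        using sm[OF ij(1)] sm[OF ij(2)] by simp
      from arg_cong[OF this, of int]
      have "int i * smax f + (int N - i) * smax h = int j * smax f + (int N - j) * smax h"
        using ij by (simp add: I_def of_nat_diff)
      hence "(int i - int j) * (int (smax f) - int (smax h)) = 0" by (simp add: algebra_simps)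
      thus "i = j" using ne by simp
    qed
  qed
  moreover have "(\<Sum>i\<in>I. ?t i) = (\<Sum>i<N. ?t i)"
    by (rule sum.mono_neutral_left) (auto simp: I_def)
  ultimately show False using rel b by simp
qed

text \<open>The polynomial \<open>c\<close> is the quotient, modulo \<open>\<phi>\<close>, of the
  top digits of \<open>f\<close> and \<open>h\<close>. Multiplying \<open>h\<close> by it reproduces
  the top digit of \<open>f\<close> up to carries of larger value.\<close>

lemma top_digit_cancel:
  assumes f: "f \<noteq> 0" and h: "h \<noteq> 0" and eq: "mu f = mu h" "smax f = smax h"
  shows "\<exists>c. degree c < degree \<phi> \<and> w c = 0 \<and> mu h < T (f - c * h) (smax h)"
proof -
  define m where "m = smax h"
  define a b where "a = digit \<phi> f m" and "b = digit \<phi> h m"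
  obtain d where d: "mu h = Val d" using h mu_eq_Infty by (cases "mu h") auto
  have Ta: "T f m = Val d" and Tb: "T h m = Val d" using smax(1)[OF f] smax(1)[OF h] eq d by (auto simp: m_def)
  have wab: "w a = Val (d - nmul m \<gamma>)" "w b = Val (d - nmul m \<gamma>)"
    using Ta Tb by (cases "w a", auto simp: T_def a_def b_def algebra_simps) (cases "w b", auto simp: b_def algebra_simps)
  hence "\<not> \<phi> dvd b" using supp[of b] by auto
  then obtain s where s: "degree s < degree \<phi>" "w (b * s - 1) = Infty" using ex_inverse by blast
  define c where "c = (a * s) mod \<phi>"
  have dc: "degree c < degree \<phi>" unfolding c_def by (rule degree_mod)
  have da: "degree a < degree \<phi>" unfolding a_def by (rule degree_digit_less[OF deg])
  have "\<phi> dvd b * s - 1" using s(2) supp by blast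
  hence "\<phi> dvd a * (b * s - 1)" by simp
  hence "(a * s * b) mod \<phi> = a mod \<phi>" by (simp add: mod_eq_dvd_iff algebra_simps)
  hence cb: "(c * b) mod \<phi> = a" using da by (simp add: c_def mod_mult_left_eq mod_poly_less)
  have "w (c * b) = w a" using w_mod[of "c * b"] cb by simp
  hence wc: "w c = 0" using wab by (cases "w c") (auto simp: val_mult[OF w])
  hence c_nz: "c \<noteq> 0" using val_zero[OF w] by auto
  have Tc: "T c i = (if i = 0 then 0 else Infty)" for i
    using dc wc by (simp add: T_def digit_less_degree val_zero[OF w])
  let ?I = "{..degree c} \<times> {..degree h} \<times> (UNIV :: bool set)" and ?t = "(0, m, True)"
  have fin: "finite ?I" by simp
  have tI: "?t \<in> ?I" using smax(2)[OF h] by (simp add: m_def)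
  have t: "contr c h m ?t = a" using dc cb by (simp add: contr_def digit_less_degree b_def)
  have rest: "Val d < w (contr c h m p) + nmul m (Val \<gamma>)" if p: "p \<noteq> ?t" for p
  proof -
    obtain i j B where ijB: "p = (i, j, B)" by (metis prod_cases3)
    show ?thesis
    proof (cases B)
      case True
      hence "m = i + j \<longrightarrow> i \<noteq> 0" using p ijB by auto
      hence inf: "w (contr c h m (i, j, True)) + nmul m (Val \<gamma>) = Infty" unfolding contr_True Tc by auto
      have "B = True" using True by simp
      show ?thesis unfolding ijB \<open>B = True\<close> inf by (rule Val_less_Infty)
    next
      case False
      show ?thesis
      proof (cases "m = Suc (i + j) \<and> T c i + T h j \<noteq> Infty")
        case True
        hence "T c i = 0" using Tc[of i] by (auto split: if_splits)
        hence "mu h \<le> T c i + T h j" using mu_le[of h j] by simp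
        also have "\<dots> < w (contr c h m (i, j, False)) + nmul m (Val \<gamma>)" using contr_False(1) True by blast
        finally have less: "Val d < w (contr c h m (i, j, False)) + nmul m (Val \<gamma>)" unfolding d .
        have "B = False" using False by simp
        show ?thesis unfolding ijB \<open>B = False\<close> by (rule less)
      next
        case no: False
        hence inf: "w (contr c h m (i, j, False)) + nmul m (Val \<gamma>) = Infty" using contr_False(2) by blast
        have "B = False" using False by simp
        show ?thesis unfolding ijB \<open>B = False\<close> inf by (rule Val_less_Infty)
      qed
    qed
  qed
  have "digit \<phi> (c * h) m = a + (\<Sum>p\<in>?I - {?t}. contr c h m p)"
    unfolding digit_mult_contr sum.remove[OF fin tI] t ..
  moreover have "digit \<phi> f m = digit \<phi> (f - c * h) m + digit \<phi> (c * h) m" using digit_add[of \<phi> "f - c * h" "c * h" m] by simp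
  ultimately have dig: "digit \<phi> (f - c * h) m = - (\<Sum>p\<in>?I - {?t}. contr c h m p)"
    by (simp add: a_def eq_neg_iff_add_eq_0)
  have "Val (d - nmul m \<gamma>) < w (\<Sum>p\<in>?I - {?t}. contr c h m p)"
  proof (rule val_sum_gt[OF w])
    fix p assume "p \<in> ?I - {?t}"
    hence "Val d < w (contr c h m p) + Val (nmul m \<gamma>)" using rest by simp
    thus "Val (d - nmul m \<gamma>) < w (contr c h m p)" by (cases "w (contr c h m p)") (auto simp: diff_less_eq)
  qed simp
  hence "Val (d - nmul m \<gamma>) < w (digit \<phi> (f - c * h) m)" unfolding dig by (simp add: val_uminus[OF w])
  hence "Val d < T (f - c * h) m" unfolding T_def by (cases "w (digit \<phi> (f - c * h) m)") (auto simp: diff_less_eq)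
  thus ?thesis using dc wc d by (auto simp: m_def)
qed

text \<open>The difference is a carry times \<open>\<phi>\<close>, so \<open>strict\<close>
  applies.\<close>

lemma residue_mult_mod:
  assumes "degree f < degree \<phi>" "degree s < degree \<phi>" "0 \<le> w f" "0 \<le> w s"
  shows "0 < mu (f * s - (f * s) mod \<phi>)"
proof (cases "f = 0 \<or> s = 0")
  case True
  thus ?thesis by (auto simp: val_zero[OF mu])
next
  case False
  define q where "q = (f * s) div \<phi>"
  have "degree q < degree \<phi>"
  proof (cases "q = 0")
    case nz: False
    have "q * \<phi> = f * s - (f * s) mod \<phi>" by (simp add: q_def minus_mod_eq_div_mult)
    hence "degree (q * \<phi>) \<le> max (degree (f * s)) (degree ((f * s) mod \<phi>))" by (simp add: degree_diff_le_max)
    hence "degree q + degree \<phi> \<le> max (degree f + degree s) (degree ((f * s) mod \<phi>))"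
      using nz phi_nz False by (simp add: degree_mult_eq)
    thus ?thesis using assms(1,2) degree_mod[of "f * s"] by simp
  qed (simp add: deg)
  have "0 \<le> w f + w s" using assms by (intro add_nonneg_nonneg)
  also have "\<dots> < w q + Val \<gamma>" unfolding q_def using strict False assms by blast
  also have "\<dots> = mu (q * \<phi>)" using mu_eq_w[OF \<open>degree q < degree \<phi>\<close>] by (simp add: val_mult[OF mu] mu_phi)
  also have "q * \<phi> = f * s - (f * s) mod \<phi>" by (simp add: q_def minus_mod_eq_div_mult)
  finally show ?thesis .
qed

end

context orthogonal_level
begin

lemma mu_orthogonal_residue: "orthogonal_residue v w \<phi> b (mu_residue_field mu) mu (mu_res_class mu)"
proof (rule orthogonal_residue.intro)
  show "orthogonal_limit v w \<phi> b" by unfold_locales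
  show "residue_map (mu_residue_field mu) v mu (mu_res_class mu)" by (rule mu.mu_residue_map[OF v mu_const])
  show "orthogonal_residue_axioms w \<phi> mu"
    using mu_eq_w residue_mult_mod by unfold_locales
qed

lemma to_fract_power: "to_fract (x ^ n) = to_fract x ^ n"
  by (induction n) simp_all

text \<open>Residues of polynomials of small degree form a finite extension, hence are algebraic.
  Conversely, an algebraic nonzero residue of f/h forces \<open>smax f = smax h\<close>; subtract
  the residue of the \<open>c\<close> that cancels the top digit. If the difference were nonzero, it
  would be algebraic as well, and f - c h would again have the same \<open>smax\<close> as h,
  although its digit there is too large.\<close>

theorem kappa_mu: "kappa mu = orthogonal_residue.residues w \<phi> (mu_res_class mu)"
proof -
  interpret mr: orthogonal_residue v w \<phi> b "mu_residue_field mu" mu "mu_res_class mu"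
    by (rule mu_orthogonal_residue)
  let ?R = "mu_residue_field mu" and ?\<rho> = "mu_res_class mu"
  have base: "base_residue_field mu = mr.constants"
    by (simp add: base_residue_field_def mr.constants_def mu_const)
  note K = mr.subfield_constants and E = mr.subfield_low_residues
  have "z \<in> kappa mu" if z: "z \<in> mr.residues" for z
  proof -
    have "mr.finite_dimension mr.constants mr.residues"
      using mr.dimension_low_residues by (rule mr.finite_dimensionI)
    hence "(mr.algebraic over mr.constants) z"
      using mr.finite_dimension_imp_algebraic[OF K subfieldE(1)[OF E]] z by blast
    thus ?thesis using z subfieldE(3)[OF E] by (auto simp: kappa_def base over_def)
  qed
  moreover have "z \<in> mr.residues" if z: "z \<in> kappa mu" for z
  proof -
    let ?L = "ring_of_type_algebra :: 'a poly fract ring" and ?W = "frac_val mu"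
    interpret F: valued_field ?L ?W by (rule mu.frac_val_valued_field)
    let ?res = "res_class ?L ?W"
    have R: "?R = residue_field ?L ?W" by (simp add: mu_residue_field_def)
    have rho: "?\<rho> f = ?res (to_fract f)" for f by (simp add: mu_res_class_def)
    have W_mult: "?W (x * y) = ?W x + ?W y" for x y using F.w_mult[of x y] by (simp add: type_ring_simps)
    have W_one: "?W 1 = 0" using F.w_one by (simp add: type_ring_simps)
    have W_add: "0 \<le> ?W (x + y)" if "0 \<le> ?W x" "0 \<le> ?W y" for x y
      using F.w_add[of x y] that by (auto simp: type_ring_simps min_def split: if_splits)
    have res_closed: "?res x \<in> carrier ?R" if "0 \<le> ?W x" for x
      using that by (auto simp: R F.carrier_residue_field type_ring_simps)
    have res_add: "?res (x + y) = ?res x \<oplus>\<^bsub>?R\<^esub> ?res y" and res_mult: "?res (x * y) = ?res x \<otimes>\<^bsub>?R\<^esub> ?res y"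
      if "0 \<le> ?W x" "0 \<le> ?W y" for x y
      using F.res_class_add[of x y] F.res_class_mult[of x y] that by (simp_all add: R type_ring_simps)
    have res_one: "?res 1 = \<one>\<^bsub>?R\<^esub>" using F.res_class_one by (simp add: R type_ring_simps)
    have minus: "x \<ominus>\<^bsub>?L\<^esub> y = x - y" for x y
    proof -
      have "\<ominus>\<^bsub>?L\<^esub> y = - y" by (rule F.minus_equality) (simp_all add: type_ring_simps)
      thus ?thesis by (simp add: a_minus_def type_ring_simps)
    qed
    have res_eq: "?res x = ?res y \<longleftrightarrow> 0 < ?W (x - y)" if "0 \<le> ?W x" "0 \<le> ?W y" for x y
      using F.res_class_eq[of x y] that by (simp add: type_ring_simps minus)
    have res_zero: "?res 0 = \<zero>\<^bsub>?R\<^esub>" using mr.res_zero by (simp add: rho)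
    have pow: "0 \<le> ?W (x ^ n)" "?res (x ^ n) = ?res x [^]\<^bsub>?R\<^esub> n" if "0 \<le> ?W x" for x and n :: nat
    proof -
      show W: "0 \<le> ?W (x ^ n)" for n using that by (induction n) (auto simp: W_one W_mult intro: add_nonneg_nonneg)
      show "?res (x ^ n) = ?res x [^]\<^bsub>?R\<^esub> n"
        by (induction n) (simp_all add: res_one res_mult that W power_Suc2 del: power_Suc)
    qed
    text \<open>Otherwise the terms of an algebraic relation for \<open>f / h\<close> would have distinct values of \<open>smax\<close>.\<close>
    have key: "smax f = smax h"
      if f: "f \<noteq> 0" and h: "h \<noteq> 0" and eq: "mu f = mu h"
        and alg: "\<not> mr.transcendental mr.constants (?res (Fract f h))" for f h
    proof -
      let ?q = "Fract f h"
      obtain d where d: "mu h = Val d" using h mu_eq_Infty by (cases "mu h") auto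
      have "?W ?q + mu h = mu h" using mu.frac_val_Fract[OF h, of f] eq by simp
      hence Wq: "?W ?q = 0" by (cases "?W ?q") (auto simp: d)
      obtain p where p: "p \<in> carrier (univ_poly ?R mr.constants)" "p \<noteq> []" "mr.eval p (?res ?q) = \<zero>\<^bsub>?R\<^esub>"
        using mr.algebraicE[OF subfieldE(1)[OF K] res_closed[of ?q]] alg Wq by (auto simp: over_def)
      define N where "N = length p"
      have pK: "set p \<subseteq> mr.constants" "List.hd p \<noteq> \<zero>\<^bsub>?R\<^esub>"
        using p(1,2) by (auto simp: univ_poly_def polynomial_def)
      \<comment> \<open>Zero residues are lifted to 0, so that every lifted coefficient is 0 or of
        value 0, as \<open>smax_eq_of_relation\<close> demands.\<close>
      have sub: "mr.constants \<subseteq> (\<lambda>a. ?\<rho> [:a:]) ` {a. a = 0 \<or> v a = 0}"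
      proof
        fix k assume "k \<in> mr.constants"
        then obtain a where a: "k = ?\<rho> [:a:]" "0 \<le> v a" by (auto simp: mr.constants_def)
        show "k \<in> (\<lambda>a. ?\<rho> [:a:]) ` {a. a = 0 \<or> v a = 0}"
        proof (cases "v a = 0")
          case False
          hence "k = ?\<rho> [:0:]" using a mr.res_eq_zero[of "[:a:]"] mr.res_zero by (simp add: mu_const)
          thus ?thesis by blast
        qed (use a in blast)
      qed
      \<comment> \<open>Polynomials are lists here, with the leading coefficient first.\<close>
      have "\<exists>c. (\<forall>i\<in>set (rev [0..<N]). c i \<in> {a. a = 0 \<or> v a = 0}) \<and> p = map (\<lambda>i. ?\<rho> [:c i:]) (rev [0..<N])"
        by (rule set_subset_image_map) (simp_all only: N_def length_rev length_upt distinct_rev distinct_upt diff_zero subset_trans[OF pK(1) sub])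
      then obtain c where c: "\<forall>i\<in>set (rev [0..<N]). c i \<in> {a. a = 0 \<or> v a = 0}" "p = map (\<lambda>i. ?\<rho> [:c i:]) (rev [0..<N])"
        by blast
      have c0: "c i = 0 \<or> v (c i) = 0" if "i < N" for i
      proof -
        have "i \<in> set (rev [0..<N])" using that by simp
        thus ?thesis using c(1) by blast
      qed
      have cge: "0 \<le> ?W (to_fract [:c i:])" if "i < N" for i
        using c0[OF that] by (auto simp: mu.frac_val_to_fract mu_const val_zero[OF v])
      have ev: "mr.eval (map (\<lambda>i. ?\<rho> [:c i:]) (rev [0..<n])) (?res ?q) = ?res (\<Sum>i<n. to_fract [:c i:] * ?q ^ i)
          \<and> 0 \<le> ?W (\<Sum>i<n. to_fract [:c i:] * ?q ^ i)" if "n \<le> N" for n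
        using that
      proof (induction n)
        case 0
        thus ?case using F.w_zero by (simp add: res_zero type_ring_simps)
      next
        case (Suc n)
        have n: "n < N" using Suc.prems by simp
        have q0: "0 \<le> ?W ?q" by (simp add: Wq)
        have t: "0 \<le> ?W (to_fract [:c n:] * ?q ^ n)"
          unfolding W_mult using cge[OF n] pow(1)[OF q0] by (intro add_nonneg_nonneg)
        have "?res (to_fract [:c n:] * ?q ^ n) = ?\<rho> [:c n:] \<otimes>\<^bsub>?R\<^esub> ?res ?q [^]\<^bsub>?R\<^esub> n"
          using res_mult[OF cge[OF n] pow(1)[OF q0, of n]] pow(2)[OF q0, of n] by (simp add: rho)
        thus ?case using Suc n t res_add[OF t, of "\<Sum>i<n. to_fract [:c i:] * ?q ^ i"]
          W_add[OF t, of "\<Sum>i<n. to_fract [:c i:] * ?q ^ i"] by (simp add: add.commute)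
      qed
      let ?S = "\<Sum>i<N. to_fract [:c i:] * ?q ^ i"
      have S: "?res ?S = \<zero>\<^bsub>?R\<^esub>" "0 \<le> ?W ?S" using ev[of N] p(3) c(2) by auto
      have Spos: "0 < ?W ?S" using res_eq[of ?S 0] S F.w_zero by (simp add: res_zero type_ring_simps)
      have hq: "to_fract h * ?q = to_fract f" using h by (simp add: to_fract_def eq_fract)
      \<comment> \<open>Multiplication by \<open>h ^ N\<close> clears denominators; \<open>N\<close>
        is one more than the degree of the relation, matching the summation over i < N.\<close>
      have summand: "to_fract (h ^ N) * (to_fract [:c i:] * ?q ^ i) = to_fract (smult (c i) (f ^ i * h ^ (N - i)))"
        if "i < N" for i
      proof -
        have "to_fract (h ^ N) * ?q ^ i = (to_fract h * ?q) ^ i * to_fract h ^ (N - i)"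
          using that by (simp add: power_mult_distrib to_fract_power ac_simps flip: power_add)
        also have "\<dots> = to_fract (f ^ i * h ^ (N - i))" unfolding hq by (simp add: to_fract_power)
        finally have e: "to_fract (h ^ N) * ?q ^ i = to_fract (f ^ i * h ^ (N - i))" .
        have "to_fract (h ^ N) * (to_fract [:c i:] * ?q ^ i) = to_fract [:c i:] * (to_fract (h ^ N) * ?q ^ i)"
          by (rule mult.left_commute)
        also have "\<dots> = to_fract ([:c i:] * (f ^ i * h ^ (N - i)))" unfolding e by (rule to_fract_mult[symmetric])
        also have "[:c i:] * (f ^ i * h ^ (N - i)) = smult (c i) (f ^ i * h ^ (N - i))" by simp
        finally show ?thesis .
      qed
      have "to_fract (h ^ N) * ?S = (\<Sum>i<N. to_fract (h ^ N) * (to_fract [:c i:] * ?q ^ i))"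
        by (rule sum_distrib_left)
      also have "\<dots> = (\<Sum>i<N. to_fract (smult (c i) (f ^ i * h ^ (N - i))))"
        by (rule sum.cong[OF refl], rule summand, simp only: lessThan_iff)
      also have "\<dots> = to_fract (\<Sum>i<N. smult (c i) (f ^ i * h ^ (N - i)))"
        by (rule to_fract_sum[symmetric])
      finally have "to_fract (h ^ N) * ?S = to_fract (\<Sum>i<N. smult (c i) (f ^ i * h ^ (N - i)))" .
      from arg_cong[OF this, of ?W]
      have "mu (h ^ N) + ?W ?S = mu (\<Sum>i<N. smult (c i) (f ^ i * h ^ (N - i)))"
        unfolding W_mult mu.frac_val_to_fract .
      moreover have "mu (h ^ N) + 0 < mu (h ^ N) + ?W ?S"
        using Spos by (rule vinf_add_strict_mono(2)) (use d in \<open>auto simp: val_power[OF mu]\<close>)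
      ultimately have rel: "nmul N (mu h) < mu (\<Sum>i<N. smult (c i) (f ^ i * h ^ (N - i)))"
        by (simp add: val_power[OF mu])
      have N: "N > 0" using p(2) by (simp add: N_def)
      have "List.hd p = ?\<rho> [:c (N - 1):]" using N by (subst c(2)) (simp add: hd_map hd_rev)
      hence "c (N - 1) \<noteq> 0" using pK(2) mr.res_zero by auto
      hence "\<exists>i<N. c i \<noteq> 0" using N by (intro exI[of _ "N - 1"]) auto
      from smax_eq_of_relation[OF f h eq this c0 rel] show ?thesis .
    qed
    obtain x where x: "z = ?res x" "0 \<le> ?W x"
      using z by (auto simp: kappa_def R F.carrier_residue_field)
    have alg: "\<not> mr.transcendental mr.constants z" using z by (simp add: kappa_def base)
    obtain f h where fh: "x = Fract f h" "h \<noteq> 0" by (cases x) auto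
    obtain d where d: "mu h = Val d" using fh(2) mu_eq_Infty by (cases "mu h") auto
    have fx: "?W x + mu h = mu f" using mu.frac_val_Fract[OF fh(2), of f] fh(1) by simp
    show ?thesis
    proof (cases "?W x = 0")
      case False
      hence "z = \<zero>\<^bsub>?R\<^esub>" using res_eq[of x 0] x F.w_zero by (simp add: res_zero type_ring_simps)
      thus ?thesis using subringE(2)[OF subfieldE(1)[OF E]] by simp
    next
      case True
      hence eq: "mu f = mu h" using fx by simp
      have f: "f \<noteq> 0" using eq d val_zero[OF mu] by auto
      have sm: "smax f = smax h" using key[OF f fh(2) eq] alg x(1) fh(1) by simp
      obtain c where c: "degree c < degree \<phi>" "w c = 0" "mu h < T (f - c * h) (smax h)"
        using top_digit_cancel[OF f fh(2) eq sm] by blast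
      have cmem: "?\<rho> c \<in> mr.residues" using c by (auto simp: mr.residues_def)
      have muc: "mu c = 0" using c mu_eq_w by simp
      have xc: "x - to_fract c = Fract (f - c * h) h"
        using fh by (simp add: to_fract_def)
      have Wc: "0 \<le> ?W (to_fract c)" by (simp add: mu.frac_val_to_fract muc)
      have ge: "mu h \<le> mu (f - c * h)" by (rule val_diff_ge[OF mu]) (simp_all add: eq val_mult[OF mu] muc)
      have fy: "?W (x - to_fract c) + mu h = mu (f - c * h)" using mu.frac_val_Fract[OF fh(2), of "f - c * h"] xc by simp
      show ?thesis
      proof (cases "mu (f - c * h) = mu h")
        case False
        hence "Val d < ?W (x - to_fract c) + Val d" using ge fy d by simp
        hence "0 < ?W (x - to_fract c)" by (cases "?W (x - to_fract c)") auto
        hence "z = ?\<rho> c" using res_eq[OF x(2) Wc] x(1) rho by simp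
        thus ?thesis using cmem by simp
      next
        \<comment> \<open>The contradictory case: the difference has a nonzero algebraic residue, so
          its \<open>smax\<close> is that of \<open>h\<close>, but the digit at this place was
          cancelled.\<close>
        case eq': True
        have nz: "f - c * h \<noteq> 0" using eq' d val_zero[OF mu] by auto
        have Wy: "?W (x - to_fract c) = 0" using fy eq' d by (cases "?W (x - to_fract c)") auto
        have "?res (x - to_fract c) \<oplus>\<^bsub>?R\<^esub> ?\<rho> c = z" using res_add[of "x - to_fract c" "to_fract c"] Wy Wc x(1) rho by simp
        hence zc: "?res (x - to_fract c) = z \<ominus>\<^bsub>?R\<^esub> ?\<rho> c"
          using res_closed[of "x - to_fract c"] res_closed[OF Wc] Wy rho x res_closed[OF x(2)]
          by (simp add: a_minus_def mr.add.inv_solve_right)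
        let ?A = "{x \<in> carrier ?R. (mr.algebraic over mr.constants) x}"
        have A: "subring ?A ?R" using mr.subfield_of_algebraics[OF K] by (rule subfieldE(1))
        have "z \<in> ?A" using alg x res_closed by (simp add: over_def)
        moreover have "?\<rho> c \<in> ?A"
        proof -
          have "mr.finite_dimension mr.constants mr.residues"
            using mr.dimension_low_residues by (rule mr.finite_dimensionI)
          hence "(mr.algebraic over mr.constants) (?\<rho> c)"
            using mr.finite_dimension_imp_algebraic[OF K subfieldE(1)[OF E]] cmem by blast
          thus ?thesis using cmem subfieldE(3)[OF E] by blast
        qed
        ultimately have "z \<ominus>\<^bsub>?R\<^esub> ?\<rho> c \<in> ?A"
          unfolding a_minus_def using subringE(5,7)[OF A] by blast
        hence "\<not> mr.transcendental mr.constants (?res (Fract (f - c * h) h))"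
          unfolding zc[symmetric] xc by (simp add: over_def)
        hence "smax (f - c * h) = smax h" by (rule key[OF nz fh(2) eq'])
        hence "T (f - c * h) (smax h) = mu h" using smax(1)[OF nz] eq' by simp
        thus ?thesis using c(3) by simp
      qed
    qed
  qed
  ultimately show ?thesis by blast
qed

end

section \<open>Degree of the residual polynomial\<close>

context poly_valuation
begin

text \<open>A nonzero homogeneous element is an initial form, and 0 is excluded because a unit
  divides 1.\<close>

lemma homogeneous_unit_gr_in:
  assumes "homogeneous_unit \<mu> (Val \<delta>) z"
  shows "\<exists>f. z = gr_in \<mu> f \<and> \<mu> f = Val \<delta>"
proof -
  have z: "z \<in> carrier \<G>" "\<And>\<beta>. \<beta> \<noteq> \<delta> \<Longrightarrow> z \<beta> = gr_plus \<mu> \<beta>" and unit: "z \<in> Units \<G>"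
    using assms by (auto simp: homogeneous_unit_def Units_def)
  obtain f where f: "Val \<delta> \<le> \<mu> f" "z \<delta> = gr_class \<mu> \<delta> f" using z(1) gr_carrier by blast
  have "\<mu> f = Val \<delta>"
  proof (rule ccontr)
    assume "\<mu> f \<noteq> Val \<delta>"
    hence "z \<delta> = gr_plus \<mu> \<delta>" using f by (simp add: gr_class_eq_plus)
    hence "z \<beta> = gr_plus \<mu> \<beta>" for \<beta> using z(2) by (cases "\<beta> = \<delta>") auto
    hence z0: "z = gr_in \<mu> 0" by (simp add: gr_in_zero fun_eq_iff)
    obtain y where y: "y \<in> carrier \<G>" "z \<otimes>\<^bsub>\<G>\<^esub> y = \<one>\<^bsub>\<G>\<^esub>" using unit by (auto simp: Units_def)
    obtain t where t: "\<And>\<beta>. t \<beta> \<in> y \<beta>" using gr_section[OF y(1)] by blast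
    have "0 \<in> z \<beta>" for \<beta> unfolding z0 using gr_in_rep[of 0 \<beta>] by simp
    from gr_mult[OF z(1) y(1) this t, of 0] have "(z \<otimes>\<^bsub>\<G>\<^esub> y) 0 = gr_class \<mu> 0 0" by simp
    moreover have "gr_in \<mu> 1 0 = gr_class \<mu> 0 1" by (simp add: gr_in_def val_one[OF val])
    ultimately have "gr_class \<mu> 0 1 = gr_plus \<mu> 0" using y(2) by (simp add: gr_one gr_class_zero)
    thus False by (simp add: gr_class_eq_plus val_one[OF val])
  qed
  moreover from this have "z = gr_in \<mu> f" using f z(2) by (intro ext) (auto simp: gr_in_def)
  ultimately show ?thesis by blast
qed

text \<open>Comparing components with those of 1 leaves an inverse with the single degree -\<delta>,
  where it has a representative \<open>t\<close>.\<close>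

lemma inv_gr_in:
  assumes unit: "gr_in \<mu> f \<in> Units \<G>" and f: "\<mu> f = Val \<delta>"
  shows "\<exists>t. inv\<^bsub>\<G>\<^esub> (gr_in \<mu> f) = gr_in \<mu> t \<and> 0 < \<mu> (f * t - 1)"
proof -
  have form: "\<exists>t. y = gr_in \<mu> t \<and> 0 < \<mu> (f * t - 1)"
    if y: "y \<in> carrier \<G>" "gr_in \<mu> f \<otimes>\<^bsub>\<G>\<^esub> y = \<one>\<^bsub>\<G>\<^esub>" for y
  proof -
    obtain s where s: "\<And>\<beta>. s \<beta> \<in> y \<beta>" using gr_section[OF y(1)] by blast
    have comp: "gr_class \<mu> \<alpha> (f * s (\<alpha> - \<delta>)) = gr_in \<mu> 1 \<alpha>" for \<alpha>
      using gr_in_mult_component[OF y(1) s f, of \<alpha>] y(2) by (simp add: gr_one)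
    have "gr_class \<mu> 0 (f * s (- \<delta>)) = gr_class \<mu> 0 1"
      using comp[of 0] by (simp add: gr_in_def val_one[OF val])
    hence t: "0 < \<mu> (f * s (- \<delta>) - 1)" by (simp add: gr_class_eq)
    have "\<mu> (f * s (- \<delta>)) = 0" using val_eq_of_diff[OF val, of 1 "f * s (- \<delta>)"] t
      by (simp add: val_one[OF val] minus_commute[of 1])
    hence ms: "\<mu> (s (- \<delta>)) = Val (- \<delta>)"
      by (cases "\<mu> (s (- \<delta>))") (auto simp: val_mult[OF val] f eq_neg_iff_add_eq_0 add.commute)
    have "y \<beta> = gr_in \<mu> (s (- \<delta>)) \<beta>" for \<beta>
    proof (cases "\<beta> = - \<delta>")
      case True
      thus ?thesis using gr_rep(2)[OF y(1) s, of \<beta>] ms by (simp add: gr_in_def)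
    next
      case False
      hence "\<beta> + \<delta> \<noteq> 0" by (simp add: eq_neg_iff_add_eq_0)
      hence "gr_class \<mu> (\<beta> + \<delta>) (f * s \<beta>) = gr_plus \<mu> (\<beta> + \<delta>)"
        using comp[of "\<beta> + \<delta>"] by (simp add: gr_in_def val_one[OF val])
      hence "Val (\<beta> + \<delta>) < \<mu> f + \<mu> (s \<beta>)" by (simp add: gr_class_eq_plus val_mult[OF val])
      hence "Val \<beta> < \<mu> (s \<beta>)" by (cases "\<mu> (s \<beta>)") (auto simp: f add.commute)
      hence "y \<beta> = gr_plus \<mu> \<beta>" using gr_rep(2)[OF y(1) s, of \<beta>] by (simp add: gr_class_eq_plus)
      thus ?thesis using False ms by (auto simp: gr_in_def)
    qed
    thus ?thesis using t by blast
  qed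
  have uniq: "gr_in \<mu> t = gr_in \<mu> t'" if t: "0 < \<mu> (f * t - 1)" "0 < \<mu> (f * t' - 1)" for t t'
  proof (rule gr_in_cong)
    have "0 < \<mu> ((f * t - 1) - (f * t' - 1))" using t by (rule val_diff_gt[OF val])
    hence less: "0 < \<mu> f + \<mu> (t - t')" by (simp add: algebra_simps flip: val_mult[OF val])
    have "\<mu> (f * t) = 0" using val_eq_of_diff[OF val, of 1 "f * t"] t(1)
      by (simp add: val_one[OF val] minus_commute[of 1])
    hence "\<mu> f + \<mu> t < \<mu> f + \<mu> (t - t')" using less by (simp add: val_mult[OF val])
    thus "\<mu> t < \<mu> (t - t')" by (cases "\<mu> t"; cases "\<mu> (t - t')") (auto simp: f)
  qed
  obtain y where y: "y \<in> carrier \<G>" "gr_in \<mu> f \<otimes>\<^bsub>\<G>\<^esub> y = \<one>\<^bsub>\<G>\<^esub>" "y \<otimes>\<^bsub>\<G>\<^esub> gr_in \<mu> f = \<one>\<^bsub>\<G>\<^esub>"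
    using unit by (auto simp: Units_def)
  have "inv\<^bsub>\<G>\<^esub> (gr_in \<mu> f) = y"
    unfolding m_inv_def
  proof (rule the_equality)
    show "y \<in> carrier \<G> \<and> gr_in \<mu> f \<otimes>\<^bsub>\<G>\<^esub> y = \<one>\<^bsub>\<G>\<^esub> \<and> y \<otimes>\<^bsub>\<G>\<^esub> gr_in \<mu> f = \<one>\<^bsub>\<G>\<^esub>" using y by blast
    fix y' assume "y' \<in> carrier \<G> \<and> gr_in \<mu> f \<otimes>\<^bsub>\<G>\<^esub> y' = \<one>\<^bsub>\<G>\<^esub> \<and> y' \<otimes>\<^bsub>\<G>\<^esub> gr_in \<mu> f = \<one>\<^bsub>\<G>\<^esub>"
    thus "y' = y" using form[OF y(1,2)] form[of y'] uniq by metis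
  qed
  thus ?thesis using form[OF y(1,2)] by simp
qed

lemma gr_in_nat_pow: "gr_in \<mu> f [^]\<^bsub>\<G>\<^esub> (n :: nat) = gr_in \<mu> (f ^ n)"
  by (induction n) (simp_all add: nat_pow_def gr_one gr_in_mult power_Suc2 del: power_Suc)

lemma gr_zero_to_res_gr_in:
  assumes v: "valuation v" "\<And>a. \<mu> [:a:] = v a" and f: "\<mu> f = 0"
  shows "gr_zero_to_res \<mu> (gr_in \<mu> f) = mu_res_class \<mu> f"
proof -
  interpret R: residue_map "mu_residue_field \<mu>" v \<mu> "mu_res_class \<mu>" by (rule mu_residue_map[OF v])
  have zero: "gr_in \<mu> f 0 = gr_class \<mu> 0 f" using f by (simp add: gr_in_def)
  have same: "mu_res_class \<mu> h = mu_res_class \<mu> f" if "h \<in> gr_class \<mu> 0 f" for h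
  proof -
    have d: "0 < \<mu> (h - f)" using that by (simp add: mem_gr_class minus_commute[of f])
    hence "\<mu> h = 0" using val_eq_of_diff[OF val, of f h] f by (simp add: minus_commute[of f])
    thus ?thesis using R.res_eq[of h f] d f by simp
  qed
  show ?thesis unfolding gr_zero_to_res_def zero
  proof (rule the_equality)
    show "\<exists>h\<in>gr_class \<mu> 0 f. mu_res_class \<mu> f = mu_res_class \<mu> h" using gr_class_self by blast
    fix c assume "\<exists>h\<in>gr_class \<mu> 0 f. c = mu_res_class \<mu> h"
    thus "c = mu_res_class \<mu> f" using same by metis
  qed
qed

end

context level
begin

lemma smax_zero_mod:
  assumes f: "f \<noteq> 0" and s: "smax f = 0"
  shows "mu f < mu (f - f mod \<phi>)"
proof -
  obtain n where n: "mu (f - f mod \<phi>) = T (f - f mod \<phi>) n" using mu_attained by blast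
  have dig: "digit \<phi> (f - f mod \<phi>) n = (if n = 0 then 0 else digit \<phi> f n)"
    using digit_add[of \<phi> "f - f mod \<phi>" "f mod \<phi>" n] degree_mod[of f]
    by (auto simp: digit_less_degree digit_zero)
  show ?thesis
  proof (cases "n = 0")
    case True
    hence "mu (f - f mod \<phi>) = Infty" using n dig by (simp add: T_def val_zero[OF w])
    moreover have "mu f \<noteq> Infty" using f mu_eq_Infty by simp
    ultimately show ?thesis by (cases "mu f") auto
  next
    case False
    thus ?thesis using n dig smax(3)[OF f, of n] s by (simp add: T_def)
  qed
qed

end

context orthogonal_level
begin

text \<open>A polynomial with \<open>smax\<close> 0 is equivalent to its remainder modulo
  \<open>\<phi>\<close>, whose residue \<open>kappa_mu\<close> places in \<kappa>(\<mu>).\<close>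

lemma mu_res_class_kappa:
  assumes f: "mu f = 0" and s: "smax f = 0"
  shows "mu_res_class mu f \<in> kappa mu"
proof -
  interpret mr: orthogonal_residue v w \<phi> b "mu_residue_field mu" mu "mu_res_class mu"
    by (rule mu_orthogonal_residue)
  have nz: "f \<noteq> 0" using f val_zero[OF mu] by auto
  have less: "0 < mu (f - f mod \<phi>)" using smax_zero_mod[OF nz s] f by simp
  have m0: "mu (f mod \<phi>) = 0" using val_eq_of_diff[OF mu, of f "f mod \<phi>"] less f by simp
  have "mu_res_class mu f = mu_res_class mu (f mod \<phi>)" using mr.res_eq[of f "f mod \<phi>"] less f m0 by simp
  moreover have "mu_res_class mu (f mod \<phi>) \<in> mr.residues"
    using degree_mod[of f] m0 mu_eq_w[OF degree_mod[of f]] by (auto simp: mr.residues_def)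
  ultimately show ?thesis by (simp add: kappa_mu)
qed

text \<open>By the shape of key polynomials the set S has minimum 0 and maximum l =
  \<open>smax \<psi>\<close>, and the digit at l is 1. Hence the coefficient at d = l/e is the
  residue of 1, and d is the degree.\<close>

theorem degree_residual_poly:
  assumes torsion: "\<exists>n>0. nmul n \<gamma> \<in> vals v" and \<psi>: "\<psi> \<in> KP mu" and less: "degree \<phi> < degree \<psi>"
    and unit: "homogeneous_unit mu (nmul (rel_index mu \<phi>) (mu \<phi>)) z"
  shows "deg (kappa_ring mu) (residual_poly mu \<phi> z \<psi>) = smax \<psi> div rel_index mu \<phi>"
proof -
  interpret mr: orthogonal_residue v w \<phi> b "mu_residue_field mu" mu "mu_res_class mu"
    by (rule mu_orthogonal_residue)
  let ?G = "gr_ring mu" and ?k = "kappa_ring mu"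
  define e l d where "e = rel_index mu \<phi>" and "l = smax \<psi>" and "d = smax \<psi> div rel_index mu \<phi>"
  define a where "a = digit \<phi> \<psi>"
  define S where "S = {n. mu (a n * \<phi> ^ n) = mu \<psi>}"
  note nz = mu.KP_D(2)[OF \<psi>]
  have e: "e > 0" "e dvd l" "l = d * e"
    using rel_index(1)[OF torsion] next_FF(2)[OF torsion \<psi> less] by (auto simp: e_def l_def d_def)
  have Ta: "mu (a n * \<phi> ^ n) = T \<psi> n" for n
    using mu_monomial[OF degree_digit_less[OF deg], of \<psi> n n] by (simp add: a_def T_def)
  have S: "S = {n. T \<psi> n = mu \<psi>}" by (simp add: S_def Ta)
  have S0: "0 \<in> S" using key_first_digit[OF \<psi> less] by (simp add: S)
  have Sl: "l \<in> S" "\<And>n. n \<in> S \<Longrightarrow> n \<le> l"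
  proof -
    show "l \<in> S" using smax(1)[OF nz] by (simp add: S l_def)
    show "n \<le> l" if "n \<in> S" for n using smax(3)[OF nz, of n] that by (force simp: S l_def)
  qed
  have finS: "finite S" using Sl(2) finite_nat_set_iff_bounded_le by blast
  have Min: "Min S = 0" using S0 finS by (intro Min_eqI) auto
  have Max: "Max S = l" using Sl finS by (intro Max_eqI) auto
  have al: "a l = 1" using key_leading_digit(2)[OF \<psi>] by (simp add: a_def l_def)
  have mpsi: "mu \<psi> = Val (nmul l \<gamma>)" using Sl(1) al by (simp add: S T_def a_def val_one[OF w])
  have delta: "nmul e (mu \<phi>) = Val (nmul e \<gamma>)" by (simp add: mu_phi)
  obtain f where f: "z = gr_in mu f" "mu f = Val (nmul e \<gamma>)"
    using mu.homogeneous_unit_gr_in[of "nmul e \<gamma>" z] unit by (auto simp: e_def mu_phi)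
  have zU: "gr_in mu f \<in> Units ?G" using unit f(1) by (simp add: homogeneous_unit_def)
  obtain t where t: "inv\<^bsub>?G\<^esub> z = gr_in mu t" "0 < mu (f * t - 1)" using mu.inv_gr_in[OF zU f(2)] f(1) by auto
  have ft: "mu 1 < mu (1 - f * t)" using t(2) by (simp add: val_one[OF mu] mu.minus_commute[of 1])
  hence mft: "mu (f * t) = 0" using val_eq_of_diff[OF mu, of 1 "f * t"] by (simp add: val_one[OF mu])
  have f0: "f \<noteq> 0" and t0: "t \<noteq> 0" using mft val_zero[OF mu] by auto
  \<comment> \<open>The product of the representatives of a unit and its inverse is equivalent to 1,
    so both have \<open>smax\<close> 0; this keeps the coefficients algebraic.\<close>
  have "smax f + smax t = smax 1" using smax_cong[OF ft] mu_mult_smax(2)[OF f0 t0] by simp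
  hence st: "smax t = 0" using smax_less_degree[of 1] deg by simp
  have mt: "mu t = Val (- nmul e \<gamma>)"
    using mft f(2) by (cases "mu t") (auto simp: val_mult[OF mu] eq_neg_iff_add_eq_0 add.commute)
  \<comment> \<open>A polynomial representing the j-th coefficient; the factor for the top digit is
    absent because that digit is 1.\<close>
  define F where "F j = t ^ (d - j) * a (j * e)" for j
  have sF: "mu (F j) = 0" "smax (F j) = 0" if j: "j \<le> d" "j * e \<in> S" for j
  proof -
    have "T \<psi> (j * e) = Val (nmul l \<gamma>)" using j(2) mpsi by (simp add: S)
    hence wa: "w (a (j * e)) + Val (nmul (j * e) \<gamma>) = Val (nmul l \<gamma>)" by (simp add: T_def a_def)
    have da: "degree (a (j * e)) < degree \<phi>" unfolding a_def by (rule degree_digit_less[OF deg])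
    have a0: "a (j * e) \<noteq> 0" using wa val_zero[OF w] by auto
    have l': "l = (d - j) * e + j * e" using e(3) j(1) by (simp add: add_mult_distrib[symmetric])
    have "nmul l \<gamma> = nmul ((d - j) * e) \<gamma> + nmul (j * e) \<gamma>" by (subst l') (rule nmul_add)
    hence "w (a (j * e)) = Val (nmul ((d - j) * e) \<gamma>)" using wa by (cases "w (a (j * e))") auto
    hence ma: "mu (a (j * e)) = Val (nmul (d - j) (nmul e \<gamma>))" using mu_eq_w[OF da] by (simp add: nmul_mult)
    show "mu (F j) = 0" by (simp add: nmul_uminus F_def val_mult[OF mu] val_power[OF mu] mt ma)
    show "smax (F j) = 0"
      using mu_mult_smax(2)[of "t ^ (d - j)" "a (j * e)"] t0 a0 mu_power_smax[OF t0] st smax_less_degree[OF a0 da]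
      by (simp add: F_def)
  qed
  have R: "residual_poly mu \<phi> z \<psi> j = (if j \<le> d \<and> j * e \<in> S then mu_res_class mu (F j) else \<zero>\<^bsub>?k\<^esub>)" for j
  proof -
    have "residual_poly mu \<phi> z \<psi> j = (if j \<le> d \<and> j * e \<in> S
              then gr_zero_to_res mu
                (inv\<^bsub>?G\<^esub> (gr_in mu (a l)) \<otimes>\<^bsub>?G\<^esub> (inv\<^bsub>?G\<^esub> z [^]\<^bsub>?G\<^esub> (d - j)) \<otimes>\<^bsub>?G\<^esub> gr_in mu (a (j * e)))
              else \<zero>\<^bsub>?k\<^esub>)"
      unfolding residual_poly_def Let_def a_def[symmetric] e_def[symmetric] S_def[symmetric] Min Max
      using e(1,3) by simp
    also have "\<dots> = (if j \<le> d \<and> j * e \<in> S then gr_zero_to_res mu (gr_in mu (F j)) else \<zero>\<^bsub>?k\<^esub>)"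
      by (simp add: al mu.gr_one[symmetric] mu.gr_inv_one t(1) mu.gr_in_nat_pow mu.gr_in_mult F_def mu.gr_one_mult mu.gr_in_carrier)
    also have "\<dots> = (if j \<le> d \<and> j * e \<in> S then mu_res_class mu (F j) else \<zero>\<^bsub>?k\<^esub>)"
      using mu.gr_zero_to_res_gr_in[OF v mu_const] sF(1) by auto
    finally show ?thesis .
  qed
  have zero: "\<zero>\<^bsub>?k\<^esub> = \<zero>\<^bsub>mu_residue_field mu\<^esub>" by (simp add: kappa_ring_def)
  have zk: "\<zero>\<^bsub>?k\<^esub> \<in> kappa mu"
    unfolding zero kappa_mu using subringE(2)[OF subfieldE(1)[OF mr.subfield_low_residues]] .
  have "residual_poly mu \<phi> z \<psi> d \<noteq> \<zero>\<^bsub>?k\<^esub>"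
  proof -
    have "residual_poly mu \<phi> z \<psi> d = \<one>\<^bsub>mu_residue_field mu\<^esub>"
      using R[of d] Sl(1) al by (simp add: F_def mr.res_one flip: e(3))
    thus ?thesis by (simp add: zero)
  qed
  moreover have "bound \<zero>\<^bsub>?k\<^esub> d (residual_poly mu \<phi> z \<psi>)"
    by (rule bound.intro) (simp add: R)
  \<comment> \<open>The coefficient function of \<open>UP\<close>, to which \<open>deg\<close>
    refers, is specified on \<open>up\<close> only, so all coefficients have to be located in
    \<kappa>(\<mu>).\<close>
  moreover from this have "residual_poly mu \<phi> z \<psi> \<in> up ?k"
    using R mu_res_class_kappa sF zk by (auto simp: up_def kappa_ring_def)
  ultimately have "deg ?k (residual_poly mu \<phi> z \<psi>) = d"
    unfolding deg_def UP_def
    by (intro Least_equality) (auto simp: bound_def not_le[symmetric])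
  thus ?thesis by (simp add: d_def)
qed

end

section \<open>Chains\<close>

text \<open>Induction over division by \<open>\<psi>\<close>: neither remainder nor quotient part
  has smaller value than \<open>f\<close>, and passing to \<gamma> only raises the latter. It is
  used to carry congruences of residues to the next level.\<close>

lemma (in poly_valuation) le_augment:
  assumes \<psi>: "\<psi> \<in> KP \<mu>" and const: "\<And>c. \<mu> [:c:] = v c" and \<gamma>: "\<mu> \<psi> < Val \<gamma>"
  shows "\<mu> f \<le> augment \<mu> \<psi> (Val \<gamma>) f"
proof -
  interpret n: level v "augment \<mu> \<psi> Infty" \<psi> \<gamma> by (rule next_level(1)[OF \<psi> const \<gamma>])
  note lim = limit_valuation[OF \<psi>]
  have "\<mu> f \<le> n.mu f"
  proof (induction "degree f" arbitrary: f rule: less_induct)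
    case less
    show ?case
    proof (cases "degree f < degree \<psi>")
      case True
      thus ?thesis using lim(4)[of f] n.mu_eq_w[of f] by simp
    next
      case False
      define q r where "q = f div \<psi>" and "r = f mod \<psi>"
      have dr: "degree r < degree \<psi>" unfolding r_def by (rule n.degree_mod)
      have f: "f = q * \<psi> + r" by (simp add: q_def r_def)
      have mr: "\<mu> f \<le> \<mu> r" using lim(3)[of f] n.w_mod[of f] lim(4)[OF dr] by (simp add: r_def)
      have "\<mu> f \<le> \<mu> (f - r)" using mr by (intro val_diff_ge[OF val]) auto
      hence mq: "\<mu> f \<le> \<mu> q + \<mu> \<psi>" by (simp add: f val_mult[OF val])
      have "degree q < degree f"
      proof (cases "q = 0")
        case True
        thus ?thesis using False n.deg by simp
      next
        case nz: False
        have "q * \<psi> = f + - r" by (simp add: q_def r_def minus_mod_eq_div_mult)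
        moreover have "degree (f + - r) = degree f" using dr False by (intro degree_add_eq_left) simp
        ultimately have "degree (q * \<psi>) = degree f" by simp
        thus ?thesis using nz n.phi_nz n.deg by (simp add: degree_mult_eq)
      qed
      hence "\<mu> q \<le> n.mu q" by (rule less)
      hence "\<mu> q + \<mu> \<psi> \<le> n.mu q + Val \<gamma>" using \<gamma> by (intro add_mono) auto
      hence "\<mu> f \<le> n.mu (q * \<psi>)" using mq by (simp add: val_mult[OF n.mu] n.mu_phi)
      moreover have "\<mu> f \<le> n.mu r" using mr lim(4)[OF dr] n.mu_eq_w[OF dr] by simp
      ultimately have "\<mu> f \<le> n.mu (q * \<psi> + r)" by (rule val_add_ge[OF n.mu])
      thus ?thesis unfolding f[symmetric] .
    qed
  qed
  thus ?thesis by (simp add: next_level(2)[OF \<psi> const \<gamma>])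
qed

context orthogonal_level
begin

context
  assumes torsion: "\<And>\<alpha>. \<exists>n>0. nmul n \<alpha> \<in> vals v"
begin

text \<open>A monoid that is torsion modulo a subgroup is a group: -y = (n - 1) y - n y.\<close>

lemma vals_mu_diff:
  assumes x: "x \<in> vals mu" and y: "y \<in> vals mu"
  shows "x - y \<in> vals mu"
proof -
  obtain n where n: "n > 0" "nmul n y \<in> vals v" using torsion by blast
  have mult: "nmul k y \<in> vals mu" for k
  proof (induction k)
    case 0
    have "mu 1 = Val 0" by (simp add: val_one[OF mu])
    hence "0 \<in> vals mu" unfolding vals_def by blast
    thus ?case by simp
  next
    case (Suc k)
    thus ?case using vals_mu_group(1)[OF Suc y] nmul_add[of k 1 y] by (simp add: add.commute)
  qed
  have "- nmul n y \<in> vals mu" using vals_group(4)[OF v n(2)] vals_v_sub vals_mu_group(2) by blast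
  hence "x + nmul (n - 1) y + - nmul n y \<in> vals mu" by (intro vals_mu_group(1) x mult)
  moreover have "nmul n y = nmul (n - 1) y + y" using n(1) nmul_add[of "n - 1" 1 y] by simp
  ultimately show ?thesis by (simp add: algebra_simps)
qed

lemma mu_value_group_eq: "mu_value_group mu = vals mu"
  by (rule mu.mu_value_group) (rule vals_mu_diff)

lemma cosets_mu_finite: "finite ((\<lambda>a. (+) a ` vals v) ` vals mu)"
proof -
  obtain N where N: "N > 0" "nmul N \<gamma> \<in> vals v" using torsion by blast
  have mult: "nmul (k * N) \<gamma> \<in> vals v" for k
    by (induction k) (auto simp: nmul_add vals_group(1)[OF v] intro: vals_group(3)[OF v] N(2))
  have "(\<lambda>a. (+) a ` vals v) ` vals mu \<subseteq> (\<lambda>(S, n). (+) (nmul n \<gamma>) ` S) ` (((\<lambda>a. (+) a ` vals v) ` vals w) \<times> {..<N})"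
  proof
    fix S assume "S \<in> (\<lambda>a. (+) a ` vals v) ` vals mu"
    then obtain \<alpha> where \<alpha>: "\<alpha> \<in> vals mu" "S = (+) \<alpha> ` vals v" by blast
    then obtain \<delta> n where d: "\<delta> \<in> vals w" "\<alpha> = \<delta> + nmul n \<gamma>" using vals_mu by blast
    have "nmul n \<gamma> = nmul (n div N * N) \<gamma> + nmul (n mod N) \<gamma>" by (simp only: div_mult_mod_eq flip: nmul_add)
    hence "\<alpha> - (nmul (n mod N) \<gamma> + \<delta>) = nmul (n div N * N) \<gamma>" using d(2) by simp
    hence "\<alpha> - (nmul (n mod N) \<gamma> + \<delta>) \<in> vals v" using mult by simp
    moreover have "(+) \<alpha> ` vals v = (+) (nmul (n mod N) \<gamma> + \<delta>) ` vals v \<longleftrightarrow> \<alpha> - (nmul (n mod N) \<gamma> + \<delta>) \<in> vals v"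
      by (rule subgroup_coset_eq) (fact vals_group(1)[OF v] vals_group(2)[OF v])+
    ultimately have "S = (+) (nmul (n mod N) \<gamma>) ` (+) \<delta> ` vals v" unfolding \<alpha>(2) by (simp add: image_image add.assoc)
    moreover have "n mod N < N" using N(1) by simp
    ultimately show "S \<in> (\<lambda>(S, n). (+) (nmul n \<gamma>) ` S) ` (((\<lambda>a. (+) a ` vals v) ` vals w) \<times> {..<N})"
      using d(1) by (intro image_eqI[of _ _ "((+) \<delta> ` vals v, n mod N)"]) auto
  qed
  thus ?thesis by (rule finite_subset) (intro finite_imageI finite_cartesian_product cosets_finite finite_lessThan)
qed

lemma chain_f_0:
  "ring.dim (mu_residue_field mu) (base_residue_field mu) (kappa mu) = FF"
proof -
  interpret mr: orthogonal_residue v w \<phi> b "mu_residue_field mu" mu "mu_res_class mu"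
    by (rule mu_orthogonal_residue)
  have "base_residue_field mu = mr.constants"
    by (simp add: base_residue_field_def mr.constants_def mu_const)
  thus ?thesis using mr.dimI[OF mr.subfield_constants mr.dimension_low_residues] by (simp add: kappa_mu over_def)
qed

text \<open>Inside the residue field of the new valuation there is a tower: constants, residues in
  degree less than deg(\<open>\<phi>\<close>), residues in degree less than
  deg(\<open>\<psi>\<close>). The middle field is the image of the old \<kappa> and has degree
  \<open>FF\<close>; the top one is the new \<kappa> and has degree the new \<open>FF\<close>. The
  interpretation \<open>m0\<close> reads the small residues in the old residue field,
  \<open>m1\<close> in the new one.\<close>

lemma next_chain:
  assumes \<psi>: "\<psi> \<in> KP mu" and less: "degree \<phi> < degree \<psi>" and \<gamma>': "mu \<psi> < Val \<gamma>'"
  defines "\<nu> \<equiv> augment mu \<psi> (Val \<gamma>')" and "w' \<equiv> augment mu \<psi> Infty"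
  shows "orthogonal_level v w' \<psi> \<gamma>' B" "level.mu w' \<psi> \<gamma>' = \<nu>"
    "grp_index (vals \<nu>) (vals v) = grp_index (mu_value_group \<nu>) (mu_value_group mu) * grp_index (vals mu) (vals v)"
    "orthogonal_limit.FF v w' \<psi> B = FF * ring.dim (mu_residue_field \<nu>) (kappa_image mu \<nu>) (kappa \<nu>)"
proof -
  note lev = mu.next_level[OF \<psi> mu_const \<gamma>', folded \<nu>_def w'_def]
  show ol: "orthogonal_level v w' \<psi> \<gamma>' B"
    using lev(1) next_orthogonal_limit[OF \<psi>, folded w'_def] by (rule orthogonal_level.intro)
  show nu: "level.mu w' \<psi> \<gamma>' = \<nu>" by (rule lev(2))
  interpret n: orthogonal_level v w' \<psi> \<gamma>' B by (rule ol)
  have w_low: "w' f = mu f" if "degree f < degree \<psi>" for f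
    unfolding w'_def using mu.limit_valuation(4)[OF \<psi> that] .
  have le: "mu f \<le> n.mu f" for f unfolding nu \<nu>_def by (rule mu.le_augment[OF \<psi> mu_const \<gamma>'])
  have vw: "vals w' = vals mu" unfolding w'_def by (rule vals_next[OF \<psi> less])
  have vg: "mu_value_group n.mu = vals n.mu" by (rule n.mu_value_group_eq[OF torsion])
  have "grp_index (vals n.mu) (vals v) = grp_index (vals n.mu) (vals mu) * grp_index (vals mu) (vals v)"
  proof (rule grp_index_mult)
    show "x + y \<in> vals n.mu" if "x \<in> vals n.mu" "y \<in> vals n.mu" for x y using n.vals_mu_group(1) that by blast
    show "0 \<in> vals mu" using vals_group(1)[OF v] vals_v_sub vals_mu_group(2) by blast
    show "x - y \<in> vals mu" if "x \<in> vals mu" "y \<in> vals mu" for x y using vals_mu_diff that by blast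
    show "0 \<in> vals v" "\<And>x y. x \<in> vals v \<Longrightarrow> y \<in> vals v \<Longrightarrow> x - y \<in> vals v" using vals_group[OF v] by blast+
    show "vals mu \<subseteq> vals n.mu" using n.vals_mu_group(2) vw by simp
    show "vals v \<subseteq> vals mu" using vals_v_sub vals_mu_group(2) by blast
    show "finite ((\<lambda>a. (+) a ` vals v) ` vals n.mu)" by (rule n.cosets_mu_finite[OF torsion])
  qed
  thus "grp_index (vals \<nu>) (vals v) = grp_index (mu_value_group \<nu>) (mu_value_group mu) * grp_index (vals mu) (vals v)"
    by (simp add: vg mu_value_group_eq flip: nu)

  let ?R = "mu_residue_field n.mu" and ?\<rho> = "mu_res_class n.mu"
  interpret mr: orthogonal_residue v w' \<psi> B ?R n.mu ?\<rho> by (rule n.mu_orthogonal_residue)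
  interpret m0: orthogonal_residue v w \<phi> b "mu_residue_field mu" mu "mu_res_class mu"
    by (rule mu_orthogonal_residue)
  \<comment> \<open>Thus a product of two polynomials of degree less than deg(\<open>\<phi>\<close>)
    still lies in the range of degrees where old and new valuation agree.\<close>
  have two: "2 * degree \<phi> \<le> degree \<psi>"
    using key_leading_digit(1)[OF \<psi>] less mult_le_mono1[of 2 "smax \<psi>" "degree \<phi>"]
    by (cases "smax \<psi> \<le> 1") (auto simp: le_Suc_eq)
  have low: "n.mu f = mu f" if "degree f < degree \<psi>" for f
    using n.mu_eq_w[OF that] w_low[OF that] by simp
  interpret m1: orthogonal_residue v w \<phi> b ?R n.mu ?\<rho>
  proof (rule orthogonal_residue.intro)
    show "orthogonal_limit v w \<phi> b" by unfold_locales
    show "residue_map ?R v n.mu ?\<rho>" by (rule mr.residue_map_axioms)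
    show "orthogonal_residue_axioms w \<phi> n.mu"
    proof
      show "n.mu f = w f" if "degree f < degree \<phi>" for f using low mu_eq_w[OF that] that less by simp
      fix f s assume fs: "degree f < degree \<phi>" "degree s < degree \<phi>" "0 \<le> w f" "0 \<le> w s"
      have "degree (f * s) \<le> degree f + degree s" by (rule degree_mult_le)
      hence "degree (f * s) < degree \<psi>" using fs(1,2) two by simp
      hence "degree (f * s - (f * s) mod \<phi>) < degree \<psi>"
        using degree_mod[of "f * s"] less by (intro degree_diff_less) auto
      thus "0 < n.mu (f * s - (f * s) mod \<phi>)" using residue_mult_mod[OF fs] low by simp
    qed
  qed
  \<comment> \<open>By \<open>kappa_mu\<close>, each class in the old \<kappa> has a representative
    of small degree, and \<open>le\<close> preserves the congruence between representatives.\<close>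
  have image: "kappa_image mu n.mu = m1.residues"
  proof (intro equalityI subsetI)
    fix y assume "y \<in> kappa_image mu n.mu"
    then obtain f where f: "y = ?\<rho> f" "0 \<le> mu f" "mu_res_class mu f \<in> m0.residues"
      by (auto simp: kappa_image_def kappa_mu)
    then obtain h where h: "mu_res_class mu f = mu_res_class mu h" "degree h < degree \<phi>" "0 \<le> w h"
      by (auto simp: m0.residues_def)
    have "0 < mu (f - h)" using m0.res_eq[of f h] f(2) h mu_eq_w[OF h(2)] by simp
    hence "0 < n.mu (f - h)" using le less_le_trans by blast
    moreover have "0 \<le> n.mu f" using f(2) le order_trans by blast
    moreover have "0 \<le> n.mu h" using h m1.u_low by simp
    ultimately have "y = ?\<rho> h" using mr.res_eq f(1) by simp
    thus "y \<in> m1.residues" using h by (auto simp: m1.residues_def)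
  next
    fix y assume "y \<in> m1.residues"
    then obtain h where h: "y = ?\<rho> h" "degree h < degree \<phi>" "0 \<le> w h" by (auto simp: m1.residues_def)
    hence "mu_res_class mu h \<in> kappa mu" "0 \<le> mu h" using mu_eq_w[OF h(2)] by (auto simp: kappa_mu m0.residues_def)
    thus "y \<in> kappa_image mu n.mu" using h(1) by (auto simp: kappa_image_def)
  qed
  have sub: "m1.residues \<subseteq> mr.residues"
  proof
    fix y assume "y \<in> m1.residues"
    then obtain h where h: "y = ?\<rho> h" "degree h < degree \<phi>" "0 \<le> w h" by (auto simp: m1.residues_def)
    thus "y \<in> mr.residues" using w_low[of h] mu_eq_w[OF h(2)] less by (auto simp: mr.residues_def)
  qed
  note K = mr.subfield_constants and F = m1.subfield_low_residues and E = mr.subfield_low_residues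
  have finE: "mr.finite_dimension mr.constants mr.residues"
    by (rule mr.finite_dimensionI) (rule mr.dimension_low_residues)
  have finF: "mr.finite_dimension mr.constants m1.residues"
    by (rule mr.finite_dimensionI) (rule m1.dimension_low_residues)
  have FE: "mr.finite_dimension m1.residues mr.residues"
    by (rule mr.finite_dimension_overfield[OF K F E m1.constants_sub_residues sub finE])
  have "mr.dim mr.constants mr.residues = mr.dim mr.constants m1.residues * mr.dim m1.residues mr.residues"
    using mr.telescopic_base_dim(2)[OF K F finF FE] by (simp add: over_def)
  moreover have "mr.dim mr.constants mr.residues = n.FF" using mr.dimI[OF K mr.dimension_low_residues] by (simp add: over_def)
  moreover have "mr.dim mr.constants m1.residues = FF" using mr.dimI[OF K m1.dimension_low_residues] by (simp add: over_def)
  ultimately have "n.FF = FF * mr.dim (kappa_image mu n.mu) (kappa n.mu)" by (simp add: image n.kappa_mu)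
  thus "n.FF = FF * ring.dim (mu_residue_field \<nu>) (kappa_image mu \<nu>) (kappa \<nu>)" unfolding nu .
qed

end

end

text \<open>Digits are constants here, so carries vanish and \<open>strict\<close> reduces to
  finiteness; orthogonality concerns the single basis element 1.\<close>

lemma depth_zero_level:
  fixes v :: "'a :: field \<Rightarrow> 'g :: linordered_ab_group_add vinf" and a :: 'a
  assumes v: "valuation v"
  defines "w \<equiv> \<lambda>f. v (poly f a)" and "b \<equiv> \<lambda>i. [:-a, 1:] ^ i"
  shows "orthogonal_level v w [:-a, 1:] \<gamma> b" "level.mu w [:-a, 1:] \<gamma> = depth_zero v a (Val \<gamma>)"
proof -
  let ?\<phi> = "[:-a, 1:]"
  have "min (w f) (w h) \<le> w (f + h)" for f h using v[unfolded valuation_def] unfolding w_def poly_add by blast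
  hence w: "valuation w" unfolding valuation_def using val_zero[OF v] val_one[OF v] val_mult[OF v] by (simp add: w_def)
  have inf: "v x = Infty \<longleftrightarrow> x = 0" for x by (rule valuation_field_eq_Infty_iff[OF v])
  have lim: "limit_val v w ?\<phi>"
    by unfold_locales (use w in \<open>auto simp: w_def inf poly_eq_0_iff_dvd\<close>)
  have "level_axioms w ?\<phi> \<gamma>"
  proof
    fix f h :: "'a poly" assume fh: "f \<noteq> 0" "h \<noteq> 0" "degree f < degree ?\<phi>" "degree h < degree ?\<phi>"
    obtain x y where xy: "f = [:x:]" "h = [:y:]" using fh(3,4) by (auto elim!: degree_eq_zeroE)
    hence "x \<noteq> 0" "y \<noteq> 0" using fh(1,2) by auto
    hence "v x \<noteq> Infty" "v y \<noteq> Infty" using inf by auto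
    moreover have "(f * h) div ?\<phi> = 0" by (rule div_poly_less) (simp add: xy)
    ultimately show "w f + w h < w ((f * h) div ?\<phi>) + Val \<gamma>"
      by (cases "v x"; cases "v y") (auto simp: xy w_def val_zero[OF v])
  qed
  hence lev: "level v w ?\<phi> \<gamma>" using lim by (rule level.intro[rotated])
  have "orthogonal_limit_axioms v w ?\<phi> b"
  proof
    show "lead_coeff (b i) = 1" for i unfolding b_def lead_coeff_power by simp
    show "degree (b i) = i" for i by (simp add: b_def degree_linear_power)
    show "orthogonal v w (degree ?\<phi>) b"
      by (simp add: orthogonal_def b_def w_def val_mult[OF v] val_one[OF v])
  qed
  hence "orthogonal_limit v w ?\<phi> b" using lim by (rule orthogonal_limit.intro[rotated])
  thus "orthogonal_level v w ?\<phi> \<gamma> b" using lev by (rule orthogonal_level.intro[rotated])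
  have "w (digit ?\<phi> f n) = v (coeff (digit ?\<phi> f n) 0)" for f n
  proof -
    have "degree (digit ?\<phi> f n) < 1" using degree_digit_less[of ?\<phi> f n] by simp
    then obtain x where "digit ?\<phi> f n = [:x:]" by (auto elim!: degree_eq_zeroE)
    thus ?thesis by (simp add: w_def)
  qed
  thus "level.mu w ?\<phi> \<gamma> = depth_zero v a (Val \<gamma>)"
    by (intro ext) (simp add: level.mu_def[OF lev] depth_zero_def)
qed

text \<open>The two products refer to different valuations of one level: e_n already counts the
  values added by \<gamma>_n, whereas the residues in \<kappa>(\<mu>_n) come from degrees below that
  of \<phi>_n, that is, from \<open>w\<close>.\<close>

lemma chain_level:
  fixes v :: "'a :: field \<Rightarrow> 'g :: linordered_ab_group_add vinf"
  assumes v: "valuation v" and torsion: "\<And>\<alpha>. \<exists>n>0. nmul n \<alpha> \<in> vals v"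
    and chain: "ordinary_MLV_chain v r \<phi> \<gamma> \<mu>" and n: "n \<le> r"
  shows "\<exists>w b. orthogonal_level v w (\<phi> n) (\<gamma> n) b \<and> level.mu w (\<phi> n) (\<gamma> n) = \<mu> n \<and>
    (\<Prod>i\<le>n. chain_e v \<mu> i) = grp_index (vals (\<mu> n)) (vals v) \<and>
    (\<Prod>i\<le>n. chain_f \<mu> i) = orthogonal_limit.FF v w (\<phi> n) b"
  using n
proof (induction n)
  case 0
  obtain a where a: "\<phi> 0 = [:-a, 1:]" "\<mu> 0 = depth_zero v a (Val (\<gamma> 0))" using chain by (auto simp: ordinary_MLV_chain_def)
  note ol = depth_zero_level[OF v, of a "\<gamma> 0", folded a]
  interpret orthogonal_level v "\<lambda>f. v (poly f a)" "\<phi> 0" "\<gamma> 0" "\<lambda>i. \<phi> 0 ^ i" by (rule ol)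
  have "mu_value_group (\<mu> 0) = vals (\<mu> 0)" using mu_value_group_eq[OF torsion] ol(2) by simp
  hence "(\<Prod>i\<le>0. chain_e v \<mu> i) = grp_index (vals (\<mu> 0)) (vals v)" by (simp add: value_group_base_field)
  moreover have "(\<Prod>i\<le>0. chain_f \<mu> i) = FF" using chain_f_0[OF torsion] ol(2) by simp
  ultimately show ?case using ol by blast
next
  case (Suc n)
  then obtain w b where IH: "orthogonal_level v w (\<phi> n) (\<gamma> n) b" "level.mu w (\<phi> n) (\<gamma> n) = \<mu> n"
    "(\<Prod>i\<le>n. chain_e v \<mu> i) = grp_index (vals (\<mu> n)) (vals v)"
    "(\<Prod>i\<le>n. chain_f \<mu> i) = orthogonal_limit.FF v w (\<phi> n) b" by auto
  interpret orthogonal_level v w "\<phi> n" "\<gamma> n" b by (rule IH)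
  have step: "\<phi> (Suc n) \<in> KP (\<mu> n)" "\<mu> n (\<phi> (Suc n)) < Val (\<gamma> (Suc n))"
    "\<mu> (Suc n) = augment (\<mu> n) (\<phi> (Suc n)) (Val (\<gamma> (Suc n)))" "KP_degree (\<mu> n) < KP_degree (\<mu> (Suc n))"
  proof -
    have "n < r" using Suc.prems by simp
    thus "\<phi> (Suc n) \<in> KP (\<mu> n)" "\<mu> n (\<phi> (Suc n)) < Val (\<gamma> (Suc n))"
      "\<mu> (Suc n) = augment (\<mu> n) (\<phi> (Suc n)) (Val (\<gamma> (Suc n)))" "KP_degree (\<mu> n) < KP_degree (\<mu> (Suc n))"
      using chain unfolding ordinary_MLV_chain_def by blast+
  qed
  note m = IH(2)
  interpret n: level v "augment (\<mu> n) (\<phi> (Suc n)) Infty" "\<phi> (Suc n)" "\<gamma> (Suc n)"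
    using mu.next_level(1)[OF _ mu_const] step(1,2) by (simp add: m)
  have "n.mu = \<mu> (Suc n)" using mu.next_level(2)[OF _ mu_const] step(1-3) by (simp add: m)
  hence less: "degree (\<phi> n) < degree (\<phi> (Suc n))" using step(4) KP_degree n.KP_degree by (simp add: m)
  note nc = next_chain[OF torsion step(1)[folded m] less step(2)[folded m], unfolded m, folded step(3)]
  have "(\<Prod>i\<le>Suc n. chain_e v \<mu> i) = grp_index (vals (\<mu> (Suc n))) (vals v)"
    using IH(3) nc(3) by (simp add: mult.commute)
  moreover have "(\<Prod>i\<le>Suc n. chain_f \<mu> i) = orthogonal_limit.FF v (augment (\<mu> n) (\<phi> (Suc n)) Infty) (\<phi> (Suc n)) B"
    using IH(4) nc(4) by simp
  ultimately show ?case using nc(1,2) by blast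
qed

section \<open>The factor singled out by a type\<close>

context valued_closure
begin

lemma w_of_valuation:
  assumes G: "G \<in> Irr_over Kh"
  shows "valuation (w_of vb G)" "w_of vb G [:a:] = v a"
proof -
  have "degree G > 0" using G by (simp add: Irr_over_def)
  then obtain \<theta> where \<theta>: "poly G \<theta> = 0" using alg_closed_imp_poly_has_root by blast
  note w_eq = w_of_eq[OF G \<theta>]
  have vb: "valuation vb" using ext by (simp add: extends_valuation_def)
  have "min (w_of vb G f) (w_of vb G h) \<le> w_of vb G (f + h)" for f h
    using vb[unfolded valuation_def] by (simp add: w_eq to_ac.mp_add)
  thus "valuation (w_of vb G)"
    unfolding valuation_def by (simp add: w_eq to_ac.mp_mult val_zero[OF vb] val_one[OF vb] val_mult[OF vb])
  show "w_of vb G [:a:] = v a" by (simp add: w_eq vb_to_ac)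
qed

text \<open>A root of \<open>G\<close> is a root of \<open>g\<close>, and by irreducibility
  \<open>g\<close> is its minimal polynomial over K.\<close>

lemma w_of_support:
  assumes g: "g \<in> Irr_over UNIV" and G: "G \<in># irr_factors Kh (ac_poly g)"
  shows "G \<in> Irr_over Kh" "w_of vb G f = Infty \<longleftrightarrow> g dvd f"
proof -
  note F = irr_factors_henselization[OF Irr_overD(2)[OF subfld_UNIV g]]
  show GI: "G \<in> Irr_over Kh" using F(1) G by blast
  hence "degree G > 0" by (simp add: Irr_over_def)
  then obtain \<theta> where \<theta>: "poly G \<theta> = 0" using alg_closed_imp_poly_has_root by blast
  have "G dvd ac_poly g" using G F(2) dvd_prod_mset by metis
  hence "poly (ac_poly g) \<theta> = 0" using \<theta> by (auto elim!: dvdE)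
  have "\<exists>m. m \<in> Irr_over UNIV \<and> (\<forall>q. poly (ac_poly q) \<theta> = 0 \<longleftrightarrow> m dvd q)"
    by (rule minpoly_ac_poly[of \<theta>]) blast
  then obtain m where m: "m \<in> Irr_over UNIV" "\<And>q. poly (ac_poly q) \<theta> = 0 \<longleftrightarrow> m dvd q" by blast
  have "m dvd g" using m(2) \<open>poly (ac_poly g) \<theta> = 0\<close> by blast
  then obtain q where q: "g = m * q" by (elim dvdE)
  have mq: "m \<in> polys_over UNIV" "q \<in> polys_over UNIV" by (simp_all add: polys_over_def)
  have "\<forall>A\<in>polys_over UNIV. \<forall>B\<in>polys_over UNIV. g = A * B \<longrightarrow> degree A = 0 \<or> degree B = 0"
    using g unfolding Irr_over_def mem_Collect_eq by (elim conjE)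
  from mp[OF bspec[OF bspec[OF this mq(1)] mq(2)] q] have "degree m = 0 \<or> degree q = 0" .
  hence "degree q = 0" using Irr_overD(3)[OF subfld_UNIV m(1)] by simp
  then obtain c where c: "q = [:c:]" by (elim degree_eq_zeroE)
  have "lead_coeff g = lead_coeff m * c" unfolding q c by (simp add: lead_coeff_mult)
  hence "c = 1" unfolding Irr_overD(2)[OF subfld_UNIV g] Irr_overD(2)[OF subfld_UNIV m(1)] by simp
  hence "m = g" using q c by simp
  thus "w_of vb G f = Infty \<longleftrightarrow> g dvd f" using m(2) by (simp add: w_of_eq[OF GI \<theta>] vb_eq_Infty)
qed

text \<open>Any element of \<open>K[x]/(g)\<close> with a new value or a new residue would give a family which is
  orthogonal with respect to \<open>w\<^sub>G\<close> and has more than \<open>deg \<phi> \<ge> deg G\<close> members.\<close>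

lemma ramification_of_factor:
  assumes G: "G \<in> Irr_over Kh" and res: "orthogonal_residue v w \<phi> b R (w_of vb G) \<rho>"
    and le: "degree G \<le> degree \<phi>"
  shows "vals (w_of vb G) = vals w"
    "carrier R = {\<rho> f | f. 0 \<le> w_of vb G f} \<Longrightarrow>
      ring.dim R (residue_map.constants v \<rho>) (carrier R) = orthogonal_limit.FF v w \<phi> b"
proof -
  interpret r: orthogonal_residue v w \<phi> b R "w_of vb G" \<rho> by (rule res)
  let ?w = "w_of vb G"
  let ?c = "\<lambda>a. (+) a ` vals v"
  \<comment> \<open>One value from each coset, so that A has \<open>EE\<close> members; a new value
    or a new residue enlarges one of the two factors in the product bound.\<close>
  obtain A where A: "A \<subseteq> vals w" "inj_on ?c A" "?c ` A = ?c ` vals w"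
    using subset_image_inj[of "?c ` vals w" ?c "vals w"] by auto
  have finA: "finite A" using r.cosets_finite A(2,3) finite_imageD by metis
  have cardA: "card A = r.EE" using card_image[OF A(2)] A(3) by (simp add: r.EE_def grp_index_def)
  have coset: "?c x = ?c y \<longleftrightarrow> x - y \<in> vals v" for x y
    by (rule subgroup_coset_eq) (fact vals_group(1)[OF v] vals_group(2)[OF v])+
  have low: "\<exists>f. ?w f = Val \<alpha>" if "\<alpha> \<in> vals w" for \<alpha>
    using that r.u_low unfolding r.vals_low by metis
  have orthh: "?w (\<Sum>j\<in>r.cls 0. smult (c j) (r.h j)) \<le> v (c i)" if "i \<in> r.cls 0" for c i
  proof -
    have "degree (\<Sum>j\<in>r.cls 0. smult (c j) (r.h j)) < degree \<phi>"
      using r.deg r.h(2) by (intro degree_sum_less) (auto intro: le_less_trans[OF degree_smult_le])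
    thus ?thesis using r.h_orth[OF that, of c] r.u_low by simp
  qed
  have h0: "0 \<le> ?w (r.h j)" if "j \<in> r.cls 0" for j using r.h(1,2)[OF that] r.u_low by simp
  show "vals ?w = vals w"
  proof (intro equalityI subsetI)
    fix \<alpha> assume "\<alpha> \<in> vals w"
    thus "\<alpha> \<in> vals ?w" using low by (auto simp: vals_def)
  next
    fix \<alpha> assume \<alpha>: "\<alpha> \<in> vals ?w"
    show "\<alpha> \<in> vals w"
    proof (rule ccontr)
      assume nin: "\<alpha> \<notin> vals w"
      let ?I = "insert \<alpha> A"
      have "\<forall>\<delta>\<in>?I. \<exists>f. ?w f = Val \<delta>" using \<alpha> low A(1) by (auto simp: vals_def)
      then obtain f where f: "\<And>\<delta>. \<delta> \<in> ?I \<Longrightarrow> ?w (f \<delta>) = Val \<delta>" by metis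
      have diff: "x - y \<notin> vals v" if xy: "x \<in> ?I" "y \<in> ?I" "x \<noteq> y" for x y
      proof
        assume d: "x - y \<in> vals v"
        have dw: "x - y \<in> vals w" "y - x \<in> vals w"
          using d vals_group(4)[OF v d] r.vals_v_sub by auto
        show False
        proof (cases "x \<in> A \<and> y \<in> A")
          case True
          thus ?thesis using d coset[of x y] A(2) xy(3) by (auto dest: inj_onD)
        next
          case False
          hence "x = \<alpha> \<and> y \<in> vals w \<or> y = \<alpha> \<and> x \<in> vals w" using xy A(1) by auto
          thus ?thesis
            using nin r.vals_w_group(3)[OF dw(1), of y] r.vals_w_group(3)[OF dw(2), of x] by auto
        qed
      qed
      have "card ?I * card (r.cls 0) \<le> degree G"
        by (rule orthogonal_product_bound[OF G w_of_valuation(1)[OF G], of ?I "r.cls 0" f "\<lambda>x. x" r.h])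
          (use finA r.finite_cls f diff h0 orthh in auto)
      moreover have "card ?I = Suc r.EE" using finA nin A(1) cardA by (subst card_insert_disjoint) auto
      ultimately have "Suc r.EE * r.FF \<le> r.EE * r.FF" using le r.degree_eq by (simp add: r.FF_def)
      thus False using r.FF_pos by simp
    qed
  qed
  assume surj: "carrier R = {\<rho> f | f. 0 \<le> ?w f}"
  have "r.residues = carrier R"
  proof (rule ccontr)
    assume "r.residues \<noteq> carrier R"
    moreover have "r.residues \<subseteq> carrier R" by (rule subfieldE(3)[OF r.subfield_low_residues])
    ultimately obtain y where y: "y \<in> carrier R" "y \<notin> r.residues" by blast
    obtain Vs where Vs: "set Vs \<subseteq> carrier R" "r.independent r.constants Vs" "length Vs = r.FF" "r.Span r.constants Vs = r.residues"
      using r.exists_base[OF r.subfield_constants r.dimension_low_residues] by blast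
    have ind: "r.independent r.constants (y # Vs)" using y Vs by (intro r.li_Cons) auto
    let ?n = "Suc r.FF"
    have "\<forall>i<?n. \<exists>f. 0 \<le> ?w f \<and> (y # Vs) ! i = \<rho> f"
    proof (intro allI impI)
      fix i assume "i < ?n"
      hence "(y # Vs) ! i \<in> set (y # Vs)" using Vs(3) by (intro nth_mem) simp
      hence "(y # Vs) ! i \<in> carrier R" using y(1) Vs(1) by auto
      thus "\<exists>f. 0 \<le> ?w f \<and> (y # Vs) ! i = \<rho> f" unfolding surj by blast
    qed
    then obtain z where z: "\<And>i. i < ?n \<Longrightarrow> 0 \<le> ?w (z i) \<and> (y # Vs) ! i = \<rho> (z i)" by metis
    have list: "y # Vs = map (\<lambda>i. \<rho> (z i)) [0..<?n]"
      by (rule nth_equalityI) (use z Vs(3) in \<open>auto simp del: upt_Suc\<close>)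
    have orthz: "?w (\<Sum>j\<in>{..<?n}. smult (c j) (z j)) \<le> v (c i)" if "i \<in> {..<?n}" for c i
      using r.independent_residues_imp[OF ind[unfolded list], of i c] z that
      by (simp add: atLeast0LessThan del: upt_Suc)
    have "\<forall>\<delta>\<in>A. \<exists>f. ?w f = Val \<delta>" using low A(1) by blast
    then obtain f where f: "\<And>\<delta>. \<delta> \<in> A \<Longrightarrow> ?w (f \<delta>) = Val \<delta>" by metis
    have diff: "x - y \<notin> vals v" if xy: "x \<in> A" "y \<in> A" "x \<noteq> y" for x y
      using coset[of x y] A(2) xy by (auto dest: inj_onD)
    have "card A * card {..<?n} \<le> degree G"
      by (rule orthogonal_product_bound[OF G w_of_valuation(1)[OF G], of A "{..<?n}" f "\<lambda>x. x" z])
        (use finA f diff z orthz in auto)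
    hence "r.EE * Suc r.FF \<le> r.EE * r.FF" using le r.degree_eq cardA by simp
    thus False using r.EE_pos by simp
  qed
  thus "ring.dim R r.constants (carrier R) = r.FF"
    using r.dimI[OF r.subfield_constants r.dimension_low_residues] by (simp add: over_def)
qed

text \<open>A polynomial of smaller degree with larger value under \<open>w\<close> could be made
  monic, against the minimal degree required in \<open>tangent\<close>.\<close>

lemma tangent_low:
  assumes \<mu>: "valuation \<mu>" and w: "valuation w" and const: "\<And>a. \<mu> [:a:] = w [:a:]" and inf: "\<And>a. a \<noteq> 0 \<Longrightarrow> \<mu> [:a:] \<noteq> Infty"
    and le: "\<mu> < w" and \<phi>: "\<phi> \<in> tangent \<mu> w" and f: "degree f < degree \<phi>"
  shows "w f = \<mu> f"
proof (rule ccontr)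
  assume ne: "w f \<noteq> \<mu> f"
  have "\<mu> f \<le> w f" using le by (simp add: less_fun_def le_fun_def)
  hence less: "\<mu> f < w f" using ne by simp
  hence f0: "f \<noteq> 0" using val_zero[OF \<mu>] by (auto simp: not_less)
  define c where "c = inverse (lead_coeff f)"
  have c: "c \<noteq> 0" using f0 by (simp add: c_def)
  have "lead_coeff (smult c f) = 1" using f0 by (simp add: c_def)
  hence lc: "lead_coeff ([:c:] * f) = 1" by simp
  have less: "\<mu> ([:c:] * f) < w ([:c:] * f)"
    unfolding val_mult[OF \<mu>] val_mult[OF w] const[symmetric] by (rule vinf_add_strict_mono(2)[OF less _ inf[OF c]]) simp
  have "\<forall>\<psi>. lead_coeff \<psi> = 1 \<and> \<mu> \<psi> < w \<psi> \<longrightarrow> degree \<phi> \<le> degree \<psi>"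
    using \<phi> unfolding tangent_def by blast
  hence "degree \<phi> \<le> degree ([:c:] * f)" using lc less by blast
  thus False using f c by simp
qed

end

theorem theorem5p1:
  fixes v :: "'a :: field \<Rightarrow> 'g :: linordered_ab_group_add vinf"
    and vb :: "'a alg_closure \<Rightarrow> 'g vinf"
    and g \<phi> :: "'a poly"
    and G :: "'a alg_closure poly"
    and r :: nat
    and \<phi>s :: "nat \<Rightarrow> 'a poly"
    and \<gamma>s :: "nat \<Rightarrow> 'g"
    and \<mu>s :: "nat \<Rightarrow> 'a poly \<Rightarrow> 'g vinf"
    and u :: "'g \<Rightarrow> 'a poly set"
  assumes "valuation v"
    and "rational_hull (value_group base_field v)"
    and "extends_valuation vb v"
    and "lead_coeff g = 1" and "irreducible g"
    and "ordinary_MLV_chain v r \<phi>s \<gamma>s \<mu>s"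
    and "inner_node v (\<mu>s r)"
    and "\<phi> \<in> KP (\<mu>s r)" and "degree (\<phi>s r) < degree \<phi>"
    and "singles_out vb (\<mu>s r) \<phi> g G"
    and "homogeneous_unit (\<mu>s r) (nmul (rel_index (\<mu>s r) (\<phi>s r)) (\<mu>s r (\<phi>s r))) u"
  shows "ramification_index (poly_quot g) (quot_val (w_of vb G)) base_field v
           = (\<Prod>n\<le>r. chain_e v \<mu>s n) \<and>
         residual_degree (poly_quot g) (quot_val (w_of vb G)) base_field v (\<lambda>a. poly_quot_class g [:a:])
           = (\<Prod>n\<le>r. chain_f \<mu>s n) *
             deg (kappa_ring (\<mu>s r)) (residual_poly (\<mu>s r) (\<phi>s r) u \<phi>)"
proof -
  interpret C: valued_closure v vb by unfold_locales fact+
  have torsion: "\<exists>n>0. nmul n \<alpha> \<in> vals v" for \<alpha>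
    using C.torsion[of \<alpha>] by (auto simp: vals_def)
  obtain w b where lev: "orthogonal_level v w (\<phi>s r) (\<gamma>s r) b" "level.mu w (\<phi>s r) (\<gamma>s r) = \<mu>s r"
    "(\<Prod>i\<le>r. chain_e v \<mu>s i) = grp_index (vals (\<mu>s r)) (vals v)"
    "(\<Prod>i\<le>r. chain_f \<mu>s i) = orthogonal_limit.FF v w (\<phi>s r) b"
    using chain_level[OF assms(1) torsion assms(6) order_refl] by blast
  interpret l: orthogonal_level v w "\<phi>s r" "\<gamma>s r" b by (rule lev)
  have KP: "\<phi> \<in> KP l.mu" and deg: "degree (\<phi>s r) < degree \<phi>" using assms(8,9) lev(2) by auto
  let ?w' = "augment l.mu \<phi> Infty" and ?W = "w_of vb G"
  interpret n: orthogonal_limit v ?w' \<phi> l.B by (rule l.next_orthogonal_limit[OF KP])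

  have F: "F_factors vb l.mu \<phi> g = {#G#}" "degree G = degree (Q_factor vb l.mu \<phi>)"
    using assms(10) by (simp_all add: singles_out_def lev(2))
  have "G \<in># F_factors vb l.mu \<phi> g" using F(1) by simp
  hence G: "G \<in># irr_factors (henselization vb) (ac_poly g)" "l.mu < ?W" "tangent l.mu ?W = KP_class l.mu \<phi>"
    by (simp_all add: F_factors_def)
  have gI: "g \<in> Irr_over UNIV" using irreducible_iff_Irr_over[OF assms(4)] assms(5) by blast
  note GI = C.w_of_support[OF gI G(1)]
  note W = C.w_of_valuation[OF GI(1)]
  have tangent: "\<phi> \<in> tangent l.mu ?W" using KP G(3) by (simp add: KP_class_def mu_equiv_def)
  have low: "?W f = l.mu f" if "degree f < degree \<phi>" for f
    by (rule C.tangent_low[OF l.mu W(1) _ _ G(2) tangent that]) (auto simp: l.mu_const W(2) l.v_eq_Infty)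
  have low': "?w' f = l.mu f" if "degree f < degree \<phi>" for f
    using l.mu.limit_valuation(4)[OF KP that] .
  have less: "l.mu \<phi> < ?W \<phi>" using tangent by (simp add: tangent_def)
  have mu_le: "l.mu f \<le> ?W f" for f using G(2) by (simp add: less_fun_def le_fun_def)

  \<comment> \<open>The difference is q \<phi>, of nonnegative value under \<mu>; under w_G the
    value of \<phi> is strictly larger.\<close>
  have prod: "0 < ?W (f * s - (f * s) mod \<phi>)"
    if fs: "degree f < degree \<phi>" "degree s < degree \<phi>" "0 \<le> ?w' f" "0 \<le> ?w' s" for f s
  proof -
    define q where "q = (f * s) div \<phi>"
    have q: "f * s - (f * s) mod \<phi> = q * \<phi>" by (simp add: q_def minus_mod_eq_div_mult)
    have p: "0 \<le> l.mu (f * s)" using fs low' by (simp add: val_mult[OF l.mu] add_nonneg_nonneg)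
    hence "0 \<le> l.mu ((f * s) mod \<phi>)"
      using l.mu.limit_valuation(3)[OF KP, of "f * s"] n.w_mod[of "f * s"] low'[OF n.degree_mod[of "f * s"]] by simp
    hence "0 \<le> l.mu (q * \<phi>)" using p unfolding q[symmetric] by (intro val_diff_ge[OF l.mu])
    hence nn: "0 \<le> l.mu q + l.mu \<phi>" by (simp add: val_mult[OF l.mu])
    show ?thesis
    proof (cases "q = 0")
      case True
      thus ?thesis unfolding q by (simp add: val_zero[OF W(1)])
    next
      case False
      hence "l.mu q \<noteq> Infty" using l.mu_eq_Infty by simp
      hence "l.mu q + l.mu \<phi> < l.mu q + ?W \<phi>" using less by (intro vinf_add_strict_mono(2)) auto
      also have "\<dots> \<le> ?W q + ?W \<phi>" using mu_le by (intro add_right_mono)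
      finally show ?thesis unfolding q using nn by (simp add: val_mult[OF W(1)])
    qed
  qed

  interpret P: poly_field g ?W by unfold_locales (fact assms(4,5) W(1) GI(2))+
  let ?R = "residue_field (poly_quot g) (quot_val ?W)"
  have res: "orthogonal_residue v ?w' \<phi> l.B ?R ?W P.quot_residue"
  proof (rule orthogonal_residue.intro)
    show "orthogonal_limit v ?w' \<phi> l.B" by unfold_locales
    show "residue_map ?R v ?W P.quot_residue" by (rule P.quot_residue_map[OF assms(1) W(2)])
    show "orthogonal_residue_axioms ?w' \<phi> ?W" by unfold_locales (use low low' prod in auto)
  qed
  have "\<phi> \<in> Irr_over UNIV" using n.irreducible_phi .
  \<comment> \<open>Here the equality of degrees in the definition of singling out is used:
    \<open>G\<close> has the degree of a factor of \<open>\<phi>\<close> over the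
    henselization.\<close>
  hence le: "degree G \<le> degree \<phi>"
    unfolding F(2) by (rule C.Q_factor_degree_le[OF n.w n.w_const _ n.supp])
  note main = C.ramification_of_factor[OF GI(1) res le]

  have "ramification_index (poly_quot g) (quot_val ?W) base_field v = grp_index (vals ?W) (vals v)"
    by (simp add: ramification_index_def P.quot_value_group value_group_base_field)
  also have "vals ?W = vals l.mu" using main(1) l.vals_next[OF KP deg] by simp
  finally have e: "ramification_index (poly_quot g) (quot_val ?W) base_field v = (\<Prod>n\<le>r. chain_e v \<mu>s n)"
    using lev(2,3) by simp

  have "{res_class (poly_quot g) (quot_val ?W) (poly_quot_class g [:a:]) | a. a \<in> carrier base_field \<and> 0 \<le> v a}
      = residue_map.constants v P.quot_residue"
    unfolding residue_map.constants_def[OF P.quot_residue_map[OF assms(1) W(2)]] by (simp add: type_ring_simps)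
  hence "residual_degree (poly_quot g) (quot_val ?W) base_field v (\<lambda>a. poly_quot_class g [:a:]) = n.FF"
    using main(2)[OF P.quot_residue_surj] by (simp add: residual_degree_def)
  \<comment> \<open>The residual degree of the limit at \<phi> is that of the last chain level times
    l/e, and l/e is the degree of the residual polynomial.\<close>
  also have "\<dots> = (l.smax \<phi> div rel_index l.mu (\<phi>s r)) * l.FF" by (rule l.next_FF(1)[OF torsion KP deg])
  also have "l.smax \<phi> div rel_index l.mu (\<phi>s r) = deg (kappa_ring l.mu) (residual_poly l.mu (\<phi>s r) u \<phi>)"
    using l.degree_residual_poly[OF torsion KP deg, of u] assms(11) lev(2) by simp
  finally have f: "residual_degree (poly_quot g) (quot_val ?W) base_field v (\<lambda>a. poly_quot_class g [:a:]) =
      (\<Prod>n\<le>r. chain_f \<mu>s n) * deg (kappa_ring (\<mu>s r)) (residual_poly (\<mu>s r) (\<phi>s r) u \<phi>)"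
    using lev(2,4) by (simp add: mult.commute)
  show ?thesis using e f by blast
qed

end
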